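(* Let $\Gamma$ and $\Gamma'$ be two bushy graphs of $\mathbb{Z}^n$s (same $n$), both with folded holonomy maps. Suppose that there is $g\in \mathrm{GL}_n(\mathbb{R})$ such that the holonomy images $\mathrm{hol}(\Gamma)$ and $g\,\mathrm{hol}'(\Gamma')\,g^{-1}$ are at bounded Hausdorff distance in $\mathrm{GL}_n(\mathbb{R})$. Then $\Gamma$ and $\Gamma'$ are quasi-isometric.
   Context: Fix $n$. A graph of $\mathbb{Z}^n$s is a group $\Gamma$ given as the fundamental group of a finite (connected) graph of groups in which every edge and vertex group is isomorphic to $\mathbb{Z}^n$ and all edge-to-vertex inclusions have finite index. Let $T$ be its Bass–Serre tree (which has finite valence). $\Gamma$ is bushy if $T$ has infinitely many ends. Holonomy. Fix a base vertex $v_0\in T$ and an isomorphism $\mathrm{stab}(v_0)\cong\mathbb{Z}^n$. Every $\gamma\in\Gamma$ commensurates $\mathrm{stab}(v_0)$, and conjugation $x\mapsto\gamma x\gamma^{-1}$ (defined on a finite index subgroup of $\mathrm{stab}(v_0)$ with values in $\mathrm{stab}(v_0)$) induces an automorphism of $\mathrm{stab}(v_0)\otimes\mathbb{Q}=\mathbb{Q}^n$. This gives a homomorphism $\mathrm{hol}:\Gamma\to\mathrm{GL}_n(\mathbb{Q})\subset\mathrm{GL}_n(\mathbb{R})$, trivial on all vertex stabilizers. Fix a fundamental domain $T_0\subset T$ for the $\Gamma$-action (a finite subtree containing $v_0$ and exactly one vertex from each vertex orbit). Define $h$ from the vertices of $T$ to $\mathrm{GL}_n(\mathbb{R})$ by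 $h(v)=\mathrm{hol}(\gamma)$ for any $\gamma$ with $v\in\gamma T_0$; this is well defined and $h(\sigma v)=\mathrm{hol}(\sigma)h(v)$. For a subtree $S\subset T$, $h(S)$ is the image of its vertex set. For $\Gamma'$ the corresponding objects are denoted $T',\mathrm{hol}',h'$. Folded holonomy. For an edge $e$ of $T$, its two sides (halfspaces) are the two components of $T$ minus the open edge $e$. A side $T^+$ is full if $\overline{h(T^+)}=\overline{h(T)}$ (closures in $\mathrm{GL}_n(\mathbb{R})$). $\Gamma$ has folded holonomy if for every edge of $T$ both sides are full. Bounded Hausdorff distance. Subsets $A,B\subset\mathrm{GL}_n(\mathbb{R})$ are at bounded Hausdorff distance if there is a compact $K\subset\mathrm{GL}_n(\mathbb{R})$ with $A\subset BK$ and $B\subset AK$ (equivalently, they are at finite Hausdorff distance for the left-invariant word metric of a compact generating set). *)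

theory Defs
  imports
    "HOL-Analysis.Analysis"
    "HOL-Algebra.Group_Action"
    "HOL-Algebra.Generated_Groups"
    "Graph_Theory.Bidirected_Digraph"
    "Graph_Theory.Digraph_Component"
begin

section \<open>Graphs of groups\<close>

text \<open>
  Graphs are Serre graphs, i.e. \<^locale>\<open>bidirected_digraph\<close>s: each geometric edge is a pair
  of arcs \<open>e\<close>, \<open>arev e\<close>. The map \<open>incl A e\<close> is the inclusion of the edge group of \<open>e\<close> into the
  vertex group of the tail of \<open>e\<close>; the inclusion at the head is \<open>incl A (rev_arc A e)\<close>.
\<close>

record ('v, 'e, 'a, 'b) gog =
  base :: "('v, 'e) pre_digraph"
  rev_arc :: "'e \<Rightarrow> 'e"
  vgrp :: "'v \<Rightarrow> 'a monoid"
  egrp :: "'e \<Rightarrow> 'b monoid"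
  incl :: "'e \<Rightarrow> 'b \<Rightarrow> 'a"

locale graph_of_groups =
  fixes A :: "('v, 'e, 'a, 'b) gog"
  assumes bidirected: "bidirected_digraph (base A) (rev_arc A)"
    and connected: "Digraph_Component.connected (base A)"
    and group_vgrp: "v \<in> verts (base A) \<Longrightarrow> group (vgrp A v)"
    and group_egrp: "e \<in> arcs (base A) \<Longrightarrow> group (egrp A e)"
    and egrp_rev: "e \<in> arcs (base A) \<Longrightarrow> egrp A (rev_arc A e) = egrp A e"
    and incl_mon: "e \<in> arcs (base A) \<Longrightarrow> incl A e \<in> mon (egrp A e) (vgrp A (tail (base A) e))"

definition Zn :: "(int ^ 'n) monoid" where
  "Zn = \<lparr>carrier = UNIV, monoid.mult = (+), one = 0\<rparr>"

definition graph_of_Zns :: "'n::finite itself \<Rightarrow> ('v, 'e, 'a, 'b) gog \<Rightarrow> bool" where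
  "graph_of_Zns _ A \<longleftrightarrow>
     graph_of_groups A \<and> fin_digraph (base A) \<and>
     (\<forall>v\<in>verts (base A). vgrp A v \<cong> (Zn :: (int ^ 'n) monoid)) \<and>
     (\<forall>e\<in>arcs (base A). egrp A e \<cong> (Zn :: (int ^ 'n) monoid)) \<and>
     (\<forall>e\<in>arcs (base A).
        finite (rcosets\<^bsub>vgrp A (tail (base A) e)\<^esub> (incl A e ` carrier (egrp A e))))"


section \<open>The fundamental group\<close>

text \<open>
  The path group \<open>F(A)\<close> is generated by the vertex groups and the arcs, subject to
  \<open>e (arev e) = 1\<close> and \<open>e \<alpha>\<^sub>h(c) = \<alpha>\<^sub>t(c) e\<close>, where \<open>\<alpha>\<^sub>t\<close>, \<open>\<alpha>\<^sub>h\<close> are the inclusions of the edge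
  group of \<open>e\<close> at its tail and its head. An element of \<open>F(A)\<close> is represented by the set of all
  words that spell it. The inverse of every generator is again a generator, so words in the
  generators suffice.
\<close>

datatype ('v, 'e, 'a) letter = VLet 'v 'a | ELet 'e

type_synonym ('v, 'e, 'a) word = "('v, 'e, 'a) letter list"

inductive pg_eq :: "('v, 'e, 'a, 'b) gog \<Rightarrow> ('v, 'e, 'a) word \<Rightarrow> ('v, 'e, 'a) word \<Rightarrow> bool"
  for A where
  pg_refl: "pg_eq A w w"
| pg_sym: "pg_eq A w w' \<Longrightarrow> pg_eq A w' w"
| pg_trans: "pg_eq A w w' \<Longrightarrow> pg_eq A w' w'' \<Longrightarrow> pg_eq A w w''"
| pg_context: "pg_eq A w w' \<Longrightarrow> pg_eq A (x @ w @ y) (x @ w' @ y)"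
| pg_mult: "v \<in> verts (base A) \<Longrightarrow> g \<in> carrier (vgrp A v) \<Longrightarrow> h \<in> carrier (vgrp A v) \<Longrightarrow>
    pg_eq A [VLet v g, VLet v h] [VLet v (g \<otimes>\<^bsub>vgrp A v\<^esub> h)]"
| pg_one: "v \<in> verts (base A) \<Longrightarrow> pg_eq A [VLet v \<one>\<^bsub>vgrp A v\<^esub>] []"
| pg_rev: "e \<in> arcs (base A) \<Longrightarrow> pg_eq A [ELet e, ELet (rev_arc A e)] []"
| pg_edge: "e \<in> arcs (base A) \<Longrightarrow> c \<in> carrier (egrp A e) \<Longrightarrow>
    pg_eq A [ELet e, VLet (head (base A) e) (incl A (rev_arc A e) c)]
            [VLet (tail (base A) e) (incl A e c), ELet e]"

definition pg_class :: "('v, 'e, 'a, 'b) gog \<Rightarrow> ('v, 'e, 'a) word \<Rightarrow> ('v, 'e, 'a) word set" where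
  "pg_class A w = {w'. pg_eq A w w'}"

text \<open>
  Besides the product of two elements of \<open>F(A)\<close>, the following operation also yields the
  product of (unions of classes representing) subsets of \<open>F(A)\<close>, e.g. cosets.
\<close>

definition pg_prod ::
  "('v, 'e, 'a, 'b) gog \<Rightarrow> ('v, 'e, 'a) word set \<Rightarrow> ('v, 'e, 'a) word set \<Rightarrow> ('v, 'e, 'a) word set" where
  "pg_prod A X Y = (\<Union>x\<in>X. \<Union>y\<in>Y. pg_class A (x @ y))"

inductive gog_path :: "('v, 'e, 'a, 'b) gog \<Rightarrow> 'v \<Rightarrow> ('v, 'e, 'a) word \<Rightarrow> 'v \<Rightarrow> bool"
  for A where
  "v \<in> verts (base A) \<Longrightarrow> gog_path A v [] v"
| "v \<in> verts (base A) \<Longrightarrow> g \<in> carrier (vgrp A v) \<Longrightarrow> gog_path A v w v' \<Longrightarrow>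
    gog_path A v (VLet v g # w) v'"
| "e \<in> arcs (base A) \<Longrightarrow> gog_path A (head (base A) e) w v' \<Longrightarrow>
    gog_path A (tail (base A) e) (ELet e # w) v'"

definition pi1 :: "('v, 'e, 'a, 'b) gog \<Rightarrow> 'v \<Rightarrow> ('v, 'e, 'a) word set monoid" where
  "pi1 A u = \<lparr>carrier = {pg_class A w | w. gog_path A u w u},
              monoid.mult = pg_prod A, one = pg_class A []\<rparr>"


section \<open>The Bass--Serre tree\<close>

definition vsub :: "('v, 'e, 'a, 'b) gog \<Rightarrow> 'v \<Rightarrow> ('v, 'e, 'a) word set" where
  "vsub A v = (\<Union>g\<in>carrier (vgrp A v). pg_class A [VLet v g])"

definition esub :: "('v, 'e, 'a, 'b) gog \<Rightarrow> 'e \<Rightarrow> ('v, 'e, 'a) word set" where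
  "esub A e = (\<Union>c\<in>carrier (egrp A e). pg_class A [VLet (tail (base A) e) (incl A e c)])"

type_synonym ('v, 'e, 'a) tree_vertex = "'v \<times> ('v, 'e, 'a) word set"
type_synonym ('v, 'e, 'a) tree_arc = "'e \<times> ('v, 'e, 'a) word set"

text \<open>
  Vertices over \<open>v\<close> are the cosets \<open>w A\<^sub>v\<close> for paths \<open>w\<close> from \<open>u\<close> to \<open>v\<close>; arcs over \<open>e\<close> are the
  cosets \<open>w A\<^sub>e\<close> for paths \<open>w\<close> from \<open>u\<close> to the tail of \<open>e\<close>, where \<open>A\<^sub>e\<close> is embedded at the tail.
  The arc \<open>w A\<^sub>e\<close> leads from \<open>w A\<^sub>v\<close> to \<open>w e A\<^sub>v\<^sub>'\<close> where \<open>v\<close>, \<open>v'\<close> are the tail and head of \<open>e\<close>,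
  and its reverse is \<open>w e A\<^sub>e\<^sub>'\<close> with \<open>e' = arev e\<close>, which is equal to \<open>w A\<^sub>e e\<close>.
\<close>

definition bs_tree ::
  "('v, 'e, 'a, 'b) gog \<Rightarrow> 'v \<Rightarrow> (('v, 'e, 'a) tree_vertex, ('v, 'e, 'a) tree_arc) pre_digraph" where
  "bs_tree A u = \<lparr>
     verts = {(v, pg_prod A (pg_class A w) (vsub A v)) | v w. gog_path A u w v},
     arcs = {(e, pg_prod A (pg_class A w) (esub A e)) | e w.
               e \<in> arcs (base A) \<and> gog_path A u w (tail (base A) e)},
     tail = (\<lambda>(e, C). (tail (base A) e, pg_prod A C (vsub A (tail (base A) e)))),
     head = (\<lambda>(e, C). (head (base A) e,
               pg_prod A (pg_prod A C (pg_class A [ELet e])) (vsub A (head (base A) e))))\<rparr>"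

definition bs_rev ::
  "('v, 'e, 'a, 'b) gog \<Rightarrow> 'v \<Rightarrow> ('v, 'e, 'a) tree_arc \<Rightarrow> ('v, 'e, 'a) tree_arc" where
  "bs_rev A u a = (if a \<in> arcs (bs_tree A u)
     then (rev_arc A (fst a), pg_prod A (snd a) (pg_class A [ELet (fst a)])) else a)"

definition bs_act ::
  "('v, 'e, 'a, 'b) gog \<Rightarrow> ('v, 'e, 'a) word set \<Rightarrow> ('v, 'e, 'a) tree_vertex \<Rightarrow> ('v, 'e, 'a) tree_vertex" where
  "bs_act A \<gamma> x = (fst x, pg_prod A \<gamma> (snd x))"

definition bs_stab ::
  "('v, 'e, 'a, 'b) gog \<Rightarrow> 'v \<Rightarrow> ('v, 'e, 'a) tree_vertex \<Rightarrow> ('v, 'e, 'a) word set set" where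
  "bs_stab A u x = stabilizer (pi1 A u) (bs_act A) x"


section \<open>Ends and sides of trees\<close>

definition rays :: "('v, 'e) pre_digraph \<Rightarrow> (nat \<Rightarrow> 'v) set" where
  "rays T = {r. inj r \<and> range r \<subseteq> verts T \<and> (\<forall>i. r i \<rightarrow>\<^bsub>T\<^esub> r (Suc i))}"

definition ends :: "('v, 'e) pre_digraph \<Rightarrow> (nat \<Rightarrow> 'v) set set" where
  "ends T = rays T // {(r, s) \<in> rays T \<times> rays T. \<exists>i j. \<forall>k. r (i + k) = s (j + k)}"

definition bushy :: "('v, 'e, 'a, 'b) gog \<Rightarrow> 'v \<Rightarrow> bool" where
  "bushy A u \<longleftrightarrow> infinite (ends (bs_tree A u))"

text \<open>
  The vertex sets of the components of \<open>T\<close> minus the open edge given by the arcs \<open>a\<close> and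
  \<open>rv a\<close>. What is left is still closed under reversal of arcs, so its connected components
  are its strongly connected components.
\<close>

definition sides :: "('v, 'e) pre_digraph \<Rightarrow> ('e \<Rightarrow> 'e) \<Rightarrow> 'e \<Rightarrow> 'v set set" where
  "sides T rv a = pre_digraph.sccs_verts (T\<lparr>arcs := arcs T - {a, rv a}\<rparr>)"


section \<open>Holonomy\<close>

definition rat_vec :: "int ^ 'n \<Rightarrow> rat ^ 'n" where
  "rat_vec x = (\<chi> i. of_int (x $ i))"

definition real_mat :: "rat ^ 'n ^ 'n \<Rightarrow> real ^ 'n ^ 'n" where
  "real_mat M = (\<chi> i j. of_rat (M $ i $ j))"

text \<open>
  For \<open>\<phi> : H \<cong> \<int>\<^sup>n\<close> and \<open>\<gamma>\<close> commensurating \<open>H\<close>: the matrix, in the coordinates \<open>\<phi>\<close>, of the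
  automorphism of \<open>H \<otimes> \<rat>\<close> induced by \<open>x \<mapsto> \<gamma> x \<gamma>\<^sup>-\<^sup>1\<close>. It is unique because
  \<open>H \<inter> \<gamma>\<^sup>-\<^sup>1 H \<gamma>\<close> has finite index in \<open>H\<close>.
\<close>

definition conj_matrix ::
  "('g, 'm) monoid_scheme \<Rightarrow> 'g set \<Rightarrow> ('g \<Rightarrow> int ^ 'n) \<Rightarrow> 'g \<Rightarrow> rat ^ 'n ^ 'n" where
  "conj_matrix G H \<phi> \<gamma> = (THE M. \<forall>x\<in>H. \<gamma> \<otimes>\<^bsub>G\<^esub> x \<otimes>\<^bsub>G\<^esub> inv\<^bsub>G\<^esub> \<gamma> \<in> H \<longrightarrow>
     rat_vec (\<phi> (\<gamma> \<otimes>\<^bsub>G\<^esub> x \<otimes>\<^bsub>G\<^esub> inv\<^bsub>G\<^esub> \<gamma>)) = M *v rat_vec (\<phi> x))"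

definition hol ::
  "('v, 'e, 'a, 'b) gog \<Rightarrow> 'v \<Rightarrow> ('v, 'e, 'a) tree_vertex \<Rightarrow> (('v, 'e, 'a) word set \<Rightarrow> int ^ 'n)
     \<Rightarrow> ('v, 'e, 'a) word set \<Rightarrow> real ^ 'n ^ 'n" where
  "hol A u x0 \<phi> \<gamma> = real_mat (conj_matrix (pi1 A u) (bs_stab A u x0) \<phi> \<gamma>)"

text \<open>
  A subtree is given by its vertex set; as \<open>T\<close> is a tree, the subtree is the induced subgraph.
\<close>

definition fundamental_domain ::
  "('v, 'e, 'a, 'b) gog \<Rightarrow> 'v \<Rightarrow> ('v, 'e, 'a) tree_vertex \<Rightarrow> ('v, 'e, 'a) tree_vertex set \<Rightarrow> bool" where
  "fundamental_domain A u x0 D \<longleftrightarrow>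
     D \<subseteq> verts (bs_tree A u) \<and> finite D \<and> x0 \<in> D \<and>
     Digraph_Component.connected (bs_tree A u \<restriction> D) \<and>
     (\<forall>x\<in>verts (bs_tree A u). \<exists>!y. y \<in> D \<and> y \<in> orbit (pi1 A u) (bs_act A) x)"

text \<open>
  The choices that enter the definition of the holonomy maps: a base vertex \<open>x0\<close> of the tree,
  an isomorphism \<open>\<phi>\<close> of its stabilizer with \<open>\<int>\<^sup>n\<close>, and a fundamental domain \<open>D\<close>.
\<close>

definition holonomy_data ::
  "('v, 'e, 'a, 'b) gog \<Rightarrow> 'v \<Rightarrow> ('v, 'e, 'a) tree_vertex \<Rightarrow> (('v, 'e, 'a) word set \<Rightarrow> int ^ 'n)
     \<Rightarrow> ('v, 'e, 'a) tree_vertex set \<Rightarrow> bool" where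
  "holonomy_data A u x0 \<phi> D \<longleftrightarrow>
     x0 \<in> verts (bs_tree A u) \<and>
     \<phi> \<in> iso ((pi1 A u)\<lparr>carrier := bs_stab A u x0\<rparr>) Zn \<and>
     fundamental_domain A u x0 D"

definition tree_hol ::
  "('v, 'e, 'a, 'b) gog \<Rightarrow> 'v \<Rightarrow> ('v, 'e, 'a) tree_vertex \<Rightarrow> (('v, 'e, 'a) word set \<Rightarrow> int ^ 'n)
     \<Rightarrow> ('v, 'e, 'a) tree_vertex set \<Rightarrow> ('v, 'e, 'a) tree_vertex \<Rightarrow> real ^ 'n ^ 'n" where
  "tree_hol A u x0 \<phi> D x =
     hol A u x0 \<phi> (SOME \<gamma>. \<gamma> \<in> carrier (pi1 A u) \<and> x \<in> bs_act A \<gamma> ` D)"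

definition GL :: "(real ^ 'n ^ 'n) set" where
  "GL = {M. invertible M}"

definition full ::
  "('t, 'k) pre_digraph \<Rightarrow> ('t \<Rightarrow> real ^ 'n ^ 'n) \<Rightarrow> 't set \<Rightarrow> bool" where
  "full T h S \<longleftrightarrow>
     Abstract_Topology.closure_of (top_of_set GL) (h ` S) =
     Abstract_Topology.closure_of (top_of_set GL) (h ` verts T)"

definition folded_holonomy ::
  "('v, 'e, 'a, 'b) gog \<Rightarrow> 'v \<Rightarrow> ('v, 'e, 'a) tree_vertex \<Rightarrow> (('v, 'e, 'a) word set \<Rightarrow> int ^ 'n)
     \<Rightarrow> ('v, 'e, 'a) tree_vertex set \<Rightarrow> bool" where
  "folded_holonomy A u x0 \<phi> D \<longleftrightarrow>
     (\<forall>a\<in>arcs (bs_tree A u). \<forall>S\<in>sides (bs_tree A u) (bs_rev A u) a.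
        full (bs_tree A u) (tree_hol A u x0 \<phi> D) S)"

definition bounded_Hausdorff_GL :: "(real ^ 'n ^ 'n) set \<Rightarrow> (real ^ 'n ^ 'n) set \<Rightarrow> bool" where
  "bounded_Hausdorff_GL X Y \<longleftrightarrow> (\<exists>K. compact K \<and> K \<subseteq> GL \<and>
     X \<subseteq> {y ** k | y k. y \<in> Y \<and> k \<in> K} \<and> Y \<subseteq> {x ** k | x k. x \<in> X \<and> k \<in> K})"


section \<open>Quasi-isometry of groups\<close>

definition word_length :: "('g, 'm) monoid_scheme \<Rightarrow> 'g set \<Rightarrow> 'g \<Rightarrow> nat" where
  "word_length G S g = (LEAST k. \<exists>ws. length ws = k \<and> set ws \<subseteq> S \<union> (\<lambda>s. inv\<^bsub>G\<^esub> s) ` S \<and>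
     g = foldr (\<lambda>x y. x \<otimes>\<^bsub>G\<^esub> y) ws \<one>\<^bsub>G\<^esub>)"

definition word_dist :: "('g, 'm) monoid_scheme \<Rightarrow> 'g set \<Rightarrow> 'g \<Rightarrow> 'g \<Rightarrow> real" where
  "word_dist G S g h = real (word_length G S (inv\<^bsub>G\<^esub> g \<otimes>\<^bsub>G\<^esub> h))"

definition quasi_isometry ::
  "'x set \<Rightarrow> ('x \<Rightarrow> 'x \<Rightarrow> real) \<Rightarrow> 'y set \<Rightarrow> ('y \<Rightarrow> 'y \<Rightarrow> real) \<Rightarrow> ('x \<Rightarrow> 'y) \<Rightarrow> bool" where
  "quasi_isometry X dX Y dY f \<longleftrightarrow> f \<in> X \<rightarrow> Y \<and> (\<exists>K C. K \<ge> 1 \<and> C \<ge> 0 \<and>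
     (\<forall>x\<in>X. \<forall>x'\<in>X. dX x x' / K - C \<le> dY (f x) (f x') \<and> dY (f x) (f x') \<le> K * dX x x' + C) \<and>
     (\<forall>y\<in>Y. \<exists>x\<in>X. dY (f x) y \<le> C))"

definition quasi_isometric_groups ::
  "('g, 'm) monoid_scheme \<Rightarrow> ('h, 'k) monoid_scheme \<Rightarrow> bool" where
  "quasi_isometric_groups G H \<longleftrightarrow> (\<exists>S S' f.
     finite S \<and> S \<subseteq> carrier G \<and> generate G S = carrier G \<and>
     finite S' \<and> S' \<subseteq> carrier H \<and> generate H S' = carrier H \<and>
     quasi_isometry (carrier G) (word_dist G S) (carrier H) (word_dist H S') f)"

end

theory Submission
  imports Defs
begin

text \<open>
  The vertex groups translate a lattice, and this extends to an affine action of \<open>\<Gamma>\<close> on \<open>\<real>\<^sup>n\<close> whose linear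
  part is the holonomy; so \<open>\<Gamma>\<close> acts properly and cocompactly on \<open>T \<times> \<real>\<^sup>n\<close>, where the fibre over
  \<open>v\<close> carries the norm \<open>x \<mapsto> \<parallel>h(v)\<^sup>-\<^sup>1 x\<parallel>\<close>. A coarse isometry of the trees \<open>T\<close>, \<open>T'\<close> that moves the
  labels \<open>h\<close>, \<open>g h' g\<^sup>-\<^sup>1\<close> by a bounded amount therefore extends by the identity of \<open>\<real>\<^sup>n\<close> to a quasi-isometry.

  Such a coarse isometry exists because folded holonomy allows steering: by cocompactness, from any vertex one
  reaches within a bounded number of steps away from the root a vertex whose label is close to any prescribed nearby value of \<open>h\<close>.
  Up to bounded changes the trees are binary without dead ends. Starting from two vertices with
  close labels, one grows finite subtrees of bounded depth below both, prescribing both the labels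
  and the numbers of the outgoing branches, so that the branches can be matched in pairs with close labels; then one recurses.
\<close>

text \<open>The recursion must not accumulate errors. A pair of vertices counts as a state when both
  labels lie within a fixed radius \<open>Suc k\<close> of one common reference label
  \<open>q\<close>. Moving towards \<open>q\<close> leaves up to \<open>k * R\<close> siblings
  behind; their labels may drift beyond that radius, and the two trees leave different numbers of
  them. Once near \<open>q\<close>, however, each branching supplies a further vertex with a label
  within \<open>2 * R + 2\<close> of \<open>q\<close>, and the number of these is free. So every
  stray sibling of one tree is paired with a well-centred vertex of the other, and the reference is
  shifted by \<open>R\<close> towards the stray one. The well-centred partner is then still within
  \<open>3 * R + 2\<close>, so the same radius serves again if \<open>k\<close> is large compared
  with \<open>R\<close>.

  The accuracy of steering must not depend on its range: the unit \<open>E\<close> of closeness is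
  built from the accuracy, and only then is the number \<open>R\<close> of steps obtained from
  \<open>E\<close>. This fixes the order of quantifiers in \<open>steer_exists\<close>.\<close>

lemma relpow_mono_Id:
  assumes "Id \<subseteq> E" "i \<le> j" shows "E ^^ i \<subseteq> E ^^ j"
proof -
  have "E ^^ i \<subseteq> E ^^ (i + k)" for k
  proof (induction k)
    case (Suc k)
    have "E ^^ (i + k) \<subseteq> E ^^ (i + k) O E" using assms(1) by auto
    then show ?case using Suc by auto
  qed simp
  from this[of "j - i"] show ?thesis using assms(2) by simp
qed

lemma relpow_trans_add: "(a, b) \<in> E ^^ i \<Longrightarrow> (b, c) \<in> E ^^ j \<Longrightarrow> (a, c) \<in> E ^^ (i + j)"
  by (auto simp: relpow_add)

lemma relpow_split: "(a, c) \<in> E ^^ (i + j) \<Longrightarrow> \<exists>b. (a, b) \<in> E ^^ i \<and> (b, c) \<in> E ^^ j"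
  by (auto simp: relpow_add)

lemma relpow_sym: "sym E \<Longrightarrow> (a, b) \<in> E ^^ i \<Longrightarrow> (b, a) \<in> E ^^ i"
proof (induction i arbitrary: b)
  case (Suc i)
  then obtain c where "(a, c) \<in> E ^^ i" "(c, b) \<in> E" by auto
  then show ?case using Suc by (meson relpow_Suc_I2 symD)
qed auto

section \<open>Rooted trees\<close>

text \<open>\<open>(p, x) \<in> C\<close> means that \<open>x\<close> is a child of \<open>p\<close>; the tree itself consists of what is reachable from \<open>r\<close>.\<close>

locale rtree =
  fixes C :: "('x \<times> 'x) set" and r :: 'x
  assumes par_unique: "(a, c) \<in> C \<Longrightarrow> (b, c) \<in> C \<Longrightarrow> a = b"
    and no_par: "(a, r) \<notin> C"
begin

definition V :: "'x set" where "V = C\<^sup>* `` {r}"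

definition dep :: "'x \<Rightarrow> nat" where "dep x = (THE k. (r, x) \<in> C ^^ k)"

definition par :: "'x \<Rightarrow> 'x" where "par x = (THE p. (p, x) \<in> C)"

definition antichain :: "'x set \<Rightarrow> bool" where
  "antichain X \<longleftrightarrow> (\<forall>a\<in>X. \<forall>b\<in>X. (a, b) \<in> C\<^sup>* \<longrightarrow> a = b)"

text \<open>The lower bound 1 on the depth keeps \<open>x\<close> itself out of the cut, so that a
  recursion over cuts advances. Only descendants of depth at least \<open>D\<close> must lie below
  the cut; hence a descendant not yet cut off is within distance \<open>D\<close> of
  \<open>x\<close>.\<close>

definition pcut :: "nat \<Rightarrow> 'x \<Rightarrow> 'x set \<Rightarrow> bool" where
  "pcut D x X \<longleftrightarrow> finite X \<and> antichain X \<and> (\<forall>a\<in>X. \<exists>i. 1 \<le> i \<and> i \<le> D \<and> (x, a) \<in> C ^^ i)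
     \<and> (\<forall>n j. (x, n) \<in> C ^^ j \<longrightarrow> D \<le> j \<longrightarrow> (\<exists>a\<in>X. (a, n) \<in> C\<^sup>*))"

lemma par_eq: "(p, x) \<in> C \<Longrightarrow> par x = p"
  unfolding par_def using par_unique by blast

lemma root_V: "r \<in> V" by (simp add: V_def)

lemma V_step: "x \<in> V \<Longrightarrow> (x, y) \<in> C \<Longrightarrow> y \<in> V"
  by (auto simp: V_def)

lemma V_rtrancl: "x \<in> V \<Longrightarrow> (x, y) \<in> C\<^sup>* \<Longrightarrow> y \<in> V"
  by (auto simp: V_def)

lemma V_relpow: "x \<in> V \<Longrightarrow> (x, y) \<in> C ^^ i \<Longrightarrow> y \<in> V"
  by (meson V_rtrancl relpow_imp_rtrancl)

lemma root_relpow_unique: "(r, x) \<in> C ^^ i \<Longrightarrow> (r, x) \<in> C ^^ j \<Longrightarrow> i = j"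
proof (induction i arbitrary: x j)
  case 0
  then show ?case using no_par by (cases j) auto
next
  case (Suc i)
  then obtain y where y: "(r, y) \<in> C ^^ i" "(y, x) \<in> C" by auto
  show ?case
  proof (cases j)
    case 0
    then show ?thesis using Suc y no_par by auto
  next
    case (Suc j')
    then obtain y' where "(r, y') \<in> C ^^ j'" "(y', x) \<in> C" using Suc.prems by auto
    then show ?thesis using y Suc Suc.IH par_unique by metis
  qed
qed

lemma dep_eq: "(r, x) \<in> C ^^ k \<Longrightarrow> dep x = k"
  unfolding dep_def using root_relpow_unique by blast

lemma dep_V: "x \<in> V \<Longrightarrow> (r, x) \<in> C ^^ dep x"
  using dep_eq by (auto simp: V_def dest!: rtrancl_imp_relpow)

lemma dep_root: "dep r = 0" by (rule dep_eq) simp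

lemma dep_relpow: "x \<in> V \<Longrightarrow> (x, y) \<in> C ^^ k \<Longrightarrow> dep y = dep x + k"
  by (meson dep_V dep_eq relpow_trans_add)

lemma dep_step: "x \<in> V \<Longrightarrow> (x, y) \<in> C \<Longrightarrow> dep y = Suc (dep x)"
  using dep_relpow[of x y 1] by simp

lemma dep_rtrancl: "x \<in> V \<Longrightarrow> (x, y) \<in> C\<^sup>* \<Longrightarrow> (x, y) \<in> C ^^ (dep y - dep x) \<and> dep x \<le> dep y"
  using dep_relpow by (auto dest!: rtrancl_imp_relpow)

lemma rtrancl_dep_eq: "x \<in> V \<Longrightarrow> (x, y) \<in> C\<^sup>* \<Longrightarrow> dep y \<le> dep x \<Longrightarrow> x = y"
  using dep_rtrancl[of x y] by simp

lemma V_cases: "x \<in> V \<Longrightarrow> x = r \<or> (\<exists>p\<in>V. (p, x) \<in> C)"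
  unfolding V_def Image_singleton_iff by (erule rtranclE) auto

lemma rtrancl_par: "(a, c) \<in> C\<^sup>* \<Longrightarrow> (b, c) \<in> C \<Longrightarrow> a = c \<or> (a, b) \<in> C\<^sup>*"
  using par_unique by (metis rtranclE)

text \<open>Walking up from \<open>n\<close> by unique parents meets all its ancestors, so they form
  a chain.\<close>

lemma anc_comparable: "(a, n) \<in> C\<^sup>* \<Longrightarrow> (b, n) \<in> C\<^sup>* \<Longrightarrow> (a, b) \<in> C\<^sup>* \<or> (b, a) \<in> C\<^sup>*"
proof (induction arbitrary: b rule: rtrancl_induct)
  case (step y z)
  then show ?case using rtrancl_par by (metis rtrancl.rtrancl_into_rtrancl)
qed auto

lemma V_induct [consumes 1, case_names root step]:
  assumes "x \<in> V" "P r" "\<And>p x. p \<in> V \<Longrightarrow> (p, x) \<in> C \<Longrightarrow> P p \<Longrightarrow> P x"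
  shows "P x"
proof -
  have "(r, x) \<in> C\<^sup>*" using assms(1) by (simp add: V_def)
  then show ?thesis
    by (induction rule: rtrancl_induct) (use assms in \<open>auto simp: V_def\<close>)
qed

text \<open>\<open>S\<close> collects the siblings left behind on a descent of length \<open>k\<close> from \<open>x\<close>.\<close>

inductive run :: "'x set \<Rightarrow> 'x \<Rightarrow> 'x \<Rightarrow> 'x set \<Rightarrow> nat \<Rightarrow> bool" for B x where
  run0: "x \<in> B \<Longrightarrow> run B x x {} 0"
| runS: "run B x y S k \<Longrightarrow> (y, z) \<in> C \<Longrightarrow> C `` {y} \<subseteq> B \<Longrightarrow> run B x z (S \<union> (C `` {y} - {z})) (Suc k)"

lemma run_mono: "run B x y S k \<Longrightarrow> B \<subseteq> B' \<Longrightarrow> run B' x y S k"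
  by (induction rule: run.induct) (auto intro!: run.intros)

lemma run_relpow: "run B x y S k \<Longrightarrow> (x, y) \<in> C ^^ k \<and> y \<in> B \<and> S \<subseteq> B"
  by (induction rule: run.induct) auto

lemma run_of_path:
  assumes "(x, y) \<in> C ^^ j"
  shows "\<exists>S. run {a. \<exists>i\<le>j. (x, a) \<in> C ^^ i} x y S j"
  using assms
proof (induction j arbitrary: y)
  case 0
  then show ?case by (auto intro!: exI[of _ "{}"] run0)
next
  case (Suc j)
  then obtain z where z: "(x, z) \<in> C ^^ j" "(z, y) \<in> C" by auto
  with Suc.IH obtain S where "run {a. \<exists>i\<le>j. (x, a) \<in> C ^^ i} x z S j" by blast
  then have "run {a. \<exists>i\<le>Suc j. (x, a) \<in> C ^^ i} x z S j" by (rule run_mono) (auto intro: le_SucI)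
  then have "run {a. \<exists>i\<le>Suc j. (x, a) \<in> C ^^ i} x y (S \<union> (C `` {z} - {y})) (Suc j)"
  proof (rule runS)
    have "(x, a) \<in> C ^^ Suc j" if "(z, a) \<in> C" for a using z that by auto
    then show "C `` {z} \<subseteq> {a. \<exists>i\<le>Suc j. (x, a) \<in> C ^^ i}" by blast
  qed (use z in auto)
  then show ?case by blast
qed

text \<open>Lengthening the run replaces its end \<open>y\<close> by all children of
  \<open>y\<close>. This keeps an antichain, and nothing deep enough is lost: a proper descendant of
  \<open>y\<close> lies below one of the children.\<close>

lemma run_cut:
  assumes "run B x y S k" "x \<in> V"
  shows "antichain (insert y S) \<and> y \<notin> S
     \<and> (\<forall>a\<in>S. \<exists>i. 1 \<le> i \<and> i \<le> k \<and> (x, a) \<in> C ^^ i)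
     \<and> (\<forall>n j. (x, n) \<in> C ^^ j \<longrightarrow> k \<le> j \<longrightarrow> (\<exists>a\<in>insert y S. (a, n) \<in> C\<^sup>*))"
  using assms
proof (induction rule: run.induct)
  case run0
  then show ?case by (auto simp: antichain_def relpow_imp_rtrancl)
next
  case (runS y S k z)
  have xy: "(x, y) \<in> C ^^ k" using runS run_relpow by blast
  have yV: "y \<in> V" using xy runS V_relpow by blast
  let ?S = "S \<union> (C `` {y} - {z})"
  have eq: "insert z ?S = S \<union> C `` {y}" using runS by auto
  have ac: "antichain (insert y S)" using runS by blast
  have S1: False if "a \<in> S" "(y, c) \<in> C" "(a, c) \<in> C\<^sup>*" for a c
    using that rtrancl_par[OF that(3,2)] ac runS by (auto simp: antichain_def)
  have S2: False if "a \<in> S" "(y, c) \<in> C" "(c, a) \<in> C\<^sup>*" for a c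
  proof -
    have "(y, a) \<in> C\<^sup>*" using that by auto
    then show False using ac that runS unfolding antichain_def by auto
  qed
  have S3: "c = c'" if "(y, c) \<in> C" "(y, c') \<in> C" "(c, c') \<in> C\<^sup>*" for c c'
    using that yV by (metis V_step dep_step order_refl rtrancl_dep_eq)
  have A: "antichain (insert z ?S)"
    unfolding eq antichain_def using S1 S2 S3 ac by (auto simp: antichain_def)
  have B: "z \<notin> ?S" using S1 runS by blast
  have D: "\<exists>a\<in>insert z ?S. (a, n) \<in> C\<^sup>*" if n: "(x, n) \<in> C ^^ j" "Suc k \<le> j" for n j
  proof -
    obtain a where a: "a \<in> insert y S" "(a, n) \<in> C\<^sup>*" using runS n by (meson Suc_leD)
    show ?thesis
    proof (cases "a = y")
      case True
      \<comment> \<open>\<open>n\<close> is deeper than \<open>y\<close>, so its path from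
        \<open>y\<close> passes through a child of \<open>y\<close>.\<close>
      have "dep n = dep x + j" "dep y = dep x + k" using n xy runS dep_relpow by auto
      then have "y \<noteq> n" using n by auto
      then obtain c where "(y, c) \<in> C" "(c, n) \<in> C\<^sup>*" using a True by (metis converse_rtranclE)
      then show ?thesis unfolding eq by blast
    next
      case False
      then show ?thesis unfolding eq using a by blast
    qed
  qed
  have E: "\<exists>i. 1 \<le> i \<and> i \<le> Suc k \<and> (x, a) \<in> C ^^ i" if "a \<in> ?S" for a
  proof (cases "a \<in> S")
    case True
    then show ?thesis using runS by (meson le_SucI)
  next
    case False
    then have "(x, a) \<in> C ^^ Suc k" using that xy by auto
    then show ?thesis by (intro exI[of _ "Suc k"]) auto
  qed
  show ?case using A B D E by blast
qed

lemma run_append: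
  assumes "run B' y z S' k'" "run B x y S k"
  shows "run (B \<union> B') x z (S \<union> S') (k + k')"
  using assms
proof (induction rule: run.induct)
  case run0
  then show ?case using run_mono by fastforce
next
  case (runS y' S' k' z)
  then have "run (B \<union> B') x z (S \<union> S' \<union> (C `` {y'} - {z})) (Suc (k + k'))"
    by (intro run.runS) auto
  then show ?case by (simp add: Un_assoc)
qed

text \<open>What the second run leaves behind lies below \<open>y\<close>, and \<open>y\<close> is
  incomparable to what the first run left behind.\<close>

lemma run_append_disjoint:
  assumes "run B' y z S' k'" "run B x y S k" "x \<in> V"
  shows "S \<inter> S' = {} \<and> z \<notin> S"
proof -
  have "antichain (insert y S)" "y \<notin> S" using run_cut assms by blast+
  moreover have "y \<in> V" using assms run_relpow V_relpow by blast
  then have "\<forall>a\<in>insert z S'. (y, a) \<in> C\<^sup>*"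
    using run_cut[OF assms(1)] run_relpow[OF assms(1)] relpow_imp_rtrancl by (metis insert_iff)
  ultimately show ?thesis unfolding antichain_def by blast
qed

end

locale binary_tree = rtree +
  assumes children: "x \<in> V \<Longrightarrow> card (C `` {x}) = 1 \<or> card (C `` {x}) = 2"
begin

lemma children_finite: "x \<in> V \<Longrightarrow> finite (C `` {x})"
  using children card.infinite by fastforce

lemma run_card:
  assumes "run B x y S k" "x \<in> V"
  shows "finite S \<and> card S \<le> k"
  using assms
proof (induction rule: run.induct)
  case (runS y S k z)
  have "y \<in> V" using runS run_relpow V_relpow by blast
  then have "finite (C `` {y} - {z})" "card (C `` {y} - {z}) \<le> 1"
    using children[of y] children_finite[of y] runS by auto
  then show ?case using runS card_Un_le[of S "C `` {y} - {z}"] by auto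
qed auto

text \<open>A step in a binary tree adds at most one sibling, so the number of siblings takes every
  intermediate value along the run.\<close>

lemma run_truncate:
  assumes "run B x y S k" "x \<in> V" "m \<le> card S"
  shows "\<exists>y' S' k'. k' \<le> k \<and> run B x y' S' k' \<and> card S' = m"
  using assms
proof (induction arbitrary: m rule: run.induct)
  case run0
  then show ?case using run.run0 by fastforce
next
  case (runS y S k z)
  show ?case
  proof (cases "m \<le> card S")
    case True
    then show ?thesis using runS by (meson le_SucI)
  next
    case False
    have "y \<in> V" using runS run_relpow V_relpow by blast
    then have f: "finite (C `` {y} - {z})" "card (C `` {y} - {z}) \<le> 1"
      using children[of y] children_finite[of y] runS by auto
    have "card (S \<union> (C `` {y} - {z})) = m"
      using runS.prems False f card_Un_le[of S "C `` {y} - {z}"] by linarith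
    then show ?thesis using run.runS[OF runS(1,2,3)] by blast
  qed
qed

end

section \<open>Steering\<close>

text \<open>\<open>E\<close> is a unit of distance between labels, and \<open>E ^^ k\<close> is the
  relation of being at most \<open>k\<close> units apart. The targets \<open>q\<close> of
  \<open>steer\<close> are arbitrary labels; in the application \<open>E\<close> relates distinct
  labels only if both occur in one of the two trees.\<close>

locale labelled_tree = binary_tree +
  fixes lab :: "'a \<Rightarrow> 'l" and E :: "('l \<times> 'l) set" and R :: nat
  assumes symE: "sym E" and IdE: "Id \<subseteq> E"
    and lab_step: "x \<in> V \<Longrightarrow> (x, y) \<in> C \<Longrightarrow> (lab x, lab y) \<in> E"
    and steer: "x \<in> V \<Longrightarrow> (lab x, q) \<in> E ^^ 2 \<Longrightarrow> \<exists>y j. j \<le> R \<and> (x, y) \<in> C ^^ j \<and> (lab y, q) \<in> E"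
    and branch: "x \<in> V \<Longrightarrow> \<exists>y j. j \<le> R \<and> (x, y) \<in> C ^^ j \<and> card (C `` {y}) = 2"
begin

lemma E_mono: "i \<le> j \<Longrightarrow> (p, q) \<in> E ^^ i \<Longrightarrow> (p, q) \<in> E ^^ j"
  using relpow_mono_Id[OF IdE] by blast

lemma lab_relpow: "x \<in> V \<Longrightarrow> (x, y) \<in> C ^^ j \<Longrightarrow> (lab x, lab y) \<in> E ^^ j"
proof (induction j arbitrary: y)
  case (Suc j)
  then obtain z where "(x, z) \<in> C ^^ j" "(z, y) \<in> C" by auto
  then show ?case using Suc lab_step V_relpow by (meson relpow_Suc_I)
qed auto

lemma lab_near:
  assumes "x \<in> V" "(lab x, q) \<in> E ^^ k" "(x, a) \<in> C ^^ i" "i \<le> j"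
  shows "(lab a, q) \<in> E ^^ (j + k)"
proof -
  have "(lab a, lab x) \<in> E ^^ i" using assms lab_relpow relpow_sym[OF symE] by blast
  then have "(lab a, q) \<in> E ^^ (i + k)" using assms(2) by (rule relpow_trans_add)
  then show ?thesis using assms(4) by (intro E_mono[of "i + k" "j + k"]) auto
qed

text \<open>Each use of \<open>steer\<close> aims at a point \<open>p\<close> two units ahead on a
  chain from the current label to \<open>q\<close>, and gains one unit for at most \<open>R\<close>
  steps. During these steps a label drifts by at most \<open>R\<close> from where it started, which
  gives the radius \<open>R + Suc k\<close>.\<close>

lemma run_to_center:
  assumes "x \<in> V" "(lab x, q) \<in> E ^^ Suc k"
  shows "\<exists>w N j. j \<le> k * R \<and> run {a. (lab a, q) \<in> E ^^ (R + Suc k)} x w N j \<and> (lab w, q) \<in> E"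
  using assms
proof (induction k arbitrary: x)
  case 0
  then show ?case using E_mono[of 1 "R + 1" "lab x" q] by (intro exI[of _ x] exI[of _ "{}"] exI[of _ 0]) (auto intro!: run0)
next
  case (Suc k)
  obtain p where p: "(lab x, p) \<in> E ^^ 2" "(p, q) \<in> E ^^ k"
    using relpow_split[of "lab x" q 2 k E] Suc.prems(2) by (metis add_2_eq_Suc)
  obtain y j where y: "j \<le> R" "(x, y) \<in> C ^^ j" "(lab y, p) \<in> E" using steer p Suc by blast
  have yV: "y \<in> V" using y Suc V_relpow by blast
  have "(lab y, q) \<in> E ^^ Suc k" using y p by (meson relpow_Suc_I2)
  then obtain w N j' where w: "j' \<le> k * R" "run {a. (lab a, q) \<in> E ^^ (R + Suc k)} y w N j'" "(lab w, q) \<in> E"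
    using Suc yV by blast
  obtain S where S: "run {a. \<exists>i\<le>j. (x, a) \<in> C ^^ i} x y S j" using run_of_path y by blast
  have "run ({a. \<exists>i\<le>j. (x, a) \<in> C ^^ i} \<union> {a. (lab a, q) \<in> E ^^ (R + Suc k)}) x w (S \<union> N) (j + j')"
    using run_append w S by blast
  then have "run {a. (lab a, q) \<in> E ^^ (R + Suc (Suc k))} x w (S \<union> N) (j + j')"
  proof (rule run_mono, safe)
    fix a i assume "i \<le> j" "(x, a) \<in> C ^^ i"
    then show "(lab a, q) \<in> E ^^ (R + Suc (Suc k))" using lab_near[of x q "Suc (Suc k)" a i R] Suc.prems y by simp
  next
    fix a assume "(lab a, q) \<in> E ^^ (R + Suc k)"
    then show "(lab a, q) \<in> E ^^ (R + Suc (Suc k))" by (rule E_mono[rotated]) linarith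
  qed
  moreover have "j + j' \<le> Suc k * R" using w y by simp
  ultimately show ?case using w by blast
qed

text \<open>One round goes to a branching in at most \<open>R\<close> steps, one step further so as
  to leave a sibling behind, and then back to the centre. The return starts at distance
  \<open>R + 2\<close>, so \<open>run_to_center\<close> with \<open>k = R + 1\<close> costs
  \<open>(R + 1) * R\<close> steps and stays within \<open>2 * R + 2\<close>.\<close>

lemma run_near_center:
  assumes "x \<in> V" "(lab x, q) \<in> E"
  shows "\<exists>y S j. j \<le> m * (R + 1 + (R + 1) * R) \<and> run {a. (lab a, q) \<in> E ^^ (2 * R + 2)} x y S j
     \<and> m \<le> card S \<and> (lab y, q) \<in> E"
proof (induction m)
  case 0
  show ?case using E_mono[of 1 "2 * R + 2" "lab x" q] assms
    by (intro exI[of _ x] exI[of _ "{}"] exI[of _ 0]) (auto intro!: run0)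
next
  case (Suc m)
  let ?B = "{a. (lab a, q) \<in> E ^^ (2 * R + 2)}"
  obtain y S j where y: "j \<le> m * (R + 1 + (R + 1) * R)" "run ?B x y S j" "m \<le> card S" "(lab y, q) \<in> E"
    using Suc by blast
  have yV: "y \<in> V" using y run_relpow V_relpow assms by blast
  obtain z i where z: "i \<le> R" "(y, z) \<in> C ^^ i" "card (C `` {z}) = 2" using branch yV by blast
  have zV: "z \<in> V" using yV z V_relpow by blast
  have "C `` {z} \<noteq> {}" using z(3) by (metis card.empty zero_neq_numeral)
  then obtain c where c: "(z, c) \<in> C" by blast
  have cV: "c \<in> V" using c zV V_step by blast
  have near: "(lab a, q) \<in> E ^^ (R + 2)" if "i \<le> R + 1" "(y, a) \<in> C ^^ i" for a i
    using lab_near[of y q 1 a i "R + 1"] that y yV by simp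
  obtain S1 where S1: "run {a. \<exists>k\<le>i. (y, a) \<in> C ^^ k} y z S1 i" using run_of_path z by blast
  have "run ?B y z S1 i" using S1
  proof (rule run_mono, safe)
    fix a k assume "k \<le> i" "(y, a) \<in> C ^^ k"
    then show "(lab a, q) \<in> E ^^ (2 * R + 2)" using near[of k a] z by (intro E_mono[of "R + 2" "2 * R + 2"]) auto
  qed
  then have S2: "run ?B y c (S1 \<union> (C `` {z} - {c})) (Suc i)"
  proof (rule runS)
    show "C `` {z} \<subseteq> ?B"
    proof safe
      fix a assume "(z, a) \<in> C"
      then have "(y, a) \<in> C ^^ Suc i" using z by auto
      then show "(lab a, q) \<in> E ^^ (2 * R + 2)" using near[of "Suc i" a] z by (intro E_mono[of "R + 2" "2 * R + 2"]) auto
    qed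
  qed fact
  let ?S2 = "S1 \<union> (C `` {z} - {c})"
  have "card (C `` {z} - {c}) = 1" using z c children_finite[OF zV] by simp
  moreover have "card (C `` {z} - {c}) \<le> card ?S2" using run_card[OF S2 yV] by (intro card_mono) auto
  ultimately have cS2: "1 \<le> card ?S2" by linarith
  have "(y, c) \<in> C ^^ Suc i" using z c by auto
  then have "(lab c, q) \<in> E ^^ Suc (R + 1)" using near[of "Suc i" c] z by simp
  then obtain w N k where w: "k \<le> (R + 1) * R" "run {a. (lab a, q) \<in> E ^^ (R + Suc (R + 1))} c w N k" "(lab w, q) \<in> E"
    using run_to_center cV by blast
  have "R + Suc (R + 1) = 2 * R + 2" by simp
  then have w2: "run ?B c w N k" using w(2) by metis
  have S3: "run ?B x c (S \<union> ?S2) (j + Suc i)" using run_append[OF S2 y(2)] by simp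
  have S4: "run ?B x w (S \<union> ?S2 \<union> N) (j + Suc i + k)" using run_append[OF w2 S3] by simp
  have "card (S \<union> ?S2) = card S + card ?S2"
    using run_append_disjoint[OF S2 y(2) assms(1)] run_card[OF S2 yV] run_card[OF y(2) assms(1)]
    by (intro card_Un_disjoint) auto
  moreover have "card (S \<union> ?S2) \<le> card (S \<union> ?S2 \<union> N)" using run_card[OF S4 assms(1)] by (intro card_mono) auto
  ultimately have "Suc m \<le> card (S \<union> ?S2 \<union> N)" using y cS2 by linarith
  moreover have "j + Suc i + k \<le> Suc m * (R + 1 + (R + 1) * R)" using y w z by (simp add: add_mono)
  ultimately show ?case using S4 w by blast
qed

text \<open>Every branching passed adds exactly one vertex to the cut, so the size of \<open>M\<close> can be prescribed.\<close>

lemma expand: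
  assumes x: "x \<in> V" "(lab x, q) \<in> E ^^ Suc k"
  shows "\<exists>N. finite N \<and> card N \<le> k * R \<and> (\<forall>a\<in>N. (lab a, q) \<in> E ^^ (R + Suc k)) \<and>
     (\<forall>m\<ge>1. \<exists>M. finite M \<and> card M = Suc m \<and> N \<inter> M = {} \<and> (\<forall>a\<in>M. (lab a, q) \<in> E ^^ (2 * R + 2))
        \<and> (\<exists>D \<le> k * R + m * (R + 1 + (R + 1) * R). pcut D x (N \<union> M)))"
proof -
  obtain w N j where w: "j \<le> k * R" "run {a. (lab a, q) \<in> E ^^ (R + Suc k)} x w N j" "(lab w, q) \<in> E"
    using run_to_center x by blast
  have wV: "w \<in> V" using w run_relpow V_relpow x by blast
  have N: "finite N" "card N \<le> j" using run_card w x by blast+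
  have N2: "\<forall>a\<in>N. (lab a, q) \<in> E ^^ (R + Suc k)" using run_relpow[OF w(2)] by blast
  have "\<exists>M. finite M \<and> card M = Suc m \<and> N \<inter> M = {} \<and> (\<forall>a\<in>M. (lab a, q) \<in> E ^^ (2 * R + 2))
        \<and> (\<exists>D \<le> k * R + m * (R + 1 + (R + 1) * R). pcut D x (N \<union> M))" if m: "1 \<le> m" for m
  proof -
    obtain y0 S0 i0 where "i0 \<le> m * (R + 1 + (R + 1) * R)"
      "run {a. (lab a, q) \<in> E ^^ (2 * R + 2)} w y0 S0 i0" "m \<le> card S0"
      using run_near_center[OF wV w(3)] by blast
    \<comment> \<open>Only a lower bound on the number of siblings is known so far; truncation makes
      it exactly \<open>m\<close>, and the end of the run is the vertex number
      \<open>Suc m\<close>.\<close>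
    then obtain y S i where y: "i \<le> m * (R + 1 + (R + 1) * R)"
      "run {a. (lab a, q) \<in> E ^^ (2 * R + 2)} w y S i" "card S = m"
      using run_truncate wV by (meson le_trans)
    let ?M = "insert y S"
    have S: "finite S" "y \<notin> S" using run_card[OF y(2) wV] run_cut[OF y(2) wV] by auto
    \<comment> \<open>Since \<open>m\<close> is at least 1, the second run has positive length and
      ends in a proper descendant of \<open>x\<close>, as a cut requires.\<close>
    have i: "1 \<le> i" using run_card[OF y(2) wV] y m by simp
    have r: "run ({a. (lab a, q) \<in> E ^^ (R + Suc k)} \<union> {a. (lab a, q) \<in> E ^^ (2 * R + 2)}) x y (N \<union> S) (j + i)"
      using run_append y w by blast
    have "(x, y) \<in> C ^^ (j + i)" using run_relpow[OF r] by blast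
    moreover have "N \<union> ?M = insert y (N \<union> S)" by auto
    moreover have "\<forall>a\<in>N \<union> S. \<exists>l. 1 \<le> l \<and> l \<le> j + i \<and> (x, a) \<in> C ^^ l" using run_cut[OF r x(1)] by blast
    ultimately have "pcut (j + i) x (N \<union> ?M)" using run_cut[OF r x(1)] i N S 
    by (simp only: pcut_def) (metis finite.insertI finite_UnI insert_iff le_refl trans_le_add2)
    moreover have "N \<inter> ?M = {}" using run_append_disjoint[OF y(2) w(2) x(1)] by auto
    moreover have "j + i \<le> k * R + m * (R + 1 + (R + 1) * R)" using w y by simp
    moreover have "\<forall>a\<in>?M. (lab a, q) \<in> E ^^ (2 * R + 2)" using run_relpow[OF y(2)] by blast
    moreover have "card ?M = Suc m" using S y by simp
    moreover have "finite ?M" using S by simp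
    ultimately show ?thesis by (intro exI[of _ ?M] conjI) blast+
  qed
  moreover have "card N \<le> k * R" using N w by simp
  ultimately show ?thesis using N(1) N2 by blast
qed

end

section \<open>Matching two trees\<close>

text \<open>This is the recursion in abstract form, with \<open>P\<close> as the set of states. The
  inverse bijections \<open>b'\<close> are carried as a parameter to make the assumptions symmetric
  in the two trees, which \<open>swap\<close> exploits.\<close>

locale matching = T: rtree C r + T': rtree C' r'
  for C :: "('x \<times> 'x) set" and r and C' :: "('y \<times> 'y) set" and r' +
  fixes D :: nat and P :: "'x \<Rightarrow> 'y \<Rightarrow> bool" and X :: "'x \<Rightarrow> 'y \<Rightarrow> 'x set" and X' :: "'x \<Rightarrow> 'y \<Rightarrow> 'y set"
    and b :: "'x \<Rightarrow> 'y \<Rightarrow> 'x \<Rightarrow> 'y" and b' :: "'x \<Rightarrow> 'y \<Rightarrow> 'y \<Rightarrow> 'x"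
  assumes P_root: "P r r'"
    and X_cut: "x \<in> T.V \<Longrightarrow> y \<in> T'.V \<Longrightarrow> P x y \<Longrightarrow> T.pcut D x (X x y)"
    and X'_cut: "x \<in> T.V \<Longrightarrow> y \<in> T'.V \<Longrightarrow> P x y \<Longrightarrow> T'.pcut D y (X' x y)"
    and b_mem: "x \<in> T.V \<Longrightarrow> y \<in> T'.V \<Longrightarrow> P x y \<Longrightarrow> a \<in> X x y \<Longrightarrow> b x y a \<in> X' x y \<and> b' x y (b x y a) = a"
    and b'_mem: "x \<in> T.V \<Longrightarrow> y \<in> T'.V \<Longrightarrow> P x y \<Longrightarrow> c \<in> X' x y \<Longrightarrow> b' x y c \<in> X x y \<and> b x y (b' x y c) = c"
    and b_P: "x \<in> T.V \<Longrightarrow> y \<in> T'.V \<Longrightarrow> P x y \<Longrightarrow> a \<in> X x y \<Longrightarrow> P a (b x y a)"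
begin

text \<open>The path from the root to \<open>n\<close> is read one vertex at a time, and the state
  changes exactly when the path meets the cut of the current state. \<open>F n\<close> is the state
  after reading \<open>n\<close>. The recursion is on the depth because the tree is given by a
  relation only.\<close>

primrec G :: "nat \<Rightarrow> 'x \<Rightarrow> 'x \<times> 'y" where
  "G 0 n = (r, r')"
| "G (Suc k) n = (let (x, y) = G k (T.par n) in if n \<in> X x y then (n, b x y n) else (x, y))"

definition F :: "'x \<Rightarrow> 'x \<times> 'y" where "F n = G (T.dep n) n"

lemma F_root: "F r = (r, r')"
  by (simp add: F_def T.dep_root)

lemma F_step: "p \<in> T.V \<Longrightarrow> (p, n) \<in> C \<Longrightarrow> F n = (let (x, y) = F p in if n \<in> X x y then (n, b x y n) else (x, y))"
  by (simp add: F_def T.dep_step T.par_eq)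

lemma cut_D: "T.pcut D x Z \<Longrightarrow> a \<in> Z \<Longrightarrow> \<exists>i. 1 \<le> i \<and> i \<le> D \<and> (x, a) \<in> C ^^ i"
  by (auto simp: T.pcut_def)

lemma cut_proper: "x \<in> T.V \<Longrightarrow> T.pcut D x Z \<Longrightarrow> a \<in> Z \<Longrightarrow> (a, x) \<notin> C\<^sup>*"
proof
  assume a: "x \<in> T.V" "T.pcut D x Z" "a \<in> Z" "(a, x) \<in> C\<^sup>*"
  then obtain i where i: "1 \<le> i" "(x, a) \<in> C ^^ i" using cut_D by blast
  then have "a \<in> T.V" using a T.V_relpow by blast
  then have "T.dep a \<le> T.dep x" using a T.dep_rtrancl by blast
  then show False using i a T.dep_relpow by fastforce
qed

lemma X'_D: "x \<in> T.V \<Longrightarrow> y \<in> T'.V \<Longrightarrow> P x y \<Longrightarrow> a \<in> X' x y \<Longrightarrow> \<exists>i. 1 \<le> i \<and> i \<le> D \<and> (y, a) \<in> C' ^^ i"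
  using X'_cut by (auto simp: T'.pcut_def)

text \<open>The last clause, that no vertex of the current cut lies above \<open>n\<close>, is what
  bounds the distance from \<open>x\<close> to \<open>n\<close> in \<open>F_close\<close>.\<close>

lemma F_inv:
  assumes "n \<in> T.V" "F n = (x, y)"
  shows "x \<in> T.V \<and> y \<in> T'.V \<and> P x y \<and> (x, n) \<in> C\<^sup>* \<and> (\<forall>a\<in>X x y. (a, n) \<notin> C\<^sup>*)"
  using assms
proof (induction n arbitrary: x y rule: T.V_induct)
  case root
  then have e: "x = r" "y = r'" using F_root by auto
  then have "\<forall>a\<in>X r r'. (a, r) \<notin> C\<^sup>*"
    using cut_proper X_cut T.root_V T'.root_V P_root by blast
  then show ?case using e T.root_V T'.root_V P_root by blast
next
  case (step p n)
  obtain x0 y0 where s: "F p = (x0, y0)" by fastforce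
  note IH = step.IH[OF s]
  have nV: "n \<in> T.V" using step T.V_step by blast
  show ?case
  proof (cases "n \<in> X x0 y0")
    case True
    then have e: "x = n" "y = b x0 y0 n" using step s F_step[OF step(1,2)] by auto
    have y: "y \<in> X' x0 y0" using e True IH b_mem by blast
    then have yV: "y \<in> T'.V" using IH X'_D T'.V_relpow by meson
    have P: "P n y" using e True IH b_P by blast
    have "\<forall>a\<in>X n y. (a, n) \<notin> C\<^sup>*" using cut_proper X_cut nV yV P by blast
    then show ?thesis using e nV yV P by blast
  next
    case False
    then have e: "x = x0" "y = y0" using step s F_step[OF step(1,2)] by auto
    have "(a, n) \<notin> C\<^sup>*" if "a \<in> X x y" for a
      using that False e IH T.rtrancl_par[OF _ step(2), of a] by auto
    then show ?thesis using e IH step(2) by (auto intro: rtrancl.rtrancl_into_rtrancl)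
  qed
qed

lemma F_close:
  assumes "n \<in> T.V" "F n = (x, y)"
  shows "\<exists>i\<le>D. (x, n) \<in> C ^^ i"
proof -
  note I = F_inv[OF assms]
  then obtain j where j: "(x, n) \<in> C ^^ j" using rtrancl_imp_relpow by blast
  have "T.pcut D x (X x y)" using X_cut I by blast
  then have "\<not> D \<le> j" using I j unfolding T.pcut_def by blast
  then show ?thesis using j by (intro exI[of _ j]) simp
qed

lemma F_lipschitz:
  assumes "p \<in> T.V" "(p, n) \<in> C"
  shows "\<exists>i\<le>D. (snd (F p), snd (F n)) \<in> C' ^^ i"
proof -
  obtain x y where s: "F p = (x, y)" by fastforce
  note I = F_inv[OF assms(1) s]
  show ?thesis
  proof (cases "n \<in> X x y")
    case True
    then show ?thesis using s F_step[OF assms] I X'_D b_mem by fastforce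
  next
    case False
    then show ?thesis using s F_step[OF assms] by (auto intro!: exI[of _ 0])
  qed
qed

lemma swap: "matching C' r' C r D (\<lambda>y x. P x y) (\<lambda>y x. X' x y) (\<lambda>y x. X x y) (\<lambda>y x. b' x y) (\<lambda>y x. b x y)"
proof
  show "P r r'" by (rule P_root)
next
  fix y x assume a: "y \<in> T'.V" "x \<in> T.V" "P x y"
  then show "T'.pcut D y (X' x y)" "T.pcut D x (X x y)" using X_cut X'_cut by auto
  fix c assume c: "c \<in> X' x y"
  then show "b' x y c \<in> X x y \<and> b x y (b' x y c) = c" using a b'_mem by blast
  then show "P (b' x y c) c" using b_P a by metis
next
  fix y x c assume a: "y \<in> T'.V" "x \<in> T.V" "P x y" "c \<in> X x y"
  then show "b x y c \<in> X' x y \<and> b' x y (b x y c) = c" using b_mem by blast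
qed

interpretation S: matching C' r' C r D "\<lambda>y x. P x y" "\<lambda>y x. X' x y" "\<lambda>y x. X x y" "\<lambda>y x. b' x y" "\<lambda>y x. b x y"
  by (rule swap)

text \<open>The descent from \<open>y0\<close> to a matched vertex \<open>y\<close> meets the cut
  \<open>X' x0 y0\<close> at \<open>y\<close> only, because the cut is an antichain. So the state of
  the second tree stays \<open>(y0, x0)\<close> until \<open>y\<close> and then changes to the
  mirror image of the state of the first tree.\<close>

lemma swap_F:
  assumes "n \<in> T.V" "F n = (x, y)"
  shows "S.F y = (y, x)"
  using assms
proof (induction n arbitrary: x y rule: T.V_induct)
  case root
  then show ?case using F_root S.F_root by simp
next
  case (step p n)
  obtain x0 y0 where s: "F p = (x0, y0)" by fastforce
  note I = F_inv[OF step(1) s]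
  note IH = step.IH[OF s]
  show ?case
  proof (cases "n \<in> X x0 y0")
    case True
    then have e: "x = n" "y = b x0 y0 n" using step s F_step[OF step(1,2)] by auto
    have y: "y \<in> X' x0 y0" using e True I b_mem by blast
    then obtain i where i: "1 \<le> i" "(y0, y) \<in> C' ^^ i" using I X'_D by meson
    then obtain j where j: "i = Suc j" by (cases i) auto
    then obtain z where z: "(y0, z) \<in> C' ^^ j" "(z, y) \<in> C'" using i by auto
    have ac: "T'.antichain (X' x0 y0)" using X'_cut I by (auto simp: T'.pcut_def)
    have "S.F m = (y0, x0) \<and> m \<in> T'.V" if "(y0, m) \<in> C' ^^ k" "(m, z) \<in> C'\<^sup>*" for k m
      using that
    proof (induction k arbitrary: m)
      case 0
      then show ?case using IH I by auto
    next
      case (Suc k)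
      then obtain m' where m': "(y0, m') \<in> C' ^^ k" "(m', m) \<in> C'" by auto
      then have IH': "S.F m' = (y0, x0)" "m' \<in> T'.V" using Suc by (auto intro: converse_rtrancl_into_rtrancl)
      have "m \<notin> X' x0 y0"
      proof
        assume m: "m \<in> X' x0 y0"
        have "(m, y) \<in> C'\<^sup>*" using Suc.prems z by auto
        then have "m = y" using ac m y by (auto simp: T'.antichain_def)
        moreover have "m \<in> T'.V" "z \<in> T'.V" using Suc.prems z I T'.V_relpow by blast+
        ultimately show False using Suc.prems(2) z(2) T'.dep_step T'.dep_rtrancl by fastforce
      qed
      then show ?case using S.F_step[OF IH'(2) m'(2)] IH' T'.V_step m' by auto
    qed
    from this[OF z(1)] have zF: "S.F z = (y0, x0)" "z \<in> T'.V" by auto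
    have "b' x0 y0 y = n" using b_mem I True e by blast
    then show ?thesis using S.F_step[OF zF(2) z(2)] zF y e by simp
  next
    case False
    then show ?thesis using step s F_step[OF step(1,2)] IH by auto
  qed
qed

lemma round_trip: "n \<in> T.V \<Longrightarrow> \<exists>i\<le>D. (snd (S.F (snd (F n))), n) \<in> C ^^ i"
  using swap_F F_close by (metis prod.collapse snd_conv)

end

text \<open>The sizes leave room to send \<open>N\<close> into \<open>M'\<close>, to cover
  \<open>N'\<close> from \<open>M\<close>, and to pair the \<open>k\<close> vertices that remain on
  either side. The point is that no element of \<open>N\<close> is sent into
  \<open>N'\<close>.\<close>

lemma bij_split:
  assumes "finite N" "finite M" "finite N'" "finite M'" "N \<inter> M = {}" "N' \<inter> M' = {}"
    "card M = card N' + k" "card M' = card N + k"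
  obtains f where "bij_betw f (N \<union> M) (N' \<union> M')" "\<And>a. a \<in> N \<Longrightarrow> f a \<in> M'"
proof -
  have le: "card N' \<le> card M" "card N \<le> card M'" using assms by simp_all
  obtain M1 where M1: "M1 \<subseteq> M" "card M1 = card N'" using obtain_subset_with_card_n[OF le(1)] .
  obtain M1' where M1': "M1' \<subseteq> M'" "card M1' = card N" using obtain_subset_with_card_n[OF le(2)] .
  have fin: "finite M1" "finite M1'" using M1 M1' assms finite_subset by blast+
  obtain f1 where f1: "bij_betw f1 N M1'" using fin assms M1' by (metis finite_same_card_bij)
  obtain f2 where f2: "bij_betw f2 M1 N'" using fin assms M1 by (metis finite_same_card_bij)
  have "card (M - M1) = k" "card (M' - M1') = k"
    using assms M1 M1' fin by (simp_all add: card_Diff_subset)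
  then obtain f3 where f3: "bij_betw f3 (M - M1) (M' - M1')"
    using assms by (metis finite_same_card_bij finite_Diff)
  define f where "f a = (if a \<in> N then f1 a else if a \<in> M1 then f2 a else f3 a)" for a
  have b1: "bij_betw f N M1'" using f1 by (rule bij_betw_cong[THEN iffD1, rotated]) (simp add: f_def)
  have b2: "bij_betw f M1 N'" using f2
    by (rule bij_betw_cong[THEN iffD1, rotated]) (use M1 assms(5) in \<open>auto simp: f_def\<close>)
  have b3: "bij_betw f (M - M1) (M' - M1')" using f3
    by (rule bij_betw_cong[THEN iffD1, rotated]) (use M1 assms(5) in \<open>auto simp: f_def\<close>)
  have "bij_betw f (N \<union> M1 \<union> (M - M1)) (M1' \<union> N' \<union> (M' - M1'))"
    by (intro bij_betw_combine b1 b2 b3) (use M1' assms in auto)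
  moreover have "N \<union> M1 \<union> (M - M1) = N \<union> M" "M1' \<union> N' \<union> (M' - M1') = N' \<union> M'"
    using M1 M1' by auto
  ultimately have "bij_betw f (N \<union> M) (N' \<union> M')" by simp
  moreover have "f a \<in> M'" if "a \<in> N" for a using b1 M1' that by (auto simp: bij_betw_def)
  ultimately show ?thesis using that by blast
qed

locale two_trees = T: labelled_tree C r lab E R + T': labelled_tree C' r' lab' E R
  for C :: "('x \<times> 'x) set" and r lab and C' :: "('y \<times> 'y) set" and r' lab' and E :: "('l \<times> 'l) set" and R +
  assumes root_close: "\<exists>k. (lab r, lab' r') \<in> E ^^ k"
begin

text \<open>For a stray \<open>a\<close> in \<open>N\<close> the new reference \<open>p\<close> is
  \<open>Suc k\<close> units from \<open>lab a\<close> and \<open>R\<close> units from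
  \<open>q\<close>; the partner of \<open>a\<close> in \<open>M'\<close> is within
  \<open>2 * R + 2 + R\<close> of \<open>p\<close>, which is at most \<open>Suc k\<close>. Pairs in
  \<open>M\<close> and \<open>M'\<close> keep the reference \<open>q\<close>. The depth
  \<open>k * R\<close> is spent on reaching the centre, and at most \<open>k * R + 1\<close> rounds
  of \<open>run_near_center\<close> follow.\<close>

lemma state_step:
  assumes k: "3 * R + 4 \<le> k"
    and x: "x \<in> T.V" "(lab x, q) \<in> E ^^ Suc k"
    and y: "y \<in> T'.V" "(lab' y, q) \<in> E ^^ Suc k"
  shows "\<exists>X X' f. T.pcut (k * R + (k * R + 1) * (R + 1 + (R + 1) * R)) x X
    \<and> T'.pcut (k * R + (k * R + 1) * (R + 1 + (R + 1) * R)) y X' \<and> bij_betw f X X'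
    \<and> (\<forall>a\<in>X. \<exists>q. (lab a, q) \<in> E ^^ Suc k \<and> (lab' (f a), q) \<in> E ^^ Suc k)"
proof -
  let ?D = "k * R + (k * R + 1) * (R + 1 + (R + 1) * R)"
  obtain N where N: "finite N" "card N \<le> k * R" "\<forall>a\<in>N. (lab a, q) \<in> E ^^ (R + Suc k)"
    and NM: "\<And>m. 1 \<le> m \<Longrightarrow> \<exists>M. finite M \<and> card M = Suc m \<and> N \<inter> M = {} \<and> (\<forall>a\<in>M. (lab a, q) \<in> E ^^ (2 * R + 2))
        \<and> (\<exists>D \<le> k * R + m * (R + 1 + (R + 1) * R). T.pcut D x (N \<union> M))"
    using T.expand[OF x] by blast
  obtain N' where N': "finite N'" "card N' \<le> k * R" "\<forall>a\<in>N'. (lab' a, q) \<in> E ^^ (R + Suc k)"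
    and NM': "\<And>m. 1 \<le> m \<Longrightarrow> \<exists>M. finite M \<and> card M = Suc m \<and> N' \<inter> M = {} \<and> (\<forall>a\<in>M. (lab' a, q) \<in> E ^^ (2 * R + 2))
        \<and> (\<exists>D \<le> k * R + m * (R + 1 + (R + 1) * R). T'.pcut D y (N' \<union> M))"
    using T'.expand[OF y] by blast
  \<comment> \<open>The sizes are crossed: \<open>M\<close> exceeds \<open>N'\<close> and
    \<open>M'\<close> exceeds \<open>N\<close> by the same 2, which also makes the two cuts equally
    large.\<close>
  have "1 \<le> card N' + 1" "1 \<le> card N + 1" by auto
  then obtain M M' D D' where M: "finite M" "card M = Suc (card N' + 1)" "N \<inter> M = {}"
      "\<forall>a\<in>M. (lab a, q) \<in> E ^^ (2 * R + 2)"
      "D \<le> k * R + (card N' + 1) * (R + 1 + (R + 1) * R)" "T.pcut D x (N \<union> M)"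
    and M': "finite M'" "card M' = Suc (card N + 1)" "N' \<inter> M' = {}"
      "\<forall>a\<in>M'. (lab' a, q) \<in> E ^^ (2 * R + 2)"
      "D' \<le> k * R + (card N + 1) * (R + 1 + (R + 1) * R)" "T'.pcut D' y (N' \<union> M')"
    using NM NM' by metis
  obtain f where f: "bij_betw f (N \<union> M) (N' \<union> M')" "\<And>a. a \<in> N \<Longrightarrow> f a \<in> M'"
    using bij_split[OF N(1) M(1) N'(1) M'(1) M(3) M'(3), of 2] M M' by auto
  have "(card N' + 1) * (R + 1 + (R + 1) * R) \<le> (k * R + 1) * (R + 1 + (R + 1) * R)"
    "(card N + 1) * (R + 1 + (R + 1) * R) \<le> (k * R + 1) * (R + 1 + (R + 1) * R)"
    using N N' by (intro mult_le_mono1; simp)+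
  then have D: "D \<le> ?D" "D' \<le> ?D" using M(5) M'(5) by linarith+
  have "T.pcut ?D x (N \<union> M)" using M(6) D(1) unfolding T.pcut_def by (meson le_trans)
  moreover have "T'.pcut ?D y (N' \<union> M')" using M'(6) D(2) unfolding T'.pcut_def by (meson le_trans)
  moreover have "\<exists>p. (lab a, p) \<in> E ^^ Suc k \<and> (lab' (f a), p) \<in> E ^^ Suc k" if a: "a \<in> N \<union> M" for a
  proof (cases "a \<in> N")
    case True
    obtain p where p: "(lab a, p) \<in> E ^^ Suc k" "(p, q) \<in> E ^^ R"
      using relpow_split[of "lab a" q "Suc k" R E] N True by (metis add.commute)
    have "(lab' (f a), q) \<in> E ^^ (2 * R + 2)" using f True M' by blast
    then have "(lab' (f a), p) \<in> E ^^ (2 * R + 2 + R)"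
      using p relpow_sym[OF T.symE] relpow_trans_add by metis
    then have "(lab' (f a), p) \<in> E ^^ Suc k" using k by (intro T.E_mono[of "2 * R + 2 + R" "Suc k"]) auto
    then show ?thesis using p by blast
  next
    case False
    then have aM: "(lab a, q) \<in> E ^^ (2 * R + 2)" using a M by blast
    show ?thesis
    proof (cases "f a \<in> N'")
      case True
      obtain p where p: "(lab' (f a), p) \<in> E ^^ Suc k" "(p, q) \<in> E ^^ R"
        using relpow_split[of "lab' (f a)" q "Suc k" R E] N' True by (metis add.commute)
      have "(lab a, p) \<in> E ^^ (2 * R + 2 + R)"
        using p aM relpow_sym[OF T.symE] relpow_trans_add by metis
      then have "(lab a, p) \<in> E ^^ Suc k" using k by (intro T.E_mono[of "2 * R + 2 + R" "Suc k"]) auto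
    then show ?thesis using p by blast
    next
      case False
      then have "f a \<in> M'" using f a by (auto simp: bij_betw_def)
      then have "(lab' (f a), q) \<in> E ^^ (2 * R + 2)" using M' by blast
      then show ?thesis using aM k T.E_mono[of "2 * R + 2" "Suc k"] by (intro exI[of _ q]) auto
    qed
  qed
  ultimately show ?thesis using f(1) by blast
qed

theorem coarse_matching:
  "\<exists>F F' D. (\<forall>n\<in>T.V. F n \<in> T'.V \<and> (lab n, lab' (F n)) \<in> E ^^ D \<and> (\<exists>i\<le>D. (F' (F n), n) \<in> C ^^ i))
     \<and> (\<forall>p\<in>T.V. \<forall>n. (p, n) \<in> C \<longrightarrow> (\<exists>i\<le>D. (F p, F n) \<in> C' ^^ i))
     \<and> (\<forall>n\<in>T'.V. F' n \<in> T.V \<and> (lab' n, lab (F' n)) \<in> E ^^ D \<and> (\<exists>i\<le>D. (F (F' n), n) \<in> C' ^^ i))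
     \<and> (\<forall>p\<in>T'.V. \<forall>n. (p, n) \<in> C' \<longrightarrow> (\<exists>i\<le>D. (F' p, F' n) \<in> C ^^ i))"
proof -
  obtain k0 where k0: "(lab r, lab' r') \<in> E ^^ k0" using root_close by blast
  \<comment> \<open>The summand \<open>k0\<close> makes the pair of roots a state, with the label of
    \<open>r'\<close> as reference; the rest is what \<open>state_step\<close> asks for.\<close>
  define k where "k = k0 + 3 * R + 4"
  define D where "D = k * R + (k * R + 1) * (R + 1 + (R + 1) * R)"
  define P where "P x y \<longleftrightarrow> (\<exists>q. (lab x, q) \<in> E ^^ Suc k \<and> (lab' y, q) \<in> E ^^ Suc k)" for x y
  have "\<exists>X X' f. T.pcut D x X \<and> T'.pcut D y X' \<and> bij_betw f X X' \<and> (\<forall>a\<in>X. P a (f a))"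
    if "x \<in> T.V" "y \<in> T'.V" "P x y" for x y
    using state_step[of k x _ y] that unfolding P_def D_def k_def by fastforce
  then obtain X X' b where X: "\<And>x y. x \<in> T.V \<Longrightarrow> y \<in> T'.V \<Longrightarrow> P x y \<Longrightarrow>
     T.pcut D x (X x y) \<and> T'.pcut D y (X' x y) \<and> bij_betw (b x y) (X x y) (X' x y) \<and> (\<forall>a\<in>X x y. P a (b x y a))"
    by metis
  have "(lab r, lab' r') \<in> E ^^ Suc k" "(lab' r', lab' r') \<in> E ^^ Suc k"
    using k0 T.E_mono[of k0 "Suc k"] T.E_mono[of 0 "Suc k"] by (auto simp: k_def)
  then have "P r r'" unfolding P_def by blast
  then interpret M: matching C r C' r' D P X X' b "\<lambda>x y. inv_into (X x y) (b x y)"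
    by unfold_locales (use X in \<open>auto simp: bij_betw_def inv_into_into f_inv_into_f\<close>)
  interpret S: matching C' r' C r D "\<lambda>y x. P x y" "\<lambda>y x. X' x y" "\<lambda>y x. X x y"
    "\<lambda>y x. inv_into (X x y) (b x y)" "\<lambda>y x. b x y"
    by (rule M.swap)
  \<comment> \<open>\<open>D\<close> from \<open>n\<close> to the vertex of its state, and
    \<open>Suc k\<close> from each member of the state to their common reference.\<close>
  let ?D = "D + (Suc k + Suc k)"
  have close: "(lab x, lab' y) \<in> E ^^ (Suc k + Suc k)" if xy: "P x y" for x y
  proof -
    obtain q where "(lab x, q) \<in> E ^^ Suc k" "(lab' y, q) \<in> E ^^ Suc k" using xy unfolding P_def by blast
    then show ?thesis by (intro relpow_trans_add[OF _ relpow_sym[OF T.symE]])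
  qed
  have P: "P (fst (M.F n)) (snd (M.F n)) \<and> fst (M.F n) \<in> T.V \<and> snd (M.F n) \<in> T'.V" if "n \<in> T.V" for n
    using M.F_inv[OF that, of "fst (M.F n)" "snd (M.F n)"] by auto
  have P': "P (snd (S.F n)) (fst (S.F n)) \<and> fst (S.F n) \<in> T'.V \<and> snd (S.F n) \<in> T.V" if "n \<in> T'.V" for n
    using S.F_inv[OF that, of "fst (S.F n)" "snd (S.F n)"] by auto
  have lab: "(lab n, lab' (snd (M.F n))) \<in> E ^^ ?D" if n: "n \<in> T.V" for n
  proof -
    obtain i where "i \<le> D" "(fst (M.F n), n) \<in> C ^^ i" using M.F_close[OF n, of "fst (M.F n)" "snd (M.F n)"] by auto
    then show ?thesis using T.lab_near P[OF n] close by blast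
  qed
  have lab': "(lab' n, lab (snd (S.F n))) \<in> E ^^ ?D" if n: "n \<in> T'.V" for n
  proof -
    obtain i where i: "(fst (S.F n), n) \<in> C' ^^ i" "i \<le> D" using S.F_close[OF n, of "fst (S.F n)" "snd (S.F n)"] by auto
    have "P (snd (S.F n)) (fst (S.F n))" and V: "fst (S.F n) \<in> T'.V" using P'[OF n] by auto
    then have "(lab' (fst (S.F n)), lab (snd (S.F n))) \<in> E ^^ (Suc k + Suc k)"
      by (intro relpow_sym[OF T.symE close])
    from T'.lab_near[OF V this i] show ?thesis .
  qed
  have *: "i \<le> D \<Longrightarrow> i \<le> ?D" for i by simp
  show ?thesis
  proof (rule exI[of _ "\<lambda>n. snd (M.F n)"], rule exI[of _ "\<lambda>n. snd (S.F n)"], rule exI[of _ ?D],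
      intro conjI ballI allI impI)
    fix n assume n: "n \<in> T.V"
    show "snd (M.F n) \<in> T'.V" using P[OF n] by simp
    show "(lab n, lab' (snd (M.F n))) \<in> E ^^ ?D" using lab[OF n] .
    show "\<exists>i\<le>?D. (snd (S.F (snd (M.F n))), n) \<in> C ^^ i" using M.round_trip[OF n] * by blast
    fix m assume "(n, m) \<in> C"
    then show "\<exists>i\<le>?D. (snd (M.F n), snd (M.F m)) \<in> C' ^^ i" using M.F_lipschitz[OF n] * by blast
  next
    fix n assume n: "n \<in> T'.V"
    show "snd (S.F n) \<in> T.V" using P'[OF n] by simp
    show "(lab' n, lab (snd (S.F n))) \<in> E ^^ ?D" using lab'[OF n] .
    show "\<exists>i\<le>?D. (snd (M.F (snd (S.F n))), n) \<in> C' ^^ i" using S.round_trip[OF n] * by blast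
    fix m assume "(n, m) \<in> C'"
    then show "\<exists>i\<le>?D. (snd (S.F n), snd (S.F m)) \<in> C ^^ i" using S.F_lipschitz[OF n] * by blast
  qed
qed

end

section \<open>Path distance in a rooted tree\<close>

lemma relpow_subset:
  fixes A B :: "('a \<times> 'a) set"
  shows "A \<subseteq> B \<Longrightarrow> A ^^ n \<subseteq> B ^^ n"
  by (induction n) auto

context rtree begin

text \<open>The diagonal is included so that \<open>nb ^^ k\<close> means distance at most
  \<open>k\<close>.\<close>

definition nb :: "('x \<times> 'x) set" where "nb = C \<union> C\<inverse> \<union> Id"

lemma nb_sym: "sym nb" by (auto simp: nb_def sym_def)
lemma nb_Id: "Id \<subseteq> nb" by (auto simp: nb_def)

lemma nb_mono: "i \<le> j \<Longrightarrow> (p, q) \<in> nb ^^ i \<Longrightarrow> (p, q) \<in> nb ^^ j"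
  using relpow_mono_Id[OF nb_Id] by blast

lemma nb_V: "x \<in> V \<Longrightarrow> (x, y) \<in> nb \<Longrightarrow> y \<in> V"
  using V_step V_cases[of x] no_par par_unique[of _ x y] by (auto simp: nb_def)

lemma nb_relpow_V: "x \<in> V \<Longrightarrow> (x, y) \<in> nb ^^ k \<Longrightarrow> y \<in> V"
  by (induction k arbitrary: y) (auto intro: nb_V)

lemma relpow_nb: "(x, y) \<in> C ^^ i \<Longrightarrow> i \<le> k \<Longrightarrow> (x, y) \<in> nb ^^ k"
proof -
  assume a: "(x, y) \<in> C ^^ i" "i \<le> k"
  have "C ^^ i \<subseteq> nb ^^ i" by (rule relpow_subset) (auto simp: nb_def)
  then show ?thesis using a nb_mono by blast
qed

end

section \<open>From finite valence to binary trees\<close>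

text \<open>The first child of a vertex and its next sibling become its children.\<close>

locale sibling_tree = rtree +
  fixes cs :: "'a \<Rightarrow> 'a list" and \<Delta> :: nat
  assumes cs: "x \<in> V \<Longrightarrow> distinct (cs x) \<and> set (cs x) = C `` {x} \<and> cs x \<noteq> [] \<and> length (cs x) \<le> \<Delta>"
begin

definition B :: "('a \<times> 'a) set" where
  "B = {(x, cs x ! 0) | x. x \<in> V} \<union> {(cs x ! i, cs x ! Suc i) | x i. x \<in> V \<and> Suc i < length (cs x)}"

lemma cs_child: "x \<in> V \<Longrightarrow> i < length (cs x) \<Longrightarrow> (x, cs x ! i) \<in> C"
  using cs nth_mem by fastforce

lemma cs_0: "x \<in> V \<Longrightarrow> (x, cs x ! 0) \<in> C"
  using cs_child[of x 0] cs[of x] by auto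

lemma child_cs: "x \<in> V \<Longrightarrow> (x, c) \<in> C \<Longrightarrow> \<exists>i<length (cs x). c = cs x ! i"
  using cs[of x] by (metis Image_singleton_iff in_set_conv_nth)

lemma cs_inj: "x \<in> V \<Longrightarrow> y \<in> V \<Longrightarrow> i < length (cs x) \<Longrightarrow> j < length (cs y) \<Longrightarrow> cs x ! i = cs y ! j \<Longrightarrow> x = y \<and> i = j"
  using cs_child[of x i] cs_child[of y j] par_unique cs[of x] by (metis nth_eq_iff_index_eq)

lemma len0: "x \<in> V \<Longrightarrow> 0 < length (cs x)" using cs by blast

lemma B_cases:
  assumes "(a, c) \<in> B"
  obtains "a \<in> V" "c = cs a ! 0" | x i where "x \<in> V" "Suc i < length (cs x)" "a = cs x ! i" "c = cs x ! Suc i"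
  using assms unfolding B_def by auto

text \<open>A vertex other than the root has a definite position in the list of its parent: it is
  either a first child or a later sibling, and in each case its new parent is determined.\<close>

lemma B_rtree: "rtree B r"
proof
  fix a b c assume "(a, c) \<in> B" "(b, c) \<in> B"
  then show "a = b"
  proof (elim B_cases)
    fix y j assume "a \<in> V" "c = cs a ! 0" "y \<in> V" "Suc j < length (cs y)" "b = cs y ! j" "c = cs y ! Suc j"
    then show "a = b" using cs_inj[of a y 0 "Suc j"] len0 by auto
  next
    fix x i assume "b \<in> V" "c = cs b ! 0" "x \<in> V" "Suc i < length (cs x)" "a = cs x ! i" "c = cs x ! Suc i"
    then show "a = b" using cs_inj[of b x 0 "Suc i"] len0 by auto
  next
    fix x i y j assume "x \<in> V" "Suc i < length (cs x)" "a = cs x ! i" "c = cs x ! Suc i"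
     "y \<in> V" "Suc j < length (cs y)" "b = cs y ! j" "c = cs y ! Suc j"
    then show "a = b" using cs_inj[of x y "Suc i" "Suc j"] by auto
  qed (use cs_inj[of a b 0 0] len0 in auto)
next
  fix a show "(a, r) \<notin> B" using cs_0 cs_child no_par by (auto elim!: B_cases)
qed

sublocale BT: rtree B r by (rule B_rtree)

lemma first_child: "x \<in> V \<Longrightarrow> (x, cs x ! 0) \<in> B"
  by (auto simp: B_def)

lemma next_sibling: "x \<in> V \<Longrightarrow> Suc i < length (cs x) \<Longrightarrow> (cs x ! i, cs x ! Suc i) \<in> B"
  by (auto simp: B_def)

lemma B_child: "x \<in> V \<Longrightarrow> i < length (cs x) \<Longrightarrow> (x, cs x ! i) \<in> B ^^ Suc i"
proof (induction i)
  case 0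
  then show ?case using first_child by simp
next
  case (Suc i)
  then show ?case using next_sibling[of x i] relpow_Suc_I[of x "cs x ! i" "Suc i" B] by auto
qed

lemma C_B: "x \<in> V \<Longrightarrow> (x, y) \<in> C \<Longrightarrow> \<exists>k\<le>\<Delta>. (x, y) \<in> B ^^ k"
  using child_cs[of x y] B_child[of x] cs[of x] by (metis Suc_leI le_trans)

lemma C_relpow_B: "x \<in> V \<Longrightarrow> (x, y) \<in> C ^^ j \<Longrightarrow> \<exists>k\<le>j * \<Delta>. (x, y) \<in> B ^^ k"
proof (induction j arbitrary: y)
  case (Suc j)
  then obtain z where z: "(x, z) \<in> C ^^ j" "(z, y) \<in> C" by auto
  then obtain k where k: "k \<le> j * \<Delta>" "(x, z) \<in> B ^^ k" using Suc by blast
  have "z \<in> V" using z Suc V_relpow by blast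
  then obtain l where l: "l \<le> \<Delta>" "(z, y) \<in> B ^^ l" using z C_B by blast
  have "(x, y) \<in> B ^^ (k + l)" using k l relpow_trans_add by fast
  then show ?case using k l by (intro exI[of _ "k + l"]) auto
qed auto

lemma BT_V: "BT.V = V"
proof (intro Set.set_eqI iffI)
  fix x assume "x \<in> BT.V"
  then show "x \<in> V"
  proof (induction rule: BT.V_induct)
    case (step p x)
    show ?case using step(2) by (cases rule: B_cases) (use cs_0 cs_child V_step in blast)+
  qed (rule root_V)
next
  fix x assume "x \<in> V"
  then show "x \<in> BT.V"
    by (induction rule: V_induct) (use BT.root_V C_B BT.V_relpow in blast)+
qed

text \<open>Without leaves, the first child always exists. The second child is the next sibling; it
  is missing only for the root and for the last vertex of a list.\<close>

lemma B_children:
  assumes x: "x \<in> V"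
  shows "card (B `` {x}) = 1 \<or> card (B `` {x}) = 2"
    and "p \<in> V \<Longrightarrow> Suc i < length (cs p) \<Longrightarrow> x = cs p ! i \<Longrightarrow> card (B `` {x}) = 2"
proof -
  have two: "card (B `` {x}) = 2" if p: "p \<in> V" "Suc i < length (cs p)" "x = cs p ! i" for p i
  proof -
    have "B `` {x} = {cs x ! 0, cs p ! Suc i}"
    proof (intro equalityI subsetI)
      fix y assume "y \<in> B `` {x}"
      then have "(x, y) \<in> B" by simp
      then show "y \<in> {cs x ! 0, cs p ! Suc i}"
      proof (cases rule: B_cases)
        case (2 z j)
        then have "p = z \<and> i = j" using cs_inj[OF p(1) 2(1), of i j] p by auto
        then show ?thesis using 2 by blast
      qed blast
    qed (use p x first_child[OF x] next_sibling[OF p(1,2)] in auto)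
    moreover have "p \<noteq> x" using p cs_child[of p i] dep_step by force
    then have "cs x ! 0 \<noteq> cs p ! Suc i" using cs_inj[of x p 0 "Suc i"] len0 p x by auto
    ultimately show ?thesis by simp
  qed
  show "card (B `` {x}) = 1 \<or> card (B `` {x}) = 2"
  proof (cases "\<exists>p i. p \<in> V \<and> Suc i < length (cs p) \<and> x = cs p ! i")
    case False
    then have "B `` {x} = {cs x ! 0}" using x by (auto simp: first_child elim!: B_cases)
    then show ?thesis by simp
  qed (use two in blast)
  show "p \<in> V \<Longrightarrow> Suc i < length (cs p) \<Longrightarrow> x = cs p ! i \<Longrightarrow> card (B `` {x}) = 2" using two .
qed

lemma B_nb: "(x, y) \<in> B \<Longrightarrow> (x, y) \<in> nb ^^ 2"
proof (elim B_cases)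
  assume "x \<in> V" "y = cs x ! 0"
  then have "(x, y) \<in> nb ^^ 1" using cs_0 by (auto simp: nb_def)
  then show ?thesis using nb_mono[of 1 2] by simp
next
  fix p i assume "p \<in> V" "Suc i < length (cs p)" "x = cs p ! i" "y = cs p ! Suc i"
  then have "(p, x) \<in> C" "(p, y) \<in> C" using cs_child by auto
  then have "(x, p) \<in> nb" "(p, y) \<in> nb" by (auto simp: nb_def)
  then show ?thesis by (auto simp: numeral_2_eq_2)
qed

lemma B_relpow_nb: "(x, y) \<in> B ^^ j \<Longrightarrow> j \<le> D \<Longrightarrow> (x, y) \<in> nb ^^ (2 * D)"
proof -
  have "(x, y) \<in> B ^^ j \<Longrightarrow> (x, y) \<in> nb ^^ (2 * j)"
  proof (induction j arbitrary: y)
    case (Suc j)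
    then obtain z where "(x, z) \<in> B ^^ j" "(z, y) \<in> B" by auto
    then have "(x, y) \<in> nb ^^ (2 * j + 2)" using Suc B_nb by (intro relpow_trans_add) auto
    then show ?case by simp
  qed auto
  then show "(x, y) \<in> B ^^ j \<Longrightarrow> j \<le> D \<Longrightarrow> (x, y) \<in> nb ^^ (2 * D)" using nb_mono[of "2 * j" "2 * D"] by auto
qed

end

section \<open>Trees of finite valence\<close>

text \<open>Labels of siblings are assumed to be close since siblings become adjacent in the binary
  tree.\<close>

locale valence_tree = rtree +
  fixes lab :: "'a \<Rightarrow> 'l" and E :: "('l \<times> 'l) set" and R :: nat
  assumes valence: "x \<in> V \<Longrightarrow> finite (C `` {x}) \<and> C `` {x} \<noteq> {} \<and> card (C `` {x}) \<le> R"
    and symE: "sym E" and IdE: "Id \<subseteq> E"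
    and lab_step: "x \<in> V \<Longrightarrow> (x, y) \<in> C \<Longrightarrow> (lab x, lab y) \<in> E"
    and lab_sibling: "x \<in> V \<Longrightarrow> (x, y) \<in> C \<Longrightarrow> (x, z) \<in> C \<Longrightarrow> (lab y, lab z) \<in> E"
    and steer: "x \<in> V \<Longrightarrow> (lab x, q) \<in> E ^^ 2 \<Longrightarrow> \<exists>y j. j \<le> R \<and> (x, y) \<in> C ^^ j \<and> (lab y, q) \<in> E"
    and branch: "x \<in> V \<Longrightarrow> \<exists>y j. j \<le> R \<and> (x, y) \<in> C ^^ j \<and> 2 \<le> card (C `` {y})"
begin

definition cs where "cs x = (SOME l. distinct l \<and> set l = C `` {x})"

lemma cs_spec: "x \<in> V \<Longrightarrow> distinct (cs x) \<and> set (cs x) = C `` {x}"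
proof -
  assume "x \<in> V"
  then have "\<exists>l. distinct l \<and> set l = C `` {x}" using finite_distinct_list[of "C `` {x}"] valence by auto
  from someI_ex[OF this] show ?thesis unfolding cs_def .
qed

sublocale sibling_tree C r cs R
  by unfold_locales (use cs_spec valence in \<open>metis distinct_card list.set(1)\<close>)

text \<open>An edge becomes a path of length at most \<open>R\<close> in the binary tree, whence
  \<open>R * R\<close> for \<open>R\<close> edges. Where the original tree branches at
  \<open>y\<close>, the binary tree branches at the first child of \<open>y\<close>, because that
  child has a next sibling; getting there takes up to \<open>R\<close> more steps.\<close>

lemma B_labelled_tree: "labelled_tree B r lab E (R * R + R)"
proof
  fix x assume "x \<in> BT.V"
  then have x: "x \<in> V" by (simp add: BT_V)
  then show "card (B `` {x}) = 1 \<or> card (B `` {x}) = 2" using B_children by blast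
  show "(lab x, lab y) \<in> E" if "(x, y) \<in> B" for y
    using that lab_step lab_sibling cs_0 cs_child x by (elim B_cases) (metis Suc_lessD)+
  show "\<exists>y j. j \<le> R * R + R \<and> (x, y) \<in> B ^^ j \<and> (lab y, q) \<in> E" if q: "(lab x, q) \<in> E ^^ 2" for q
  proof -
    obtain y j where y: "j \<le> R" "(x, y) \<in> C ^^ j" "(lab y, q) \<in> E" using steer x q by blast
    then obtain k where k: "k \<le> j * R" "(x, y) \<in> B ^^ k" using C_relpow_B x by blast
    have "k \<le> R * R + R" using k y by (meson le_trans mult_le_mono1 trans_le_add1)
    then show ?thesis using k y by blast
  qed
  show "\<exists>y j. j \<le> R * R + R \<and> (x, y) \<in> B ^^ j \<and> card (B `` {y}) = 2"
  proof -
    obtain y j where y: "j \<le> R" "(x, y) \<in> C ^^ j" "2 \<le> card (C `` {y})" using branch x by blast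
    have yV: "y \<in> V" using y x V_relpow by blast
    have "2 \<le> length (cs y)" using y cs_spec[OF yV] by (metis distinct_card)
    then have c: "card (B `` {cs y ! 0}) = 2" using B_children(2)[of "cs y ! 0" y 0] yV cs_0 V_step by auto
    obtain k where k: "k \<le> j * R" "(x, y) \<in> B ^^ k" using C_relpow_B x y by blast
    obtain l where l: "l \<le> R" "(y, cs y ! 0) \<in> B ^^ l" using C_B yV cs_0 by blast
    have "k + l \<le> R * R + R" using k l y by (meson add_le_mono le_trans mult_le_mono1)
    then show ?thesis using c relpow_trans_add[OF k(2) l(2)] by blast
  qed
qed (rule symE, rule IdE)

end

locale two_valence_trees = T: valence_tree C r lab E R + T': valence_tree C' r' lab' E R
  for C :: "('x \<times> 'x) set" and r lab and C' :: "('y \<times> 'y) set" and r' lab' and E :: "('l \<times> 'l) set" and R +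
  assumes root_close: "\<exists>k. (lab r, lab' r') \<in> E ^^ k"
begin

theorem coarse_matching:
  "\<exists>F F' D. (\<forall>n\<in>T.V. F n \<in> T'.V \<and> (lab n, lab' (F n)) \<in> E ^^ D \<and> (F' (F n), n) \<in> T.nb ^^ D)
     \<and> (\<forall>p\<in>T.V. \<forall>n. (p, n) \<in> C \<longrightarrow> (F p, F n) \<in> T'.nb ^^ D)
     \<and> (\<forall>n\<in>T'.V. F' n \<in> T.V \<and> (lab' n, lab (F' n)) \<in> E ^^ D \<and> (F (F' n), n) \<in> T'.nb ^^ D)
     \<and> (\<forall>p\<in>T'.V. \<forall>n. (p, n) \<in> C' \<longrightarrow> (F' p, F' n) \<in> T.nb ^^ D)"
proof -
  interpret B: labelled_tree T.B r lab E "R * R + R" by (rule T.B_labelled_tree)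
  interpret B': labelled_tree T'.B r' lab' E "R * R + R" by (rule T'.B_labelled_tree)
  interpret BB: two_trees T.B r lab T'.B r' lab' E "R * R + R" by unfold_locales (rule root_close)
  obtain F F' D where
     F: "\<forall>n\<in>T.V. F n \<in> T'.V \<and> (lab n, lab' (F n)) \<in> E ^^ D \<and> (\<exists>i\<le>D. (F' (F n), n) \<in> T.B ^^ i)"
     "\<forall>p\<in>T.V. \<forall>n. (p, n) \<in> T.B \<longrightarrow> (\<exists>i\<le>D. (F p, F n) \<in> T'.B ^^ i)"
     and F': "\<forall>n\<in>T'.V. F' n \<in> T.V \<and> (lab' n, lab (F' n)) \<in> E ^^ D \<and> (\<exists>i\<le>D. (F (F' n), n) \<in> T'.B ^^ i)"
     "\<forall>p\<in>T'.V. \<forall>n. (p, n) \<in> T'.B \<longrightarrow> (\<exists>i\<le>D. (F' p, F' n) \<in> T.B ^^ i)"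
    using BB.coarse_matching unfolding T.BT_V T'.BT_V by metis
  have 1: "(F p, F n) \<in> T'.nb ^^ (k * (2 * D))" if p: "p \<in> T.V" "(p, n) \<in> T.B ^^ k" for p n k
    using p
  proof (induction k arbitrary: n)
    case (Suc k)
    then obtain z where z: "(p, z) \<in> T.B ^^ k" "(z, n) \<in> T.B" by auto
    have "z \<in> T.V" using z Suc(2) T.BT.V_relpow T.BT_V by blast
    then have "(F z, F n) \<in> T'.nb ^^ (2 * D)" using F(2) z T'.B_relpow_nb by blast
    then have "(F p, F n) \<in> T'.nb ^^ (k * (2 * D) + 2 * D)" using Suc z relpow_trans_add by fast
    then show ?case by (simp add: add.commute)
  qed simp
  have 2: "(F' p, F' n) \<in> T.nb ^^ (k * (2 * D))" if p: "p \<in> T'.V" "(p, n) \<in> T'.B ^^ k" for p n k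
    using p
  proof (induction k arbitrary: n)
    case (Suc k)
    then obtain z where z: "(p, z) \<in> T'.B ^^ k" "(z, n) \<in> T'.B" by auto
    have "z \<in> T'.V" using z Suc(2) T'.BT.V_relpow T'.BT_V by blast
    then have "(F' z, F' n) \<in> T.nb ^^ (2 * D)" using F'(2) z T.B_relpow_nb by blast
    then have "(F' p, F' n) \<in> T.nb ^^ (k * (2 * D) + 2 * D)" using Suc z relpow_trans_add by fast
    then show ?case by (simp add: add.commute)
  qed simp
  \<comment> \<open>An edge consists of at most \<open>R\<close> binary edges, each moving the image
    by at most \<open>2 * D\<close>. The round trips need \<open>2 * D\<close> and the labels
    \<open>D\<close>.\<close>
  let ?D = "R * (2 * D) + 2 * D"
  have E_mono: "(p, q) \<in> E ^^ D \<Longrightarrow> (p, q) \<in> E ^^ ?D" for p q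
    using relpow_mono_Id[OF T.IdE, of D ?D] by auto
  have 3: "(F p, F n) \<in> T'.nb ^^ ?D" if pn: "p \<in> T.V" "(p, n) \<in> C" for p n
  proof -
    obtain k where "k \<le> R" "(p, n) \<in> T.B ^^ k" using T.C_B pn by blast
    then show ?thesis using 1[of p n k] pn T'.nb_mono[of "k * (2 * D)" ?D] by (simp add: trans_le_add1)
  qed
  have 4: "(F' p, F' n) \<in> T.nb ^^ ?D" if pn: "p \<in> T'.V" "(p, n) \<in> C'" for p n
  proof -
    obtain k where "k \<le> R" "(p, n) \<in> T'.B ^^ k" using T'.C_B pn by blast
    then show ?thesis using 2[of p n k] pn T.nb_mono[of "k * (2 * D)" ?D] by (simp add: trans_le_add1)
  qed
  have 5: "(F' (F n), n) \<in> T.nb ^^ ?D" if n: "n \<in> T.V" for n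
  proof -
    obtain i where "i \<le> D" "(F' (F n), n) \<in> T.B ^^ i" using F n by blast
    then have "(F' (F n), n) \<in> T.nb ^^ (2 * D)" using T.B_relpow_nb by blast
    then show ?thesis by (rule T.nb_mono[rotated]) simp
  qed
  have 6: "(F (F' n), n) \<in> T'.nb ^^ ?D" if n: "n \<in> T'.V" for n
  proof -
    obtain i where "i \<le> D" "(F (F' n), n) \<in> T'.B ^^ i" using F' n by blast
    then have "(F (F' n), n) \<in> T'.nb ^^ (2 * D)" using T'.B_relpow_nb by blast
    then show ?thesis by (rule T'.nb_mono[rotated]) simp
  qed
  show ?thesis
    by (intro exI[of _ F] exI[of _ F'] exI[of _ ?D]) (use F(1) F'(1) E_mono 3 4 5 6 in blast)
qed

end

section \<open>Pruning\<close>

text \<open>Dead ends prevent a binary tree in which every vertex has a child. Since they have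
  bounded depth, cutting them off moves vertices by a bounded distance only.\<close>

locale pruned = rtree +
  fixes R :: nat and core :: "'a set"
  assumes core_def: "core = {x \<in> V. infinite (C\<^sup>* `` {x})}"
    and infinite_V: "infinite V"
    and valence: "x \<in> V \<Longrightarrow> finite (C `` {x}) \<and> card (C `` {x}) \<le> R"
    and finite_cone: "x \<in> V \<Longrightarrow> x \<notin> core \<Longrightarrow> (x, y) \<in> C ^^ j \<Longrightarrow> j \<le> R"
begin

definition K :: "('a \<times> 'a) set" where "K = C \<inter> (core \<times> core)"

lemma core_V: "x \<in> core \<Longrightarrow> x \<in> V" by (simp add: core_def)

lemma root_core: "r \<in> core" using infinite_V root_V by (simp add: core_def V_def)

lemma core_upward: "x \<in> V \<Longrightarrow> (x, y) \<in> C\<^sup>* \<Longrightarrow> y \<in> core \<Longrightarrow> x \<in> core"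
proof -
  assume a: "x \<in> V" "(x, y) \<in> C\<^sup>*" "y \<in> core"
  then have "C\<^sup>* `` {y} \<subseteq> C\<^sup>* `` {x}" by auto
  then show ?thesis using a finite_subset unfolding core_def by blast
qed

text \<open>Koenig's argument: finitely many finite cones have a finite union.\<close>

lemma core_child:
  assumes "x \<in> core" shows "\<exists>y\<in>core. (x, y) \<in> C"
proof (rule ccontr)
  assume n: "\<not> ?thesis"
  have x: "x \<in> V" using assms core_V by blast
  have "C\<^sup>* `` {x} \<subseteq> insert x (\<Union>y\<in>C `` {x}. C\<^sup>* `` {y})"
    by (auto elim: converse_rtranclE)
  moreover have "finite (C\<^sup>* `` {y})" if "(x, y) \<in> C" for y
    using n that x V_step by (auto simp: core_def)
  ultimately have "finite (C\<^sup>* `` {x})" using valence[OF x] by (meson finite_UN finite_insert finite_subset Image_singleton_iff)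
  then show False using assms by (simp add: core_def)
qed

sublocale KT: rtree K r
  by unfold_locales (use par_unique no_par in \<open>auto simp: K_def\<close>)

lemma K_relpow: "x \<in> V \<Longrightarrow> (x, y) \<in> C ^^ j \<Longrightarrow> y \<in> core \<Longrightarrow> (x, y) \<in> K ^^ j"
proof (induction j arbitrary: y)
  case (Suc j)
  then obtain z where z: "(x, z) \<in> C ^^ j" "(z, y) \<in> C" by auto
  then have "z \<in> core" using Suc core_upward V_relpow by (meson r_into_rtrancl)
  then show ?case using z Suc by (intro relpow_Suc_I[of x z]) (auto simp: K_def)
qed auto

lemma KT_V: "KT.V = core"
proof (intro Set.set_eqI iffI)
  fix x assume "x \<in> KT.V" then show "x \<in> core"
    by (induction rule: KT.V_induct) (auto simp: root_core K_def)
next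
  fix x assume x: "x \<in> core"
  then have "(r, x) \<in> C ^^ dep x" using core_V dep_V by blast
  then have "(r, x) \<in> K ^^ dep x" using x K_relpow root_V by blast
  then show "x \<in> KT.V" unfolding KT.V_def using relpow_imp_rtrancl by blast
qed

lemma KT_nb: "(x, y) \<in> KT.nb ^^ k \<Longrightarrow> (x, y) \<in> nb ^^ k"
proof -
  have "K \<subseteq> C" by (auto simp: K_def)
  then have "KT.nb ^^ k \<subseteq> nb ^^ k" unfolding nb_def KT.nb_def by (intro relpow_subset) auto
  then show "(x, y) \<in> KT.nb ^^ k \<Longrightarrow> (x, y) \<in> nb ^^ k" by blast
qed

lemma core_anc: "x \<in> V \<Longrightarrow> \<exists>c j. c \<in> core \<and> (c, x) \<in> C ^^ j \<and> j \<le> Suc R \<and> (x \<in> core \<longrightarrow> c = x)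
   \<and> (x \<notin> core \<longrightarrow> (\<exists>d i. (c, d) \<in> C \<and> d \<notin> core \<and> (d, x) \<in> C ^^ i))"
proof (induction rule: V_induct)
  case root
  then show ?case using root_core by (intro exI[of _ r] exI[of _ 0]) auto
next
  case (step p x)
  then obtain c j where c: "c \<in> core" "(c, p) \<in> C ^^ j" "j \<le> Suc R" "p \<in> core \<longrightarrow> c = p"
    "p \<notin> core \<longrightarrow> (\<exists>d i. (c, d) \<in> C \<and> d \<notin> core \<and> (d, p) \<in> C ^^ i)" by blast
  have xV: "x \<in> V" using step V_step by blast
  consider "x \<in> core" | "x \<notin> core" "p \<in> core" | "x \<notin> core" "p \<notin> core" by blast
  then show ?case
  proof cases
    case 1
    then show ?thesis by (intro exI[of _ x] exI[of _ 0]) auto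
  next
    case 2
    then show ?thesis using c step
      by (intro exI[of _ p] exI[of _ 1]) (auto intro!: exI[of _ x] exI[of _ 0])
  next
    case 3
    then obtain d i where d: "(c, d) \<in> C" "d \<notin> core" "(d, p) \<in> C ^^ i" using c by blast
    have dx: "(d, x) \<in> C ^^ Suc i" using d step by auto
    have dV: "d \<in> V" using d c core_V V_step by blast
    have "Suc i \<le> R" using finite_cone[OF dV d(2) dx] .
    moreover have "(c, x) \<in> C ^^ Suc (Suc i)" using d(1) dx by (rule relpow_Suc_I2)
    moreover have "\<exists>d i. (c, d) \<in> C \<and> d \<notin> core \<and> (d, x) \<in> C ^^ i" using d dx by blast
    ultimately show ?thesis using c(1) 3(1) by (intro exI[of _ c] exI[of _ "Suc (Suc i)"] conjI) simp_all
  qed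
qed

lemma core_near:
  assumes "x \<in> core" "(x, w) \<in> C\<^sup>*"
  shows "\<exists>c j. c \<in> core \<and> (x, c) \<in> C\<^sup>* \<and> (c, w) \<in> C ^^ j \<and> j \<le> Suc R"
proof -
  have wV: "w \<in> V" using assms core_V V_rtrancl by blast
  obtain c j where c: "c \<in> core" "(c, w) \<in> C ^^ j" "j \<le> Suc R" "w \<in> core \<longrightarrow> c = w"
    "w \<notin> core \<longrightarrow> (\<exists>d i. (c, d) \<in> C \<and> d \<notin> core \<and> (d, w) \<in> C ^^ i)"
    using core_anc[OF wV] by blast
  have "(x, c) \<in> C\<^sup>*"
  proof (cases "w \<in> core")
    case False
    then obtain d where d: "(c, d) \<in> C" "d \<notin> core" "(d, w) \<in> C\<^sup>*" using c relpow_imp_rtrancl by metis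
    have "d \<in> V" using c d core_V V_step by blast
    then have "(x, d) \<in> C\<^sup>*" using anc_comparable[OF assms(2) d(3)] core_upward d assms by blast
    then show ?thesis using rtrancl_par d assms by blast
  qed (use c assms in auto)
  then show ?thesis using c by blast
qed

text \<open>The child \<open>d\<close> outside the core expresses that \<open>c\<close> is the
  nearest ancestor in the core.\<close>

definition retr :: "'a \<Rightarrow> 'a" where
  "retr x = (SOME c. c \<in> core \<and> (c, x) \<in> C\<^sup>* \<and> (x \<in> core \<longrightarrow> c = x)
   \<and> (x \<notin> core \<longrightarrow> (\<exists>d. (c, d) \<in> C \<and> d \<notin> core \<and> (d, x) \<in> C\<^sup>*)))"

lemma retr: assumes "x \<in> V"
  shows "retr x \<in> core" "(retr x, x) \<in> C\<^sup>*" "x \<in> core \<Longrightarrow> retr x = x"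
    "x \<notin> core \<Longrightarrow> \<exists>d. (retr x, d) \<in> C \<and> d \<notin> core \<and> (d, x) \<in> C\<^sup>*" "(x, retr x) \<in> nb ^^ Suc R"
proof -
  have "\<exists>c. c \<in> core \<and> (c, x) \<in> C\<^sup>* \<and> (x \<in> core \<longrightarrow> c = x)
   \<and> (x \<notin> core \<longrightarrow> (\<exists>d. (c, d) \<in> C \<and> d \<notin> core \<and> (d, x) \<in> C\<^sup>*))"
    using core_anc[OF assms] relpow_imp_rtrancl by metis
  from someI_ex[OF this] show *: "retr x \<in> core" "(retr x, x) \<in> C\<^sup>*" "x \<in> core \<Longrightarrow> retr x = x"
    "x \<notin> core \<Longrightarrow> \<exists>d. (retr x, d) \<in> C \<and> d \<notin> core \<and> (d, x) \<in> C\<^sup>*" unfolding retr_def by blast+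
  show "(x, retr x) \<in> nb ^^ Suc R"
  proof (cases "x \<in> core")
    case True
    then show ?thesis using *(3) nb_mono[of 0 "Suc R" x x] by auto
  next
    case False
    then obtain d where d: "(retr x, d) \<in> C" "d \<notin> core" "(d, x) \<in> C\<^sup>*" using *(4) by blast
    obtain i where i: "(d, x) \<in> C ^^ i" using d rtrancl_imp_relpow by blast
    have "d \<in> V" using d *(1) core_V V_step by blast
    then have "i \<le> R" using finite_cone d i by blast
    moreover have "(retr x, x) \<in> C ^^ Suc i" using d(1) i by (rule relpow_Suc_I2)
    ultimately have "(retr x, x) \<in> nb ^^ Suc R" using relpow_nb[of "retr x" x "Suc i" "Suc R"] by simp
    then show ?thesis by (rule relpow_sym[OF nb_sym])
  qed
qed

text \<open>The retraction is constant on every finite branch that hangs off the core, and a child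
  \<open>n\<close> outside the core either belongs to the branch of \<open>p\<close> or hangs
  directly on \<open>p\<close>.\<close>

lemma retr_step:
  assumes "p \<in> V" "(p, n) \<in> C" shows "retr n = retr p \<or> (retr p, retr n) \<in> K"
proof (cases "n \<in> core")
  case True
  then have "p \<in> core" using core_upward assms by blast
  then show ?thesis using True retr(3) assms core_V by (auto simp: K_def)
next
  case False
  have nV: "n \<in> V" using assms V_step by blast
  obtain d where d: "(retr n, d) \<in> C" "d \<notin> core" "(d, n) \<in> C\<^sup>*" using retr(4)[OF nV False] by blast
  show ?thesis
  proof (cases "p \<in> core")
    case True
    then have "\<not> (d, p) \<in> C\<^sup>*" using core_upward d retr(1)[OF nV] core_V V_step by blast
    then have "d = n" using rtrancl_par[OF d(3) assms(2)] by blast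
    then have "retr n = p" using d assms par_unique by blast
    then show ?thesis using True retr(3) assms by auto
  next
    case False
    then obtain e where e: "(retr p, e) \<in> C" "e \<notin> core" "(e, p) \<in> C\<^sup>*" using retr(4)[OF assms(1)] by blast
    have eV: "e \<in> V" "d \<in> V" using e d retr(1)[OF assms(1)] retr(1)[OF nV] core_V V_step by blast+
    have "(e, n) \<in> C\<^sup>*" using e assms by auto
    then have "(e, d) \<in> C\<^sup>* \<or> (d, e) \<in> C\<^sup>*" using anc_comparable d by blast
    moreover have "e = d" if "(e, d) \<in> C\<^sup>*"
      using rtrancl_par[OF that d(1)] core_upward[OF eV(1)] e retr(1)[OF nV] by blast
    moreover have "e = d" if "(d, e) \<in> C\<^sup>*"
      using rtrancl_par[OF that e(1)] core_upward[OF eV(2)] d retr(1)[OF assms(1)] by blast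
    ultimately have "e = d" by blast
    then show ?thesis using d e par_unique by blast
  qed
qed

end

text \<open>Steering and branching are required to end inside the core, so that they survive
  pruning.\<close>

locale pruned_tree = pruned C r R core for C :: "('x \<times> 'x) set" and r and lab :: "'x \<Rightarrow> 'l" and E :: "('l \<times> 'l) set" and R core +
  assumes symE: "sym E" and IdE: "Id \<subseteq> E"
    and lab_step: "x \<in> V \<Longrightarrow> (x, y) \<in> C \<Longrightarrow> (lab x, lab y) \<in> E"
    and lab_sibling: "x \<in> V \<Longrightarrow> (x, y) \<in> C \<Longrightarrow> (x, z) \<in> C \<Longrightarrow> (lab y, lab z) \<in> E"
    and steer: "x \<in> core \<Longrightarrow> (lab x, q) \<in> E ^^ 2 \<Longrightarrow> \<exists>y j. y \<in> core \<and> j \<le> R \<and> (x, y) \<in> C ^^ j \<and> (lab y, q) \<in> E"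
    and branch: "x \<in> core \<Longrightarrow> \<exists>y j c d. j \<le> R \<and> (x, y) \<in> C ^^ j \<and> (y, c) \<in> C \<and> (y, d) \<in> C \<and> c \<noteq> d \<and> c \<in> core \<and> d \<in> core"
begin

lemma K_valence_tree: "valence_tree K r lab E R"
proof
  fix x assume "x \<in> KT.V"
  then have x: "x \<in> core" "x \<in> V" using KT_V core_V by auto
  have sub: "K `` {x} \<subseteq> C `` {x}" by (auto simp: K_def)
  show "finite (K `` {x}) \<and> K `` {x} \<noteq> {} \<and> card (K `` {x}) \<le> R"
    using valence[OF x(2)] sub finite_subset[OF sub] card_mono[OF _ sub] core_child[OF x(1)] x by (fastforce simp: K_def)
  show "(lab x, lab y) \<in> E" if "(x, y) \<in> K" for y using that lab_step x by (auto simp: K_def)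
  show "(lab y, lab z) \<in> E" if "(x, y) \<in> K" "(x, z) \<in> K" for y z using that lab_sibling x by (auto simp: K_def)
  show "\<exists>y j. j \<le> R \<and> (x, y) \<in> K ^^ j \<and> (lab y, q) \<in> E" if "(lab x, q) \<in> E ^^ 2" for q
    using steer[OF x(1) that] K_relpow x by blast
  obtain y j c d where y: "j \<le> R" "(x, y) \<in> C ^^ j" "(y, c) \<in> C" "(y, d) \<in> C" "c \<noteq> d" "c \<in> core" "d \<in> core"
    using branch x by blast
  have yV: "y \<in> V" using x y V_relpow by blast
  have yC: "y \<in> core" using core_upward[OF yV _ y(6)] y by blast
  have "{c, d} \<subseteq> K `` {y}" using y yC by (auto simp: K_def)
  moreover have "finite (K `` {y})" using valence[OF yV] by (rule_tac finite_subset[of _ "C `` {y}"]) (auto simp: K_def)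
  ultimately have "card {c, d} \<le> card (K `` {y})" by (meson card_mono)
  then show "\<exists>y j. j \<le> R \<and> (x, y) \<in> K ^^ j \<and> 2 \<le> card (K `` {y})"
    using y K_relpow[OF x(2) y(2) yC] by (intro exI[of _ y] exI[of _ j]) auto
qed (rule symE, rule IdE)

lemma lab_nb: "x \<in> V \<Longrightarrow> (x, y) \<in> nb ^^ j \<Longrightarrow> (lab x, lab y) \<in> E ^^ j"
proof (induction j arbitrary: y)
  case (Suc j)
  then obtain z where z: "(x, z) \<in> nb ^^ j" "(z, y) \<in> nb" by auto
  have zV: "z \<in> V" using z Suc nb_relpow_V by blast
  have "(lab z, lab y) \<in> E"
    using z(2) zV nb_V[OF zV z(2)] lab_step symD[OF symE] IdE by (auto simp: nb_def)
  then show ?case using Suc z by (meson relpow_Suc_I)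
qed auto

end

locale two_pruned_trees = T: pruned_tree C r lab E R core + T': pruned_tree C' r' lab' E R core'
  for C :: "('x \<times> 'x) set" and r lab core and C' :: "('y \<times> 'y) set" and r' lab' core' and E :: "('l \<times> 'l) set" and R +
  assumes root_close: "\<exists>k. (lab r, lab' r') \<in> E ^^ k"
begin

theorem coarse_matching:
  "\<exists>F F' D. (\<forall>n\<in>T.V. F n \<in> T'.V \<and> (lab n, lab' (F n)) \<in> E ^^ D \<and> (F' (F n), n) \<in> T.nb ^^ D)
     \<and> (\<forall>p\<in>T.V. \<forall>n. (p, n) \<in> C \<longrightarrow> (F p, F n) \<in> T'.nb ^^ D)
     \<and> (\<forall>n\<in>T'.V. F' n \<in> T.V \<and> (lab' n, lab (F' n)) \<in> E ^^ D \<and> (F (F' n), n) \<in> T'.nb ^^ D)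
     \<and> (\<forall>p\<in>T'.V. \<forall>n. (p, n) \<in> C' \<longrightarrow> (F' p, F' n) \<in> T.nb ^^ D)"
proof -
  interpret K: valence_tree T.K r lab E R by (rule T.K_valence_tree)
  interpret K': valence_tree T'.K r' lab' E R by (rule T'.K_valence_tree)
  interpret KK: two_valence_trees T.K r lab T'.K r' lab' E R by unfold_locales (rule root_close)
  obtain F F' D where
     F: "\<forall>n\<in>core. F n \<in> core' \<and> (lab n, lab' (F n)) \<in> E ^^ D \<and> (F' (F n), n) \<in> T.KT.nb ^^ D"
     "\<forall>p\<in>core. \<forall>n. (p, n) \<in> T.K \<longrightarrow> (F p, F n) \<in> T'.KT.nb ^^ D"
     and F': "\<forall>n\<in>core'. F' n \<in> core \<and> (lab' n, lab (F' n)) \<in> E ^^ D \<and> (F (F' n), n) \<in> T'.KT.nb ^^ D"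
     "\<forall>p\<in>core'. \<forall>n. (p, n) \<in> T'.K \<longrightarrow> (F' p, F' n) \<in> T.KT.nb ^^ D"
    using KK.coarse_matching unfolding T.KT_V T'.KT_V by metis
  \<comment> \<open>\<open>Suc R\<close> for the retraction to a core and \<open>D\<close> for the
    matching of the cores.\<close>
  let ?D = "Suc R + D"
  have step: "(F (T.retr p), F (T.retr n)) \<in> T'.nb ^^ ?D" if pn: "p \<in> T.V" "(p, n) \<in> C" for p n
  proof -
    have "(F (T.retr p), F (T.retr n)) \<in> T'.nb ^^ D"
      using T.retr_step[OF pn] F(2) T.retr(1)[OF pn(1)] T'.KT_nb T'.nb_mono[of 0 D] by fastforce
    then show ?thesis by (rule T'.nb_mono[rotated]) simp
  qed
  have step': "(F' (T'.retr p), F' (T'.retr n)) \<in> T.nb ^^ ?D" if pn: "p \<in> T'.V" "(p, n) \<in> C'" for p n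
  proof -
    have "(F' (T'.retr p), F' (T'.retr n)) \<in> T.nb ^^ D"
      using T'.retr_step[OF pn] F'(2) T'.retr(1)[OF pn(1)] T.KT_nb T.nb_mono[of 0 D] by fastforce
    then show ?thesis by (rule T.nb_mono[rotated]) simp
  qed
  have l: "(lab n, lab' (F (T.retr n))) \<in> E ^^ ?D" if "n \<in> T.V" for n
  proof (rule relpow_trans_add)
    show "(lab n, lab (T.retr n)) \<in> E ^^ Suc R" using T.lab_nb[OF that] T.retr(5)[OF that] by blast
    show "(lab (T.retr n), lab' (F (T.retr n))) \<in> E ^^ D" using F(1) T.retr(1)[OF that] by blast
  qed
  have l': "(lab' n, lab (F' (T'.retr n))) \<in> E ^^ ?D" if "n \<in> T'.V" for n
  proof (rule relpow_trans_add)
    show "(lab' n, lab' (T'.retr n)) \<in> E ^^ Suc R" using T'.lab_nb[OF that] T'.retr(5)[OF that] by blast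
    show "(lab' (T'.retr n), lab (F' (T'.retr n))) \<in> E ^^ D" using F'(1) T'.retr(1)[OF that] by blast
  qed
  have t: "(F' (T'.retr (F (T.retr n))), n) \<in> T.nb ^^ ?D" if n: "n \<in> T.V" for n
  proof -
    have c: "F (T.retr n) \<in> core'" "(F' (F (T.retr n)), T.retr n) \<in> T.nb ^^ D"
      using F(1) T.retr(1)[OF n] T.KT_nb by auto
    have e: "T'.retr (F (T.retr n)) = F (T.retr n)" using T'.retr(3) c T'.core_V by blast
    have "(F' (F (T.retr n)), n) \<in> T.nb ^^ (D + Suc R)"
      using c(2) relpow_sym[OF T.nb_sym T.retr(5)[OF n]] by (rule relpow_trans_add)
    then show ?thesis by (simp only: e add.commute)
  qed
  have t': "(F (T.retr (F' (T'.retr n))), n) \<in> T'.nb ^^ ?D" if n: "n \<in> T'.V" for n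
  proof -
    have c: "F' (T'.retr n) \<in> core" "(F (F' (T'.retr n)), T'.retr n) \<in> T'.nb ^^ D"
      using F'(1) T'.retr(1)[OF n] T'.KT_nb by auto
    have e: "T.retr (F' (T'.retr n)) = F' (T'.retr n)" using T.retr(3) c T.core_V by blast
    have "(F (F' (T'.retr n)), n) \<in> T'.nb ^^ (D + Suc R)"
      using c(2) relpow_sym[OF T'.nb_sym T'.retr(5)[OF n]] by (rule relpow_trans_add)
    then show ?thesis by (simp only: e add.commute)
  qed
  have v: "F (T.retr n) \<in> T'.V" if "n \<in> T.V" for n using F(1) T.retr(1)[OF that] T'.core_V by blast
  have v': "F' (T'.retr n) \<in> T.V" if "n \<in> T'.V" for n using F'(1) T'.retr(1)[OF that] T.core_V by blast
  show ?thesis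
    by (intro exI[of _ "\<lambda>n. F (T.retr n)"] exI[of _ "\<lambda>n. F' (T'.retr n)"] exI[of _ ?D])
       (use step step' l l' t t' v v' in blast)
qed

end

section \<open>Matrices at bounded distance\<close>

definition op_bound :: "real \<Rightarrow> real ^ 'n ^ 'n \<Rightarrow> bool" where
  "op_bound c M \<longleftrightarrow> 0 \<le> c \<and> (\<forall>v. norm (M *v v) \<le> c * norm v)"

text \<open>On a logarithmic scale \<open>c\<close> measures a left-invariant distance on the
  general linear group: constants multiply along chains, and a common invertible factor on the left
  changes nothing. Left invariance is what makes the notion equivariant, since the group acts on
  labels by left multiplication.\<close>

definition close :: "real \<Rightarrow> real ^ 'n ^ 'n \<Rightarrow> real ^ 'n ^ 'n \<Rightarrow> bool" where
  "close c p q \<longleftrightarrow> invertible p \<and> invertible q \<and> op_bound c (matrix_inv p ** q) \<and> op_bound c (matrix_inv q ** p)"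

lemma matrix_inv_both:
  assumes "invertible A" shows "A ** matrix_inv A = mat 1" "matrix_inv A ** A = mat 1"
  using someI_ex[OF assms[unfolded invertible_def]] by (simp_all add: matrix_inv_def)

lemma matrix_inv_cancel:
  fixes p :: "real ^ 'n ^ 'n"
  assumes "invertible p"
  shows "p ** matrix_inv p = mat 1" "matrix_inv p ** p = mat 1"
    "p ** (matrix_inv p ** q) = q" "matrix_inv p ** (p ** q) = q"
    "p *v (matrix_inv p *v v) = v" "matrix_inv p *v (p *v v) = v"
  using matrix_inv_both[OF assms] by (simp_all add: matrix_mul_assoc matrix_vector_mul_assoc)

lemma invertible_inv: "invertible (p :: real ^ 'n ^ 'n) \<Longrightarrow> invertible (matrix_inv p)"
  unfolding invertible_def[of "matrix_inv p"] using matrix_inv_both by blast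

lemma matrix_inv_eqI:
  fixes p :: "real ^ 'n ^ 'n"
  assumes "p ** q = mat 1" shows "matrix_inv p = q"
proof -
  have "invertible p" using assms by (auto simp: invertible_def matrix_left_right_inverse)
  then show ?thesis using matrix_inv_cancel(4)[of p q] assms by simp
qed

lemma matrix_inv_mult:
  fixes p q :: "real ^ 'n ^ 'n"
  assumes "invertible p" "invertible q" shows "matrix_inv (p ** q) = matrix_inv q ** matrix_inv p"
  by (rule matrix_inv_eqI) (simp add: assms matrix_inv_cancel matrix_mul_assoc[symmetric])

lemma op_bound_mult:
  assumes "op_bound c M" "op_bound d N" shows "op_bound (c * d) (M ** N)"
  unfolding op_bound_def
proof (intro conjI allI)
  fix v
  have "norm (M *v (N *v v)) \<le> c * norm (N *v v)" using assms by (auto simp: op_bound_def)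
  also have "\<dots> \<le> c * (d * norm v)" using assms by (intro mult_left_mono) (auto simp: op_bound_def)
  finally show "norm (M ** N *v v) \<le> c * d * norm v" by (simp add: matrix_vector_mul_assoc mult.assoc)
qed (use assms in \<open>auto simp: op_bound_def\<close>)

lemma op_bound_mono: "op_bound c M \<Longrightarrow> c \<le> d \<Longrightarrow> op_bound d M"
  unfolding op_bound_def by (meson dual_order.trans mult_right_mono norm_ge_zero)

text \<open>\<open>norm\<close> of a matrix is the Euclidean norm of its entries. Estimating each
  row by Cauchy-Schwarz costs a dimension factor; together with \<open>norm_op_bound\<close> this
  makes it equivalent to the operator norm.\<close>

lemma op_bound_norm: "op_bound (real CARD('n) * norm M) (M :: real ^ 'n ^ 'n)"
  unfolding op_bound_def
proof (intro conjI allI)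
  fix v
  have "norm (M *v v) \<le> (\<Sum>i\<in>UNIV. \<bar>(M *v v) $ i\<bar>)" by (rule norm_le_l1_cart)
  also have "\<dots> \<le> (\<Sum>i\<in>(UNIV :: 'n set). norm M * norm v)"
  proof (rule sum_mono)
    fix i
    have "\<bar>(M *v v) $ i\<bar> \<le> norm (M $ i) * norm v"
      by (simp add: matrix_vector_mul_component Cauchy_Schwarz_ineq2)
    also have "\<dots> \<le> norm M * norm v" by (intro mult_right_mono) (auto simp: Finite_Cartesian_Product.norm_nth_le)
    finally show "\<bar>(M *v v) $ i\<bar> \<le> norm M * norm v" .
  qed
  finally show "norm (M *v v) \<le> real CARD('n) * norm M * norm v" by simp
qed auto

lemma norm_op_bound:
  fixes M :: "real ^ 'n ^ 'n"
  assumes "op_bound c M" shows "norm M \<le> real (CARD('n) * CARD('n)) * c"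
proof -
  have e: "\<bar>M $ i $ j\<bar> \<le> c" for i j
  proof -
    have "M $ i $ j = (M *v axis j 1) $ i" by (simp add: matrix_vector_mult_basis column_def)
    also have "\<bar>\<dots>\<bar> \<le> norm (M *v axis j 1)" by (rule component_le_norm_cart)
    also have "\<dots> \<le> c * norm (axis j (1::real) :: real ^ 'n)" using assms unfolding op_bound_def by blast
    finally show ?thesis by (simp add: norm_axis_1)
  qed
  have "norm M \<le> (\<Sum>i\<in>UNIV. norm (M $ i))" unfolding norm_vec_def by (rule L2_set_le_sum) simp
  also have "\<dots> \<le> (\<Sum>i\<in>(UNIV :: 'n set). \<Sum>j\<in>(UNIV :: 'n set). c)"
    by (intro sum_mono order_trans[OF norm_le_l1_cart] e)
  finally show ?thesis by (simp add: mult.assoc)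
qed

lemma close_sym: "close c p q \<Longrightarrow> close c q p" by (auto simp: close_def)

lemma close_mono: "close c p q \<Longrightarrow> c \<le> d \<Longrightarrow> close d p q"
  unfolding close_def using op_bound_mono by blast

lemma close_inv: "close c p q \<Longrightarrow> invertible p \<and> invertible q \<and> 0 \<le> c" by (auto simp: close_def op_bound_def)

lemma close_refl: "invertible p \<Longrightarrow> 1 \<le> c \<Longrightarrow> close c p p"
  by (auto simp: close_def op_bound_def matrix_inv_cancel mult_le_cancel_right1)

lemma close_trans:
  assumes "close c p q" "close d q t" shows "close (c * d) p t"
proof -
  have "matrix_inv p ** t = (matrix_inv p ** q) ** (matrix_inv q ** t)"
    "matrix_inv t ** p = (matrix_inv t ** q) ** (matrix_inv q ** p)"
    using assms by (simp_all add: close_def matrix_mul_assoc[symmetric] matrix_inv_cancel)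
  moreover have "op_bound (c * d) ((matrix_inv p ** q) ** (matrix_inv q ** t))"
    using assms op_bound_mult unfolding close_def by blast
  moreover have "op_bound (d * c) ((matrix_inv t ** q) ** (matrix_inv q ** p))"
    using assms op_bound_mult unfolding close_def by blast
  ultimately show ?thesis using assms by (auto simp: close_def mult.commute)
qed

lemma close_left:
  assumes "invertible g" "close c p q" shows "close c (g ** p) (g ** q)"
  using assms unfolding close_def
  by (simp add: invertible_mult matrix_inv_mult matrix_mul_assoc[symmetric] matrix_inv_cancel)

lemma close_left_iff:
  fixes g :: "real ^ 'n ^ 'n"
  assumes "invertible g" shows "close c (g ** p) (g ** q) \<longleftrightarrow> close c p q"
  using close_left[OF assms] close_left[OF invertible_inv[OF assms], of c "g ** p" "g ** q"] assms
  by (auto simp: matrix_inv_cancel)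

lemma close_exists:
  fixes p q :: "real ^ 'n ^ 'n"
  assumes "invertible p" "invertible q" shows "\<exists>c. close c p q"
proof -
  let ?a = "real CARD('n) * norm (matrix_inv p ** q)" and ?b = "real CARD('n) * norm (matrix_inv q ** p)"
  have "op_bound (max ?a ?b) (matrix_inv p ** q)" "op_bound (max ?a ?b) (matrix_inv q ** p)"
    by (rule op_bound_mono[OF op_bound_norm], simp)+
  then show ?thesis using assms by (auto simp: close_def)
qed

text \<open>\<open>matrix_inv p ** q\<close> is the identity plus a term of operator norm at most
  1/2. So it is bounded by 3/2, and its inverse by 2 as in a geometric series.\<close>

lemma close_near:
  fixes p q :: "real ^ 'n ^ 'n"
  assumes inv: "invertible p" "invertible q" and b: "op_bound c (matrix_inv p)"
    and n: "real CARD('n) * norm (q - p) * c \<le> 1 / 2"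
  shows "close 2 p q"
proof -
  have e: "matrix_inv p *v (q *v v) = v + matrix_inv p *v ((q - p) *v v)" for v
    using inv by (simp add: matrix_vector_mult_diff_rdistrib matrix_vector_mult_diff_distrib matrix_inv_cancel)
  have s: "norm (matrix_inv p *v ((q - p) *v v)) \<le> 1 / 2 * norm v" for v
  proof -
    have "norm (matrix_inv p *v ((q - p) *v v)) \<le> c * norm ((q - p) *v v)" using b by (auto simp: op_bound_def)
    also have "\<dots> \<le> c * (real CARD('n) * norm (q - p) * norm v)"
      using op_bound_norm[of "q - p"] b by (intro mult_left_mono) (auto simp: op_bound_def)
    also have "\<dots> = (real CARD('n) * norm (q - p) * c) * norm v" by simp
    also have "\<dots> \<le> 1 / 2 * norm v" using n by (rule mult_right_mono) simp
    finally show ?thesis .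
  qed
  have "op_bound 2 (matrix_inv p ** q)"
    unfolding op_bound_def
  proof (intro conjI allI)
    fix v
    have "norm (matrix_inv p ** q *v v) \<le> norm v + 1 / 2 * norm v"
      unfolding matrix_vector_mul_assoc[symmetric] e using s[of v] norm_triangle_ineq by (meson add_left_mono order_trans)
    then show "norm (matrix_inv p ** q *v v) \<le> 2 * norm v" using norm_ge_zero[of v] by linarith
  qed simp
  moreover have "op_bound 2 (matrix_inv q ** p)"
    unfolding op_bound_def
  proof (intro conjI allI)
    fix v
    define u where "u = matrix_inv q ** p *v v"
    have "q *v u = p *v v" unfolding u_def using inv by (simp add: matrix_vector_mul_assoc[symmetric] matrix_inv_cancel)
    then have "v = u + matrix_inv p *v ((q - p) *v u)" using e[of u] inv by (simp add: matrix_inv_cancel)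
    then have "u = v - matrix_inv p *v ((q - p) *v u)" by (simp add: algebra_simps)
    then have "norm u \<le> norm v + norm (matrix_inv p *v ((q - p) *v u))"
      using norm_triangle_ineq4[of v "matrix_inv p *v ((q - p) *v u)"] by simp
    then have "norm u \<le> norm v + 1 / 2 * norm u" using s[of u] by linarith
    then show "norm (matrix_inv q ** p *v v) \<le> 2 * norm v" unfolding u_def by simp
  qed simp
  ultimately show ?thesis using inv by (simp add: close_def)
qed

lemma close_ball:
  fixes p :: "real ^ 'n ^ 'n"
  assumes "invertible p"
  shows "\<exists>e>0. \<forall>q. invertible q \<longrightarrow> norm (q - p) < e \<longrightarrow> close 2 p q"
proof -
  let ?c = "real CARD('n) * norm (matrix_inv p) + 1"
  have b: "op_bound ?c (matrix_inv p)" by (rule op_bound_mono[OF op_bound_norm]) simp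
  have c: "?c > 0" by (simp add: add_nonneg_pos)
  let ?e = "1 / (2 * real CARD('n) * ?c)"
  have "?e > 0" using c by simp
  moreover have "close 2 p q" if "invertible q" "norm (q - p) < ?e" for q
  proof (rule close_near[OF assms that(1) b])
    have "norm (q - p) * (2 * real CARD('n) * ?c) \<le> 1"
      using that(2) c by (simp add: pos_less_divide_eq less_imp_le)
    then show "real CARD('n) * norm (q - p) * ?c \<le> 1 / 2" by (simp add: algebra_simps)
  qed
  ultimately show ?thesis by blast
qed

text \<open>Matrices close to \<open>p\<close> are bounded, and their inverses are bounded by a
  single \<open>d\<close>. A sufficiently fine Euclidean net is therefore a net for
  \<open>close 2\<close>. Its points are picked from \<open>Q\<close> itself, because in the
  application they have to be labels.\<close>

lemma close_net:
  fixes p :: "real ^ 'n ^ 'n"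
  shows "\<exists>W. finite W \<and> W \<subseteq> {q\<in>Q. close c p q} \<and> (\<forall>q\<in>Q. close c p q \<longrightarrow> (\<exists>w\<in>W. close 2 w q))"
proof (cases "invertible p \<and> 0 \<le> c")
  case False
  then have "\<not> close c p q" for q using close_inv by blast
  then show ?thesis by (intro exI[of _ "{}"]) auto
next
  case True
  then have p: "invertible p" and c: "0 \<le> c" by auto
  let ?S = "{q\<in>Q. close c p q}"
  let ?N = "real CARD('n)"
  define d where "d = c * (?N * norm (matrix_inv p)) + 1"
  have d: "d > 0" using c by (simp add: d_def add_nonneg_pos)
  have bdq: "op_bound d (matrix_inv q)" if "q \<in> ?S" for q
  proof -
    have q: "invertible q" "op_bound c (matrix_inv q ** p)" using that by (auto simp: close_def)
    have "matrix_inv q = (matrix_inv q ** p) ** matrix_inv p"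
      using p by (simp add: matrix_mul_assoc[symmetric] matrix_inv_cancel)
    then have "op_bound (c * (?N * norm (matrix_inv p))) (matrix_inv q)" using op_bound_mult[OF q(2) op_bound_norm] by metis
    then show ?thesis by (rule op_bound_mono) (simp add: d_def)
  qed
  have "norm q \<le> real (CARD('n) * CARD('n)) * (?N * norm p * c)" if "q \<in> ?S" for q
  proof (rule norm_op_bound)
    have "q = p ** (matrix_inv p ** q)" using p by (simp add: matrix_inv_cancel)
    then show "op_bound (?N * norm p * c) q" using op_bound_mult[OF op_bound_norm[of p], of c "matrix_inv p ** q"] that
      by (auto simp: close_def)
  qed
  then have "bounded ?S" unfolding bounded_iff by blast
  then have "compact (closure ?S)" by (simp add: compact_closure)
  \<comment> \<open>Two points of one ball are less than \<open>2 * e\<close> apart, and then the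
    quantity in \<open>close_near\<close> is at most 1/2.\<close>
  moreover define e where "e = 1 / (4 * ?N * d)"
  have e: "e > 0" using d by (simp add: e_def)
  ultimately obtain k where k: "finite k" "closure ?S \<subseteq> (\<Union>x\<in>k. ball x e)"
    using compact_eq_totally_bounded by blast
  define pick where "pick x = (SOME q. q \<in> ?S \<and> q \<in> ball x e)" for x
  let ?W = "pick ` {x\<in>k. \<exists>q. q \<in> ?S \<and> q \<in> ball x e}"
  have pick: "pick x \<in> ?S \<and> pick x \<in> ball x e" if "\<exists>q. q \<in> ?S \<and> q \<in> ball x e" for x
    unfolding pick_def using someI_ex[OF that] .
  have "\<exists>w\<in>?W. close 2 w q" if q: "q \<in> Q" "close c p q" for q
  proof -
    have qS: "q \<in> ?S" using q by simp
    then have "q \<in> closure ?S" by (rule closure_subset[THEN subsetD])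
    then obtain x where x: "x \<in> k" "q \<in> ball x e" using k(2) by (meson UN_E subsetD)
    have ex: "\<exists>q. q \<in> ?S \<and> q \<in> ball x e" using x(2) qS by (intro exI[of _ q] conjI)
    have px: "pick x \<in> ?S" "pick x \<in> ball x e" using pick[OF ex] by simp_all
    have "norm (q - pick x) < 2 * e"
      using x(2) px(2) dist_triangle_half_r[of x q "2 * e" "pick x"] by (simp add: dist_norm norm_minus_commute)
    then have "norm (q - pick x) * (4 * ?N * d) \<le> 2" using d by (simp add: e_def field_simps)
    then have n: "?N * norm (q - pick x) * d \<le> 1 / 2" by (simp add: algebra_simps)
    have "close 2 (pick x) q" using px q by (intro close_near[OF _ _ bdq[OF px(1)] n]) (auto simp: close_def)
    then show ?thesis using x(1) ex by blast
  qed
  moreover have "finite ?W" using k by simp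
  moreover have "?W \<subseteq> ?S"
  proof (rule image_subsetI)
    fix x assume "x \<in> {x\<in>k. \<exists>q. q \<in> ?S \<and> q \<in> ball x e}"
    then have "\<exists>q. q \<in> ?S \<and> q \<in> ball x e" by simp
    then show "pick x \<in> ?S" using pick by blast
  qed
  ultimately show ?thesis by (intro exI[of _ ?W] conjI allI impI ballI) simp_all
qed

section \<open>Groups acting on labelled trees\<close>

text \<open>The root need not be fixed, so \<open>act_C\<close> lets an edge be turned upside down.
  \<open>full\<close> is the density given by folded holonomy, for the side of an edge away from the
  root; \<open>three\<close> is the form in which bushiness is used.\<close>

locale tree_action = rtree C r + group G for C :: "('x \<times> 'x) set" and r and G :: "('g, 'm) monoid_scheme" (structure) +
  fixes act :: "'g \<Rightarrow> 'x \<Rightarrow> 'x" and L :: "'g \<Rightarrow> real ^ 'n ^ 'n" and lam :: "'x \<Rightarrow> real ^ 'n ^ 'n"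
  assumes C_V: "(x, y) \<in> C \<Longrightarrow> x \<in> V"
    and act_V: "g \<in> carrier G \<Longrightarrow> x \<in> V \<Longrightarrow> act g x \<in> V"
    and act_mult: "g \<in> carrier G \<Longrightarrow> h \<in> carrier G \<Longrightarrow> x \<in> V \<Longrightarrow> act (g \<otimes> h) x = act g (act h x)"
    and act_one: "x \<in> V \<Longrightarrow> act \<one> x = x"
    and act_C: "g \<in> carrier G \<Longrightarrow> (x, y) \<in> C \<Longrightarrow> (act g x, act g y) \<in> C \<or> (act g y, act g x) \<in> C"
    and locally_finite: "x \<in> V \<Longrightarrow> finite (C `` {x})"
    and cocompact: "\<exists>P0. finite P0 \<and> (\<forall>(x, y) \<in> C. \<exists>g\<in>carrier G. (act g x, act g y) \<in> P0)"
    and L_inv: "g \<in> carrier G \<Longrightarrow> invertible (L g)"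
    and lam_inv: "x \<in> V \<Longrightarrow> invertible (lam x)"
    and lam_act: "g \<in> carrier G \<Longrightarrow> x \<in> V \<Longrightarrow> lam (act g x) = L g ** lam x"
    and full: "(p, x) \<in> C \<Longrightarrow> z \<in> V \<Longrightarrow> e > 0 \<Longrightarrow> \<exists>w. (x, w) \<in> C\<^sup>* \<and> norm (lam w - lam z) < e"
    and three: "\<exists>c1 c2 c3. {c1, c2, c3} \<subseteq> V \<and> c1 \<noteq> c2 \<and> c1 \<noteq> c3 \<and> c2 \<noteq> c3 \<and> dep c1 = dep c2 \<and> dep c1 = dep c3
       \<and> infinite (C\<^sup>* `` {c1}) \<and> infinite (C\<^sup>* `` {c2}) \<and> infinite (C\<^sup>* `` {c3})"
begin

definition core :: "'x set" where "core = {x \<in> V. infinite (C\<^sup>* `` {x})}"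

lemma C_V2: "(x, y) \<in> C \<Longrightarrow> y \<in> V" using C_V V_step by blast

lemma act_inv: "g \<in> carrier G \<Longrightarrow> x \<in> V \<Longrightarrow> act (inv g) (act g x) = x"
  using act_mult[of "inv g" g x] act_one by simp

lemma act_inv': "g \<in> carrier G \<Longrightarrow> x \<in> V \<Longrightarrow> act g (act (inv g) x) = x"
  using act_mult[of g "inv g" x] act_one by simp

lemma act_inj: "g \<in> carrier G \<Longrightarrow> x \<in> V \<Longrightarrow> y \<in> V \<Longrightarrow> act g x = act g y \<Longrightarrow> x = y"
  using act_inv by metis

lemma infinite_V: "infinite V"
proof -
  obtain c where "c \<in> V" "infinite (C\<^sup>* `` {c})" using three by blast
  moreover have "C\<^sup>* `` {c} \<subseteq> V" using V_rtrancl calculation(1) by blast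
  ultimately show ?thesis using finite_subset by blast
qed

text \<open>Otherwise \<open>act g a\<close> and \<open>act g c\<close> would both be the parent of
  \<open>act g b\<close>, against injectivity.\<close>

lemma turn_down:
  assumes "g \<in> carrier G" "(a, b) \<in> C" "(b, c) \<in> C" "(act g a, act g b) \<in> C"
  shows "(act g b, act g c) \<in> C"
proof (rule ccontr)
  assume "\<not> ?thesis"
  then have "(act g c, act g b) \<in> C" using act_C assms by blast
  then have "act g c = act g a" using assms par_unique by blast
  then have "c = a" using act_inj assms C_V C_V2 by blast
  then show False using assms dep_step C_V C_V2 by (metis Suc_n_not_le_n lessI less_imp_le)
qed

lemma turn_up:
  assumes "g \<in> carrier G" "(a, b) \<in> C" "(b, c) \<in> C" "(act g c, act g b) \<in> C"
  shows "(act g b, act g a) \<in> C"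
proof (rule ccontr)
  assume "\<not> ?thesis"
  then have "(act g a, act g b) \<in> C" using act_C assms by blast
  then have "act g c = act g a" using assms par_unique by blast
  then have "c = a" using act_inj assms C_V C_V2 by blast
  then show False using assms dep_step C_V C_V2 by (metis Suc_n_not_le_n lessI less_imp_le)
qed

text \<open>Once \<open>g\<close> keeps one edge pointing down, it does so for every edge below, and
  the cone at \<open>x\<close> goes into the cone at \<open>act g x\<close>. The second conjunct
  supplies \<open>turn_down\<close> with the edge entering \<open>w\<close>.\<close>

lemma cone_map:
  assumes g: "g \<in> carrier G" "(p, x) \<in> C" "(act g p, act g x) \<in> C" and "(x, w) \<in> C ^^ j"
  shows "(act g x, act g w) \<in> C ^^ j \<and> (\<exists>q. (q, w) \<in> C \<and> (act g q, act g w) \<in> C)"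
  using assms(4)
proof (induction j arbitrary: w)
  case (Suc j)
  then obtain y where y: "(x, y) \<in> C ^^ j" "(y, w) \<in> C" by auto
  then obtain q where q: "(q, y) \<in> C" "(act g q, act g y) \<in> C" "(act g x, act g y) \<in> C ^^ j" using Suc by blast
  then have "(act g y, act g w) \<in> C" using turn_down g y by blast
  then show ?case using q y by (meson relpow_Suc_I)
qed (use assms in auto)

lemma cone_map_inv:
  assumes g: "g \<in> carrier G" "(p, x) \<in> C" "(act g p, act g x) \<in> C" and w: "(act g x, w) \<in> C ^^ j"
  shows "(x, act (inv g) w) \<in> C ^^ j"
proof -
  have V: "p \<in> V" "x \<in> V" using g C_V C_V2 by auto
  have "(act (inv g) (act g x), act (inv g) w) \<in> C ^^ j"
    by (rule cone_map[THEN conjunct1, OF _ g(3) _ w]) (use g V act_inv in auto)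
  then show ?thesis using act_inv g V by simp
qed

lemma core_act:
  assumes g: "g \<in> carrier G" "(p, x) \<in> C" "(act g p, act g x) \<in> C"
  shows "act g x \<in> core \<longleftrightarrow> x \<in> core"
proof -
  have V: "p \<in> V" "x \<in> V" using g C_V C_V2 by auto
  have *: "C\<^sup>* `` {act g x} = act g ` (C\<^sup>* `` {x})"
  proof (intro equalityI subsetI)
    fix w assume "w \<in> C\<^sup>* `` {act g x}"
    then obtain j where j: "(act g x, w) \<in> C ^^ j" by (auto dest: rtrancl_imp_relpow)
    then have "w \<in> V" using V_relpow act_V g V by blast
    then have "w = act g (act (inv g) w)" using act_inv' g by simp
    moreover have "act (inv g) w \<in> C\<^sup>* `` {x}" using cone_map_inv[OF g j] relpow_imp_rtrancl by blast
    ultimately show "w \<in> act g ` (C\<^sup>* `` {x})" by blast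
  next
    fix w assume "w \<in> act g ` (C\<^sup>* `` {x})"
    then obtain v where "(x, v) \<in> C\<^sup>*" "w = act g v" by auto
    then show "w \<in> C\<^sup>* `` {act g x}"
      using cone_map[OF g] relpow_imp_rtrancl by (metis Image_singleton_iff rtrancl_imp_relpow)
  qed
  have "inj_on (act g) (C\<^sup>* `` {x})"
    using act_inj[OF g(1)] V_rtrancl[OF V(2)] by (auto intro!: inj_onI)
  then show ?thesis using V act_V g * by (simp add: core_def finite_image_iff)
qed

text \<open>For each pair of \<open>P0\<close> that is hit at all, one downward edge sent to it is
  kept. Two downward edges sent to the same pair differ by a group element that maps one to the
  other, parent to parent. Direction is preserved, so cones are comparable along an orbit.\<close>

lemma reps: "\<exists>X0. finite X0 \<and> X0 \<subseteq> C \<and> (\<forall>p x. (p, x) \<in> C \<longrightarrow> (\<exists>g q y. g \<in> carrier G \<and> (q, y) \<in> X0 \<and> act g q = p \<and> act g y = x))"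
proof -
  obtain P0 where P0: "finite P0" "\<And>x y. (x, y) \<in> C \<Longrightarrow> \<exists>g\<in>carrier G. (act g x, act g y) \<in> P0" using cocompact by fastforce
  define good where "good t e \<longleftrightarrow> e \<in> C \<and> (\<exists>g\<in>carrier G. (act g (fst e), act g (snd e)) = t)" for t e
  define X0 where "X0 = (\<lambda>t. SOME e. good t e) ` {t \<in> P0. \<exists>e. good t e}"
  have good: "good t (SOME e. good t e)" if "good t e" for t e using that by (rule someI)
  have "finite X0" using P0 by (simp add: X0_def)
  moreover have "X0 \<subseteq> C"
  proof
    fix e assume "e \<in> X0"
    then obtain t e' where "e = (SOME e. good t e)" "good t e'" unfolding X0_def by blast
    then have "good t e" using good by simp
    then show "e \<in> C" by (simp add: good_def)
  qed
  moreover have "\<exists>g q y. g \<in> carrier G \<and> (q, y) \<in> X0 \<and> act g q = p \<and> act g y = x" if e: "(p, x) \<in> C" for p x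
  proof -
    obtain g where g: "g \<in> carrier G" "(act g p, act g x) \<in> P0" using P0 e by blast
    let ?t = "(act g p, act g x)"
    have gd: "good ?t (p, x)" using g e by (auto simp: good_def)
    obtain q y where qy: "(q, y) = (SOME e. good ?t e)" by (metis prod.collapse)
    then have "good ?t (q, y)" using good[OF gd] by simp
    then obtain h where h: "h \<in> carrier G" "act h q = act g p" "act h y = act g x" "(q, y) \<in> C" by (auto simp: good_def)
    have V: "q \<in> V" "y \<in> V" "p \<in> V" "x \<in> V" using h e C_V C_V2 by auto
    have "act (inv g \<otimes> h) q = p" "act (inv g \<otimes> h) y = x" using h g V act_mult act_inv by simp_all
    moreover have "(q, y) \<in> X0" unfolding X0_def qy using g gd by (intro imageI) blast
    ultimately show ?thesis using g h by (intro exI[of _ "inv g \<otimes> h"] exI[of _ q] exI[of _ y]) auto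
  qed
  ultimately show ?thesis by blast
qed

text \<open>A bound depending on an edge is uniform_bound as soon as it is invariant under the group.\<close>

lemma uniform_bound:
  assumes "\<And>p x. (p, x) \<in> C \<Longrightarrow> \<exists>k::nat. Q p x k"
    and "\<And>p x k l. Q p x k \<Longrightarrow> k \<le> l \<Longrightarrow> Q p x l"
    and "\<And>p x k g. (p, x) \<in> C \<Longrightarrow> g \<in> carrier G \<Longrightarrow> (act g p, act g x) \<in> C \<Longrightarrow> Q p x k \<Longrightarrow> Q (act g p) (act g x) k"
  shows "\<exists>k. \<forall>p x. (p, x) \<in> C \<longrightarrow> Q p x k"
proof -
  obtain X0 where X0: "finite X0" "X0 \<subseteq> C"
    "\<And>p x. (p, x) \<in> C \<Longrightarrow> \<exists>g q y. g \<in> carrier G \<and> (q, y) \<in> X0 \<and> act g q = p \<and> act g y = x" using reps by blast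
  have "\<forall>e\<in>X0. \<exists>k. Q (fst e) (snd e) k" using assms(1) X0(2) by auto
  then obtain k where k: "\<forall>e\<in>X0. Q (fst e) (snd e) (k e)" by metis
  define K where "K = (\<Sum>e\<in>X0. k e)"
  have K: "Q q y K" if "(q, y) \<in> X0" for q y
  proof -
    have "k (q, y) \<le> K" unfolding K_def using X0(1) that by (intro member_le_sum) auto
    then show ?thesis using k that assms(2) by fastforce
  qed
  have "Q p x K" if px: "(p, x) \<in> C" for p x
  proof -
    obtain g q y where g: "g \<in> carrier G" "(q, y) \<in> X0" "act g q = p" "act g y = x" using X0(3) px by blast
    have "(q, y) \<in> C" using g X0 by blast
    then show ?thesis using assms(3)[of q y g K] K g px by blast
  qed
  then show ?thesis by blast
qed

lemma valence_bound: "\<exists>k. \<forall>x\<in>V. card (C `` {x}) \<le> k"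
proof -
  have "\<exists>k. \<forall>p x. (p, x) \<in> C \<longrightarrow> card (C `` {x}) \<le> k"
  proof (rule uniform_bound)
    fix p x k g assume a: "(p, x) \<in> C" "g \<in> carrier G" "(act g p, act g x) \<in> C" "card (C `` {x}) \<le> k"
    have xV: "x \<in> V" using a C_V2 by blast
    have "C `` {act g x} \<subseteq> act g ` (C `` {x})"
    proof
      fix w assume "w \<in> C `` {act g x}"
      then have w: "(act g x, w) \<in> C" by simp
      then have "(x, act (inv g) w) \<in> C" using cone_map_inv[OF a(2,1,3), of w 1] by simp
      moreover have "act g (act (inv g) w) = w" using act_inv' a w C_V2 by blast
      ultimately show "w \<in> act g ` (C `` {x})" by (metis Image_singleton_iff imageI)
    qed
    then have "card (C `` {act g x}) \<le> card (C `` {x})" using locally_finite[OF xV] surj_card_le by blast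
    then show "card (C `` {act g x}) \<le> k" using a by simp
  qed auto
  then obtain k where k: "\<And>p x. (p, x) \<in> C \<Longrightarrow> card (C `` {x}) \<le> k" by blast
  \<comment> \<open>The root has no edge entering it and is bounded separately.\<close>
  have "card (C `` {x}) \<le> max k (card (C `` {r}))" if "x \<in> V" for x
    using V_cases[OF that] k by (auto simp: max.coboundedI1)
  then show ?thesis by blast
qed

lemma cone_bound: "\<exists>k. \<forall>x\<in>V. x \<notin> core \<longrightarrow> (\<forall>y j. (x, y) \<in> C ^^ j \<longrightarrow> j \<le> k)"
proof -
  have "\<exists>k. \<forall>p x. (p, x) \<in> C \<longrightarrow> (x \<notin> core \<longrightarrow> (\<forall>y j. (x, y) \<in> C ^^ j \<longrightarrow> j \<le> k))"
  proof (rule uniform_bound)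
    fix p x assume px: "(p, x) \<in> C"
    have xV: "x \<in> V" using px C_V2 by blast
    show "\<exists>k. x \<notin> core \<longrightarrow> (\<forall>y j. (x, y) \<in> C ^^ j \<longrightarrow> j \<le> k)"
    proof (cases "x \<in> core")
      case False
      then have f: "finite (C\<^sup>* `` {x})" using xV by (simp add: core_def)
      have "j \<le> (\<Sum>y\<in>C\<^sup>* `` {x}. dep y)" if "(x, y) \<in> C ^^ j" for y j
      proof -
        have "y \<in> C\<^sup>* `` {x}" using that relpow_imp_rtrancl by blast
        then have "dep y \<le> (\<Sum>y\<in>C\<^sup>* `` {x}. dep y)" using f by (intro member_le_sum) auto
        then show ?thesis using dep_relpow[OF xV that] by simp
      qed
      then show ?thesis by blast
    qed blast
  next
    fix p x k g assume a: "(p, x) \<in> C" "g \<in> carrier G" "(act g p, act g x) \<in> C"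
      and k: "x \<notin> core \<longrightarrow> (\<forall>y j. (x, y) \<in> C ^^ j \<longrightarrow> j \<le> k)"
    show "act g x \<notin> core \<longrightarrow> (\<forall>y j. (act g x, y) \<in> C ^^ j \<longrightarrow> j \<le> k)"
      using core_act[OF a(2,1,3)] k cone_map_inv[OF a(2,1,3)] by blast
  qed (meson le_trans)
  moreover have "r \<in> core" using infinite_V root_V by (simp add: core_def V_def)
  ultimately show ?thesis using V_cases by metis
qed

lemma pruned_exists: "\<exists>R0. \<forall>R\<ge>R0. pruned C r R core"
proof -
  obtain k1 where k1: "\<forall>x\<in>V. card (C `` {x}) \<le> k1" using valence_bound by blast
  obtain k2 where k2: "\<forall>x\<in>V. x \<notin> core \<longrightarrow> (\<forall>y j. (x, y) \<in> C ^^ j \<longrightarrow> j \<le> k2)" using cone_bound by blast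
  have "pruned C r R core" if "k1 + k2 \<le> R" for R
  proof
    show "infinite V" by (rule infinite_V)
    show "finite (C `` {x}) \<and> card (C `` {x}) \<le> R" if "x \<in> V" for x
      using k1 locally_finite that \<open>k1 + k2 \<le> R\<close> by fastforce
    show "j \<le> R" if "x \<in> V" "x \<notin> core" "(x, y) \<in> C ^^ j" for x y j
      using k2 that \<open>k1 + k2 \<le> R\<close> by fastforce
  qed (rule core_def)
  then show ?thesis by blast
qed

section \<open>Uniform steering and branching inside the core\<close>

lemma lam_step: "\<exists>s\<ge>1. \<forall>x y. (x, y) \<in> C \<longrightarrow> close s (lam x) (lam y)"
proof -
  have "\<exists>k. \<forall>p x. (p, x) \<in> C \<longrightarrow> close (real k) (lam p) (lam x)"
  proof (rule uniform_bound)
    fix p x assume "(p, x) \<in> C"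
    then obtain c where "close c (lam p) (lam x)" using close_exists lam_inv C_V C_V2 by metis
    then show "\<exists>k. close (real k) (lam p) (lam x)" using close_mono real_arch_simple by blast
  next
    fix p x k g assume "(p, x) \<in> C" "g \<in> carrier G" "close (real k) (lam p) (lam x)"
    then show "close (real k) (lam (act g p)) (lam (act g x))"
      using close_left lam_act L_inv C_V C_V2 by metis
  qed (use close_mono of_nat_mono in blast)
  then obtain k where k: "\<And>p x. (p, x) \<in> C \<Longrightarrow> close (real k) (lam p) (lam x)" by blast
  have "close (max 1 (real k)) (lam x) (lam y)" if "(x, y) \<in> C" for x y
    by (rule close_mono[OF k[OF that]]) simp
  then show ?thesis by (intro exI[of _ "max 1 (real k)"]) auto
qed

lemma lam_relpow:
  assumes s: "1 \<le> s" "\<And>x y. (x, y) \<in> C \<Longrightarrow> close s (lam x) (lam y)"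
    and "x \<in> V" "(x, y) \<in> C ^^ j" "j \<le> k"
  shows "close (s ^ k) (lam x) (lam y)"
proof -
  have "close (s ^ j) (lam x) (lam y)" using assms(4)
  proof (induction j arbitrary: y)
    case 0
    then show ?case using close_refl lam_inv assms by auto
  next
    case (Suc j)
    then obtain z where "(x, z) \<in> C ^^ j" "(z, y) \<in> C" by auto
    then have "close (s ^ j * s) (lam x) (lam y)" using Suc s close_trans by blast
    then show ?case by (simp add: mult.commute)
  qed
  then show ?thesis using assms by (meson close_mono power_increasing)
qed

text \<open>The accuracy \<open>s\<close> is chosen before the range \<open>c\<close>. Below a fixed
  \<open>x\<close>, the labels within \<open>c\<close> of \<open>lam x\<close> have a finite net
  \<open>W\<close>, and \<open>full\<close> comes close to each of its points; the depth needed
  depends on \<open>c\<close>, the error does not. Left invariance of \<open>close\<close> and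
  \<open>uniform_bound\<close> make the depth independent of \<open>x\<close>.\<close>

lemma steer_exists:
  "\<exists>s\<ge>1. (\<forall>x y. (x, y) \<in> C \<longrightarrow> close s (lam x) (lam y)) \<and>
     (\<forall>c. \<exists>R0. \<forall>x\<in>core. \<forall>z\<in>V. close c (lam x) (lam z) \<longrightarrow> (\<exists>y\<in>core. \<exists>j\<le>R0. (x, y) \<in> C ^^ j \<and> close s (lam z) (lam y)))"
proof -
  obtain s1 where s1: "1 \<le> s1" "\<And>x y. (x, y) \<in> C \<Longrightarrow> close s1 (lam x) (lam y)" using lam_step by blast
  obtain R1 where "pruned C r R1 core" using pruned_exists by blast
  then interpret P: pruned C r R1 core .
  \<comment> \<open>One factor 2 for the net, another for the approximation by \<open>full\<close>,
    and \<open>s1 ^ Suc R1\<close> for climbing back to the core.\<close>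
  define s where "s = 4 * s1 ^ Suc R1"
  have ss: "s1 \<le> s" using s1(1) self_le_power[of s1 "Suc R1"] unfolding s_def by linarith
  define S where "S c x k \<longleftrightarrow> (\<forall>z\<in>V. close c (lam x) (lam z) \<longrightarrow> (\<exists>y\<in>core. \<exists>j\<le>k. (x, y) \<in> C ^^ j \<and> close s (lam z) (lam y)))"
    for c x and k :: nat
  have "\<exists>k. \<forall>p x. (p, x) \<in> C \<longrightarrow> (x \<in> core \<longrightarrow> S c x k)" for c
  proof (rule uniform_bound)
    fix p x assume px: "(p, x) \<in> C"
    show "\<exists>k. x \<in> core \<longrightarrow> S c x k"
    proof (cases "x \<in> core")
      case True
      then have xV: "x \<in> V" by (simp add: core_def)
      obtain W where W: "finite W" "W \<subseteq> {q \<in> lam ` V. close c (lam x) q}"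
        "\<forall>q\<in>lam ` V. close c (lam x) q \<longrightarrow> (\<exists>w\<in>W. close 2 w q)" using close_net[of "lam ` V" c "lam x"] by (elim exE conjE)
      have near: "\<exists>y\<in>core. \<exists>j. (x, y) \<in> C ^^ j \<and> close (2 * s1 ^ Suc R1) q (lam y)" if q: "q \<in> W" for q
      proof -
        obtain z where z: "z \<in> V" "q = lam z" using q W by blast
        obtain e where e: "e > 0" "\<And>t. invertible t \<Longrightarrow> norm (t - q) < e \<Longrightarrow> close 2 q t"
          using close_ball[of q] lam_inv z by blast
        obtain w where w: "(x, w) \<in> C\<^sup>*" "norm (lam w - lam z) < e" using full[OF px z(1) e(1)] by blast
        have qw: "close 2 q (lam w)" using e w z lam_inv V_rtrancl xV by blast
        obtain y j where y: "y \<in> core" "(x, y) \<in> C\<^sup>*" "(y, w) \<in> C ^^ j" "j \<le> Suc R1"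
          using P.core_near[OF True w(1)] by blast
        have "close (s1 ^ Suc R1) (lam y) (lam w)" using lam_relpow s1 y P.core_V by blast
        then have "close (2 * s1 ^ Suc R1) q (lam y)" using qw close_trans close_sym by blast
        then show ?thesis using y rtrancl_imp_relpow by blast
      qed
      then obtain y j where y: "\<And>q. q \<in> W \<Longrightarrow> y q \<in> core \<and> (x, y q) \<in> C ^^ j q \<and> close (2 * s1 ^ Suc R1) q (lam (y q))"
        by metis
      have "S c x (\<Sum>q\<in>W. j q)"
        unfolding S_def
      proof (intro ballI impI)
        fix z assume z: "z \<in> V" "close c (lam x) (lam z)"
        then obtain q where q: "q \<in> W" "close 2 q (lam z)" using W by blast
        have "close (2 * (2 * s1 ^ Suc R1)) (lam z) (lam (y q))"
          using close_trans[OF close_sym[OF q(2)]] y[OF q(1)] by blast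
        then have "close s (lam z) (lam (y q))" by (simp add: s_def)
        moreover have "j q \<le> (\<Sum>q\<in>W. j q)" using W q by (intro member_le_sum) auto
        ultimately show "\<exists>y\<in>core. \<exists>l\<le>\<Sum>q\<in>W. j q. (x, y) \<in> C ^^ l \<and> close s (lam z) (lam y)" using y[OF q(1)] by blast
      qed
      then show ?thesis by blast
    qed blast
  next
    fix p x and k l :: nat assume "x \<in> core \<longrightarrow> S c x k" "k \<le> l"
    then show "x \<in> core \<longrightarrow> S c x l" unfolding S_def by (meson le_trans)
  next
    fix p x k g assume a: "(p, x) \<in> C" "g \<in> carrier G" "(act g p, act g x) \<in> C" and S: "x \<in> core \<longrightarrow> S c x k"
    have xV: "x \<in> V" using a C_V2 by blast
    show "act g x \<in> core \<longrightarrow> S c (act g x) k"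
      unfolding S_def
    proof (intro ballI impI)
      fix z assume z: "act g x \<in> core" "z \<in> V" "close c (lam (act g x)) (lam z)"
      define z' where "z' = act (inv g) z"
      have z': "z' \<in> V" "act g z' = z" using act_V act_inv' a z by (auto simp: z'_def)
      then have "close c (L g ** lam x) (L g ** lam z')" using z lam_act a xV by metis
      then have "close c (lam x) (lam z')" using close_left_iff L_inv a by blast
      then obtain y j where y: "y \<in> core" "j \<le> k" "(x, y) \<in> C ^^ j" "close s (lam z') (lam y)"
        using S z' z core_act[OF a(2,1,3)] unfolding S_def by blast
      have yV: "y \<in> V" using y P.core_V by blast
      obtain q where q: "(q, y) \<in> C" "(act g q, act g y) \<in> C" "(act g x, act g y) \<in> C ^^ j"
        using cone_map[OF a(2,1,3) y(3)] by blast
      have "act g y \<in> core" using core_act[OF a(2) q(1,2)] y by blast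
      moreover have "close s (L g ** lam z') (L g ** lam y)" using y close_left L_inv a by blast
      then have "close s (lam z) (lam (act g y))" using lam_act[OF a(2)] z' yV by metis
      ultimately show "\<exists>y\<in>core. \<exists>j\<le>k. (act g x, y) \<in> C ^^ j \<and> close s (lam z) (lam y)" using q y by blast
    qed
  qed
  then obtain k where k: "\<And>c p x. (p, x) \<in> C \<Longrightarrow> x \<in> core \<Longrightarrow> S c x (k c)" by metis
  have "\<exists>R0. \<forall>x\<in>core. S c x R0" for c
  proof -
    \<comment> \<open>No edge enters the root, so steering starts one step below it, which widens
      the range from \<open>c\<close> to \<open>s1 * c\<close>.\<close>
    obtain x1 where x1: "x1 \<in> core" "(r, x1) \<in> C" using P.core_child P.root_core by blast
    have "S c x (k c + (Suc (k (s1 * c))))" if x: "x \<in> core" for x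
    proof (cases "x = r")
      case True
      show ?thesis
        unfolding S_def
      proof (intro ballI impI)
        fix z assume z: "z \<in> V" "close c (lam x) (lam z)"
        have "close (s1 * c) (lam x1) (lam z)" using z s1(2)[OF x1(2)] close_sym close_trans True by blast
        then obtain y j where y: "y \<in> core" "j \<le> k (s1 * c)" "(x1, y) \<in> C ^^ j" "close s (lam z) (lam y)"
          using k[OF x1(2,1), of "s1 * c"] z unfolding S_def by blast
        have "(x, y) \<in> C ^^ Suc j" using x1 y True by (meson relpow_Suc_I2)
        moreover have "Suc j \<le> k c + Suc (k (s1 * c))" using y by simp
        ultimately show "\<exists>y\<in>core. \<exists>j\<le>k c + Suc (k (s1 * c)). (x, y) \<in> C ^^ j \<and> close s (lam z) (lam y)" using y by blast
      qed
    next
      case False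
      then obtain p where "(p, x) \<in> C" using V_cases x P.core_V by blast
      then have "S c x (k c)" using k x by blast
      then show ?thesis unfolding S_def by (meson le_add1 le_trans)
    qed
    then show ?thesis by blast
  qed
  moreover have "1 \<le> s" using ss s1 by simp
  moreover have "\<forall>x y. (x, y) \<in> C \<longrightarrow> close s (lam x) (lam y)" using s1 ss close_mono by blast
  ultimately show ?thesis unfolding S_def by blast
qed

text \<open>Turning over one edge turns over all edges above it, by \<open>turn_up\<close>. So the
  image of the path from \<open>p\<close> to the root descends from \<open>act g p\<close>, and
  whatever branches off that path outside the cone at \<open>c\<close> hangs below it.\<close>

lemma up_cone:
  assumes g: "g \<in> carrier G" "(p, c) \<in> C" "(act g c, act g p) \<in> C" and y: "y \<in> V" "(c, y) \<notin> C\<^sup>*"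
  shows "(act g p, act g y) \<in> C\<^sup>*"
proof -
  have V: "p \<in> V" "c \<in> V" using g C_V C_V2 by auto
  have up: "(act g p, act g a) \<in> C\<^sup>* \<and> (\<exists>b. (a, b) \<in> C \<and> (act g b, act g a) \<in> C)" if "(a, p) \<in> C\<^sup>*" for a
    using that
  proof (induction rule: converse_rtrancl_induct)
    case (step a a')
    then obtain b where "(a', b) \<in> C" "(act g b, act g a') \<in> C" by blast
    then have "(act g a', act g a) \<in> C" using turn_up g step by blast
    then show ?case using step by auto
  qed (use g in auto)
  show ?thesis using y
  proof (induction rule: V_induct)
    case root
    have "(r, p) \<in> C\<^sup>*" using V by (simp add: V_def)
    then show ?case using up by blast
  next
    case (step q y)
    have "(c, q) \<notin> C\<^sup>*" using step by (meson rtrancl.rtrancl_into_rtrancl)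
    then have q: "(act g p, act g q) \<in> C\<^sup>*" using step by blast
    show ?case
    proof (cases "(act g q, act g y) \<in> C")
      case False
      then have yq: "(act g y, act g q) \<in> C" using act_C g step by blast
      have "act g p \<noteq> act g q"
      proof
        assume "act g p = act g q"
        then have "act g y = act g c" using yq g par_unique by metis
        then have "y = c" using act_inj g V step C_V2 by blast
        then show False using step by blast
      qed
      then show ?thesis using rtrancl_par[OF q yq] by blast
    qed (use q in auto)
  qed
qed

text \<open>A step lowers the depth below \<open>x\<close> by at most one, so leaving the cone at
  \<open>x\<close> takes more than \<open>j\<close> steps.\<close>

lemma nb_stay:
  assumes "(x, w) \<in> C ^^ j" "(w, u) \<in> nb ^^ k" "k \<le> j"
  shows "\<exists>i. j \<le> i + k \<and> (x, u) \<in> C ^^ i"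
  using assms(2,3)
proof (induction k arbitrary: u)
  case 0
  then show ?case using assms by auto
next
  case (Suc k)
  then obtain v where v: "(w, v) \<in> nb ^^ k" "(v, u) \<in> nb" by auto
  then obtain i where i: "j \<le> i + k" "(x, v) \<in> C ^^ i" using Suc by (meson Suc_leD)
  consider "(v, u) \<in> C" | "(u, v) \<in> C" | "u = v" using v by (auto simp: nb_def)
  then show ?case
  proof cases
    case 1
    then have "(x, u) \<in> C ^^ Suc i" using i by auto
    then show ?thesis using i by (intro exI[of _ "Suc i"]) auto
  next
    case 2
    have "i \<noteq> 0" using i Suc by auto
    then obtain i' where i': "i = Suc i'" by (cases i) auto
    then obtain v' where "(x, v') \<in> C ^^ i'" "(v', v) \<in> C" using i by auto
    then have "(x, u) \<in> C ^^ i'" using 2 par_unique by blast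
    then show ?thesis using i i' by (intro exI[of _ "i'"]) auto
  next
    case 3
    then show ?thesis using i by (intro exI[of _ i]) auto
  qed
qed

lemma nb_act: "g \<in> carrier G \<Longrightarrow> (x, y) \<in> nb ^^ k \<Longrightarrow> (act g x, act g y) \<in> nb ^^ k"
proof (induction k arbitrary: y)
  case (Suc k)
  then obtain z where z: "(x, z) \<in> nb ^^ k" "(z, y) \<in> nb" by auto
  then have "(act g z, act g y) \<in> nb" using act_C[OF Suc(2)] by (auto simp: nb_def)
  then show ?case using Suc z by (meson relpow_Suc_I)
qed auto

text \<open>The descents from \<open>x\<close> to \<open>a\<close> and to \<open>b\<close> must
  part, since neither end lies above the other. The first vertices after the parting are ancestors
  of core vertices, hence in the core.\<close>

lemma split_core:
  assumes "(x, a) \<in> C ^^ i" "(x, b) \<in> C\<^sup>*" "a \<in> core" "b \<in> core" "(a, b) \<notin> C\<^sup>*" "(b, a) \<notin> C\<^sup>*" "x \<in> V"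
  shows "\<exists>y c d j. (x, y) \<in> C ^^ j \<and> (y, c) \<in> C \<and> (y, d) \<in> C \<and> c \<noteq> d \<and> c \<in> core \<and> d \<in> core"
  using assms
proof (induction i arbitrary: x)
  case (Suc i)
  then obtain x1 where x1: "(x, x1) \<in> C" "(x1, a) \<in> C ^^ i" by (meson relpow_Suc_D2)
  have "x \<noteq> b" using Suc relpow_imp_rtrancl by blast
  then obtain x2 where x2: "(x, x2) \<in> C" "(x2, b) \<in> C\<^sup>*" using Suc by (metis converse_rtranclE)
  obtain R1 where "pruned C r R1 core" using pruned_exists by blast
  then interpret P: pruned C r R1 core .
  have V: "x1 \<in> V" "x2 \<in> V" using x1 x2 C_V2 by auto
  show ?case
  proof (cases "x1 = x2")
    case True
    then obtain y c d j where "(x1, y) \<in> C ^^ j" "(y, c) \<in> C" "(y, d) \<in> C" "c \<noteq> d" "c \<in> core" "d \<in> core"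
      using Suc.IH[OF x1(2)] x2 Suc V by blast
    then show ?thesis using relpow_Suc_I2[OF x1(1)] by blast
  next
    case False
    have "x1 \<in> core" "x2 \<in> core" using P.core_upward V x1 x2 Suc relpow_imp_rtrancl by blast+
    then show ?thesis using x1 x2 False by (intro exI[of _ x] exI[of _ x1] exI[of _ x2] exI[of _ 0]) auto
  qed
qed auto

text \<open>Three incomparable core vertices of equal depth are carried below \<open>x\<close> by a
  suitable \<open>g\<close>. At most one of the edges entering them gets turned upside down; the
  other two vertices keep their infinite cones and stay incomparable, so \<open>split_core\<close>
  applies. Two vertices would not do, as one may be lost.\<close>

lemma branch_point:
  assumes x: "x \<in> core"
  shows "\<exists>y c d j. (x, y) \<in> C ^^ j \<and> (y, c) \<in> C \<and> (y, d) \<in> C \<and> c \<noteq> d \<and> c \<in> core \<and> d \<in> core"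
proof -
  obtain R1 where "pruned C r R1 core" using pruned_exists by blast
  then interpret P: pruned C r R1 core .
  obtain c1 c2 c3 where c: "c1 \<in> core" "c2 \<in> core" "c3 \<in> core" "c1 \<noteq> c2" "c1 \<noteq> c3" "c2 \<noteq> c3" "dep c1 = dep c2" "dep c1 = dep c3"
    using three unfolding core_def by auto
  obtain X0 where X0: "finite X0" "X0 \<subseteq> C"
    "\<And>p x. (p, x) \<in> C \<Longrightarrow> \<exists>g q y. g \<in> carrier G \<and> (q, y) \<in> X0 \<and> act g q = p \<and> act g y = x" using reps by blast
  define M where "M = (\<Sum>e\<in>X0. dep (snd e))"
  \<comment> \<open>Deep enough that \<open>act g\<close> of the root, and of every vertex no deeper
    than \<open>c1\<close>, still lies below \<open>x\<close>.\<close>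
  define n where "n = M + dep c1 + 2"
  have "\<exists>w\<in>core. (x, w) \<in> C ^^ k" for k
  proof (induction k)
    case (Suc k)
    then obtain w where w: "w \<in> core" "(x, w) \<in> C ^^ k" by blast
    obtain w' where "w' \<in> core" "(w, w') \<in> C" using P.core_child w by blast
    then show ?case using w by (intro bexI[of _ w']) auto
  qed (use x in auto)
  then obtain w where w: "w \<in> core" "(x, w) \<in> C ^^ Suc n" by blast
  then obtain w0 where "(w0, w) \<in> C" by auto
  then obtain g q y where g: "g \<in> carrier G" "(q, y) \<in> X0" "act g y = w" using X0(3) by blast
  have yV: "y \<in> V" using g X0 C_V2 by blast
  have "dep y \<le> M" unfolding M_def using X0(1) g member_le_sum[of "(q, y)" X0 "\<lambda>e. dep (snd e)"] by auto
  then have "(r, y) \<in> nb ^^ M" using dep_V[OF yV] relpow_nb by blast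
  then have wr: "(w, act g r) \<in> nb ^^ M" using nb_act[OF g(1)] g relpow_sym[OF nb_sym] by blast
  have stay: "(x, act g v) \<in> C\<^sup>* \<and> act g v \<noteq> r" if v: "v \<in> V" "dep v \<le> dep c1" for v
  proof -
    have "(act g r, act g v) \<in> nb ^^ dep c1" using nb_act[OF g(1)] relpow_nb dep_V[OF v(1)] v by blast
    then have "(w, act g v) \<in> nb ^^ (M + dep c1)" by (rule relpow_trans_add[OF wr])
    then obtain i where i: "Suc n \<le> i + (M + dep c1)" "(x, act g v) \<in> C ^^ i"
      using nb_stay[OF w(2), of "act g v" "M + dep c1"] by (auto simp: n_def simp del: relpow.simps)
    have "i \<noteq> 0" using i by (auto simp: n_def)
    then have "act g v \<noteq> r" using i(2) no_par by (cases i) auto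
    then show ?thesis using i relpow_imp_rtrancl by blast
  qed
  have par: "\<exists>p. (p, ci) \<in> C" if "ci \<in> core" "dep ci = dep c1" for ci
  proof -
    have "dep c1 \<noteq> 0"
      using c(4,7) dep_V[OF P.core_V[OF c(1)]] dep_V[OF P.core_V[OF c(2)]] by (cases "dep c1") auto
    then show ?thesis using V_cases[OF P.core_V[OF that(1)]] that dep_root by auto
  qed
  define down where "down ci \<longleftrightarrow> (\<exists>p. (p, ci) \<in> C \<and> (act g p, act g ci) \<in> C)" for ci
  have incomp: "(ci, cj) \<notin> C\<^sup>*" if "ci \<in> core" "ci \<noteq> cj" "dep ci = dep cj" for ci cj
    using rtrancl_dep_eq[of ci cj] that P.core_V by auto
  have both_down: ?thesis  if d: "down ci" "down cj" "ci \<in> core" "cj \<in> core" "ci \<noteq> cj" "dep ci = dep c1" "dep cj = dep c1" for ci cj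
  proof -
    have nc: "(act g a, act g b) \<notin> C\<^sup>*" if da: "down a" "a \<in> core" "b \<in> core" "a \<noteq> b" "dep a = dep b" for a b
    proof
      assume "(act g a, act g b) \<in> C\<^sup>*"
      then obtain i where i: "(act g a, act g b) \<in> C ^^ i" using rtrancl_imp_relpow by blast
      obtain p where p: "(p, a) \<in> C" "(act g p, act g a) \<in> C" using da(1) unfolding down_def by (elim exE conjE)
      have "(a, act (inv g) (act g b)) \<in> C ^^ i" using cone_map_inv[OF g(1) p i] .
      then have "(a, b) \<in> C\<^sup>*" using act_inv[OF g(1) P.core_V[OF da(3)]] relpow_imp_rtrancl by metis
      then show False using incomp[OF da(2,4,5)] by blast
    qed
    have "act g ci \<in> core" "act g cj \<in> core" using d(1-4) core_act[OF g(1)] unfolding down_def by blast+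
    moreover have "(x, act g ci) \<in> C\<^sup>*" "(x, act g cj) \<in> C\<^sup>*" using stay d P.core_V by auto
    moreover obtain i where "(x, act g ci) \<in> C ^^ i" using calculation rtrancl_imp_relpow by blast
    moreover have "(act g ci, act g cj) \<notin> C\<^sup>*" "(act g cj, act g ci) \<notin> C\<^sup>*" using nc[of ci cj] nc[of cj ci] d by auto
    ultimately show ?thesis using split_core P.core_V[OF x] by blast
  qed
  \<comment> \<open>If both edges were turned over, \<open>up_cone\<close> would place the image of
    each parent above the image of the other vertex. Together with the turned edges this gives a
    cyclic chain of strict inequalities of depths.\<close>
  have one_up: "down ci \<or> down cj" if d: "ci \<in> core" "cj \<in> core" "ci \<noteq> cj" "dep ci = dep c1" "dep cj = dep c1" for ci cj
  proof (rule ccontr)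
    assume nd: "\<not> ?thesis"
    obtain pi pj where p: "(pi, ci) \<in> C" "(pj, cj) \<in> C" using par d by metis
    have u: "(act g ci, act g pi) \<in> C" "(act g cj, act g pj) \<in> C" using nd p act_C[OF g(1)] unfolding down_def by blast+
    have V: "pi \<in> V" "pj \<in> V" "ci \<in> V" "cj \<in> V" using p C_V C_V2 by auto
    have "(ci, cj) \<notin> C\<^sup>*" "(cj, ci) \<notin> C\<^sup>*" using incomp d by auto
    then have *: "(act g pi, act g cj) \<in> C\<^sup>*" "(act g pj, act g ci) \<in> C\<^sup>*"
      using up_cone[OF g(1) p(1) u(1)] up_cone[OF g(1) p(2) u(2)] V by blast+
    have "dep (act g pi) \<le> dep (act g cj)" "dep (act g pj) \<le> dep (act g ci)"
      using * dep_rtrancl act_V g V by blast+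
    moreover have "dep (act g pj) = Suc (dep (act g cj))" "dep (act g pi) = Suc (dep (act g ci))"
      using u dep_step C_V by blast+
    ultimately show False by linarith
  qed
  show ?thesis
    using both_down one_up[OF c(1,2)] one_up[OF c(1,3)] one_up[OF c(2,3)] c by metis
qed

lemma branch_exists:
  "\<exists>R0. \<forall>x\<in>core. \<exists>y j c d. j \<le> R0 \<and> (x, y) \<in> C ^^ j \<and> (y, c) \<in> C \<and> (y, d) \<in> C \<and> c \<noteq> d \<and> c \<in> core \<and> d \<in> core"
proof -
  obtain R1 where "pruned C r R1 core" using pruned_exists by blast
  then interpret P: pruned C r R1 core .
  define S where "S x k \<longleftrightarrow> (\<exists>y j c d. j \<le> k \<and> (x, y) \<in> C ^^ j \<and> (y, c) \<in> C \<and> (y, d) \<in> C \<and> c \<noteq> d \<and> c \<in> core \<and> d \<in> core)"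
    for x and k :: nat
  have "\<exists>k. \<forall>p x. (p, x) \<in> C \<longrightarrow> (x \<in> core \<longrightarrow> S x k)"
  proof (rule uniform_bound)
    fix p x assume "(p, x) \<in> C"
    show "\<exists>k. x \<in> core \<longrightarrow> S x k" unfolding S_def using branch_point by blast
  next
    fix p x and k l :: nat assume "x \<in> core \<longrightarrow> S x k" "k \<le> l"
    then show "x \<in> core \<longrightarrow> S x l" unfolding S_def by (meson le_trans)
  next
    fix p x k g assume a: "(p, x) \<in> C" "g \<in> carrier G" "(act g p, act g x) \<in> C" and S: "x \<in> core \<longrightarrow> S x k"
    show "act g x \<in> core \<longrightarrow> S (act g x) k"
    proof
      assume "act g x \<in> core"
      then obtain y j c d where y: "j \<le> k" "(x, y) \<in> C ^^ j" "(y, c) \<in> C" "(y, d) \<in> C" "c \<noteq> d" "c \<in> core" "d \<in> core"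
        using S core_act[OF a(2,1,3)] unfolding S_def by blast
      obtain q where q: "(q, y) \<in> C" "(act g q, act g y) \<in> C" "(act g x, act g y) \<in> C ^^ j"
        using cone_map[OF a(2,1,3) y(2)] by blast
      have "(act g y, act g c) \<in> C" "(act g y, act g d) \<in> C" using turn_down a q y by blast+
      moreover have "act g c \<in> core" "act g d \<in> core" using core_act[OF a(2)] y calculation by blast+
      moreover have "act g c \<noteq> act g d" using act_inj a y P.core_V by blast
      ultimately show "S (act g x) k" unfolding S_def using q y by blast
    qed
  qed
  then obtain k where k: "\<And>p x. (p, x) \<in> C \<Longrightarrow> x \<in> core \<Longrightarrow> S x k" by blast
  obtain l where l: "S r l" using branch_point[OF P.root_core] unfolding S_def by blast
  have "S x (k + l)" if x: "x \<in> core" for x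
  proof (cases "x = r")
    case True
    then show ?thesis using l unfolding S_def by (metis le_add2 le_trans)
  next
    case False
    then obtain p where "(p, x) \<in> C" using V_cases x P.core_V by blast
    then have "S x k" using k x by blast
    then show ?thesis unfolding S_def by (metis le_add1 le_trans)
  qed
  then show ?thesis unfolding S_def by blast
qed

end

section \<open>Words and cosets\<close>

context graph_of_groups
begin

sublocale Bd: bidirected_digraph "base A" "rev_arc A" by (rule bidirected)

abbreviation "tl' \<equiv> tail (base A)"
abbreviation "hd' \<equiv> head (base A)"
abbreviation "rv \<equiv> rev_arc A"
abbreviation "VG \<equiv> vgrp A"
abbreviation "EG \<equiv> egrp A"
abbreviation peq :: "('v, 'e, 'a) word \<Rightarrow> ('v, 'e, 'a) word \<Rightarrow> bool" (infix "\<doteq>" 50) where "w \<doteq> w' \<equiv> pg_eq A w w'"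

lemma incl_rev: "e \<in> arcs (base A) \<Longrightarrow> incl A (rv e) \<in> mon (EG e) (VG (hd' e))"
  using incl_mon[of "rv e"] egrp_rev by simp

lemma incl_closed: "e \<in> arcs (base A) \<Longrightarrow> c \<in> carrier (EG e) \<Longrightarrow> incl A e c \<in> carrier (VG (tl' e))"
  using incl_mon by (auto simp: mon_def hom_def)

lemma incl_rev_closed: "e \<in> arcs (base A) \<Longrightarrow> c \<in> carrier (EG e) \<Longrightarrow> incl A (rv e) c \<in> carrier (VG (hd' e))"
  using incl_rev by (auto simp: mon_def hom_def)

lemma tail_hd [simp]: "e \<in> arcs (base A) \<Longrightarrow> tl' e \<in> verts (base A)" "e \<in> arcs (base A) \<Longrightarrow> hd' e \<in> verts (base A)"
  by auto

lemma pg_app: "w \<doteq> w' \<Longrightarrow> z \<doteq> z' \<Longrightarrow> w @ z \<doteq> w' @ z'"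
  using pg_context[of A w w' "[]" z] pg_context[of A z z' w' "[]"] by (auto intro: pg_trans)

lemma pg_app1: "w \<doteq> w' \<Longrightarrow> w @ z \<doteq> w' @ z" by (rule pg_app) (auto intro: pg_refl)
lemma pg_app2: "z \<doteq> z' \<Longrightarrow> w @ z \<doteq> w @ z'" by (rule pg_app) (auto intro: pg_refl)

lemma path_verts: "gog_path A u w v \<Longrightarrow> u \<in> verts (base A) \<and> v \<in> verts (base A)"
  by (induction rule: gog_path.induct) auto

lemma path_app: "gog_path A u w v \<Longrightarrow> gog_path A v z x \<Longrightarrow> gog_path A u (w @ z) x"
  by (induction rule: gog_path.induct) (auto intro: gog_path.intros)

lemma path_V: "v \<in> verts (base A) \<Longrightarrow> g \<in> carrier (VG v) \<Longrightarrow> gog_path A v [VLet v g] v"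
  by (auto intro: gog_path.intros)

lemma path_E: "e \<in> arcs (base A) \<Longrightarrow> gog_path A (tl' e) [ELet e] (hd' e)"
  by (rule gog_path.intros(3)) (auto intro: gog_path.intros(1))

fun linv :: "('v, 'e, 'a) letter \<Rightarrow> ('v, 'e, 'a) letter" where
  "linv (VLet v g) = VLet v (inv\<^bsub>VG v\<^esub> g)"
| "linv (ELet e) = ELet (rv e)"

definition winv :: "('v, 'e, 'a) word \<Rightarrow> ('v, 'e, 'a) word" where "winv w = rev (map linv w)"

lemma winv_path: "gog_path A u w v \<Longrightarrow> gog_path A v (winv w) u \<and> w @ winv w \<doteq> [] \<and> winv w @ w \<doteq> []"
proof (induction rule: gog_path.induct)
  case (1 v)
  then show ?case by (auto simp: winv_def intro: gog_path.intros pg_refl)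
next
  case (2 v g w v')
  interpret G: group "VG v" using 2 group_vgrp by blast
  let ?i = "[VLet v (inv\<^bsub>VG v\<^esub> g)]"
  have e: "winv (VLet v g # w) = winv w @ ?i" by (simp add: winv_def)
  have c: "[VLet v g] @ ?i \<doteq> []" "?i @ [VLet v g] \<doteq> []"
    using pg_mult[of v A g "inv\<^bsub>VG v\<^esub> g"] pg_mult[of v A "inv\<^bsub>VG v\<^esub> g" g] pg_one[of v A] 2 by (auto intro: pg_trans)
  have "gog_path A v' (winv w @ ?i) v" using 2 path_app path_V[of v "inv\<^bsub>VG v\<^esub> g"] by auto
  moreover have "[VLet v g] @ (w @ winv w) @ ?i \<doteq> [VLet v g] @ [] @ ?i" using 2 pg_context by blast
  moreover have "winv w @ (?i @ [VLet v g]) @ w \<doteq> winv w @ [] @ w" using c pg_context by blast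
  ultimately show ?case unfolding e using c 2 by (auto intro: pg_trans)
next
  case (3 e w v')
  have e: "winv (ELet e # w) = winv w @ [ELet (rv e)]" by (simp add: winv_def)
  have c: "[ELet e] @ [ELet (rv e)] \<doteq> []" "[ELet (rv e)] @ [ELet e] \<doteq> []"
    using pg_rev[of e A] pg_rev[of "rv e" A] 3 by auto
  have "gog_path A v' (winv w @ [ELet (rv e)]) (tl' e)" using 3 path_app path_E[of "rv e"] by auto
  moreover have "[ELet e] @ (w @ winv w) @ [ELet (rv e)] \<doteq> [ELet e] @ [] @ [ELet (rv e)]" using 3 pg_context by blast
  moreover have "winv w @ ([ELet (rv e)] @ [ELet e]) @ w \<doteq> winv w @ [] @ w" using c pg_context by blast
  ultimately show ?case unfolding e using c 3 by (auto intro: pg_trans)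
qed

abbreviation "cl \<equiv> pg_class A"

lemma cl_eq: "cl w = cl w' \<longleftrightarrow> w \<doteq> w'"
  unfolding pg_class_def by (auto intro: pg_refl pg_trans pg_sym)

lemma mem_prod: "z \<in> pg_prod A X Y \<longleftrightarrow> (\<exists>x\<in>X. \<exists>y\<in>Y. x @ y \<doteq> z)"
  by (auto simp: pg_prod_def pg_class_def)

lemma mem_cl: "z \<in> cl w \<longleftrightarrow> w \<doteq> z" by (simp add: pg_class_def)

lemma prod_cl: "pg_prod A (cl w) (cl z) = cl (w @ z)"
proof (intro equalityI subsetI)
  fix x assume "x \<in> pg_prod A (cl w) (cl z)"
  then obtain a b where ab: "w \<doteq> a" "z \<doteq> b" "a @ b \<doteq> x" by (auto simp: mem_prod mem_cl)
  from pg_trans[OF pg_app[OF ab(1,2)] ab(3)] show "x \<in> cl (w @ z)" by (simp add: mem_cl)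
next
  fix x assume "x \<in> cl (w @ z)"
  then show "x \<in> pg_prod A (cl w) (cl z)"
    unfolding mem_prod mem_cl by (intro bexI[of _ w] bexI[of _ z]) (auto simp: mem_cl intro: pg_refl)
qed

text \<open>The coset as one union of classes, with \<open>pg_prod\<close> eliminated;
  \<open>prod_vsub\<close> identifies it with the form used in the definition of the tree.\<close>

definition vertex_coset :: "('v, 'e, 'a) word \<Rightarrow> 'v \<Rightarrow> ('v, 'e, 'a) word set" where
  "vertex_coset w v = {z. \<exists>a\<in>carrier (VG v). w @ [VLet v a] \<doteq> z}"

definition edge_coset :: "('v, 'e, 'a) word \<Rightarrow> 'e \<Rightarrow> ('v, 'e, 'a) word set" where
  "edge_coset w e = {z. \<exists>c\<in>carrier (EG e). w @ [VLet (tl' e) (incl A e c)] \<doteq> z}"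

lemma mem_vsub: "z \<in> vsub A v \<longleftrightarrow> (\<exists>a\<in>carrier (VG v). [VLet v a] \<doteq> z)"
  by (auto simp: vsub_def mem_cl)

lemma mem_esub: "z \<in> esub A e \<longleftrightarrow> (\<exists>c\<in>carrier (EG e). [VLet (tl' e) (incl A e c)] \<doteq> z)"
  by (auto simp: esub_def mem_cl)

text \<open>Serves for products with \<open>vsub\<close>, with \<open>esub\<close> and with cosets
  alike.\<close>

lemma mem_prod_cl: "z \<in> pg_prod A (cl w) {y. \<exists>a\<in>S. f a \<doteq> y} \<longleftrightarrow> (\<exists>a\<in>S. w @ f a \<doteq> z)"
proof
  assume "z \<in> pg_prod A (cl w) {y. \<exists>a\<in>S. f a \<doteq> y}"
  then obtain x y a where x: "w \<doteq> x" "a \<in> S" "f a \<doteq> y" "x @ y \<doteq> z" by (auto simp: mem_prod mem_cl)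
  then have "w @ f a \<doteq> z" using pg_app[OF x(1,3)] by (rule_tac pg_trans)
  then show "\<exists>a\<in>S. w @ f a \<doteq> z" using x by blast
next
  assume "\<exists>a\<in>S. w @ f a \<doteq> z"
  then obtain a where "a \<in> S" "w @ f a \<doteq> z" by blast
  then show "z \<in> pg_prod A (cl w) {y. \<exists>a\<in>S. f a \<doteq> y}"
    unfolding mem_prod mem_cl by (intro bexI[of _ w] bexI[of _ "f a"]) (auto simp: mem_cl intro: pg_refl)
qed

lemma prod_vsub: "pg_prod A (cl w) (vsub A v) = vertex_coset w v"
proof -
  have "vsub A v = {y. \<exists>a\<in>carrier (VG v). [VLet v a] \<doteq> y}" by (auto simp: mem_vsub)
  then show ?thesis by (simp add: set_eq_iff[of "pg_prod A (cl w) _"] mem_prod_cl vertex_coset_def)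
qed

lemma prod_esub: "pg_prod A (cl w) (esub A e) = edge_coset w e"
proof -
  have "esub A e = {y. \<exists>c\<in>carrier (EG e). [VLet (tl' e) (incl A e c)] \<doteq> y}" by (auto simp: mem_esub)
  then show ?thesis by (simp add: set_eq_iff[of "pg_prod A (cl w) _"] mem_prod_cl edge_coset_def)
qed

lemma prod_vertex_coset: "pg_prod A (cl g) (vertex_coset w v) = vertex_coset (g @ w) v"
  by (simp only: set_eq_iff mem_prod_cl vertex_coset_def mem_Collect_eq append_assoc) simp

lemma V_one: "v \<in> verts (base A) \<Longrightarrow> w @ [VLet v \<one>\<^bsub>VG v\<^esub>] \<doteq> w"
  using pg_app2[OF pg_one[of v A], of w] by simp

lemma V_mult: "v \<in> verts (base A) \<Longrightarrow> a \<in> carrier (VG v) \<Longrightarrow> b \<in> carrier (VG v) \<Longrightarrow>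
  w @ [VLet v a, VLet v b] \<doteq> w @ [VLet v (a \<otimes>\<^bsub>VG v\<^esub> b)]"
  by (rule pg_app2, rule pg_mult)

lemma vertex_coset_eq:
  assumes v: "v \<in> verts (base A)"
  shows "vertex_coset w v = vertex_coset w' v \<longleftrightarrow> (\<exists>a\<in>carrier (VG v). w @ [VLet v a] \<doteq> w')"
proof
  interpret G: group "VG v" using v group_vgrp by blast
  assume "vertex_coset w v = vertex_coset w' v"
  moreover have "w' \<in> vertex_coset w' v" unfolding vertex_coset_def using V_one[OF v] by auto
  ultimately show "\<exists>a\<in>carrier (VG v). w @ [VLet v a] \<doteq> w'" by (auto simp: vertex_coset_def)
next
  interpret G: group "VG v" using v group_vgrp by blast
  assume "\<exists>a\<in>carrier (VG v). w @ [VLet v a] \<doteq> w'"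
  then obtain a where a: "a \<in> carrier (VG v)" "w @ [VLet v a] \<doteq> w'" by blast
  have 1: "w @ [VLet v (a \<otimes>\<^bsub>VG v\<^esub> b)] \<doteq> w' @ [VLet v b]" if "b \<in> carrier (VG v)" for b
    using pg_app1[OF a(2), of "[VLet v b]"] V_mult[OF v a(1) that, of w] by (auto intro: pg_trans pg_sym)
  show "vertex_coset w v = vertex_coset w' v"
  proof (intro equalityI subsetI)
    fix z assume "z \<in> vertex_coset w v"
    then obtain b where b: "b \<in> carrier (VG v)" "w @ [VLet v b] \<doteq> z" by (auto simp: vertex_coset_def)
    have "w @ [VLet v b] \<doteq> w' @ [VLet v (inv\<^bsub>VG v\<^esub> a \<otimes>\<^bsub>VG v\<^esub> b)]"
      using 1[of "inv\<^bsub>VG v\<^esub> a \<otimes>\<^bsub>VG v\<^esub> b"] a b by (simp add: G.m_assoc[symmetric])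
    then show "z \<in> vertex_coset w' v" using a b unfolding vertex_coset_def by (auto intro!: bexI[of _ "inv\<^bsub>VG v\<^esub> a \<otimes>\<^bsub>VG v\<^esub> b"] intro: pg_trans pg_sym)
  next
    fix z assume "z \<in> vertex_coset w' v"
    then obtain b where b: "b \<in> carrier (VG v)" "w' @ [VLet v b] \<doteq> z" by (auto simp: vertex_coset_def)
    then show "z \<in> vertex_coset w v" using 1[OF b(1)] a unfolding vertex_coset_def
      by (auto intro!: bexI[of _ "a \<otimes>\<^bsub>VG v\<^esub> b"] intro: pg_trans)
  qed
qed

lemma edge_swap: "e \<in> arcs (base A) \<Longrightarrow> c \<in> carrier (EG e) \<Longrightarrow>
  w @ [VLet (tl' e) (incl A e c), ELet e] \<doteq> w @ [ELet e, VLet (hd' e) (incl A (rv e) c)]"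
  by (rule pg_app2, rule pg_sym, rule pg_edge)

lemma edge_coset_sub_vertex_coset:
  assumes e: "e \<in> arcs (base A)" "gog_path A u w (tl' e)"
  shows "pg_prod A (edge_coset w e) (vsub A (tl' e)) = vertex_coset w (tl' e)"
proof -
  interpret G: group "VG (tl' e)" using e group_vgrp by auto
  interpret K: group "EG e" using e group_egrp by auto
  have i1: "incl A e \<one>\<^bsub>EG e\<^esub> = \<one>\<^bsub>VG (tl' e)\<^esub>" using incl_mon[OF e(1)] hom_one[OF _ K.group_axioms G.group_axioms] by (auto simp: mon_def)
  show ?thesis
  proof (intro equalityI subsetI)
    fix z assume "z \<in> pg_prod A (edge_coset w e) (vsub A (tl' e))"
    then obtain x y a c where x: "c \<in> carrier (EG e)" "w @ [VLet (tl' e) (incl A e c)] \<doteq> x" "a \<in> carrier (VG (tl' e))"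
      "[VLet (tl' e) a] \<doteq> y" "x @ y \<doteq> z" by (auto simp: mem_prod edge_coset_def mem_vsub)
    then have "w @ [VLet (tl' e) (incl A e c), VLet (tl' e) a] \<doteq> z"
      using pg_app[OF x(2,4)] by (auto intro: pg_trans)
    moreover have "incl A e c \<in> carrier (VG (tl' e))" using incl_closed e x by blast
    ultimately show "z \<in> vertex_coset w (tl' e)" unfolding vertex_coset_def using x V_mult[of "tl' e" "incl A e c" a w] e
      by (auto intro!: bexI[of _ "incl A e c \<otimes>\<^bsub>VG (tl' e)\<^esub> a"] intro: pg_trans pg_sym)
  next
    fix z assume "z \<in> vertex_coset w (tl' e)"
    then obtain a where a: "a \<in> carrier (VG (tl' e))" "w @ [VLet (tl' e) a] \<doteq> z" by (auto simp: vertex_coset_def)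
    have "w \<in> edge_coset w e" unfolding edge_coset_def using V_one[of "tl' e" w] e i1 by (auto intro!: bexI[of _ "\<one>\<^bsub>EG e\<^esub>"])
    moreover have "[VLet (tl' e) a] \<in> vsub A (tl' e)" using a by (auto simp: mem_vsub intro: pg_refl)
    ultimately show "z \<in> pg_prod A (edge_coset w e) (vsub A (tl' e))" using a by (auto simp: mem_prod)
  qed
qed

text \<open>The edge group passes through the letter \<open>e\<close> by the defining relation and
  is then absorbed by the vertex group at the head.\<close>

lemma edge_coset_head:
  assumes e: "e \<in> arcs (base A)" "gog_path A u w (tl' e)"
  shows "pg_prod A (pg_prod A (edge_coset w e) (cl [ELet e])) (vsub A (hd' e)) = vertex_coset (w @ [ELet e]) (hd' e)"
proof -
  interpret G: group "VG (tl' e)" using e group_vgrp by auto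
  interpret H: group "VG (hd' e)" using e group_vgrp by auto
  interpret K: group "EG e" using e group_egrp by auto
  have i1: "incl A e \<one>\<^bsub>EG e\<^esub> = \<one>\<^bsub>VG (tl' e)\<^esub>" using incl_mon[OF e(1)] hom_one[OF _ K.group_axioms G.group_axioms] by (auto simp: mon_def)
  show ?thesis
  proof (intro equalityI subsetI)
    fix z assume "z \<in> pg_prod A (pg_prod A (edge_coset w e) (cl [ELet e])) (vsub A (hd' e))"
    then obtain x t x' y a c where x: "c \<in> carrier (EG e)" "w @ [VLet (tl' e) (incl A e c)] \<doteq> x" "a \<in> carrier (VG (hd' e))"
      "[ELet e] \<doteq> t" "x @ t \<doteq> x'" "[VLet (hd' e) a] \<doteq> y" "x' @ y \<doteq> z" by (auto simp: mem_prod mem_cl edge_coset_def mem_vsub)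
    have "w @ [VLet (tl' e) (incl A e c), ELet e] \<doteq> x'" using pg_app[OF x(2,4)] x by (auto intro: pg_trans)
    then have "w @ [ELet e, VLet (hd' e) (incl A (rv e) c)] \<doteq> x'" using edge_swap[OF e(1) x(1), of w] by (auto intro: pg_trans pg_sym)
    from pg_app[OF this x(6)] have "(w @ [ELet e]) @ [VLet (hd' e) (incl A (rv e) c), VLet (hd' e) a] \<doteq> z" using x by (auto intro: pg_trans)
    moreover have "incl A (rv e) c \<in> carrier (VG (hd' e))" using incl_rev_closed e x by blast
    ultimately show "z \<in> vertex_coset (w @ [ELet e]) (hd' e)" unfolding vertex_coset_def
      using x V_mult[of "hd' e" "incl A (rv e) c" a "w @ [ELet e]"] e
      by (auto intro!: bexI[of _ "incl A (rv e) c \<otimes>\<^bsub>VG (hd' e)\<^esub> a"] intro: pg_trans pg_sym)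
  next
    fix z assume "z \<in> vertex_coset (w @ [ELet e]) (hd' e)"
    then obtain a where a: "a \<in> carrier (VG (hd' e))" "w @ [ELet e, VLet (hd' e) a] \<doteq> z" by (auto simp: vertex_coset_def)
    have "w \<in> edge_coset w e" unfolding edge_coset_def using V_one[of "tl' e" w] e i1 by (auto intro!: bexI[of _ "\<one>\<^bsub>EG e\<^esub>"])
    then have "w @ [ELet e] \<in> pg_prod A (edge_coset w e) (cl [ELet e])" by (auto simp: mem_prod mem_cl intro!: bexI intro: pg_refl)
    moreover have "[VLet (hd' e) a] \<in> vsub A (hd' e)" using a by (auto simp: mem_vsub intro: pg_refl)
    ultimately show "z \<in> pg_prod A (pg_prod A (edge_coset w e) (cl [ELet e])) (vsub A (hd' e))"
      unfolding mem_prod[of z] using a by (intro bexI[of _ "w @ [ELet e]"] bexI[of _ "[VLet (hd' e) a]"]) auto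
  qed
qed

lemma bs_verts: "verts (bs_tree A u) = {(v, vertex_coset w v) | v w. gog_path A u w v}"
  by (simp add: bs_tree_def prod_vsub)

lemma bs_arcs: "arcs (bs_tree A u) = {(e, edge_coset w e) | e w. e \<in> arcs (base A) \<and> gog_path A u w (tl' e)}"
  by (simp add: bs_tree_def prod_esub)

lemma bs_tail: "e \<in> arcs (base A) \<Longrightarrow> gog_path A u w (tl' e) \<Longrightarrow> tail (bs_tree A u) (e, edge_coset w e) = (tl' e, vertex_coset w (tl' e))"
  by (simp add: bs_tree_def edge_coset_sub_vertex_coset)

lemma bs_head: "e \<in> arcs (base A) \<Longrightarrow> gog_path A u w (tl' e) \<Longrightarrow>
  head (bs_tree A u) (e, edge_coset w e) = (hd' e, vertex_coset (w @ [ELet e]) (hd' e))"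
  by (simp add: bs_tree_def edge_coset_head)

lemma bs_act_vertex_coset: "bs_act A (cl g) (v, vertex_coset w v) = (v, vertex_coset (g @ w) v)"
  by (simp add: bs_act_def prod_vertex_coset)

lemma pi1_simps: "carrier (pi1 A u) = {cl w | w. gog_path A u w u}" "mult (pi1 A u) = pg_prod A" "one (pi1 A u) = cl []"
  by (simp_all add: pi1_def)

lemma pi1_group: "u \<in> verts (base A) \<Longrightarrow> group (pi1 A u)"
proof (rule groupI)
  assume u: "u \<in> verts (base A)"
  show "\<one>\<^bsub>pi1 A u\<^esub> \<in> carrier (pi1 A u)" using u by (auto simp: pi1_simps intro!: exI[of _ "[]"] gog_path.intros(1))
  fix x y z assume "x \<in> carrier (pi1 A u)" "y \<in> carrier (pi1 A u)" "z \<in> carrier (pi1 A u)"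
  then obtain a b c where "x = cl a" "y = cl b" "z = cl c" "gog_path A u a u" "gog_path A u b u" by (auto simp: pi1_simps)
  then show "x \<otimes>\<^bsub>pi1 A u\<^esub> y \<in> carrier (pi1 A u)" "x \<otimes>\<^bsub>pi1 A u\<^esub> y \<otimes>\<^bsub>pi1 A u\<^esub> z = x \<otimes>\<^bsub>pi1 A u\<^esub> (y \<otimes>\<^bsub>pi1 A u\<^esub> z)"
    using path_app by (auto simp: pi1_simps prod_cl)
next
  fix x assume u: "u \<in> verts (base A)" and "x \<in> carrier (pi1 A u)"
  then obtain a where a: "x = cl a" "gog_path A u a u" by (auto simp: pi1_simps)
  then show "\<one>\<^bsub>pi1 A u\<^esub> \<otimes>\<^bsub>pi1 A u\<^esub> x = x" by (simp add: pi1_simps prod_cl)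
  show "\<exists>y\<in>carrier (pi1 A u). y \<otimes>\<^bsub>pi1 A u\<^esub> x = \<one>\<^bsub>pi1 A u\<^esub>"
  proof (rule bexI[of _ "cl (winv a)"])
    show "cl (winv a) \<otimes>\<^bsub>pi1 A u\<^esub> x = \<one>\<^bsub>pi1 A u\<^esub>" using winv_path[OF a(2)] a by (simp add: pi1_simps prod_cl cl_eq)
    show "cl (winv a) \<in> carrier (pi1 A u)" using winv_path[OF a(2)] by (auto simp: pi1_simps)
  qed
qed

end

section \<open>Normal forms\<close>

text \<open>The trivial coset is represented by \<open>1\<close>, so that a cancelling pair of edges is visible in a normal form.\<close>

definition coset_rep :: "('a, 'm) monoid_scheme \<Rightarrow> ('b, 'k) monoid_scheme \<Rightarrow> ('b \<Rightarrow> 'a) \<Rightarrow> 'a \<Rightarrow> 'a" where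
  "coset_rep G K i g = (if \<exists>c\<in>carrier K. g \<otimes>\<^bsub>G\<^esub> i c = \<one>\<^bsub>G\<^esub> then \<one>\<^bsub>G\<^esub> else SOME x. \<exists>c\<in>carrier K. g \<otimes>\<^bsub>G\<^esub> i c = x)"

definition coset_part :: "('a, 'm) monoid_scheme \<Rightarrow> ('b, 'k) monoid_scheme \<Rightarrow> ('b \<Rightarrow> 'a) \<Rightarrow> 'a \<Rightarrow> 'b" where
  "coset_part G K i g = (SOME c. c \<in> carrier K \<and> g = coset_rep G K i g \<otimes>\<^bsub>G\<^esub> i c)"

text \<open>The representative depends only on the coset of \<open>g\<close> modulo the image of
  \<open>i\<close>. As \<open>i\<close> is injective, the part in \<open>K\<close> is unique, which
  yields the equations for \<open>coset_part\<close>.\<close>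

lemma coset_rep_props:
  assumes "group G" "group K" "i \<in> mon K G" and g: "g \<in> carrier G"
  shows "coset_rep G K i g \<in> carrier G" "coset_part G K i g \<in> carrier K" "g = coset_rep G K i g \<otimes>\<^bsub>G\<^esub> i (coset_part G K i g)"
    "c \<in> carrier K \<Longrightarrow> coset_rep G K i (g \<otimes>\<^bsub>G\<^esub> i c) = coset_rep G K i g"
    "c \<in> carrier K \<Longrightarrow> coset_part G K i (g \<otimes>\<^bsub>G\<^esub> i c) = coset_part G K i g \<otimes>\<^bsub>K\<^esub> c"
    "coset_rep G K i (coset_rep G K i g) = coset_rep G K i g" "coset_part G K i (coset_rep G K i g) = \<one>\<^bsub>K\<^esub>"
    "coset_rep G K i \<one>\<^bsub>G\<^esub> = \<one>\<^bsub>G\<^esub>" "c \<in> carrier K \<Longrightarrow> coset_rep G K i (i c) = \<one>\<^bsub>G\<^esub>"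
    "c \<in> carrier K \<Longrightarrow> coset_part G K i (i c) = c"
proof -
  interpret G: group G by fact
  interpret K: group K by fact
  have i: "i \<in> hom K G" "inj_on i (carrier K)" using assms by (auto simp: mon_def)
  interpret I: group_hom K G i using i by (simp add: group_hom_def group_hom_axioms_def assms)
  have cos: "\<exists>c\<in>carrier K. g \<otimes>\<^bsub>G\<^esub> i c = coset_rep G K i g" for g
  proof (cases "\<exists>c\<in>carrier K. g \<otimes>\<^bsub>G\<^esub> i c = \<one>\<^bsub>G\<^esub>")
    case False
    have "\<exists>x. \<exists>c\<in>carrier K. g \<otimes>\<^bsub>G\<^esub> i c = x" by blast
    from someI_ex[OF this] show ?thesis using False by (simp add: coset_rep_def)
  qed (simp add: coset_rep_def)
  have car: "coset_rep G K i g \<in> carrier G" if "g \<in> carrier G" for g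
    using cos[of g] that by (metis G.m_closed I.hom_closed)
  have ex: "\<exists>c. c \<in> carrier K \<and> g = coset_rep G K i g \<otimes>\<^bsub>G\<^esub> i c" if "g \<in> carrier G" for g
  proof -
    obtain c where c: "c \<in> carrier K" "g \<otimes>\<^bsub>G\<^esub> i c = coset_rep G K i g" using cos by blast
    then have "g = coset_rep G K i g \<otimes>\<^bsub>G\<^esub> i (inv\<^bsub>K\<^esub> c)"
      using that by (metis G.inv_solve_right' I.hom_closed I.hom_inv car K.inv_closed)
    then show ?thesis using c by blast
  qed
  have part: "coset_part G K i g \<in> carrier K \<and> g = coset_rep G K i g \<otimes>\<^bsub>G\<^esub> i (coset_part G K i g)" if "g \<in> carrier G" for g
    unfolding coset_part_def by (rule someI_ex[OF ex[OF that]])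
  show 1: "coset_rep G K i g \<in> carrier G" "coset_part G K i g \<in> carrier K" "g = coset_rep G K i g \<otimes>\<^bsub>G\<^esub> i (coset_part G K i g)"
    using car part g by blast+
  have uniq: "coset_part G K i g = c" if "g \<in> carrier G" "c \<in> carrier K" "g = coset_rep G K i g \<otimes>\<^bsub>G\<^esub> i c" for g c
  proof -
    have "coset_rep G K i g \<otimes>\<^bsub>G\<^esub> i (coset_part G K i g) = coset_rep G K i g \<otimes>\<^bsub>G\<^esub> i c" using that part by metis
    moreover have "coset_rep G K i g \<in> Units G" "i (coset_part G K i g) \<in> carrier G" "i c \<in> carrier G"
      using car[OF that(1)] part[OF that(1)] that(2) by (auto simp: G.Units_eq)
    ultimately have "i (coset_part G K i g) = i c" by (metis G.Units_l_cancel)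
    then show ?thesis using i that part by (auto simp: inj_on_def)
  qed
  \<comment> \<open>Both choices in \<open>coset_rep\<close> depend only on the set of products of
    \<open>h\<close> with the image of \<open>i\<close>, and that set does not change when
    \<open>h\<close> is multiplied by \<open>i c\<close>.\<close>
  have shift: "(\<exists>c'\<in>carrier K. h \<otimes>\<^bsub>G\<^esub> i c \<otimes>\<^bsub>G\<^esub> i c' = x) \<longleftrightarrow> (\<exists>c'\<in>carrier K. h \<otimes>\<^bsub>G\<^esub> i c' = x)"
    if "c \<in> carrier K" "h \<in> carrier G" for c x h
  proof
    assume "\<exists>c'\<in>carrier K. h \<otimes>\<^bsub>G\<^esub> i c \<otimes>\<^bsub>G\<^esub> i c' = x"
    then obtain c' where "c' \<in> carrier K" "h \<otimes>\<^bsub>G\<^esub> i c \<otimes>\<^bsub>G\<^esub> i c' = x" by blast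
    then show "\<exists>c'\<in>carrier K. h \<otimes>\<^bsub>G\<^esub> i c' = x" using that by (intro bexI[of _ "c \<otimes>\<^bsub>K\<^esub> c'"]) (auto simp: G.m_assoc)
  next
    assume "\<exists>c'\<in>carrier K. h \<otimes>\<^bsub>G\<^esub> i c' = x"
    then obtain c' where c': "c' \<in> carrier K" "h \<otimes>\<^bsub>G\<^esub> i c' = x" by blast
    have "i c \<otimes>\<^bsub>G\<^esub> i (inv\<^bsub>K\<^esub> c \<otimes>\<^bsub>K\<^esub> c') = i c'"
      using that c' I.hom_mult[of c "inv\<^bsub>K\<^esub> c \<otimes>\<^bsub>K\<^esub> c'"] by (simp del: I.hom_mult add: K.m_assoc[symmetric])
    then show "\<exists>c'\<in>carrier K. h \<otimes>\<^bsub>G\<^esub> i c \<otimes>\<^bsub>G\<^esub> i c' = x" using that c'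
      by (intro bexI[of _ "inv\<^bsub>K\<^esub> c \<otimes>\<^bsub>K\<^esub> c'"]) (auto simp: G.m_assoc simp del: I.hom_mult)
  qed
  show 4: "coset_rep G K i (g \<otimes>\<^bsub>G\<^esub> i c) = coset_rep G K i g" if "c \<in> carrier K" for c
    unfolding coset_rep_def shift[OF that g] ..
  show "coset_part G K i (g \<otimes>\<^bsub>G\<^esub> i c) = coset_part G K i g \<otimes>\<^bsub>K\<^esub> c" if "c \<in> carrier K" for c
  proof (rule uniq)
    have "coset_rep G K i g \<otimes>\<^bsub>G\<^esub> i (coset_part G K i g \<otimes>\<^bsub>K\<^esub> c) = coset_rep G K i g \<otimes>\<^bsub>G\<^esub> i (coset_part G K i g) \<otimes>\<^bsub>G\<^esub> i c"
      using 1(1,2) that by (simp add: G.m_assoc)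
    then show "g \<otimes>\<^bsub>G\<^esub> i c = coset_rep G K i (g \<otimes>\<^bsub>G\<^esub> i c) \<otimes>\<^bsub>G\<^esub> i (coset_part G K i g \<otimes>\<^bsub>K\<^esub> c)"
      by (simp only: 1(3)[symmetric] 4[OF that])
  qed (use g 1 that in auto)
  obtain c0 where c0: "c0 \<in> carrier K" "g \<otimes>\<^bsub>G\<^esub> i c0 = coset_rep G K i g" using cos by blast
  show 6: "coset_rep G K i (coset_rep G K i g) = coset_rep G K i g" using 4[OF c0(1)] c0 by simp
  show "coset_part G K i (coset_rep G K i g) = \<one>\<^bsub>K\<^esub>" by (rule uniq) (use 1 6 in auto)
  show 8: "coset_rep G K i \<one>\<^bsub>G\<^esub> = \<one>\<^bsub>G\<^esub>" 
  proof -
    have "\<exists>c\<in>carrier K. \<one>\<^bsub>G\<^esub> \<otimes>\<^bsub>G\<^esub> i c = \<one>\<^bsub>G\<^esub>" by (rule bexI[of _ "\<one>\<^bsub>K\<^esub>"]) auto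
    then show ?thesis by (simp only: coset_rep_def if_True)
  qed
  show 9: "coset_rep G K i (i c) = \<one>\<^bsub>G\<^esub>" if "c \<in> carrier K" for c
  proof -
    have "\<exists>d\<in>carrier K. i c \<otimes>\<^bsub>G\<^esub> i d = \<one>\<^bsub>G\<^esub>" using that by (intro bexI[of _ "inv\<^bsub>K\<^esub> c"]) auto
    then show ?thesis by (simp only: coset_rep_def if_True)
  qed
  show "coset_part G K i (i c) = c" if "c \<in> carrier K" for c by (rule uniq) (use that 9 in auto)
qed

context graph_of_groups
begin

abbreviation "rp e \<equiv> coset_rep (VG (tl' e)) (EG e) (incl A e)"
abbreviation "kp e \<equiv> coset_part (VG (tl' e)) (EG e) (incl A e)"

lemma arc_groups: "e \<in> arcs (base A) \<Longrightarrow> group (VG (tl' e))" "e \<in> arcs (base A) \<Longrightarrow> group (VG (hd' e))" "e \<in> arcs (base A) \<Longrightarrow> group (EG e)"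
  using group_vgrp group_egrp by auto

lemmas rp_props = coset_rep_props[OF arc_groups(1) arc_groups(3) incl_mon]

lemma incl_mult: "e \<in> arcs (base A) \<Longrightarrow> c \<in> carrier (EG e) \<Longrightarrow> d \<in> carrier (EG e) \<Longrightarrow>
  incl A (rv e) (c \<otimes>\<^bsub>EG e\<^esub> d) = incl A (rv e) c \<otimes>\<^bsub>VG (hd' e)\<^esub> incl A (rv e) d"
  using incl_rev by (auto simp: mon_def hom_def)

lemma incl_one: "e \<in> arcs (base A) \<Longrightarrow> incl A (rv e) \<one>\<^bsub>EG e\<^esub> = \<one>\<^bsub>VG (hd' e)\<^esub>"
  using incl_rev hom_one[OF _ arc_groups(3) arc_groups(2)] by (auto simp: mon_def)

text \<open>The list spells a reduced word \<open>s1 e1 s2 e2 ...\<close>: every \<open>s\<close>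
  represents its coset of the edge group, and no edge is followed by \<open>1\<close> and its
  reverse. The final vertex group element is omitted, so a normal form describes a coset of a vertex
  group, that is a vertex of the tree.\<close>

fun normal_form :: "'v \<Rightarrow> ('a \<times> 'e) list \<Rightarrow> 'v \<Rightarrow> bool" where
  "normal_form x [] y \<longleftrightarrow> x \<in> verts (base A) \<and> x = y"
| "normal_form x ((s, e) # l) y \<longleftrightarrow> e \<in> arcs (base A) \<and> x = tl' e \<and> s \<in> carrier (VG x) \<and> rp e s = s \<and> normal_form (hd' e) l y
     \<and> (l \<noteq> [] \<longrightarrow> hd l \<noteq> (\<one>\<^bsub>VG (hd' e)\<^esub>, rv e))"

text \<open>Left multiplication by \<open>g\<close>: the product is split into a representative and
  an edge group element, which is moved across the edge and multiplied onto the rest. What arrives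
  at the right end is dropped, being absorbed by the coset.\<close>

fun vertex_act :: "'a \<Rightarrow> ('a \<times> 'e) list \<Rightarrow> ('a \<times> 'e) list" where
  "vertex_act g [] = []"
| "vertex_act g ((s, e) # l) = (rp e (g \<otimes>\<^bsub>VG (tl' e)\<^esub> s), e) # vertex_act (incl A (rv e) (kp e (g \<otimes>\<^bsub>VG (tl' e)\<^esub> s))) l"

definition edge_act :: "'e \<Rightarrow> ('a \<times> 'e) list \<Rightarrow> ('a \<times> 'e) list" where
  "edge_act e l = (if l \<noteq> [] \<and> hd l = (\<one>\<^bsub>VG (hd' e)\<^esub>, rv e) then tl l else (\<one>\<^bsub>VG (tl' e)\<^esub>, e) # l)"

lemma normal_form_verts: "normal_form x l y \<Longrightarrow> x \<in> verts (base A) \<and> y \<in> verts (base A)"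
  by (induction x l y rule: normal_form.induct) auto

text \<open>Elements of the edge group neither create nor destroy a cancelling pair. If the new
  representative is \<open>1\<close>, then \<open>s\<close> lies in the edge group, and as a
  representative it is then \<open>1\<close> itself.\<close>

lemma vertex_act_hd:
  assumes e: "e \<in> arcs (base A)" "c \<in> carrier (EG e)" and "normal_form (hd' e) l y" "l \<noteq> []"
  shows "hd (vertex_act (incl A (rv e) c) l) = (\<one>\<^bsub>VG (hd' e)\<^esub>, rv e) \<longleftrightarrow> hd l = (\<one>\<^bsub>VG (hd' e)\<^esub>, rv e)"
proof -
  obtain s f l' where l: "l = (s, f) # l'" using assms(4) by (metis list.exhaust prod.exhaust)
  show ?thesis
  proof (cases "f = rv e")
    case True
    interpret G: group "VG (hd' e)" using e arc_groups by blast
    interpret K: group "EG e" using e arc_groups by blast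
    have f: "rv e \<in> arcs (base A)" "tl' (rv e) = hd' e" "EG (rv e) = EG e" using e egrp_rev by auto
    have s: "s \<in> carrier (VG (hd' e))" "rp (rv e) s = s" using assms(3) l True by auto
    note R = rp_props[OF f(1) f(1) f(1), unfolded f(2,3)]
    have c: "incl A (rv e) c \<in> carrier (VG (hd' e))" using e incl_rev_closed by blast
    have "rp (rv e) (incl A (rv e) c \<otimes>\<^bsub>VG (hd' e)\<^esub> s) = \<one>\<^bsub>VG (hd' e)\<^esub> \<longleftrightarrow> s = \<one>\<^bsub>VG (hd' e)\<^esub>"
    proof
      assume a: "rp (rv e) (incl A (rv e) c \<otimes>\<^bsub>VG (hd' e)\<^esub> s) = \<one>\<^bsub>VG (hd' e)\<^esub>"
      let ?g = "incl A (rv e) c \<otimes>\<^bsub>VG (hd' e)\<^esub> s"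
      let ?k = "kp (rv e) ?g"
      have g: "?g \<in> carrier (VG (hd' e))" using c s by blast
      have k: "?k \<in> carrier (EG e)" "?g = incl A (rv e) ?k"
        using R(2)[OF g] R(3)[OF g] a incl_rev_closed[OF e(1)] f by (auto simp: G.l_one)
      have "s = inv\<^bsub>VG (hd' e)\<^esub> incl A (rv e) c \<otimes>\<^bsub>VG (hd' e)\<^esub> incl A (rv e) ?k"
        using k(2) c s by (metis G.inv_closed G.l_inv G.l_one G.m_assoc)
      also have "\<dots> = incl A (rv e) (inv\<^bsub>EG e\<^esub> c \<otimes>\<^bsub>EG e\<^esub> ?k)"
      proof -
        interpret I: group_hom "EG e" "VG (hd' e)" "incl A (rv e)"
          using incl_rev[OF e(1)] by (simp add: group_hom_def group_hom_axioms_def mon_def G.group_axioms K.group_axioms)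
        show ?thesis using k e by simp
      qed
      finally show "s = \<one>\<^bsub>VG (hd' e)\<^esub>" using R(9)[OF G.one_closed, of "inv\<^bsub>EG e\<^esub> c \<otimes>\<^bsub>EG e\<^esub> ?k"] s k e f by simp
    next
      assume "s = \<one>\<^bsub>VG (hd' e)\<^esub>"
      then show "rp (rv e) (incl A (rv e) c \<otimes>\<^bsub>VG (hd' e)\<^esub> s) = \<one>\<^bsub>VG (hd' e)\<^esub>"
        using R(9)[OF G.one_closed, of c] c e f by simp
    qed
    then show ?thesis using l True f by simp
  qed (use l in auto)
qed

lemma normal_form_vertex_act: "normal_form x l y \<Longrightarrow> g \<in> carrier (VG x) \<Longrightarrow> normal_form x (vertex_act g l) y"
proof (induction x l y arbitrary: g rule: normal_form.induct)
  case (2 x s e l y)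
  then have e: "e \<in> arcs (base A)" "x = tl' e" "s \<in> carrier (VG x)" "normal_form (hd' e) l y" by auto
  interpret G: group "VG (tl' e)" using e arc_groups by blast
  have gs: "g \<otimes>\<^bsub>VG (tl' e)\<^esub> s \<in> carrier (VG (tl' e))" using e 2 by auto
  note R = rp_props[OF e(1) e(1) e(1) gs]
  have "incl A (rv e) (kp e (g \<otimes>\<^bsub>VG (tl' e)\<^esub> s)) \<in> carrier (VG (hd' e))" using R incl_rev_closed e by blast
  then have "normal_form (hd' e) (vertex_act (incl A (rv e) (kp e (g \<otimes>\<^bsub>VG (tl' e)\<^esub> s))) l) y" using 2 e by auto
  moreover have "vertex_act h l \<noteq> [] \<longleftrightarrow> l \<noteq> []" for h by (cases l) auto
  ultimately show ?case using 2 e R vertex_act_hd[OF e(1) R(2) e(4)] by auto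
qed auto

text \<open>Splitting \<open>h\<close> times \<open>s\<close> before multiplying by \<open>g\<close>
  leads to the same coset, and the two edge group parts multiply in the right order. The induction
  hypothesis then applies beyond the edge.\<close>

lemma vertex_act_mult: "normal_form x l y \<Longrightarrow> g \<in> carrier (VG x) \<Longrightarrow> h \<in> carrier (VG x) \<Longrightarrow> vertex_act (g \<otimes>\<^bsub>VG x\<^esub> h) l = vertex_act g (vertex_act h l)"
proof (induction x l y arbitrary: g h rule: normal_form.induct)
  case (2 x s e l y)
  then have e: "e \<in> arcs (base A)" "x = tl' e" "s \<in> carrier (VG x)" "normal_form (hd' e) l y" by auto
  interpret G: group "VG (tl' e)" using e arc_groups by blast
  let ?m = "\<lambda>a b. a \<otimes>\<^bsub>VG (tl' e)\<^esub> b"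
  have hs: "?m h s \<in> carrier (VG (tl' e))" using e 2 by auto
  note R = rp_props[OF e(1) e(1) e(1) hs]
  have gr: "?m g (rp e (?m h s)) \<in> carrier (VG (tl' e))" using R e 2 by auto
  note S = rp_props[OF e(1) e(1) e(1) gr]
  have eq: "?m (?m g h) s = ?m (?m g (rp e (?m h s))) (incl A e (kp e (?m h s)))"
    using R(1-3) e 2 incl_closed[OF e(1) R(2)] by (metis G.m_assoc)
  have "rp e (?m (?m g h) s) = rp e (?m g (rp e (?m h s)))" unfolding eq using S(4) R by blast
  moreover have "kp e (?m (?m g h) s) = kp e (?m g (rp e (?m h s))) \<otimes>\<^bsub>EG e\<^esub> kp e (?m h s)" unfolding eq using S(5) R by blast
  moreover have "incl A (rv e) (kp e (?m g (rp e (?m h s)))) \<in> carrier (VG (hd' e))"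
    "incl A (rv e) (kp e (?m h s)) \<in> carrier (VG (hd' e))" using R S incl_rev_closed e by blast+
  ultimately show ?case using 2 e R(2) S(2) by (simp add: incl_mult)
qed auto

lemma vertex_act_one: "normal_form x l y \<Longrightarrow> vertex_act \<one>\<^bsub>VG x\<^esub> l = l"
proof (induction x l y rule: normal_form.induct)
  case (2 x s e l y)
  then have e: "e \<in> arcs (base A)" "x = tl' e" "s \<in> carrier (VG x)" "normal_form (hd' e) l y" "rp e s = s" by auto
  interpret G: group "VG (tl' e)" using e arc_groups by blast
  have "kp e s = \<one>\<^bsub>EG e\<^esub>" using rp_props(7)[OF e(1) e(1) e(1), of s] e by auto
  then show ?case using 2 e by (simp add: incl_one)
qed auto

lemma normal_form_edge_act: "e \<in> arcs (base A) \<Longrightarrow> normal_form (hd' e) l y \<Longrightarrow> normal_form (tl' e) (edge_act e l) y"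
proof -
  assume e: "e \<in> arcs (base A)" "normal_form (hd' e) l y"
  interpret G: group "VG (tl' e)" using e arc_groups by blast
  show ?thesis
  proof (cases "l \<noteq> [] \<and> hd l = (\<one>\<^bsub>VG (hd' e)\<^esub>, rv e)")
    case True
    then obtain l' where "l = (\<one>\<^bsub>VG (hd' e)\<^esub>, rv e) # l'" by (metis list.collapse)
    then show ?thesis using e by (auto simp: edge_act_def)
  next
    case False
    then show ?thesis using e rp_props(8)[OF e(1) e(1) e(1) G.one_closed] by (auto simp: edge_act_def)
  qed
qed

lemma edge_act_rev: "e \<in> arcs (base A) \<Longrightarrow> normal_form (tl' e) l y \<Longrightarrow> edge_act e (edge_act (rv e) l) = l"
proof -
  assume e: "e \<in> arcs (base A)" "normal_form (tl' e) l y"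
  show ?thesis
  proof (cases "l \<noteq> [] \<and> hd l = (\<one>\<^bsub>VG (tl' e)\<^esub>, e)")
    case True
    then obtain l' where l: "l = (\<one>\<^bsub>VG (tl' e)\<^esub>, e) # l'" by (metis list.collapse)
    then show ?thesis using e by (auto simp: edge_act_def)
  next
    case False
    then show ?thesis using e by (auto simp: edge_act_def)
  qed
qed

text \<open>If \<open>e\<close> cancels, the element of the edge group crosses the cancelled pair
  unchanged. If not, \<open>vertex_act_hd\<close> excludes a new cancellation, and the element
  crosses the prepended edge.\<close>

lemma edge_act_edge:
  assumes e: "e \<in> arcs (base A)" "normal_form (hd' e) l y" "c \<in> carrier (EG e)"
  shows "edge_act e (vertex_act (incl A (rv e) c) l) = vertex_act (incl A e c) (edge_act e l)"
proof (cases "l \<noteq> [] \<and> hd l = (\<one>\<^bsub>VG (hd' e)\<^esub>, rv e)")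
  case True
  interpret H: group "VG (hd' e)" using e arc_groups by blast
  obtain l' where l: "l = (\<one>\<^bsub>VG (hd' e)\<^esub>, rv e) # l'" using True by (metis list.collapse)
  have f: "rv e \<in> arcs (base A)" "tl' (rv e) = hd' e" "EG (rv e) = EG e" using e egrp_rev by auto
  note R = rp_props[OF f(1) f(1) f(1), unfolded f(2,3), OF H.one_closed]
  have "incl A (rv e) c \<otimes>\<^bsub>VG (hd' e)\<^esub> \<one>\<^bsub>VG (hd' e)\<^esub> = incl A (rv e) c" using e incl_rev_closed by simp
  then show ?thesis using l R(9,10) e f by (simp add: edge_act_def)
next
  case False
  interpret G: group "VG (tl' e)" using e arc_groups by blast
  have "\<not> (vertex_act (incl A (rv e) c) l \<noteq> [] \<and> hd (vertex_act (incl A (rv e) c) l) = (\<one>\<^bsub>VG (hd' e)\<^esub>, rv e))"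
    using False vertex_act_hd[OF e(1,3,2)] by (cases l) auto
  then have "edge_act e (vertex_act (incl A (rv e) c) l) = (\<one>\<^bsub>VG (tl' e)\<^esub>, e) # vertex_act (incl A (rv e) c) l" by (simp only: edge_act_def if_False)
  moreover have "edge_act e l = (\<one>\<^bsub>VG (tl' e)\<^esub>, e) # l" using False by (simp only: edge_act_def if_False)
  moreover have "incl A e c \<otimes>\<^bsub>VG (tl' e)\<^esub> \<one>\<^bsub>VG (tl' e)\<^esub> = incl A e c" using e incl_closed by simp
  ultimately show ?thesis using e rp_props(9,10)[OF e(1) e(1) e(1) G.one_closed e(3)] by simp
qed

text \<open>To make every letter act on all pairs, \<open>e\<close> acts at its tail as its reverse does.\<close>

fun letter_act :: "('v, 'e, 'a) letter \<Rightarrow> 'v \<times> ('a \<times> 'e) list \<Rightarrow> 'v \<times> ('a \<times> 'e) list" where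
  "letter_act (VLet w g) (v, l) = (if v = w \<and> g \<in> carrier (VG w) then (v, vertex_act g l) else (v, l))"
| "letter_act (ELet e) (v, l) = (if e \<in> arcs (base A) then if v = hd' e then (tl' e, edge_act e l) else if v = tl' e then (hd' e, edge_act (rv e) l)
      else (v, l) else (v, l))"

definition word_act :: "('v, 'e, 'a) word \<Rightarrow> 'v \<times> ('a \<times> 'e) list \<Rightarrow> 'v \<times> ('a \<times> 'e) list" where "word_act = foldr letter_act"

definition normal_forms :: "('v \<times> ('a \<times> 'e) list) set" where "normal_forms = {(v, l). \<exists>y. normal_form v l y}"

lemma letter_act_normal_forms: "x \<in> normal_forms \<Longrightarrow> letter_act a x \<in> normal_forms"
proof -
  assume "x \<in> normal_forms"
  then obtain v l y where x: "x = (v, l)" "normal_form v l y" by (auto simp: normal_forms_def)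
  show ?thesis
  proof (cases a)
    case (VLet w g)
    then show ?thesis using x normal_form_vertex_act[OF x(2), of g] by (auto simp: normal_forms_def)
  next
    case (ELet e)
    then show ?thesis using x normal_form_edge_act[of e l y] normal_form_edge_act[of "rv e" l y] by (auto simp: normal_forms_def)
  qed
qed

lemma word_act_simps [simp]: "word_act [] x = x" "word_act (a # w) x = letter_act a (word_act w x)" "word_act (w @ z) x = word_act w (word_act z x)"
  by (simp_all add: word_act_def)

lemma word_act_normal_forms: "x \<in> normal_forms \<Longrightarrow> word_act w x \<in> normal_forms"
  by (induction w) (auto intro: letter_act_normal_forms)

text \<open>Van der Waerden's method: the defining relations of the path group hold for the maps on
  normal forms, so the effect of a word on a normal form depends on its class alone.\<close>

lemma word_act_peq: "w \<doteq> w' \<Longrightarrow> x \<in> normal_forms \<Longrightarrow> word_act w x = word_act w' x"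
proof (induction arbitrary: x rule: pg_eq.induct)
  case (pg_context w w' y z)
  then show ?case using word_act_normal_forms by simp
next
  case (pg_mult v g h)
  interpret G: group "VG v" using pg_mult group_vgrp by blast
  obtain a l where x: "x = (a, l)" by fastforce
  then obtain y where "normal_form a l y" using pg_mult by (auto simp: normal_forms_def)
  then show ?case using x pg_mult vertex_act_mult by auto
next
  case (pg_one v)
  interpret G: group "VG v" using pg_one group_vgrp by blast
  obtain a l where x: "x = (a, l)" by fastforce
  then obtain y where "normal_form a l y" using pg_one by (auto simp: normal_forms_def)
  then show ?case using x vertex_act_one by auto
next
  case (pg_rev e)
  obtain a l where x: "x = (a, l)" by fastforce
  then obtain y where "normal_form a l y" using pg_rev by (auto simp: normal_forms_def)
  then show ?case using x pg_rev edge_act_rev[of e l y] edge_act_rev[of "rv e" l y] by auto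
next
  case (pg_edge e c)
  obtain a l where x: "x = (a, l)" by fastforce
  then obtain y where "normal_form a l y" using pg_edge by (auto simp: normal_forms_def)
  then show ?case using x pg_edge edge_act_edge[of e l y c] incl_closed incl_rev_closed by auto
qed auto

section \<open>The Bass--Serre tree is a tree\<close>

fun form_word :: "('a \<times> 'e) list \<Rightarrow> ('v, 'e, 'a) word" where
  "form_word [] = []"
| "form_word ((s, e) # l) = VLet (tl' e) s # ELet e # form_word l"

lemma form_word_app: "form_word (l @ l') = form_word l @ form_word l'"
  by (induction l rule: form_word.induct) auto

lemma form_word_path: "normal_form x l y \<Longrightarrow> gog_path A x (form_word l) y"
  by (induction x l y rule: normal_form.induct) (auto intro: gog_path.intros)

lemma normal_form_app1: "normal_form x (l @ m) y \<Longrightarrow> \<exists>z. normal_form x l z \<and> normal_form z m y"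
proof (induction l arbitrary: x)
  case Nil
  then show ?case using normal_form_verts by auto
next
  case (Cons p l)
  obtain s e where p: "p = (s, e)" by fastforce
  then obtain z where "normal_form (hd' e) l z" "normal_form z m y" using Cons by auto
  then show ?case using Cons.prems p by (auto intro!: exI[of _ z])
qed

lemma normal_form_end_unique: "normal_form x l y \<Longrightarrow> normal_form x l y' \<Longrightarrow> y = y'"
  by (induction x l y rule: normal_form.induct) auto

text \<open>As long as the result is reduced, nothing cancels and every representative stays as it
  is, so the form is merely prepended. With \<open>m\<close> empty this recovers a normal form from
  the word that it spells.\<close>

lemma word_act_form_word: "normal_form x (l @ m) y \<Longrightarrow> normal_form x l z \<Longrightarrow> word_act (form_word l) (z, m) = (x, l @ m)"
proof (induction l arbitrary: x)
  case (Cons p l)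
  obtain s e where p: "p = (s, e)" by fastforce
  then have e: "e \<in> arcs (base A)" "x = tl' e" "s \<in> carrier (VG (tl' e))" "normal_form (hd' e) (l @ m) y" "normal_form (hd' e) l z" "rp e s = s"
    "l @ m \<noteq> [] \<longrightarrow> hd (l @ m) \<noteq> (\<one>\<^bsub>VG (hd' e)\<^esub>, rv e)"
    using Cons.prems by auto
  interpret G: group "VG (tl' e)" using e arc_groups by blast
  have "kp e s = \<one>\<^bsub>EG e\<^esub>" using rp_props(7)[OF e(1) e(1) e(1) e(3)] e by simp
  then have "vertex_act s ((\<one>\<^bsub>VG (tl' e)\<^esub>, e) # l @ m) = (s, e) # l @ m" using e vertex_act_one by (simp add: incl_one)
  moreover have "edge_act e (l @ m) = (\<one>\<^bsub>VG (tl' e)\<^esub>, e) # l @ m" using e(7) by (auto simp: edge_act_def)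
  ultimately show ?case using Cons.IH[OF e(4,5)] p e by simp
qed auto

text \<open>The computation done by \<open>vertex_act\<close> is valid in the path group, up to the
  element \<open>a\<close> that it drops at the right end.\<close>

lemma form_word_vertex_act:
  "normal_form x l y \<Longrightarrow> g \<in> carrier (VG x) \<Longrightarrow> \<exists>a\<in>carrier (VG y). VLet x g # form_word l \<doteq> form_word (vertex_act g l) @ [VLet y a]"
proof (induction x l y arbitrary: g rule: normal_form.induct)
  case (1 x y)
  then show ?case by (auto intro: pg_refl)
next
  case (2 x s e l y)
  then have e: "e \<in> arcs (base A)" "x = tl' e" "s \<in> carrier (VG x)" "normal_form (hd' e) l y" by auto
  interpret G: group "VG (tl' e)" using e arc_groups by blast
  let ?g = "g \<otimes>\<^bsub>VG (tl' e)\<^esub> s"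
  have gs: "?g \<in> carrier (VG (tl' e))" using e 2 by auto
  note R = rp_props[OF e(1) e(1) e(1) gs]
  have i: "incl A (rv e) (kp e ?g) \<in> carrier (VG (hd' e))" "incl A e (kp e ?g) \<in> carrier (VG (tl' e))"
    using R incl_rev_closed incl_closed e by blast+
  obtain a where a: "a \<in> carrier (VG y)"
    "VLet (hd' e) (incl A (rv e) (kp e ?g)) # form_word l \<doteq> form_word (vertex_act (incl A (rv e) (kp e ?g)) l) @ [VLet y a]"
    using 2 e i by blast
  have "[VLet (tl' e) g, VLet (tl' e) s] @ ELet e # form_word l \<doteq> [VLet (tl' e) ?g] @ ELet e # form_word l"
    using e 2 by (intro pg_app1 pg_mult) auto
  moreover have "[VLet (tl' e) ?g] @ ELet e # form_word l \<doteq> [VLet (tl' e) (rp e ?g), VLet (tl' e) (incl A e (kp e ?g))] @ ELet e # form_word l"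
    using pg_mult[of "tl' e" A "rp e ?g" "incl A e (kp e ?g)"] R(1,3) i e by (intro pg_app1 pg_sym[OF pg_mult, of "tl' e" A "rp e ?g" "incl A e (kp e ?g)", folded R(3)]) auto
  moreover have "[VLet (tl' e) (rp e ?g), VLet (tl' e) (incl A e (kp e ?g))] @ ELet e # form_word l
     \<doteq> [VLet (tl' e) (rp e ?g)] @ [ELet e, VLet (hd' e) (incl A (rv e) (kp e ?g))] @ form_word l"
    using pg_app1[OF edge_swap[OF e(1) R(2), of "[VLet (tl' e) (rp e ?g)]"], of "form_word l"] by simp
  moreover have "[VLet (tl' e) (rp e ?g)] @ [ELet e, VLet (hd' e) (incl A (rv e) (kp e ?g))] @ form_word l
     \<doteq> [VLet (tl' e) (rp e ?g), ELet e] @ form_word (vertex_act (incl A (rv e) (kp e ?g)) l) @ [VLet y a]"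
    using pg_app2[OF a(2), of "[VLet (tl' e) (rp e ?g), ELet e]"] by simp
  ultimately have "[VLet (tl' e) g, VLet (tl' e) s] @ ELet e # form_word l
     \<doteq> [VLet (tl' e) (rp e ?g), ELet e] @ form_word (vertex_act (incl A (rv e) (kp e ?g)) l) @ [VLet y a]"
    by (meson pg_trans)
  then show ?case using e a by auto
qed

lemma form_word_edge_act: "e \<in> arcs (base A) \<Longrightarrow> normal_form (hd' e) l y \<Longrightarrow> ELet e # form_word l \<doteq> form_word (edge_act e l)"
proof -
  assume e: "e \<in> arcs (base A)" "normal_form (hd' e) l y"
  show ?thesis
  proof (cases "l \<noteq> [] \<and> hd l = (\<one>\<^bsub>VG (hd' e)\<^esub>, rv e)")
    case True
    then obtain l' where l: "l = (\<one>\<^bsub>VG (hd' e)\<^esub>, rv e) # l'" by (metis list.collapse)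
    have "[ELet e, VLet (hd' e) \<one>\<^bsub>VG (hd' e)\<^esub>] @ ELet (rv e) # form_word l' \<doteq> [ELet e] @ ELet (rv e) # form_word l'"
      using V_one[of "hd' e" "[ELet e]"] e by (intro pg_app1) auto
    moreover have "[ELet e, ELet (rv e)] @ form_word l' \<doteq> [] @ form_word l'" using e by (intro pg_app1 pg_rev)
    ultimately show ?thesis using l e by (auto simp: edge_act_def intro: pg_trans)
  next
    case False
    have "[] @ ELet e # form_word l \<doteq> [VLet (tl' e) \<one>\<^bsub>VG (tl' e)\<^esub>] @ ELet e # form_word l"
      using pg_one[of "tl' e" A] e by (intro pg_app1 pg_sym[OF pg_one]) auto
    then show ?thesis using False by (auto simp: edge_act_def)
  qed
qed

text \<open>Existence of normal forms: letting the word act on the empty form computes one, and the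
  dropped elements gather in \<open>a\<close>.\<close>

lemma path_normal_form:
  "gog_path A x w y \<Longrightarrow> \<exists>l a. word_act w (y, []) = (x, l) \<and> normal_form x l y \<and> a \<in> carrier (VG y) \<and> w \<doteq> form_word l @ [VLet y a]"
proof (induction rule: gog_path.induct)
  case (1 v)
  interpret G: group "VG v" using 1 group_vgrp by blast
  show ?case using 1 pg_sym[OF pg_one[OF 1]] by auto
next
  case (2 v g w v')
  then obtain l a where l: "word_act w (v', []) = (v, l)" "normal_form v l v'" "a \<in> carrier (VG v')" "w \<doteq> form_word l @ [VLet v' a]" by blast
  have v': "v' \<in> verts (base A)" using path_verts 2 by blast
  interpret G: group "VG v'" using v' group_vgrp by blast
  obtain b where b: "b \<in> carrier (VG v')" "VLet v g # form_word l \<doteq> form_word (vertex_act g l) @ [VLet v' b]" using form_word_vertex_act l 2 by blast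
  have "VLet v g # w \<doteq> VLet v g # form_word l @ [VLet v' a]" using pg_app2[OF l(4), of "[VLet v g]"] by simp
  moreover have "VLet v g # form_word l @ [VLet v' a] \<doteq> form_word (vertex_act g l) @ [VLet v' b, VLet v' a]" using pg_app1[OF b(2), of "[VLet v' a]"] by simp
  moreover have "form_word (vertex_act g l) @ [VLet v' b, VLet v' a] \<doteq> form_word (vertex_act g l) @ [VLet v' (b \<otimes>\<^bsub>VG v'\<^esub> a)]" using V_mult v' b l by blast
  ultimately have "VLet v g # w \<doteq> form_word (vertex_act g l) @ [VLet v' (b \<otimes>\<^bsub>VG v'\<^esub> a)]" by (meson pg_trans)
  moreover have "normal_form v (vertex_act g l) v'" using normal_form_vertex_act l 2 by blast
  ultimately show ?case using l 2 b by (auto intro!: exI[of _ "b \<otimes>\<^bsub>VG v'\<^esub> a"])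
next
  case (3 e w v')
  then obtain l a where l: "word_act w (v', []) = (hd' e, l)" "normal_form (hd' e) l v'" "a \<in> carrier (VG v')" "w \<doteq> form_word l @ [VLet v' a]" by blast
  have "ELet e # w \<doteq> ELet e # form_word l @ [VLet v' a]" using pg_app2[OF l(4), of "[ELet e]"] by simp
  moreover have "ELet e # form_word l @ [VLet v' a] \<doteq> form_word (edge_act e l) @ [VLet v' a]" using pg_app1[OF form_word_edge_act[OF 3(1) l(2)], of "[VLet v' a]"] by simp
  ultimately have "ELet e # w \<doteq> form_word (edge_act e l) @ [VLet v' a]" by (meson pg_trans)
  then show ?case using l normal_form_edge_act[OF 3(1) l(2)] 3 by auto
qed

lemma nil_normal_forms: "v \<in> verts (base A) \<Longrightarrow> (v, []) \<in> normal_forms" by (auto simp: normal_forms_def)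

text \<open>A vertex group element at \<open>v\<close> acts trivially on the empty form, so the
  action forgets exactly the right factor of \<open>path_normal_form\<close>.\<close>

lemma vertex_coset_eq_iff_word_act:
  assumes "gog_path A u w v" "gog_path A u w' v"
  shows "vertex_coset w v = vertex_coset w' v \<longleftrightarrow> word_act w (v, []) = word_act w' (v, [])"
proof -
  have v: "v \<in> verts (base A)" using path_verts assms by blast
  interpret G: group "VG v" using v group_vgrp by blast
  show ?thesis
  proof
    assume "vertex_coset w v = vertex_coset w' v"
    then obtain a where "a \<in> carrier (VG v)" "w @ [VLet v a] \<doteq> w'" using vertex_coset_eq[OF v] by blast
    then show "word_act w (v, []) = word_act w' (v, [])" using word_act_peq[OF _ nil_normal_forms[OF v]] by fastforce
  next
    assume eq: "word_act w (v, []) = word_act w' (v, [])"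
    obtain l a where l: "word_act w (v, []) = (u, l)" "a \<in> carrier (VG v)" "w \<doteq> form_word l @ [VLet v a]" using path_normal_form assms by blast
    obtain l' a' where l': "word_act w' (v, []) = (u, l')" "a' \<in> carrier (VG v)" "w' \<doteq> form_word l' @ [VLet v a']" using path_normal_form assms by blast
    have [simp]: "l' = l" using l l' eq by simp
    let ?b = "inv\<^bsub>VG v\<^esub> a \<otimes>\<^bsub>VG v\<^esub> a'"
    have "w @ [VLet v ?b] \<doteq> form_word l @ [VLet v a, VLet v ?b]" using pg_app1[OF l(3), of "[VLet v ?b]"] by simp
    moreover have "form_word l @ [VLet v a, VLet v ?b] \<doteq> form_word l @ [VLet v (a \<otimes>\<^bsub>VG v\<^esub> ?b)]" using V_mult[OF v l(2)] l l' by simp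
    moreover have "a \<otimes>\<^bsub>VG v\<^esub> ?b = a'" using l l' by (simp add: G.m_assoc[symmetric])
    ultimately have "w @ [VLet v ?b] \<doteq> w'" using pg_sym[OF l'(3)] by (auto intro: pg_trans)
    then show "vertex_coset w v = vertex_coset w' v" using vertex_coset_eq[OF v] l l' by blast
  qed
qed

end

text \<open>A ray that has gone down once never turns up again, so from some level on it passes
  every level exactly once. Inequivalent rays are disjoint on late levels, because a coincidence
  passes on to the ancestors. Three such rays give three vertices of one late level, whose cones
  contain the rest of the rays.\<close>

lemma (in rtree) rays_three:
  fixes T :: "('x, 'k) pre_digraph"
  assumes verts: "verts T = V" and adj: "\<And>x y. x \<rightarrow>\<^bsub>T\<^esub> y \<longleftrightarrow> (x, y) \<in> C \<or> (y, x) \<in> C"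
    and inf: "infinite (ends T)"
  shows "\<exists>c1 c2 c3. {c1, c2, c3} \<subseteq> V \<and> c1 \<noteq> c2 \<and> c1 \<noteq> c3 \<and> c2 \<noteq> c3 \<and> dep c1 = dep c2 \<and> dep c1 = dep c3
       \<and> infinite (C\<^sup>* `` {c1}) \<and> infinite (C\<^sup>* `` {c2}) \<and> infinite (C\<^sup>* `` {c3})"
proof (rule ccontr)
  assume no: "\<not> ?thesis"
  define E where "E = {(r, s) \<in> rays T \<times> rays T. \<exists>i j. \<forall>k. r (i + k) = s (j + k)}"
  have equ: "equiv (rays T) E"
  proof (rule equivI)
    show "E \<subseteq> rays T \<times> rays T" by (auto simp: E_def)
    show "refl_on (rays T) E" unfolding refl_on_def E_def by auto
    show "sym E" unfolding sym_def E_def by (auto, metis)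
    show "trans E"
    proof (rule transI)
      fix a b c assume "(a, b) \<in> E" "(b, c) \<in> E"
      then obtain i j i' j' where h: "a \<in> rays T" "c \<in> rays T" "\<And>k. a (i + k) = b (j + k)" "\<And>k. b (i' + k) = c (j' + k)"
        by (auto simp: E_def)
      have "a ((i + i') + k) = c ((j' + j) + k)" for k
        using h(3)[of "i' + k"] h(4)[of "j + k"] by (simp add: ac_simps)
      then show "(a, c) \<in> E" unfolding E_def using h by blast
    qed
  qed
  have down: "\<exists>N. \<forall>k. (a (N + k), a (Suc (N + k))) \<in> C" if a: "a \<in> rays T" for a
  proof -
    have st: "(a i, a (Suc i)) \<in> C \<or> (a (Suc i), a i) \<in> C" for i using a adj by (auto simp: rays_def)
    have inj: "inj a" and aV: "a i \<in> V" for i using a verts by (auto simp: rays_def)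
    have "\<exists>N. (a N, a (Suc N)) \<in> C"
    proof (rule ccontr)
      assume "\<not> ?thesis"
      then have up: "(a (Suc i), a i) \<in> C" for i using st by blast
      have "dep (a i) + i = dep (a 0)" for i
      proof (induction i)
        case (Suc i)
        then show ?case using dep_step[OF aV up[of i]] by simp
      qed simp
      from this[of "Suc (dep (a 0))"] show False by simp
    qed
    then obtain N where N: "(a N, a (Suc N)) \<in> C" by blast
    have "(a (N + k), a (Suc (N + k))) \<in> C" for k
    proof (induction k)
      case (Suc k)
      show ?case
      proof (rule ccontr)
        assume "\<not> ?thesis"
        then have "(a (Suc (Suc (N + k))), a (Suc (N + k))) \<in> C" using st by auto
        then have "a (Suc (Suc (N + k))) = a (N + k)" using Suc par_unique by blast
        then show False using inj by (metis injD n_not_Suc_n Suc_n_not_le_n lessI less_or_eq_imp_le less_SucI)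
      qed
    qed (use N in auto)
    then show ?thesis by blast
  qed
  obtain B where B: "card B = 3" "B \<subseteq> ends T" using infinite_arbitrarily_large[OF inf, of 3] by blast
  obtain X Y Z where XYZ: "B = {X, Y, Z}" "X \<noteq> Y" "X \<noteq> Z" "Y \<noteq> Z" using B by (auto simp: card_3_iff)
  have "X \<in> rays T // E" "Y \<in> rays T // E" "Z \<in> rays T // E" using B XYZ by (auto simp: ends_def E_def)
  then obtain a1 a2 a3 where a: "a1 \<in> rays T" "X = E `` {a1}" "a2 \<in> rays T" "Y = E `` {a2}" "a3 \<in> rays T" "Z = E `` {a3}"
    by (auto elim!: quotientE)
  have ne: "(a1, a2) \<notin> E" "(a1, a3) \<notin> E" "(a2, a3) \<notin> E" using XYZ a equiv_class_eq[OF equ] by blast+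
  obtain N where N: "\<And>a k. a \<in> rays T \<Longrightarrow> (a (N a + k), a (Suc (N a + k))) \<in> C" using down by metis
  \<comment> \<open>The vertex of the ray on level \<open>d\<close>, meaningful once
    \<open>d\<close> is at least the level where the ray has started to descend.\<close>
  define lev where "lev a d = a (N a + (d - dep (a (N a))))" for a d
  have aV: "a i \<in> V" if "a \<in> rays T" for a i using that verts by (auto simp: rays_def)
  have chain: "(a (N a + i), a (N a + (i + k))) \<in> C ^^ k" if "a \<in> rays T" for a i k
  proof (induction k)
    case (Suc k)
    then show ?case using N[OF that, of "i + k"] by (auto simp: add.assoc)
  qed simp
  have lev_dep: "dep (lev a d) = d" if "a \<in> rays T" "dep (a (N a)) \<le> d" for a d
    using dep_relpow[OF aV[OF that(1)] chain[OF that(1), of 0 "d - dep (a (N a))"]] that by (simp add: lev_def)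
  have lev_chain: "(lev a d, lev a (d + k)) \<in> C ^^ k" if "a \<in> rays T" "dep (a (N a)) \<le> d" for a d k
    using chain[OF that(1), of "d - dep (a (N a))" k] that by (simp add: lev_def)
  have lev_inf: "infinite (C\<^sup>* `` {lev a d})" if a: "a \<in> rays T" "dep (a (N a)) \<le> d" for a d
  proof -
    have "range (\<lambda>k. lev a (d + k)) \<subseteq> C\<^sup>* `` {lev a d}" using lev_chain[OF a] relpow_imp_rtrancl by blast
    moreover have "inj (\<lambda>k. lev a (d + k))"
    proof (rule injI)
      fix k l assume "lev a (d + k) = lev a (d + l)"
      then have "dep (lev a (d + k)) = dep (lev a (d + l))" by simp
      then show "k = l" using lev_dep[OF a(1), of "d + k"] lev_dep[OF a(1), of "d + l"] a(2) by simp
    qed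
    ultimately show ?thesis using finite_subset range_inj_infinite by blast
  qed
  define D where "D = dep (a1 (N a1)) + dep (a2 (N a2)) + dep (a3 (N a3))"
  have two: "lev a1 d = lev a2 d \<or> lev a1 d = lev a3 d \<or> lev a2 d = lev a3 d" if "D \<le> d" for d
  proof (rule ccontr)
    assume n: "\<not> ?thesis"
    have d: "dep (a1 (N a1)) \<le> d" "dep (a2 (N a2)) \<le> d" "dep (a3 (N a3)) \<le> d" using that by (auto simp: D_def)
    have "{lev a1 d, lev a2 d, lev a3 d} \<subseteq> V" using aV a by (auto simp: lev_def)
    then show False using no n lev_dep[OF a(1) d(1)] lev_dep[OF a(3) d(2)] lev_dep[OF a(5) d(3)]
      lev_inf[OF a(1) d(1)] lev_inf[OF a(3) d(2)] lev_inf[OF a(5) d(3)] by metis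
  qed
  have sep: "\<exists>d0. \<forall>d\<ge>d0. lev a d \<noteq> lev b d"
    if ab: "a \<in> rays T" "b \<in> rays T" "(a, b) \<notin> E" for a b
  proof (rule ccontr)
    assume "\<not> ?thesis"
    then have often: "\<And>d0. \<exists>d\<ge>d0. lev a d = lev b d" by blast
    let ?m = "dep (a (N a)) + dep (b (N b))"
    have eq: "lev a d = lev b d" if "?m \<le> d" for d
    proof -
      obtain d' where d': "d' \<ge> d" "lev a d' = lev b d'" using often by blast
      have "(lev a d, lev a d') \<in> C ^^ (d' - d)" "(lev b d, lev a d') \<in> C ^^ (d' - d)"
        using lev_chain[OF ab(1), of d "d' - d"] lev_chain[OF ab(2), of d "d' - d"] that d' by auto
      then have "(lev a d, lev b d) \<in> C\<^sup>* \<or> (lev b d, lev a d) \<in> C\<^sup>*"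
        using anc_comparable relpow_imp_rtrancl by metis
      moreover have "dep (lev a d) = dep (lev b d)" using lev_dep ab that by simp
      moreover have "lev a d \<in> V" "lev b d \<in> V" using aV ab by (auto simp: lev_def)
      ultimately show ?thesis using rtrancl_dep_eq by (metis order_refl)
    qed
    have "a (N a + (?m - dep (a (N a))) + k) = b (N b + (?m - dep (b (N b))) + k)" for k
      using eq[of "?m + k"] by (simp add: lev_def add.assoc)
    then show False using ab unfolding E_def by blast
  qed
  obtain d1 where d1: "\<And>d. d1 \<le> d \<Longrightarrow> lev a1 d \<noteq> lev a2 d" using sep[OF a(1,3) ne(1)] by blast
  obtain d2 where d2: "\<And>d. d2 \<le> d \<Longrightarrow> lev a1 d \<noteq> lev a3 d" using sep[OF a(1,5) ne(2)] by blast
  obtain d3 where d3: "\<And>d. d3 \<le> d \<Longrightarrow> lev a2 d \<noteq> lev a3 d" using sep[OF a(3,5) ne(3)] by blast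
  show False using two[of "D + d1 + d2 + d3"] d1[of "D + d1 + d2 + d3"] d2[of "D + d1 + d2 + d3"] d3[of "D + d1 + d2 + d3"] by simp
qed

section \<open>The Bass-Serre tree as a rooted tree of normal forms\<close>

context graph_of_groups
begin

lemma normal_form_join:
  "normal_form x l z \<Longrightarrow> normal_form z m y \<Longrightarrow> (l \<noteq> [] \<Longrightarrow> m \<noteq> [] \<Longrightarrow> hd m \<noteq> (\<one>\<^bsub>VG z\<^esub>, rv (snd (last l)))) \<Longrightarrow> normal_form x (l @ m) y"
proof (induction l arbitrary: x)
  case (Cons p l)
  obtain s e where p: "p = (s, e)" by fastforce
  show ?case
  proof (cases l)
    case Nil
    then show ?thesis using Cons.prems p by (cases m) auto
  next
    case (Cons q l')
    then have "normal_form (hd' e) (l @ m) y" using Cons.IH[of "hd' e"] Cons.prems p by auto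
    then show ?thesis using Cons.prems p Cons by auto
  qed
qed auto

context
  fixes u :: 'v
  assumes u: "u \<in> verts (base A)"
begin

text \<open>Independent of the chosen representative \<open>w\<close>, by
  \<open>vertex_coset_eq_iff_word_act\<close>.\<close>

definition nfv :: "('v, 'e, 'a) tree_vertex \<Rightarrow> ('a \<times> 'e) list" where
  "nfv x = snd (word_act (SOME w. gog_path A u w (fst x) \<and> snd x = vertex_coset w (fst x)) (fst x, []))"

abbreviation "TV \<equiv> verts (bs_tree A u)"

lemma nfv_eq:
  assumes "gog_path A u w v"
  shows "word_act w (v, []) = (u, nfv (v, vertex_coset w v))" "normal_form u (nfv (v, vertex_coset w v)) v"
    "\<exists>a\<in>carrier (VG v). w \<doteq> form_word (nfv (v, vertex_coset w v)) @ [VLet v a]"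
proof -
  define w' where "w' = (SOME w'. gog_path A u w' v \<and> vertex_coset w v = vertex_coset w' v)"
  have w': "gog_path A u w' v \<and> vertex_coset w v = vertex_coset w' v" unfolding w'_def by (rule someI[of _ w]) (use assms in simp)
  have "nfv (v, vertex_coset w v) = snd (word_act w' (v, []))" by (simp add: nfv_def w'_def)
  also have "word_act w' (v, []) = word_act w (v, [])" using vertex_coset_eq_iff_word_act[OF assms, of w'] w' by simp
  finally show "word_act w (v, []) = (u, nfv (v, vertex_coset w v))" "normal_form u (nfv (v, vertex_coset w v)) v"
    "\<exists>a\<in>carrier (VG v). w \<doteq> form_word (nfv (v, vertex_coset w v)) @ [VLet v a]"
    using path_normal_form[OF assms] by auto
qed

lemma TV_cases: "x \<in> TV \<Longrightarrow> \<exists>w. x = (fst x, vertex_coset w (fst x)) \<and> gog_path A u w (fst x)"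
  by (auto simp: bs_verts)

lemma TV_I: "gog_path A u w v \<Longrightarrow> (v, vertex_coset w v) \<in> TV"
  by (auto simp: bs_verts)

lemma nfv_normal_form: "x \<in> TV \<Longrightarrow> normal_form u (nfv x) (fst x)"
  using nfv_eq(2) TV_cases by metis

lemma nfv_inj:
  assumes "x \<in> TV" "y \<in> TV" "nfv x = nfv y" shows "x = y"
proof -
  have f: "fst x = fst y" using nfv_normal_form[OF assms(1)] nfv_normal_form[OF assms(2)] assms(3) normal_form_end_unique by metis
  obtain w w' where w: "x = (fst x, vertex_coset w (fst x))" "gog_path A u w (fst x)"
    "y = (fst y, vertex_coset w' (fst y))" "gog_path A u w' (fst y)" using TV_cases assms by meson
  have "word_act w (fst x, []) = word_act w' (fst x, [])"
    using nfv_eq(1)[OF w(2)] nfv_eq(1)[OF w(4)] w(1,3) f assms(3) by metis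
  then have "vertex_coset w (fst x) = vertex_coset w' (fst x)" using vertex_coset_eq_iff_word_act w f by metis
  then show ?thesis using w f by metis
qed

lemma form_word_TV: "normal_form u l v \<Longrightarrow> (v, vertex_coset (form_word l) v) \<in> TV \<and> nfv (v, vertex_coset (form_word l) v) = l"
  using nfv_eq(1)[OF form_word_path] word_act_form_word[of u l "[]" v v] TV_I[OF form_word_path] by auto

definition rt :: "('v, 'e, 'a) tree_vertex" where "rt = (u, vertex_coset [] u)"

lemma rt: "rt \<in> TV" "nfv rt = []"
  using form_word_TV[of "[]" u] u by (auto simp: rt_def)

text \<open>Normal forms ordered by prefixes: uniqueness of parents is immediate, the root is the
  empty form, and the depth is the length. The work lies in comparing this with the arcs of the
  tree.\<close>

definition bs_child :: "(('v, 'e, 'a) tree_vertex \<times> ('v, 'e, 'a) tree_vertex) set" where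
  "bs_child = {(x, y). x \<in> TV \<and> y \<in> TV \<and> (\<exists>p. nfv y = nfv x @ [p])}"

text \<open>Following an edge deletes the last pair of the normal form if it undoes the last edge,
  and appends a pair otherwise. This is why every arc joins a parent and a child.\<close>

lemma arc_head:
  assumes e: "e \<in> arcs (base A)" "gog_path A u w (tl' e)" and a: "a \<in> carrier (VG (tl' e))"
    and l: "l = nfv (tl' e, vertex_coset w (tl' e))" "w \<doteq> form_word l @ [VLet (tl' e) a]"
  shows "nfv (hd' e, vertex_coset (w @ [ELet e]) (hd' e)) =
     (if l \<noteq> [] \<and> snd (last l) = rv e \<and> rp e a = \<one>\<^bsub>VG (tl' e)\<^esub> then butlast l else l @ [(rp e a, e)])"
proof -
  interpret G: group "VG (tl' e)" using e arc_groups by blast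
  note R = rp_props[OF e(1) e(1) e(1) a]
  have path: "gog_path A u (w @ [ELet e]) (hd' e)" using path_app path_E e by blast
  have "word_act (w @ [ELet e]) (hd' e, []) = word_act w (tl' e, [(\<one>\<^bsub>VG (tl' e)\<^esub>, e)])" using e by (simp add: edge_act_def)
  also have "\<dots> = word_act (form_word l @ [VLet (tl' e) a]) (tl' e, [(\<one>\<^bsub>VG (tl' e)\<^esub>, e)])"
    using normal_form_edge_act[of e "[]" "hd' e"] e by (intro word_act_peq[OF l(2)]) (auto simp: normal_forms_def edge_act_def)
  also have "\<dots> = word_act (form_word l) (tl' e, [(rp e a, e)])" using a by simp
  finally have eq: "word_act (w @ [ELet e]) (hd' e, []) = word_act (form_word l) (tl' e, [(rp e a, e)])" .
  have nfl: "normal_form u l (tl' e)" using nfv_eq(2)[OF e(2)] l by simp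
  have nfe: "normal_form (tl' e) [(rp e a, e)] (hd' e)" using e R by simp
  show ?thesis
  proof (cases "l \<noteq> [] \<and> snd (last l) = rv e \<and> rp e a = \<one>\<^bsub>VG (tl' e)\<^esub>")
    case True
    obtain s0 where l0: "l = butlast l @ [(s0, rv e)]" using True by (metis append_butlast_last_id prod.collapse)
    obtain z where z: "normal_form u (butlast l) z" "normal_form z [(s0, rv e)] (tl' e)" using normal_form_app1 nfl l0 by metis
    then have z2: "z = hd' e" "s0 \<in> carrier (VG (hd' e))" using e by auto
    have "word_act (form_word l) (tl' e, [(rp e a, e)]) = word_act (form_word (butlast l)) (word_act [VLet (hd' e) s0, ELet (rv e)] (tl' e, [(\<one>\<^bsub>VG (tl' e)\<^esub>, e)]))"
      by (subst l0, simp only: form_word_app word_act_simps(3)) (use True e in simp)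
    also have "word_act [VLet (hd' e) s0, ELet (rv e)] (tl' e, [(\<one>\<^bsub>VG (tl' e)\<^esub>, e)]) = (hd' e, [])"
      using e by (simp add: edge_act_def)
    also have "word_act (form_word (butlast l)) (hd' e, []) = (u, butlast l)" using word_act_form_word[of u "butlast l" "[]" z z] z z2 by simp
    finally show ?thesis using eq nfv_eq(1)[OF path] True by simp
  next
    case False
    have "normal_form u (l @ [(rp e a, e)]) (hd' e)"
    proof (rule normal_form_join[OF nfl nfe])
      assume ln: "l \<noteq> []"
      obtain s0 f where l0: "l = butlast l @ [(s0, f)]" using ln by (metis append_butlast_last_id prod.collapse)
      obtain z where z: "normal_form z [(s0, f)] (tl' e)" using normal_form_app1 nfl l0 by metis
      then have f: "f \<in> arcs (base A)" by auto
      have "snd (last l) = f" using l0 by (metis last_snoc snd_conv)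
      then show "hd [(rp e a, e)] \<noteq> (\<one>\<^bsub>VG (tl' e)\<^esub>, rv (snd (last l)))" using False ln f by auto
    qed
    then have "word_act (form_word l) (tl' e, [(rp e a, e)]) = (u, l @ [(rp e a, e)])" using word_act_form_word nfl by blast
    then have "nfv (hd' e, vertex_coset (w @ [ELet e]) (hd' e)) = l @ [(rp e a, e)]" using eq nfv_eq(1)[OF path] by (simp only: prod.inject)
    then show ?thesis using False by (simp only: if_False)
  qed
qed

lemma edge_coset_eqI:
  assumes e: "e \<in> arcs (base A)" "c \<in> carrier (EG e)" "w @ [VLet (tl' e) (incl A e c)] \<doteq> w'"
  shows "edge_coset w e = edge_coset w' e"
proof -
  interpret K: group "EG e" using e arc_groups by blast
  interpret G: group "VG (tl' e)" using e arc_groups by blast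
  interpret I: group_hom "EG e" "VG (tl' e)" "incl A e"
    using incl_mon[OF e(1)] by (simp add: group_hom_def group_hom_axioms_def mon_def G.group_axioms K.group_axioms)
  have 1: "w' @ [VLet (tl' e) (incl A e d)] \<doteq> w @ [VLet (tl' e) (incl A e (c \<otimes>\<^bsub>EG e\<^esub> d))]" if "d \<in> carrier (EG e)" for d
    using pg_app1[OF e(3), of "[VLet (tl' e) (incl A e d)]"] V_mult[of "tl' e" "incl A e c" "incl A e d" w] e that
    by (auto intro: pg_trans pg_sym)
  show ?thesis
  proof (intro equalityI subsetI)
    fix z assume "z \<in> edge_coset w e"
    then obtain d where d: "d \<in> carrier (EG e)" "w @ [VLet (tl' e) (incl A e d)] \<doteq> z" by (auto simp: edge_coset_def)
    have "c \<otimes>\<^bsub>EG e\<^esub> (inv\<^bsub>EG e\<^esub> c \<otimes>\<^bsub>EG e\<^esub> d) = d" using d e by (simp add: K.m_assoc[symmetric])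
    then have "w' @ [VLet (tl' e) (incl A e (inv\<^bsub>EG e\<^esub> c \<otimes>\<^bsub>EG e\<^esub> d))] \<doteq> z"
      using 1[of "inv\<^bsub>EG e\<^esub> c \<otimes>\<^bsub>EG e\<^esub> d"] d e pg_trans by (metis K.inv_closed K.m_closed)
    then show "z \<in> edge_coset w' e" unfolding edge_coset_def using d e K.inv_closed K.m_closed by blast
  next
    fix z assume "z \<in> edge_coset w' e"
    then obtain d where d: "d \<in> carrier (EG e)" "w' @ [VLet (tl' e) (incl A e d)] \<doteq> z" by (auto simp: edge_coset_def)
    have "w @ [VLet (tl' e) (incl A e (c \<otimes>\<^bsub>EG e\<^esub> d))] \<doteq> z" by (rule pg_trans[OF pg_sym[OF 1[OF d(1)]] d(2)])
    then show "z \<in> edge_coset w e" unfolding edge_coset_def using d e K.m_closed by blast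
  qed
qed

text \<open>Equal heads force the same \<open>e\<close> and the same coset representative of
  \<open>a\<close> and \<open>a'\<close>, by \<open>arc_head\<close>. Then \<open>a\<close> and
  \<open>a'\<close> differ by an element of the edge group, so the arcs are the same coset.\<close>

lemma no_parallel:
  assumes b: "b \<in> arcs (bs_tree A u)" "b' \<in> arcs (bs_tree A u)"
    "tail (bs_tree A u) b = tail (bs_tree A u) b'" "head (bs_tree A u) b = head (bs_tree A u) b'"
  shows "b = b'"
proof -
  obtain e w where w: "b = (e, edge_coset w e)" "e \<in> arcs (base A)" "gog_path A u w (tl' e)" using b by (auto simp: bs_arcs)
  obtain e' w' where w': "b' = (e', edge_coset w' e')" "e' \<in> arcs (base A)" "gog_path A u w' (tl' e')" using b by (auto simp: bs_arcs)
  let ?x = "(tl' e, vertex_coset w (tl' e))"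
  have tl: "?x = (tl' e', vertex_coset w' (tl' e'))" and hd: "(hd' e, vertex_coset (w @ [ELet e]) (hd' e)) = (hd' e', vertex_coset (w' @ [ELet e']) (hd' e'))"
    using b(3,4) unfolding w(1) w'(1) bs_tail[OF w(2,3)] bs_tail[OF w'(2,3)] bs_head[OF w(2,3)] bs_head[OF w'(2,3)] by auto
  define l where "l = nfv ?x"
  obtain a where a: "a \<in> carrier (VG (tl' e))" "w \<doteq> form_word l @ [VLet (tl' e) a]" using nfv_eq(3)[OF w(3)] l_def by blast
  obtain a' where a': "a' \<in> carrier (VG (tl' e'))" "w' \<doteq> form_word l @ [VLet (tl' e') a']" using nfv_eq(3)[OF w'(3)] l_def tl by metis
  have l': "l = nfv (tl' e', vertex_coset w' (tl' e'))" using l_def tl by metis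
  note h = arc_head[OF w(2,3) a(1) l_def a(2)] and h' = arc_head[OF w'(2,3) a'(1) l' a'(2)]
  \<comment> \<open>The two cases of \<open>arc_head\<close> cannot be mixed, as the lengths
    differ.\<close>
  have len: "butlast l \<noteq> l @ [p]" for p
  proof
    assume "butlast l = l @ [p]"
    then have "length (butlast l) = length (l @ [p])" by (rule arg_cong)
    then show False by simp
  qed
  have e: "e = e' \<and> rp e a = rp e' a'"
  proof (cases "l \<noteq> [] \<and> snd (last l) = rv e \<and> rp e a = \<one>\<^bsub>VG (tl' e)\<^esub>")
    case True
    then have "l \<noteq> [] \<and> snd (last l) = rv e' \<and> rp e' a' = \<one>\<^bsub>VG (tl' e')\<^esub>" using h h' hd len by (metis (no_types, lifting))
    then have "rv (rv e) = rv (rv e')" "rp e a = \<one>\<^bsub>VG (tl' e)\<^esub>" "rp e' a' = \<one>\<^bsub>VG (tl' e')\<^esub>" using True by simp_all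
    then show ?thesis by simp
  next
    case False
    then have "\<not> (l \<noteq> [] \<and> snd (last l) = rv e' \<and> rp e' a' = \<one>\<^bsub>VG (tl' e')\<^esub>)" using h h' hd len by (metis (no_types, lifting))
    then have "l @ [(rp e a, e)] = l @ [(rp e' a', e')]" using False h h' hd by metis
    then have "(rp e a, e) = (rp e' a', e')" by (simp only: same_append_eq list.inject)
    then show ?thesis by (elim Pair_inject) (intro conjI)
  qed
  have e1 [simp]: "e' = e" using e by simp
  have ra: "rp e a = rp e a'" using e unfolding e1 by (rule conjunct2)
  interpret K: group "EG e" using w arc_groups by blast
  interpret G: group "VG (tl' e)" using w arc_groups by blast
  interpret I: group_hom "EG e" "VG (tl' e)" "incl A e"
    using incl_mon[OF w(2)] by (simp add: group_hom_def group_hom_axioms_def mon_def G.group_axioms K.group_axioms)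
  note R = rp_props(1-3)[OF w(2) w(2) w(2) a(1)] and R' = rp_props(1-3)[OF w(2) w(2) w(2), of a']
  let ?c = "inv\<^bsub>EG e\<^esub> (kp e a) \<otimes>\<^bsub>EG e\<^esub> kp e a'"
  have a'c: "a' \<in> carrier (VG (tl' e))" using a' by simp
  have c: "?c \<in> carrier (EG e)" using R R'(2)[OF a'c] by blast
  have ic: "incl A e (kp e a) \<in> carrier (VG (tl' e))" "incl A e ?c \<in> carrier (VG (tl' e))" using incl_closed[OF w(2)] R(2) c by blast+
  have "incl A e (kp e a) \<otimes>\<^bsub>VG (tl' e)\<^esub> incl A e ?c = incl A e (kp e a \<otimes>\<^bsub>EG e\<^esub> ?c)"
    using I.hom_mult[OF R(2) c] by simp
  also have "kp e a \<otimes>\<^bsub>EG e\<^esub> ?c = kp e a'" using R(2) R'(2)[OF a'c] by (simp add: K.m_assoc[symmetric])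
  finally have ik: "incl A e (kp e a) \<otimes>\<^bsub>VG (tl' e)\<^esub> incl A e ?c = incl A e (kp e a')" .
  have "a \<otimes>\<^bsub>VG (tl' e)\<^esub> incl A e ?c = (rp e a \<otimes>\<^bsub>VG (tl' e)\<^esub> incl A e (kp e a)) \<otimes>\<^bsub>VG (tl' e)\<^esub> incl A e ?c"
    by (simp only: R(3)[symmetric])
  also have "\<dots> = rp e a' \<otimes>\<^bsub>VG (tl' e)\<^esub> incl A e (kp e a')"
    by (simp only: G.m_assoc[OF R(1) ic, unfolded ra] ik ra)
  also have "\<dots> = a'" by (rule R'(3)[OF a'c, symmetric])
  finally have ac: "a \<otimes>\<^bsub>VG (tl' e)\<^esub> incl A e ?c = a'" .
  have "w @ [VLet (tl' e) (incl A e ?c)] \<doteq> form_word l @ [VLet (tl' e) a, VLet (tl' e) (incl A e ?c)]"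
    using pg_app1[OF a(2), of "[VLet (tl' e) (incl A e ?c)]"] by simp
  moreover have "form_word l @ [VLet (tl' e) a, VLet (tl' e) (incl A e ?c)] \<doteq> form_word l @ [VLet (tl' e) a']"
    using V_mult[of "tl' e" a "incl A e ?c" "form_word l"] a c w(2) ac I.hom_closed by auto
  ultimately have "w @ [VLet (tl' e) (incl A e ?c)] \<doteq> w'" using pg_sym[OF a'(2)] by (auto intro: pg_trans)
  then show ?thesis using edge_coset_eqI[OF w(2) c] w w' by simp
qed

lemma arcs_ends_TV:
  assumes "b \<in> arcs (bs_tree A u)"
  shows "tail (bs_tree A u) b \<in> TV" "head (bs_tree A u) b \<in> TV"
    "(tail (bs_tree A u) b, head (bs_tree A u) b) \<in> bs_child \<or> (head (bs_tree A u) b, tail (bs_tree A u) b) \<in> bs_child"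
proof -
  obtain e w where w: "b = (e, edge_coset w e)" "e \<in> arcs (base A)" "gog_path A u w (tl' e)" using assms by (auto simp: bs_arcs)
  let ?x = "(tl' e, vertex_coset w (tl' e))" and ?y = "(hd' e, vertex_coset (w @ [ELet e]) (hd' e))"
  have th: "tail (bs_tree A u) b = ?x" "head (bs_tree A u) b = ?y" using w by (simp_all add: bs_tail bs_head)
  have TV: "?x \<in> TV" "?y \<in> TV" using TV_I w path_app path_E by blast+
  show "tail (bs_tree A u) b \<in> TV" "head (bs_tree A u) b \<in> TV" using th TV by auto
  obtain a where a: "a \<in> carrier (VG (tl' e))" "w \<doteq> form_word (nfv ?x) @ [VLet (tl' e) a]" using nfv_eq(3)[OF w(3)] by blast
  note h = arc_head[OF w(2,3) a(1) refl a(2)]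
  show "(tail (bs_tree A u) b, head (bs_tree A u) b) \<in> bs_child \<or> (head (bs_tree A u) b, tail (bs_tree A u) b) \<in> bs_child"
  proof (cases "nfv ?x \<noteq> [] \<and> snd (last (nfv ?x)) = rv e \<and> rp e a = \<one>\<^bsub>VG (tl' e)\<^esub>")
    case True
    then have "nfv ?x = nfv ?y @ [last (nfv ?x)]" using h by simp
    then show ?thesis unfolding th bs_child_def using TV by blast
  next
    case False
    then have "nfv ?y = nfv ?x @ [(rp e a, e)]" using h by auto
    then show ?thesis unfolding th bs_child_def using TV by blast
  qed
qed

lemma bs_rev_eq:
  assumes "e \<in> arcs (base A)" "gog_path A u w (tl' e)"
  shows "bs_rev A u (e, edge_coset w e) = (rv e, edge_coset (w @ [ELet e]) (rv e))"
proof -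
  have "(e, edge_coset w e) \<in> arcs (bs_tree A u)" using assms by (auto simp: bs_arcs)
  moreover have "pg_prod A (edge_coset w e) (cl [ELet e]) = edge_coset (w @ [ELet e]) (rv e)"
  proof (intro equalityI subsetI)
    fix z assume "z \<in> pg_prod A (edge_coset w e) (cl [ELet e])"
    then obtain x t c where x: "c \<in> carrier (EG e)" "w @ [VLet (tl' e) (incl A e c)] \<doteq> x" "[ELet e] \<doteq> t" "x @ t \<doteq> z"
      by (auto simp: mem_prod mem_cl edge_coset_def)
    have "w @ [VLet (tl' e) (incl A e c), ELet e] \<doteq> z" using pg_app[OF x(2,3)] x by (auto intro: pg_trans)
    then have "w @ [ELet e, VLet (hd' e) (incl A (rv e) c)] \<doteq> z" using edge_swap[OF assms(1) x(1), of w] by (auto intro: pg_trans pg_sym)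
    then show "z \<in> edge_coset (w @ [ELet e]) (rv e)" using x assms egrp_rev by (auto simp: edge_coset_def)
  next
    fix z assume "z \<in> edge_coset (w @ [ELet e]) (rv e)"
    then obtain c where c: "c \<in> carrier (EG e)" "w @ [ELet e, VLet (hd' e) (incl A (rv e) c)] \<doteq> z"
      using assms egrp_rev by (auto simp: edge_coset_def)
    have "(w @ [VLet (tl' e) (incl A e c)]) @ [ELet e] \<doteq> z" using edge_swap[OF assms(1) c(1), of w] c by (auto intro: pg_trans)
    moreover have "w @ [VLet (tl' e) (incl A e c)] \<in> edge_coset w e" using c by (auto simp: edge_coset_def intro: pg_refl)
    ultimately show "z \<in> pg_prod A (edge_coset w e) (cl [ELet e])" unfolding mem_prod using mem_cl pg_refl by blast
  qed
  ultimately show ?thesis by (simp add: bs_rev_def)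
qed

lemma bs_rev_props:
  assumes "b \<in> arcs (bs_tree A u)"
  shows "bs_rev A u b \<in> arcs (bs_tree A u)" "tail (bs_tree A u) (bs_rev A u b) = head (bs_tree A u) b"
    "head (bs_tree A u) (bs_rev A u b) = tail (bs_tree A u) b"
proof -
  obtain e w where w: "b = (e, edge_coset w e)" "e \<in> arcs (base A)" "gog_path A u w (tl' e)" using assms by (auto simp: bs_arcs)
  have p: "gog_path A u (w @ [ELet e]) (tl' (rv e))" using w path_app path_E by auto
  have p2: "gog_path A u (w @ [ELet e, ELet (rv e)]) (tl' e)" using path_app[OF p path_E[of "rv e"]] w by auto
  have f: "rv e \<in> arcs (base A)" using w by auto
  have r: "bs_rev A u b = (rv e, edge_coset (w @ [ELet e]) (rv e))" using bs_rev_eq w by blast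
  show "bs_rev A u b \<in> arcs (bs_tree A u)" unfolding r bs_arcs using f p by blast
  show "tail (bs_tree A u) (bs_rev A u b) = head (bs_tree A u) b"
    unfolding r bs_tail[OF f p] using w by (simp add: bs_head)
  have "word_act (w @ [ELet e, ELet (rv e)]) (tl' e, []) = word_act w (tl' e, [])"
    using word_act_peq[OF pg_app2[OF pg_rev[OF w(2)], of w] nil_normal_forms, of "tl' e"] w by simp
  then have "vertex_coset (w @ [ELet e, ELet (rv e)]) (tl' e) = vertex_coset w (tl' e)" using vertex_coset_eq_iff_word_act p2 w by blast
  then show "head (bs_tree A u) (bs_rev A u b) = tail (bs_tree A u) b"
    unfolding r bs_head[OF f p] using w by (simp add: bs_tail)
qed

lemma bs_child_arc:
  assumes "(x, y) \<in> bs_child"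
  shows "\<exists>b\<in>arcs (bs_tree A u). tail (bs_tree A u) b = x \<and> head (bs_tree A u) b = y"
proof -
  obtain s e where xy: "x \<in> TV" "y \<in> TV" "nfv y = nfv x @ [(s, e)]" using assms by (auto simp: bs_child_def)
  obtain z where z: "normal_form u (nfv x) z" "normal_form z [(s, e)] (fst y)" using normal_form_app1 nfv_normal_form xy by metis
  then have e: "z = tl' e" "e \<in> arcs (base A)" "s \<in> carrier (VG (tl' e))" "fst y = hd' e" "rp e s = s" by auto
  interpret G: group "VG (tl' e)" using e arc_groups by blast
  let ?w = "form_word (nfv x) @ [VLet (tl' e) s]"
  have p: "gog_path A u ?w (tl' e)" using path_app[OF form_word_path[OF z(1)]] path_V[of "tl' e" s] e by auto
  have p2: "gog_path A u (?w @ [ELet e]) (hd' e)" using path_app[OF p path_E] e by auto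
  have "word_act ?w (tl' e, []) = (u, nfv x)" using word_act_form_word[of u "nfv x" "[]" z z] z e by simp
  then have "nfv (tl' e, vertex_coset ?w (tl' e)) = nfv x" using nfv_eq(1)[OF p] by simp
  then have t: "(tl' e, vertex_coset ?w (tl' e)) = x" using nfv_inj TV_I[OF p] xy by blast
  have "word_act (?w @ [ELet e]) (hd' e, []) = word_act (form_word (nfv x)) (tl' e, [(s, e)])" using e by (simp add: edge_act_def)
  also have "\<dots> = (u, nfv y)" using word_act_form_word[of u "nfv x" "[(s, e)]" "fst y" z] z e xy nfv_normal_form[OF xy(2)] by simp
  finally have "nfv (hd' e, vertex_coset (?w @ [ELet e]) (hd' e)) = nfv y" using nfv_eq(1)[OF p2] by simp
  then have h: "(hd' e, vertex_coset (?w @ [ELet e]) (hd' e)) = y" using nfv_inj TV_I[OF p2] xy by blast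
  show ?thesis using t h e p by (intro bexI[of _ "(e, edge_coset ?w e)"]) (auto simp: bs_tail bs_head bs_arcs)
qed

lemma adj_arc:
  "(\<exists>b\<in>arcs (bs_tree A u). tail (bs_tree A u) b = x \<and> head (bs_tree A u) b = y) \<longleftrightarrow> (x, y) \<in> bs_child \<or> (y, x) \<in> bs_child"
  using bs_child_arc arcs_ends_TV(3) bs_rev_props by metis

lemma dominates_iff: "x \<rightarrow>\<^bsub>bs_tree A u\<^esub> y \<longleftrightarrow> (x, y) \<in> bs_child \<or> (y, x) \<in> bs_child"
  unfolding adj_arc[symmetric] by (auto simp: arcs_ends_def arc_to_ends_def)

lemma bs_child_rtree: "rtree bs_child rt"
proof
  fix a b c assume "(a, c) \<in> bs_child" "(b, c) \<in> bs_child"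
  then have "a \<in> TV" "b \<in> TV" "nfv a = nfv b" by (auto simp: bs_child_def)
  then show "a = b" using nfv_inj by blast
qed (auto simp: bs_child_def rt)

interpretation T: rtree bs_child rt by (rule bs_child_rtree)

lemma TV_eq: "T.V = TV"
proof (intro equalityI subsetI)
  fix x assume "x \<in> T.V" then show "x \<in> TV" by (induction rule: T.V_induct) (auto simp: rt bs_child_def)
next
  fix x assume "x \<in> TV"
  then show "x \<in> T.V"
  proof (induction "nfv x" arbitrary: x rule: rev_induct)
    case Nil
    then have "x = rt" using nfv_inj rt by metis
    then show ?case using T.root_V by simp
  next
    case (snoc p l)
    obtain z where z: "normal_form u l z" using normal_form_app1[of u l "[p]"] nfv_normal_form[OF snoc(3)] snoc(2) by auto
    let ?y = "(z, vertex_coset (form_word l) z)"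
    have y: "?y \<in> TV" "nfv ?y = l" using form_word_TV[OF z] by auto
    then have "(?y, x) \<in> bs_child" using snoc(2,3) unfolding bs_child_def by (simp, metis surj_pair)
    then show ?case using snoc(1)[of ?y] y T.V_step by auto
  qed
qed

text \<open>The only arc leading out of the cone goes from \<open>x\<close> to \<open>p\<close>, and
  by \<open>no_parallel\<close> it is the removed reverse arc. Inside the cone both directions of
  every edge survive, so the cone is strongly connected.\<close>

lemma cone_side:
  assumes px: "(p, x) \<in> bs_child" and a: "a \<in> arcs (bs_tree A u)" "tail (bs_tree A u) a = p" "head (bs_tree A u) a = x"
  shows "bs_child\<^sup>* `` {x} \<in> sides (bs_tree A u) (bs_rev A u) a"
proof -
  let ?T = "bs_tree A u"
  let ?S = "bs_child\<^sup>* `` {x}"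
  define T' where "T' = ?T\<lparr>arcs := arcs ?T - {a, bs_rev A u a}\<rparr>"
  have V: "p \<in> T.V" "x \<in> T.V" using px TV_eq by (auto simp: bs_child_def)
  have SV: "s \<in> T.V" if "s \<in> ?S" for s using that V T.V_rtrancl by auto
  have pS: "p \<notin> ?S" using T.dep_step[OF V(1) px] T.dep_rtrancl[OF V(2), of p] by fastforce
  have ends: "(s, t) \<in> arcs_ends T' \<longleftrightarrow> (\<exists>b\<in>arcs ?T. b \<noteq> a \<and> b \<noteq> bs_rev A u a \<and> tail ?T b = s \<and> head ?T b = t)" for s t
    by (auto simp: arcs_ends_def arc_to_ends_def T'_def)
  have T'V: "verts T' = T.V" by (simp add: T'_def TV_eq)
  have no_x: "t \<noteq> x" if "s \<in> ?S" "(s, t) \<in> bs_child" for s t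
    using that px T.par_unique pS by blast
  have inside: "(s, t) \<in> arcs_ends T' \<and> (t, s) \<in> arcs_ends T'" if st: "s \<in> ?S" "(s, t) \<in> bs_child" for s t
  proof -
    have t: "t \<in> ?S" using st by auto
    obtain b where b: "b \<in> arcs ?T" "tail ?T b = s" "head ?T b = t" using bs_child_arc st by blast
    note rb = bs_rev_props[OF b(1)] and ra = bs_rev_props[OF a(1)]
    have "b \<noteq> a" "b \<noteq> bs_rev A u a" using b a ra t pS no_x st by auto
    moreover have "bs_rev A u b \<noteq> a" "bs_rev A u b \<noteq> bs_rev A u a" using rb ra b a t pS st no_x by auto
    ultimately show ?thesis unfolding ends using b rb by blast
  qed
  have closed: "t \<in> ?S" if s: "s \<in> ?S" and st: "(s, t) \<in> arcs_ends T'" for s t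
  proof -
    obtain b where b: "b \<in> arcs ?T" "b \<noteq> bs_rev A u a" "tail ?T b = s" "head ?T b = t" using st ends by blast
    then have "(s, t) \<in> bs_child \<or> (t, s) \<in> bs_child" using adj_arc by blast
    then show ?thesis
    proof
      assume "(s, t) \<in> bs_child" then show ?thesis using s by auto
    next
      assume ts: "(t, s) \<in> bs_child"
      have "s \<noteq> x"
      proof
        assume "s = x"
        then have "t = p" using ts px T.par_unique by blast
        then have "b = bs_rev A u a" using no_parallel b a bs_rev_props[OF a(1)] \<open>s = x\<close> by metis
        then show False using b by simp
      qed
      then show ?thesis using T.rtrancl_par[OF _ ts, of x] s by auto
    qed
  qed
  have reach: "x \<rightarrow>\<^sup>*\<^bsub>T'\<^esub> s \<and> s \<rightarrow>\<^sup>*\<^bsub>T'\<^esub> x" if "s \<in> ?S" for s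
  proof -
    have "(x, s) \<in> bs_child\<^sup>*" using that by simp
    then show ?thesis
    proof (induction rule: rtrancl_induct)
      case base
      then show ?case using V T'V by (simp add: reachable_def)
    next
      case (step s t)
      have "s \<in> ?S" using step by simp
      then have st: "(s, t) \<in> arcs_ends T'" "(t, s) \<in> arcs_ends T'" using inside step by blast+
      have "t \<in> ?S" using rtrancl.rtrancl_into_rtrancl[OF step(1,2)] by simp
      then have tV: "t \<in> verts T'" unfolding T'V by (rule SV)
      have "(x, t) \<in> rtrancl_on (verts T') (arcs_ends T')"
        using step st tV unfolding reachable_def by (blast intro: rtrancl_on_into_rtrancl_on)
      moreover have "(t, x) \<in> rtrancl_on (verts T') (arcs_ends T')"
        using step st tV unfolding reachable_def by (blast intro: converse_rtrancl_on_into_rtrancl_on)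
      ultimately show ?case by (simp add: reachable_def)
    qed
  qed
  have stay: "t \<in> ?S" if "s \<in> ?S" "s \<rightarrow>\<^sup>*\<^bsub>T'\<^esub> t" for s t
    using that(2,1) unfolding reachable_def by (induction rule: rtrancl_on_induct) (use closed in auto)
  have "?S \<in> pre_digraph.sccs_verts T'"
    unfolding pre_digraph.sccs_verts_def
  proof (intro CollectI conjI ballI allI impI)
    show "?S \<noteq> {}" by auto
    fix s t assume "s \<in> ?S" "t \<in> ?S"
    then show "s \<rightarrow>\<^sup>*\<^bsub>T'\<^esub> t" using reach unfolding reachable_def by (meson rtrancl_on_trans)
  next
    fix s t assume "s \<in> ?S" "t \<notin> ?S"
    then show "\<not> s \<rightarrow>\<^sup>*\<^bsub>T'\<^esub> t \<or> \<not> t \<rightarrow>\<^sup>*\<^bsub>T'\<^esub> s" using stay by blast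
  qed
  then show ?thesis unfolding sides_def T'_def .
qed

end

end

section \<open>Additive maps on integer vectors\<close>

definition rvec :: "int ^ 'n \<Rightarrow> real ^ 'n" where "rvec z = (\<chi> i. real_of_int (z $ i))"

lemma rvec_simps: "rvec (x + y) = rvec x + rvec y" "rvec 0 = 0" "rvec x $ i = real_of_int (x $ i)"
  by (simp_all add: rvec_def vec_eq_iff)

lemma rvec_inj: "rvec x = rvec y \<longleftrightarrow> x = y"
  by (simp add: rvec_def vec_eq_iff)

lemma rvec_axis: "rvec (axis i k) = real_of_int k *\<^sub>R axis i 1"
  by (simp add: rvec_def vec_eq_iff axis_def)

lemma additive_int:
  fixes f :: "int \<Rightarrow> 'b::real_vector"
  assumes add: "\<And>x y. f (x + y) = f x + f y" shows "f k = real_of_int k *\<^sub>R f 1"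
proof (induction k rule: int_induct[of _ 0])
  case base
  then show ?case using add[of 0 0] by simp
next
  case (step1 i)
  then show ?case using add[of i 1] by (simp add: algebra_simps)
next
  case (step2 i)
  then show ?case using add[of "i - 1" 1] by (simp add: algebra_simps)
qed

lemma additive_matrix:
  fixes f :: "int ^ 'n::finite \<Rightarrow> real ^ 'm::finite"
  assumes add: "\<And>x y. f (x + y) = f x + f y"
  shows "\<exists>M. \<forall>z. f z = M *v rvec z"
proof -
  have sm: "f (sum g S) = (\<Sum>i\<in>S. f (g i))" if "finite S" for g and S :: "'n set"
    using that by (induction S) (use add add[of 0 0] in auto)
  define M :: "real ^ 'n ^ 'm" where "M = (\<chi> i j. f (axis j 1) $ i)"
  have "f z = M *v rvec z" for z
  proof -
    have "z = (\<Sum>i\<in>UNIV. axis i (z $ i))"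
      by (simp add: vec_eq_iff axis_def if_distrib cong: if_cong)
    then have "f z = (\<Sum>i\<in>UNIV. f (axis i (z $ i)))" using sm[of UNIV "\<lambda>i. axis i (z $ i)"] by simp
    also have "\<dots> = (\<Sum>i\<in>UNIV. real_of_int (z $ i) *\<^sub>R f (axis i 1))"
    proof (rule sum.cong[OF refl])
      fix i :: 'n
      have "f (axis i (x + y)) = f (axis i x) + f (axis i y)" for x y
      proof -
        have "axis i (x + y) = axis i x + axis i y" by (simp add: axis_def vec_eq_iff)
        then show ?thesis using add by simp
      qed
      from additive_int[of "\<lambda>k. f (axis i k)", OF this] show "f (axis i (z $ i)) = real_of_int (z $ i) *\<^sub>R f (axis i 1)" .
    qed
    also have "\<dots> = M *v rvec z"
      by (simp add: vec_eq_iff matrix_vector_mult_def M_def rvec_def mult.commute)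
    finally show ?thesis .
  qed
  then show ?thesis by blast
qed

lemma invertible_axis:
  fixes M :: "real ^ 'n::finite ^ 'n"
  assumes "\<And>i. \<exists>y. M *v y = axis i 1" shows "invertible M"
proof -
  obtain y where y: "\<And>i. M *v y i = axis i 1" using assms by metis
  define N :: "real ^ 'n ^ 'n" where "N = (\<chi> i j. y j $ i)"
  have "(M ** N) $ i $ j = (mat 1 :: real ^ 'n ^ 'n) $ i $ j" for i j
  proof -
    have "(M ** N) $ i $ j = (M *v y j) $ i" by (simp add: matrix_matrix_mult_def matrix_vector_mult_def N_def)
    also have "\<dots> = (mat 1 :: real ^ 'n ^ 'n) $ i $ j" by (simp add: y axis_def mat_def)
    finally show ?thesis .
  qed
  then have "M ** N = mat 1" by (simp add: vec_eq_iff)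
  then show ?thesis by (auto simp: invertible_def matrix_left_right_inverse)
qed

section \<open>Graphs of free abelian groups\<close>

locale Zn_graph =
  fixes A :: "('v, 'e, 'a, 'b) gog" and ty :: "'n::finite itself"
  assumes zn: "graph_of_Zns ty A"

sublocale Zn_graph \<subseteq> graph_of_groups A
  using zn by (simp add: graph_of_Zns_def)

context Zn_graph
begin

lemma fin: "fin_digraph (base A)" using zn by (simp add: graph_of_Zns_def)

lemma fin_arcs: "finite (arcs (base A))"
  using fin by (simp add: fin_digraph_def fin_digraph_axioms_def)

lemma fin_index: "e \<in> arcs (base A) \<Longrightarrow> finite (rcosets\<^bsub>VG (tl' e)\<^esub> (incl A e ` carrier (EG e)))"
  using zn by (simp add: graph_of_Zns_def)

definition co :: "('c, 'm) monoid_scheme \<Rightarrow> 'c \<Rightarrow> int ^ 'n" where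
  "co K = (SOME f. f \<in> iso K Zn)"

lemma co_V: "v \<in> verts (base A) \<Longrightarrow> co (VG v) \<in> iso (VG v) Zn"
  using zn unfolding co_def graph_of_Zns_def is_iso_def by (metis someI_ex ex_in_conv)

lemma co_E: "e \<in> arcs (base A) \<Longrightarrow> co (EG e) \<in> iso (EG e) Zn"
  using zn unfolding co_def graph_of_Zns_def is_iso_def by (metis someI_ex ex_in_conv)

lemma iso_Zn:
  assumes "f \<in> iso K (Zn :: (int ^ 'n) monoid)"
  shows "x \<in> carrier K \<Longrightarrow> y \<in> carrier K \<Longrightarrow> f (x \<otimes>\<^bsub>K\<^esub> y) = f x + f y"
    "inj_on f (carrier K)" "\<exists>x\<in>carrier K. f x = z"
proof -
  have "f \<in> hom K (Zn :: (int ^ 'n) monoid)" "bij_betw f (carrier K) (UNIV :: (int ^ 'n) set)"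
    using assms by (auto simp: iso_def Zn_def)
  then show "x \<in> carrier K \<Longrightarrow> y \<in> carrier K \<Longrightarrow> f (x \<otimes>\<^bsub>K\<^esub> y) = f x + f y" "inj_on f (carrier K)" "\<exists>x\<in>carrier K. f x = z"
    by (auto simp: hom_def Zn_def bij_betw_def) (metis UNIV_I imageE)
qed

lemma V_comm:
  assumes "v \<in> verts (base A)" "x \<in> carrier (VG v)" "y \<in> carrier (VG v)"
  shows "x \<otimes>\<^bsub>VG v\<^esub> y = y \<otimes>\<^bsub>VG v\<^esub> x"
proof -
  interpret G: group "VG v" using assms group_vgrp by blast
  note i = iso_Zn[OF co_V[OF assms(1)]]
  have "co (VG v) (x \<otimes>\<^bsub>VG v\<^esub> y) = co (VG v) (y \<otimes>\<^bsub>VG v\<^esub> x)" using i(1) assms by (simp add: add.commute)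
  then show ?thesis using i(2) assms by (meson G.m_closed inj_onD)
qed

text \<open>The representatives belong to left cosets, while the index counts right cosets;
  commutativity identifies the two.\<close>

lemma finite_reps:
  assumes e: "e \<in> arcs (base A)" shows "finite (rp e ` carrier (VG (tl' e)))"
proof -
  interpret G: group "VG (tl' e)" using e arc_groups by blast
  let ?H = "incl A e ` carrier (EG e)"
  \<comment> \<open>\<open>F\<close> repeats the choice made in \<open>coset_rep\<close>, so that
    \<open>rp e\<close> factors through the finite set of cosets.\<close>
  define F where "F X = (if \<one>\<^bsub>VG (tl' e)\<^esub> \<in> X then \<one>\<^bsub>VG (tl' e)\<^esub> else SOME x. x \<in> X)" for X
  have "rp e g = F (?H #>\<^bsub>VG (tl' e)\<^esub> g)" if g: "g \<in> carrier (VG (tl' e))" for g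
  proof -
    have X: "?H #>\<^bsub>VG (tl' e)\<^esub> g = {x. \<exists>c\<in>carrier (EG e). g \<otimes>\<^bsub>VG (tl' e)\<^esub> incl A e c = x}"
      using V_comm[of "tl' e" g] g e incl_closed[OF e] by (auto simp: r_coset_def)
    show ?thesis unfolding F_def X coset_rep_def by simp
  qed
  then have "rp e ` carrier (VG (tl' e)) \<subseteq> F ` (rcosets\<^bsub>VG (tl' e)\<^esub> ?H)" by (auto simp: RCOSETS_def)
  then show ?thesis using fin_index[OF e] finite_subset by blast
qed

definition psi :: "'v \<Rightarrow> 'a \<Rightarrow> real ^ 'n" where "psi v g = rvec (co (VG v) g)"

lemma psi_mult: "v \<in> verts (base A) \<Longrightarrow> g \<in> carrier (VG v) \<Longrightarrow> h \<in> carrier (VG v) \<Longrightarrow> psi v (g \<otimes>\<^bsub>VG v\<^esub> h) = psi v g + psi v h"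
  using iso_Zn(1)[OF co_V] by (simp add: psi_def rvec_simps)

lemma psi_one: "v \<in> verts (base A) \<Longrightarrow> psi v \<one>\<^bsub>VG v\<^esub> = 0"
proof -
  assume v: "v \<in> verts (base A)"
  interpret G: group "VG v" using v group_vgrp by blast
  show ?thesis using psi_mult[OF v, of "\<one>\<^bsub>VG v\<^esub>" "\<one>\<^bsub>VG v\<^esub>"] by simp
qed

lemma psi_surj: "v \<in> verts (base A) \<Longrightarrow> \<exists>g\<in>carrier (VG v). psi v g = rvec z"
  using iso_Zn(3)[OF co_V] by (metis psi_def)

lemma Me_ex:
  assumes e: "e \<in> arcs (base A)"
  shows "\<exists>M. \<forall>c\<in>carrier (EG e). psi (tl' e) (incl A e c) = M *v rvec (co (EG e) c)"
proof -
  note i = iso_Zn[OF co_E[OF e]]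
  have h: "incl A e (c \<otimes>\<^bsub>EG e\<^esub> d) = incl A e c \<otimes>\<^bsub>VG (tl' e)\<^esub> incl A e d" if "c \<in> carrier (EG e)" "d \<in> carrier (EG e)" for c d
    using incl_mon[OF e] that by (auto simp: mon_def hom_def)
  interpret K: group "EG e" using e arc_groups by blast
  define f where "f z = psi (tl' e) (incl A e (inv_into (carrier (EG e)) (co (EG e)) z))" for z
  have inv: "inv_into (carrier (EG e)) (co (EG e)) (co (EG e) c) = c" if "c \<in> carrier (EG e)" for c
    using i(2) that by (rule inv_into_f_f)
  have "f (x + y) = f x + f y" for x y
  proof -
    obtain c d where c: "c \<in> carrier (EG e)" "co (EG e) c = x" "d \<in> carrier (EG e)" "co (EG e) d = y" using i(3) by meson
    then have "x + y = co (EG e) (c \<otimes>\<^bsub>EG e\<^esub> d)" using i(1) by simp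
    then have "f (x + y) = psi (tl' e) (incl A e (c \<otimes>\<^bsub>EG e\<^esub> d))" using inv[of "c \<otimes>\<^bsub>EG e\<^esub> d"] c by (simp add: f_def)
    also have "\<dots> = psi (tl' e) (incl A e c) + psi (tl' e) (incl A e d)"
      using h c psi_mult[of "tl' e"] incl_closed e by simp
    also have "\<dots> = f x + f y" using inv c by (auto simp: f_def)
    finally show ?thesis .
  qed
  then obtain M where "\<forall>z. f z = M *v rvec z" using additive_matrix by blast
  then show ?thesis using inv by (metis f_def)
qed

definition Me :: "'e \<Rightarrow> real ^ 'n ^ 'n" where
  "Me e = (SOME M. \<forall>c\<in>carrier (EG e). psi (tl' e) (incl A e c) = M *v rvec (co (EG e) c))"

lemma Me: "e \<in> arcs (base A) \<Longrightarrow> c \<in> carrier (EG e) \<Longrightarrow> psi (tl' e) (incl A e c) = Me e *v rvec (co (EG e) c)"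
  using someI_ex[OF Me_ex] unfolding Me_def by blast

lemma psi_pow:
  assumes "v \<in> verts (base A)" "g \<in> carrier (VG v)"
  shows "psi v (g [^]\<^bsub>VG v\<^esub> (k::nat)) = real k *\<^sub>R psi v g"
proof -
  interpret G: group "VG v" using assms group_vgrp by blast
  show ?thesis using assms by (induction k) (simp_all add: psi_one psi_mult algebra_simps)
qed

text \<open>Two distinct powers of \<open>g\<close> lie in the same coset, and their quotient is the
  desired power.\<close>

lemma finite_index_power:
  assumes G: "group G" and H: "subgroup H G" and f: "finite (rcosets\<^bsub>G\<^esub> H)" and g: "g \<in> carrier G"
  shows "\<exists>k::nat. 0 < k \<and> g [^]\<^bsub>G\<^esub> k \<in> H"
proof -
  interpret G: group G by fact
  have "\<not> inj (\<lambda>k::nat. H #>\<^bsub>G\<^esub> (g [^]\<^bsub>G\<^esub> k))"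
  proof
    assume "inj (\<lambda>k::nat. H #>\<^bsub>G\<^esub> (g [^]\<^bsub>G\<^esub> k))"
    moreover have "range (\<lambda>k::nat. H #>\<^bsub>G\<^esub> (g [^]\<^bsub>G\<^esub> k)) \<subseteq> rcosets\<^bsub>G\<^esub> H" using g by (auto simp: RCOSETS_def)
    ultimately show False using f finite_subset range_inj_infinite by blast
  qed
  then obtain i j :: nat where ij: "i < j" "H #>\<^bsub>G\<^esub> (g [^]\<^bsub>G\<^esub> i) = H #>\<^bsub>G\<^esub> (g [^]\<^bsub>G\<^esub> j)"
    by (auto simp: inj_on_def) (metis nat_neq_iff)
  have "g [^]\<^bsub>G\<^esub> j \<in> H #>\<^bsub>G\<^esub> (g [^]\<^bsub>G\<^esub> i)" using ij(2) G.rcos_self[OF _ H] g by simp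
  then obtain h where h: "h \<in> H" "g [^]\<^bsub>G\<^esub> j = h \<otimes>\<^bsub>G\<^esub> (g [^]\<^bsub>G\<^esub> i)" by (auto simp: r_coset_def)
  have "g [^]\<^bsub>G\<^esub> j = g [^]\<^bsub>G\<^esub> (j - i) \<otimes>\<^bsub>G\<^esub> g [^]\<^bsub>G\<^esub> i" using ij g by (simp add: G.nat_pow_mult)
  then have "g [^]\<^bsub>G\<^esub> (j - i) = h" using h g subgroup.mem_carrier[OF H h(1)] by (metis G.nat_pow_closed G.right_cancel)
  then show ?thesis using h ij by (intro exI[of _ "j - i"]) auto
qed

text \<open>This is where finite index enters: a positive power of each basis element comes from the
  edge group, so every axis vector is attained over the reals.\<close>

lemma Me_inv: "e \<in> arcs (base A) \<Longrightarrow> invertible (Me e)"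
proof (rule invertible_axis)
  fix i :: 'n assume e: "e \<in> arcs (base A)"
  interpret G: group "VG (tl' e)" using e arc_groups by blast
  interpret K: group "EG e" using e arc_groups by blast
  interpret I: group_hom "EG e" "VG (tl' e)" "incl A e"
    using incl_mon[OF e(1)] by (simp add: group_hom_def group_hom_axioms_def mon_def G.group_axioms K.group_axioms)
  obtain g where g: "g \<in> carrier (VG (tl' e))" "psi (tl' e) g = rvec (axis i 1)" using psi_surj[of "tl' e"] e by auto
  obtain k :: nat where k: "0 < k" "g [^]\<^bsub>VG (tl' e)\<^esub> k \<in> incl A e ` carrier (EG e)"
    using finite_index_power[OF G.group_axioms I.img_is_subgroup fin_index[OF e] g(1)] by blast
  then obtain c where c: "c \<in> carrier (EG e)" "g [^]\<^bsub>VG (tl' e)\<^esub> k = incl A e c" by blast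
  have "Me e *v rvec (co (EG e) c) = real k *\<^sub>R axis i 1"
    using Me[OF e c(1)] psi_pow[of "tl' e" g k] c g e by (simp add: rvec_axis)
  then have "Me e *v ((1 / real k) *\<^sub>R rvec (co (EG e) c)) = axis i 1"
    using k by (simp add: matrix_vector_mult_scaleR)
  then show "\<exists>y. Me e *v y = axis i 1" by blast
qed

text \<open>Coordinates of the vertex group at the head are translated into those at the tail,
  passing through the coordinates of the common edge group.\<close>

definition Le :: "'e \<Rightarrow> real ^ 'n ^ 'n" where "Le e = Me e ** matrix_inv (Me (rv e))"

lemma Le_inv: "e \<in> arcs (base A) \<Longrightarrow> invertible (Le e)"
  unfolding Le_def by (intro invertible_mult Me_inv invertible_inv) auto

lemma Le_rev: "e \<in> arcs (base A) \<Longrightarrow> Le e ** Le (rv e) = mat 1"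
  unfolding Le_def using Me_inv[of e] Me_inv[of "rv e"]
  by (simp add: matrix_mul_assoc[symmetric] matrix_inv_cancel)

lemma Le_edge: "e \<in> arcs (base A) \<Longrightarrow> c \<in> carrier (EG e) \<Longrightarrow>
  Le e *v psi (hd' e) (incl A (rv e) c) = psi (tl' e) (incl A e c)"
  using Me[of e c] Me[of "rv e" c] egrp_rev[of e] Me_inv[of "rv e"]
  by (simp add: Le_def matrix_vector_mul_assoc[symmetric] matrix_inv_cancel)

subsection \<open>The affine representation\<close>

text \<open>A vertex group element becomes the translation by its coordinates, an edge the linear
  change of coordinates. All vertex groups thus act on one space, and the edge relation of the path
  group becomes \<open>Le_edge\<close>.\<close>

fun lin :: "('v, 'e, 'a) letter \<Rightarrow> real ^ 'n ^ 'n" where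
  "lin (VLet v g) = mat 1"
| "lin (ELet e) = (if e \<in> arcs (base A) then Le e else mat 1)"

fun off :: "('v, 'e, 'a) letter \<Rightarrow> real ^ 'n" where
  "off (VLet v g) = psi v g"
| "off (ELet e) = 0"

definition wl :: "('v, 'e, 'a) word \<Rightarrow> real ^ 'n ^ 'n" where "wl w = foldr (\<lambda>a M. lin a ** M) w (mat 1)"

definition wt :: "('v, 'e, 'a) word \<Rightarrow> real ^ 'n" where "wt w = foldr (\<lambda>a x. off a + lin a *v x) w 0"

lemma wl_simps [simp]: "wl [] = mat 1" "wl (a # w) = lin a ** wl w" "wt [] = 0" "wt (a # w) = off a + lin a *v wt w"
  by (simp_all add: wl_def wt_def)

lemma wl_app [simp]: "wl (w @ z) = wl w ** wl z"
  by (induction w) (simp_all add: matrix_mul_assoc)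

lemma wt_app [simp]: "wt (w @ z) = wt w + wl w *v wt z"
  by (induction w) (simp_all add: matrix_vector_mul_assoc[symmetric] matrix_vector_right_distrib add.assoc)

lemma wl_inv: "invertible (wl w)"
proof (induction w)
  case Nil
  show ?case by (auto simp: invertible_def intro!: exI[of _ "mat 1"])
next
  case (Cons a w)
  have "invertible (mat 1 :: real ^ 'n ^ 'n)" by (auto simp: invertible_def intro!: exI[of _ "mat 1"])
  then have "invertible (lin a)" by (cases a) (auto simp: Le_inv)
  then show ?case using Cons by (simp add: invertible_mult)
qed

lemma peq_affine: "w \<doteq> w' \<Longrightarrow> wl w = wl w' \<and> wt w = wt w'"
proof (induction rule: pg_eq.induct)
  case (pg_mult v g h)
  then show ?case by (simp add: psi_mult)
next
  case (pg_one v)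
  then show ?case by (simp add: psi_one)
next
  case (pg_rev e)
  then show ?case by (simp add: Le_rev)
next
  case (pg_edge e c)
  then show ?case by (simp add: Le_edge)
qed auto

end

lemma (in rtree) finite_sphere:
  assumes "\<And>x. x \<in> V \<Longrightarrow> finite (C `` {x})" "x \<in> V" shows "finite {y. (x, y) \<in> nb ^^ k}"
proof (induction k)
  case (Suc k)
  have sub: "{y. (x, y) \<in> nb ^^ Suc k} \<subseteq> (\<Union>z\<in>{z. (x, z) \<in> nb ^^ k}. C `` {z} \<union> {par z} \<union> {z})"
  proof
    fix y assume "y \<in> {y. (x, y) \<in> nb ^^ Suc k}"
    then obtain z where z: "(x, z) \<in> nb ^^ k" "(z, y) \<in> nb" by auto
    then show "y \<in> (\<Union>z\<in>{z. (x, z) \<in> nb ^^ k}. C `` {z} \<union> {par z} \<union> {z})"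
      using par_eq by (auto simp: nb_def)
  qed
  have "finite (C `` {z})" if "(x, z) \<in> nb ^^ k" for z using assms nb_relpow_V that by blast
  then have "finite (\<Union>z\<in>{z. (x, z) \<in> nb ^^ k}. C `` {z} \<union> {par z} \<union> {z})" using Suc by simp
  with sub show ?case by (rule finite_subset)
qed auto

lemma (in rtree) nb_connected:
  assumes "x \<in> V" "y \<in> V" shows "(x, y) \<in> nb ^^ (dep x + dep y)"
  using relpow_trans_add[OF relpow_sym[OF nb_sym relpow_nb[OF dep_V[OF assms(1)] order_refl]] relpow_nb[OF dep_V[OF assms(2)] order_refl]] .

lemma real_mat_vec:
  fixes M :: "rat ^ 'n::finite ^ 'n"
  shows "(\<chi> i. of_rat ((M *v v) $ i)) = real_mat M *v (\<chi> i. of_rat (v $ i))"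
  by (simp add: vec_eq_iff matrix_vector_mult_def real_mat_def of_rat_sum of_rat_mult)

lemma rat_vec_eq_iff: "rat_vec x = M *v rat_vec y \<longleftrightarrow> rvec x = real_mat M *v rvec y"
proof -
  have e: "rvec z = (\<chi> i. of_rat (rat_vec z $ i))" for z :: "int ^ 'n" by (simp add: rvec_def rat_vec_def vec_eq_iff)
  have "rvec x = real_mat M *v rvec y \<longleftrightarrow> (\<chi> i. real_of_rat (rat_vec x $ i)) = (\<chi> i. of_rat ((M *v rat_vec y) $ i))"
    by (simp only: e real_mat_vec)
  also have "\<dots> \<longleftrightarrow> rat_vec x = M *v rat_vec y" by (simp add: vec_eq_iff)
  finally show ?thesis ..
qed

section \<open>Holonomy as the linear part of the affine representation\<close>

locale holonomy_setting = Zn_graph A ty for A :: "('v, 'e, 'a, 'b) gog" and ty :: "'n::finite itself" +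
  fixes u :: 'v and x0 :: "('v, 'e, 'a) tree_vertex" and \<phi> :: "('v, 'e, 'a) word set \<Rightarrow> int ^ 'n"
    and Dm :: "('v, 'e, 'a) tree_vertex set"
  assumes u: "u \<in> verts (base A)" and hd: "holonomy_data A u x0 \<phi> Dm"
begin

sublocale T: rtree "bs_child u" "rt u" by (rule bs_child_rtree[OF u])
sublocale G: group "pi1 A u" by (rule pi1_group[OF u])

abbreviation "\<Gamma> \<equiv> pi1 A u"
abbreviation "TX \<equiv> verts (bs_tree A u)"

lemma TV_V: "TX = T.V" by (rule TV_eq[OF u, symmetric])

lemma G_cases: "g \<in> carrier \<Gamma> \<Longrightarrow> \<exists>w. g = cl w \<and> gog_path A u w u" by (auto simp: pi1_simps)

lemma V_cases': "x \<in> TX \<Longrightarrow> \<exists>w. x = (fst x, vertex_coset w (fst x)) \<and> gog_path A u w (fst x)"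
  by (rule TV_cases[OF u])

lemma act_TV: "g \<in> carrier \<Gamma> \<Longrightarrow> x \<in> TX \<Longrightarrow> bs_act A g x \<in> TX"
  using G_cases[of g] V_cases'[of x] bs_act_vertex_coset TV_I[OF u] path_app by metis

lemma act_mult: "g \<in> carrier \<Gamma> \<Longrightarrow> h \<in> carrier \<Gamma> \<Longrightarrow> x \<in> TX \<Longrightarrow> bs_act A (g \<otimes>\<^bsub>\<Gamma>\<^esub> h) x = bs_act A g (bs_act A h x)"
proof -
  assume a: "g \<in> carrier \<Gamma>" "h \<in> carrier \<Gamma>" "x \<in> TX"
  obtain w w' z where "g = cl w" "h = cl w'" "x = (fst x, vertex_coset z (fst x))" using G_cases[OF a(1)] G_cases[OF a(2)] V_cases'[OF a(3)] by blast
  then show ?thesis by (metis append_assoc bs_act_vertex_coset pi1_simps(2) prod_cl)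
qed

lemma act_one: "x \<in> TX \<Longrightarrow> bs_act A \<one>\<^bsub>\<Gamma>\<^esub> x = x"
  using V_cases'[of x] bs_act_vertex_coset by (metis append_Nil pi1_simps(3))

lemma act_arc:
  assumes "g = cl s" "gog_path A u s u" "e \<in> arcs (base A)" "gog_path A u w (tl' e)"
  shows "bs_act A g (tl' e, vertex_coset w (tl' e)) = (tl' e, vertex_coset (s @ w) (tl' e))"
    "bs_act A g (hd' e, vertex_coset (w @ [ELet e]) (hd' e)) = (hd' e, vertex_coset ((s @ w) @ [ELet e]) (hd' e))"
  using assms by (simp_all add: bs_act_vertex_coset)

lemma edge_word:
  assumes "(x, y) \<in> bs_child u"
  shows "\<exists>e w. e \<in> arcs (base A) \<and> gog_path A u w (tl' e) \<and> x = (tl' e, vertex_coset w (tl' e)) \<and> y = (hd' e, vertex_coset (w @ [ELet e]) (hd' e))"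
proof -
  obtain b where b: "b \<in> arcs (bs_tree A u)" "tail (bs_tree A u) b = x" "head (bs_tree A u) b = y" using bs_child_arc[OF u assms] by blast
  obtain e w where w: "b = (e, edge_coset w e)" "e \<in> arcs (base A)" "gog_path A u w (tl' e)" using b by (auto simp: bs_arcs)
  show ?thesis using w b by (intro exI[of _ e] exI[of _ w]) (simp add: bs_tail bs_head)
qed

lemma word_edge:
  assumes "e \<in> arcs (base A)" "gog_path A u w (tl' e)"
  shows "((tl' e, vertex_coset w (tl' e)), (hd' e, vertex_coset (w @ [ELet e]) (hd' e))) \<in> bs_child u \<or> ((hd' e, vertex_coset (w @ [ELet e]) (hd' e)), (tl' e, vertex_coset w (tl' e))) \<in> bs_child u"
proof -
  have "(e, edge_coset w e) \<in> arcs (bs_tree A u)" using assms by (auto simp: bs_arcs)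
  from arcs_ends_TV(3)[OF u this] show ?thesis using assms by (simp add: bs_tail bs_head)
qed

lemma act_bs_child:
  assumes "g \<in> carrier \<Gamma>" "(x, y) \<in> bs_child u"
  shows "(bs_act A g x, bs_act A g y) \<in> bs_child u \<or> (bs_act A g y, bs_act A g x) \<in> bs_child u"
proof -
  obtain s where s: "g = cl s" "gog_path A u s u" using G_cases assms by blast
  obtain e w where w: "e \<in> arcs (base A)" "gog_path A u w (tl' e)" "x = (tl' e, vertex_coset w (tl' e))" "y = (hd' e, vertex_coset (w @ [ELet e]) (hd' e))"
    using edge_word assms by blast
  show ?thesis using word_edge[OF w(1) path_app[OF s(2) w(2)]] act_arc[OF s w(1,2)] w by simp
qed

text \<open>Every edge is a translate of one that is based on the fixed path \<open>p e\<close>; the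
  translating element goes out along \<open>p e\<close> and back along \<open>w\<close>.\<close>

lemma cocompact: "\<exists>P0. finite P0 \<and> (\<forall>(x, y) \<in> bs_child u. \<exists>g\<in>carrier \<Gamma>. (bs_act A g x, bs_act A g y) \<in> P0)"
proof -
  define p where "p e = (SOME w. gog_path A u w (tl' e))" for e
  define P0 where "P0 = (\<lambda>e. ((tl' e, vertex_coset (p e) (tl' e)), (hd' e, vertex_coset (p e @ [ELet e]) (hd' e)))) ` arcs (base A)"
  have "\<exists>g\<in>carrier \<Gamma>. (bs_act A g x, bs_act A g y) \<in> P0" if xy: "(x, y) \<in> bs_child u" for x y
  proof -
    obtain e w where w: "e \<in> arcs (base A)" "gog_path A u w (tl' e)" "x = (tl' e, vertex_coset w (tl' e))" "y = (hd' e, vertex_coset (w @ [ELet e]) (hd' e))"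
      using edge_word xy by blast
    have p: "gog_path A u (p e) (tl' e)" unfolding p_def using w(2) by (rule someI)
    note wi = winv_path[OF w(2)]
    let ?s = "p e @ winv w"
    have s: "gog_path A u ?s u" using path_app p wi by blast
    have eq: "?s @ w \<doteq> p e" using pg_app2[of "winv w @ w" "[]" "p e"] wi by simp
    have c1: "vertex_coset (?s @ w) (tl' e) = vertex_coset (p e) (tl' e)"
      using vertex_coset_eq_iff_word_act[OF path_app[OF s w(2)] p] word_act_peq[OF eq nil_normal_forms[of "tl' e"]] w by simp
    have eq2: "(?s @ w) @ [ELet e] \<doteq> p e @ [ELet e]" using pg_app1[OF eq] .
    have "hd' e \<in> verts (base A)" using w by simp
    then have c2: "vertex_coset ((?s @ w) @ [ELet e]) (hd' e) = vertex_coset (p e @ [ELet e]) (hd' e)"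
      using word_act_peq[OF eq2 nil_normal_forms] vertex_coset_eq_iff_word_act[OF path_app[OF path_app[OF s w(2)] path_E[OF w(1)]] path_app[OF p path_E[OF w(1)]]] by blast
    have "(bs_act A (cl ?s) x, bs_act A (cl ?s) y) \<in> P0"
      unfolding w(3,4) act_arc[OF refl s w(1,2)] c1 c2 P0_def using w(1) by blast
    then show ?thesis using s by (intro bexI[of _ "cl ?s"]) (auto simp: pi1_simps)
  qed
  moreover have "finite P0" unfolding P0_def using fin_arcs by blast
  ultimately show ?thesis by blast
qed

text \<open>Children differ in the last pair \<open>(s, e)\<close> of the normal form, and there are
  finitely many edges and finitely many coset representatives.\<close>

lemma locally_finite: "x \<in> TX \<Longrightarrow> finite (bs_child u `` {x})"
proof -
  assume x: "x \<in> TX"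
  let ?N = "(\<lambda>p. nfv u x @ [p]) ` (\<Union>e\<in>arcs (base A). (\<lambda>s. (s, e)) ` (rp e ` carrier (VG (tl' e))))"
  have "nfv u y \<in> ?N" if y: "(x, y) \<in> bs_child u" for y
  proof -
    obtain s e where p: "nfv u y = nfv u x @ [(s, e)]" "y \<in> TX" using y by (auto simp: bs_child_def[OF u])
    obtain z where z: "normal_form z [(s, e)] (fst y)" using normal_form_app1 nfv_normal_form[OF u p(2)] p by metis
    then have "e \<in> arcs (base A)" "s \<in> carrier (VG (tl' e))" "rp e s = s" by auto
    then show ?thesis unfolding p(1) by (metis (no_types, lifting) UN_I imageI)
  qed
  then have "nfv u ` (bs_child u `` {x}) \<subseteq> ?N" by blast
  moreover have "finite ?N" using fin_arcs finite_reps by blast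
  ultimately have "finite (nfv u ` (bs_child u `` {x}))" by (rule finite_subset)
  moreover have "inj_on (nfv u) (bs_child u `` {x})" using nfv_inj[OF u] by (auto simp: inj_on_def bs_child_def[OF u])
  ultimately show ?thesis using finite_imageD by blast
qed

definition lin_part :: "('v, 'e, 'a) word set \<Rightarrow> real ^ 'n ^ 'n" where "lin_part g = wl (SOME w. w \<in> g)"
definition trans_part :: "('v, 'e, 'a) word set \<Rightarrow> real ^ 'n" where "trans_part g = wt (SOME w. w \<in> g)"

lemma lin_part_cl: "lin_part (cl w) = wl w" "trans_part (cl w) = wt w"
proof -
  have "(SOME w'. w' \<in> cl w) \<in> cl w" by (rule someI[of _ w]) (simp add: mem_cl pg_refl)
  then have "w \<doteq> (SOME w'. w' \<in> cl w)" by (simp add: mem_cl)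
  from peq_affine[OF this] show "lin_part (cl w) = wl w" "trans_part (cl w) = wt w" by (simp_all add: lin_part_def trans_part_def)
qed

lemma lin_part_mult: "g \<in> carrier \<Gamma> \<Longrightarrow> h \<in> carrier \<Gamma> \<Longrightarrow> lin_part (g \<otimes>\<^bsub>\<Gamma>\<^esub> h) = lin_part g ** lin_part h \<and> trans_part (g \<otimes>\<^bsub>\<Gamma>\<^esub> h) = trans_part g + lin_part g *v trans_part h"
  using G_cases[of g] G_cases[of h] by (auto simp: pi1_simps prod_cl lin_part_cl)

lemma lin_part_inv: "g \<in> carrier \<Gamma> \<Longrightarrow> invertible (lin_part g)"
  using G_cases[of g] by (auto simp: lin_part_cl wl_inv)

lemma lin_part_one: "lin_part \<one>\<^bsub>\<Gamma>\<^esub> = mat 1" "trans_part \<one>\<^bsub>\<Gamma>\<^esub> = 0"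
  by (simp_all add: pi1_simps lin_part_cl)

text \<open>An element that fixes the coset of \<open>w\<close> is the conjugate by \<open>w\<close>
  of a vertex group element, and a conjugate of a translation is a translation.\<close>

lemma stab_affine:
  assumes x: "x = (v, vertex_coset w v)" "gog_path A u w v" and g: "g \<in> carrier \<Gamma>" "bs_act A g x = x"
  shows "lin_part g = mat 1" "\<exists>a\<in>carrier (VG v). trans_part g = wl w *v psi v a \<and> g = cl (w @ [VLet v a] @ winv w)"
proof -
  have v: "v \<in> verts (base A)" using path_verts x by blast
  obtain s where s: "g = cl s" "gog_path A u s u" using G_cases g by blast
  have "vertex_coset w v = vertex_coset (s @ w) v" using g x s by (simp add: bs_act_vertex_coset)
  then obtain a where a: "a \<in> carrier (VG v)" "w @ [VLet v a] \<doteq> s @ w" using vertex_coset_eq[OF v] by blast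
  from peq_affine[OF a(2)] have e: "wl s ** wl w = wl w" "wt s + wl s *v wt w = wt w + wl w *v psi v a" by auto
  have "wl s = (wl s ** wl w) ** matrix_inv (wl w)" by (simp add: matrix_mul_assoc[symmetric] matrix_inv_cancel wl_inv)
  then have 1: "wl s = mat 1" by (simp add: e matrix_inv_cancel wl_inv)
  then show "lin_part g = mat 1" by (simp add: s lin_part_cl)
  have 2: "trans_part g = wl w *v psi v a" using e 1 by (simp add: s lin_part_cl)
  have "(w @ [VLet v a]) @ winv w \<doteq> (s @ w) @ winv w" by (rule pg_app1[OF a(2)])
  moreover have "s @ (w @ winv w) \<doteq> s @ []" using winv_path[OF x(2)] by (intro pg_app2) blast
  ultimately have "w @ [VLet v a] @ winv w \<doteq> s" by (auto intro: pg_trans)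
  then have "g = cl (w @ [VLet v a] @ winv w)" using s by (simp add: cl_eq[symmetric])
  then show "\<exists>a\<in>carrier (VG v). trans_part g = wl w *v psi v a \<and> g = cl (w @ [VLet v a] @ winv w)" using a 2 by blast
qed

lemma stab_elt:
  assumes "gog_path A u w v" "a \<in> carrier (VG v)"
  shows "cl (w @ [VLet v a] @ winv w) \<in> carrier \<Gamma>" "bs_act A (cl (w @ [VLet v a] @ winv w)) (v, vertex_coset w v) = (v, vertex_coset w v)"
    "trans_part (cl (w @ [VLet v a] @ winv w)) = wl w *v psi v a"
proof -
  have v: "v \<in> verts (base A)" using path_verts assms by blast
  note wi = winv_path[OF assms(1)]
  have p: "gog_path A u (w @ [VLet v a] @ winv w) u" using path_app assms path_V[OF v assms(2)] wi by blast
  then show g: "cl (w @ [VLet v a] @ winv w) \<in> carrier \<Gamma>" by (auto simp: pi1_simps)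
  have "(w @ [VLet v a]) @ (winv w @ w) \<doteq> (w @ [VLet v a]) @ []" using wi by (intro pg_app2) blast
  then have eq: "w @ [VLet v a] \<doteq> (w @ [VLet v a] @ winv w) @ w" by (auto intro: pg_sym)
  then have cs: "vertex_coset w v = vertex_coset ((w @ [VLet v a] @ winv w) @ w) v" using vertex_coset_eq[OF v] assms by blast
  show "bs_act A (cl (w @ [VLet v a] @ winv w)) (v, vertex_coset w v) = (v, vertex_coset w v)" unfolding bs_act_vertex_coset by (simp only: cs[symmetric])
  from peq_affine[OF eq] have "wl w = wl (w @ [VLet v a] @ winv w) ** wl w"
    "wt w + wl w *v psi v a = wt (w @ [VLet v a] @ winv w) + wl (w @ [VLet v a] @ winv w) *v wt w"
    by (auto simp only: wl_app wt_app) (simp_all add: matrix_mul_assoc)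
  moreover have "wl (w @ [VLet v a] @ winv w) = mat 1"
  proof -
    have "wl (w @ winv w) = wl []" using peq_affine wi by blast
    then show ?thesis by simp
  qed
  ultimately show "trans_part (cl (w @ [VLet v a] @ winv w)) = wl w *v psi v a" by (simp add: lin_part_cl)
qed

abbreviation "H \<equiv> bs_stab A u x0"

lemma H_def': "H = {g \<in> carrier \<Gamma>. bs_act A g x0 = x0}"
  by (simp add: bs_stab_def stabilizer_def)

lemma x0: "x0 \<in> TX" using hd by (simp add: holonomy_data_def)

lemma phi:
  shows phi_mult: "g \<in> H \<Longrightarrow> h \<in> H \<Longrightarrow> \<phi> (g \<otimes>\<^bsub>\<Gamma>\<^esub> h) = \<phi> g + \<phi> h"
    and phi_inj: "inj_on \<phi> H" and phi_surj: "\<exists>g\<in>H. \<phi> g = z"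
proof -
  have "\<phi> \<in> iso (\<Gamma>\<lparr>carrier := H\<rparr>) Zn" using hd by (simp add: holonomy_data_def)
  note i = iso_Zn[OF this]
  show "g \<in> H \<Longrightarrow> h \<in> H \<Longrightarrow> \<phi> (g \<otimes>\<^bsub>\<Gamma>\<^esub> h) = \<phi> g + \<phi> h" "inj_on \<phi> H" "\<exists>g\<in>H. \<phi> g = z" using i by auto
qed

lemma H_mult: "g \<in> H \<Longrightarrow> h \<in> H \<Longrightarrow> g \<otimes>\<^bsub>\<Gamma>\<^esub> h \<in> H"
  unfolding H_def' using act_mult x0 by auto

lemma H_one: "\<one>\<^bsub>\<Gamma>\<^esub> \<in> H" unfolding H_def' using act_one x0 by auto

lemma H_lin_part: "g \<in> H \<Longrightarrow> lin_part g = mat 1"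
  using stab_affine(1) V_cases'[OF x0] unfolding H_def' by blast

text \<open>Translation parts are additive on the stabilizer, hence linear in the coordinates
  \<open>\<phi>\<close>. They contain the images of all axis vectors under the invertible
  \<open>wl w\<close>, so the matrix is invertible.\<close>

lemma P_exists: "\<exists>P. invertible P \<and> (\<forall>g\<in>H. trans_part g = P *v rvec (\<phi> g))"
proof -
  obtain v w where w: "x0 = (v, vertex_coset w v)" "gog_path A u w v" using V_cases'[OF x0] by blast
  define f where "f z = trans_part (inv_into H \<phi> z)" for z
  have inv: "inv_into H \<phi> (\<phi> g) = g" if "g \<in> H" for g using phi_inj that by (rule inv_into_f_f)
  have "f (x + y) = f x + f y" for x y
  proof -
    obtain g h where g: "g \<in> H" "\<phi> g = x" "h \<in> H" "\<phi> h = y" using phi_surj by meson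
    then have "x + y = \<phi> (g \<otimes>\<^bsub>\<Gamma>\<^esub> h)" using phi_mult by simp
    then have "f (x + y) = trans_part (g \<otimes>\<^bsub>\<Gamma>\<^esub> h)" using inv[OF H_mult] g by (simp add: f_def)
    also have "\<dots> = trans_part g + trans_part h" using lin_part_mult[of g h] g H_lin_part H_def' by simp
    finally show ?thesis using inv g by (auto simp: f_def)
  qed
  then obtain P where "\<forall>z. f z = P *v rvec z" using additive_matrix by blast
  then have P: "trans_part g = P *v rvec (\<phi> g)" if "g \<in> H" for g using inv[OF that] by (metis f_def)
  have v: "v \<in> verts (base A)" using path_verts w by blast
  have "\<exists>g\<in>H. trans_part g = wl w *v axis i 1" for i
  proof -
    obtain a where a: "a \<in> carrier (VG v)" "psi v a = rvec (axis i 1)" using psi_surj[OF v] by blast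
    have "cl (w @ [VLet v a] @ winv w) \<in> H" using stab_elt[OF w(2) a(1)] unfolding H_def' w(1)[symmetric] by blast
    then show ?thesis using stab_elt(3)[OF w(2) a(1)] a(2) by (metis rvec_axis of_int_1 scaleR_one)
  qed
  then obtain g where g: "\<And>i. g i \<in> H" "\<And>i. trans_part (g i) = wl w *v axis i 1" by metis
  \<comment> \<open>The columns are the coordinates of elements that translate by the columns of
    \<open>wl w\<close>, whence \<open>P ** N = wl w\<close>.\<close>
  define N :: "real ^ 'n ^ 'n" where "N = (\<chi> i j. rvec (\<phi> (g j)) $ i)"
  have "(P ** N) $ i $ j = wl w $ i $ j" for i j
  proof -
    have "(P ** N) $ i $ j = (P *v rvec (\<phi> (g j))) $ i" by (simp add: matrix_matrix_mult_def matrix_vector_mult_def N_def)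
    also have "\<dots> = (wl w *v axis j 1) $ i" using P[OF g(1)] g(2) by simp
    finally show ?thesis by (simp add: matrix_vector_mult_basis column_def)
  qed
  then have "P ** N = wl w" by (simp add: vec_eq_iff)
  then have "P ** (N ** matrix_inv (wl w)) = mat 1" by (simp add: matrix_mul_assoc matrix_inv_cancel wl_inv)
  then have "invertible P" by (auto simp: invertible_def matrix_left_right_inverse)
  then show ?thesis using P by blast
qed

definition P :: "real ^ 'n ^ 'n" where "P = (SOME P. invertible P \<and> (\<forall>g\<in>H. trans_part g = P *v rvec (\<phi> g)))"

lemma P: "invertible P" "g \<in> H \<Longrightarrow> trans_part g = P *v rvec (\<phi> g)"
  using someI_ex[OF P_exists] unfolding P_def by blast+

lemma nb_act:
  assumes g: "g \<in> carrier \<Gamma>" shows "(x, y) \<in> T.nb ^^ k \<Longrightarrow> (bs_act A g x, bs_act A g y) \<in> T.nb ^^ k"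
proof (induction k arbitrary: y)
  case (Suc k)
  then obtain z where z: "(x, z) \<in> T.nb ^^ k" "(z, y) \<in> T.nb" by auto
  then have "(bs_act A g z, bs_act A g y) \<in> T.nb" using act_bs_child[OF g, of z y] act_bs_child[OF g, of y z] by (auto simp: T.nb_def)
  then show ?case using Suc z by (meson relpow_Suc_I)
qed auto

text \<open>The finitely many vertices at a given distance from \<open>\<gamma> x0\<close> are permuted by \<open>\<gamma> H \<gamma>\<^sup>-\<^sup>1\<close>.\<close>

lemma commensurate:
  assumes g: "g \<in> carrier \<Gamma>" and x: "x \<in> H"
  shows "\<exists>k::nat. 0 < k \<and> x [^]\<^bsub>\<Gamma>\<^esub> k \<in> H \<and> g \<otimes>\<^bsub>\<Gamma>\<^esub> x [^]\<^bsub>\<Gamma>\<^esub> k \<otimes>\<^bsub>\<Gamma>\<^esub> inv\<^bsub>\<Gamma>\<^esub> g \<in> H"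
proof -
  have xc: "x \<in> carrier \<Gamma>" "bs_act A x x0 = x0" using x H_def' by auto
  have pH: "x [^]\<^bsub>\<Gamma>\<^esub> (k::nat) \<in> H" for k by (induction k) (use H_one H_mult x in auto)
  let ?y = "\<lambda>k::nat. g \<otimes>\<^bsub>\<Gamma>\<^esub> x [^]\<^bsub>\<Gamma>\<^esub> k \<otimes>\<^bsub>\<Gamma>\<^esub> inv\<^bsub>\<Gamma>\<^esub> g"
  let ?z = "bs_act A g x0"
  have zV: "?z \<in> T.V" using act_TV g x0 TV_V by blast
  have x0V: "x0 \<in> T.V" using x0 TV_V by blast
  have yc: "?y k \<in> carrier \<Gamma>" for k using g xc by simp
  have fix_z: "bs_act A (?y k) ?z = ?z" for k
  proof -
    have "bs_act A (?y k) ?z = bs_act A (?y k \<otimes>\<^bsub>\<Gamma>\<^esub> g) x0" using act_mult[OF yc g x0] by simp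
    also have "?y k \<otimes>\<^bsub>\<Gamma>\<^esub> g = g \<otimes>\<^bsub>\<Gamma>\<^esub> x [^]\<^bsub>\<Gamma>\<^esub> k" using g xc by (simp add: G.m_assoc)
    also have "bs_act A \<dots> x0 = ?z" using act_mult[OF g _ x0, of "x [^]\<^bsub>\<Gamma>\<^esub> k"] pH[of k] H_def' by simp
    finally show ?thesis .
  qed
  define d where "d = T.dep ?z + T.dep x0"
  have dist: "(?z, x0) \<in> T.nb ^^ d" unfolding d_def using T.nb_connected zV x0V by blast
  have "range (\<lambda>k. bs_act A (?y k) x0) \<subseteq> {t. (?z, t) \<in> T.nb ^^ d}"
    using nb_act[OF yc dist] fix_z by auto
  moreover have "finite {t. (?z, t) \<in> T.nb ^^ d}" using T.finite_sphere locally_finite zV TV_V by blast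
  ultimately have "\<not> inj (\<lambda>k. bs_act A (?y k) x0)" using finite_subset range_inj_infinite by blast
  then obtain i j where ij: "i < j" "bs_act A (?y i) x0 = bs_act A (?y j) x0"
    by (auto simp: inj_on_def) (metis nat_neq_iff)
  have split: "?y j = ?y i \<otimes>\<^bsub>\<Gamma>\<^esub> ?y (j - i)"
  proof -
    have "x [^]\<^bsub>\<Gamma>\<^esub> j = x [^]\<^bsub>\<Gamma>\<^esub> i \<otimes>\<^bsub>\<Gamma>\<^esub> x [^]\<^bsub>\<Gamma>\<^esub> (j - i)" using ij xc by (simp add: G.nat_pow_mult)
    moreover have "inv\<^bsub>\<Gamma>\<^esub> g \<otimes>\<^bsub>\<Gamma>\<^esub> (g \<otimes>\<^bsub>\<Gamma>\<^esub> t) = t" if "t \<in> carrier \<Gamma>" for t using that g by (simp add: G.m_assoc[symmetric])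
    ultimately show ?thesis using g xc by (simp add: G.m_assoc)
  qed
  have "bs_act A (inv\<^bsub>\<Gamma>\<^esub> (?y i)) (bs_act A (?y i) x0) = bs_act A (inv\<^bsub>\<Gamma>\<^esub> (?y i)) (bs_act A (?y i) (bs_act A (?y (j - i)) x0))"
    using ij split act_mult yc x0 by metis
  moreover have "bs_act A (inv\<^bsub>\<Gamma>\<^esub> (?y i)) (bs_act A (?y i) t) = t" if "t \<in> TX" for t
    using act_mult[of "inv\<^bsub>\<Gamma>\<^esub> (?y i)" "?y i" t] act_one that yc by (simp only: G.inv_closed G.l_inv)
  ultimately have "x0 = bs_act A (?y (j - i)) x0" using x0 act_TV yc by metis
  then have "?y (j - i) \<in> H" using yc H_def' by auto
  then show ?thesis using ij pH by (intro exI[of _ "j - i"]) auto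
qed

lemma conj_trans_part:
  assumes g: "g \<in> carrier \<Gamma>" and x: "x \<in> H"
  shows "trans_part (g \<otimes>\<^bsub>\<Gamma>\<^esub> x \<otimes>\<^bsub>\<Gamma>\<^esub> inv\<^bsub>\<Gamma>\<^esub> g) = lin_part g *v trans_part x"
proof -
  have xc: "x \<in> carrier \<Gamma>" using x H_def' by auto
  have "trans_part (g \<otimes>\<^bsub>\<Gamma>\<^esub> x \<otimes>\<^bsub>\<Gamma>\<^esub> inv\<^bsub>\<Gamma>\<^esub> g) = trans_part g + lin_part g *v trans_part x + lin_part g *v trans_part (inv\<^bsub>\<Gamma>\<^esub> g)"
    using lin_part_mult g xc H_lin_part[OF x] by simp
  moreover have "trans_part g + lin_part g *v trans_part (inv\<^bsub>\<Gamma>\<^esub> g) = 0" using lin_part_mult[OF g, of "inv\<^bsub>\<Gamma>\<^esub> g"] g lin_part_one by simp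
  ultimately show ?thesis by (simp add: algebra_simps)
qed

abbreviation "ho \<equiv> hol A u x0 \<phi>"

lemma phi_pow: "x \<in> H \<Longrightarrow> \<phi> (x [^]\<^bsub>\<Gamma>\<^esub> (k::nat)) = of_nat k *s \<phi> x \<and> x [^]\<^bsub>\<Gamma>\<^esub> k \<in> H"
proof (induction k)
  case 0
  have "\<phi> \<one>\<^bsub>\<Gamma>\<^esub> = 0" using phi_mult[OF H_one H_one] by simp
  then show ?case using H_one by (simp add: vec_eq_iff)
next
  case (Suc k)
  then show ?case using phi_mult[of "x [^]\<^bsub>\<Gamma>\<^esub> k" x] H_mult by (simp add: vec_eq_iff algebra_simps)
qed

text \<open>Conjugation by \<open>g\<close> multiplies translations by \<open>lin_part g\<close>, so
  in the coordinates \<open>\<phi>\<close> it is given by this real matrix. It remains to see that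
  exactly one rational matrix satisfies the defining condition; \<open>commensurate\<close> supplies
  the test vectors, namely nonzero multiples of all axis vectors.\<close>

lemma ho_eq:
  assumes g: "g \<in> carrier \<Gamma>" shows "ho g = matrix_inv P ** lin_part g ** P"
proof -
  let ?Q = "matrix_inv P ** lin_part g ** P"
  let ?c = "\<lambda>x. g \<otimes>\<^bsub>\<Gamma>\<^esub> x \<otimes>\<^bsub>\<Gamma>\<^esub> inv\<^bsub>\<Gamma>\<^esub> g"
  have Q: "rvec (\<phi> (?c x)) = ?Q *v rvec (\<phi> x)" if "x \<in> H" "?c x \<in> H" for x
  proof -
    have "P *v rvec (\<phi> (?c x)) = lin_part g *v (P *v rvec (\<phi> x))" using conj_trans_part[OF g that(1)] P(2) that by simp
    then have "matrix_inv P *v (P *v rvec (\<phi> (?c x))) = matrix_inv P *v (lin_part g *v (P *v rvec (\<phi> x)))" by simp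
    then show ?thesis using P(1) by (simp add: matrix_inv_cancel matrix_vector_mul_assoc matrix_mul_assoc)
  qed
  have "\<exists>x k. x \<in> H \<and> ?c x \<in> H \<and> (0::int) < k \<and> \<phi> x = axis i k" for i
  proof -
    obtain y where y: "y \<in> H" "\<phi> y = axis i 1" using phi_surj by blast
    obtain k :: nat where k: "0 < k" "y [^]\<^bsub>\<Gamma>\<^esub> k \<in> H" "?c (y [^]\<^bsub>\<Gamma>\<^esub> k) \<in> H" using commensurate[OF g y(1)] by blast
    have "\<phi> (y [^]\<^bsub>\<Gamma>\<^esub> k) = axis i (int k)" using phi_pow[OF y(1), of k] y by (simp add: vec_eq_iff axis_def)
    then show ?thesis using k by (intro exI[of _ "y [^]\<^bsub>\<Gamma>\<^esub> k"] exI[of _ "int k"]) auto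
  qed
  then obtain x k where xk: "\<And>i. x i \<in> H" "\<And>i. ?c (x i) \<in> H" "\<And>i. (0::int) < k i" "\<And>i. \<phi> (x i) = axis i (k i)" by metis
  have col: "real_of_int (k i) * ?Q $ j $ i = real_of_int (\<phi> (?c (x i)) $ j)" for i j
  proof -
    have "rvec (\<phi> (?c (x i))) $ j = (?Q *v (real_of_int (k i) *\<^sub>R axis i 1)) $ j"
      using Q[OF xk(1,2), of i] xk(4)[of i] by (simp add: rvec_axis)
    then show ?thesis by (simp add: rvec_simps matrix_vector_mult_scaleR matrix_vector_mult_basis column_def)
  qed
  \<comment> \<open>Rational, since each column is an integral vector divided by an integer.\<close>
  define M :: "rat ^ 'n ^ 'n" where "M = (\<chi> j i. of_int (\<phi> (?c (x i)) $ j) / of_int (k i))"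
  have MQ: "real_mat M = ?Q"
  proof -
    have "real_mat M $ j $ i = ?Q $ j $ i" for i j
      using col[of i j] xk(3)[of i] by (simp add: real_mat_def M_def of_rat_divide field_simps)
    then show ?thesis by (simp add: vec_eq_iff)
  qed
  have "conj_matrix \<Gamma> H \<phi> g = M"
    unfolding conj_matrix_def
  proof (rule the_equality)
    show "\<forall>x\<in>H. ?c x \<in> H \<longrightarrow> rat_vec (\<phi> (?c x)) = M *v rat_vec (\<phi> x)"
      unfolding rat_vec_eq_iff MQ using Q by blast
    fix M' assume M': "\<forall>x\<in>H. ?c x \<in> H \<longrightarrow> rat_vec (\<phi> (?c x)) = M' *v rat_vec (\<phi> x)"
    have "real_mat M' $ j $ i = ?Q $ j $ i" for i j
    proof -
      have "rvec (\<phi> (?c (x i))) = real_mat M' *v rvec (\<phi> (x i))" using M' xk rat_vec_eq_iff by blast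
      then have "rvec (\<phi> (?c (x i))) $ j = (real_mat M' *v (real_of_int (k i) *\<^sub>R axis i 1)) $ j" using xk(4)[of i] by (simp add: rvec_axis)
      then have "real_of_int (\<phi> (?c (x i)) $ j) = real_of_int (k i) * real_mat M' $ j $ i"
        by (simp add: rvec_simps matrix_vector_mult_scaleR matrix_vector_mult_basis column_def)
      then have "real_of_int (k i) * real_mat M' $ j $ i = real_of_int (k i) * ?Q $ j $ i"
        unfolding col[of i j] by (rule sym)
      then show ?thesis using xk(3)[of i] by (metis less_irrefl mult_left_cancel of_int_eq_0_iff)
    qed
    then have "real_mat M' = real_mat M" unfolding MQ by (simp add: vec_eq_iff)
    then show "M' = M" by (simp add: real_mat_def vec_eq_iff)
  qed
  then show ?thesis by (simp add: hol_def MQ)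
qed

text \<open>The translation part in the coordinates \<open>\<phi>\<close>. With it the affine action
  has linear part \<open>ho\<close>, and the stabilizer of \<open>x0\<close> translates by the
  integer lattice.\<close>

definition th :: "('v, 'e, 'a) word set \<Rightarrow> real ^ 'n" where "th g = matrix_inv P *v trans_part g"

lemma ho_mult: "g \<in> carrier \<Gamma> \<Longrightarrow> h \<in> carrier \<Gamma> \<Longrightarrow> ho (g \<otimes>\<^bsub>\<Gamma>\<^esub> h) = ho g ** ho h"
  using P(1) by (simp add: ho_eq lin_part_mult matrix_mul_assoc[symmetric] matrix_inv_cancel)

lemma th_mult: "g \<in> carrier \<Gamma> \<Longrightarrow> h \<in> carrier \<Gamma> \<Longrightarrow> th (g \<otimes>\<^bsub>\<Gamma>\<^esub> h) = th g + ho g *v th h"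
  using P(1) by (simp add: ho_eq th_def lin_part_mult matrix_vector_right_distrib matrix_vector_mul_assoc[symmetric] matrix_inv_cancel)

lemma ho_inv: "g \<in> carrier \<Gamma> \<Longrightarrow> invertible (ho g)"
  using P(1) by (simp add: ho_eq invertible_mult invertible_inv lin_part_inv)

lemma ho_stab: "g \<in> carrier \<Gamma> \<Longrightarrow> x \<in> TX \<Longrightarrow> bs_act A g x = x \<Longrightarrow> ho g = mat 1"
  using P(1) stab_affine(1) V_cases' by (metis ho_eq matrix_inv_cancel(2) matrix_mul_rid)

lemma th_H: "g \<in> H \<Longrightarrow> th g = rvec (\<phi> g)"
  using P by (simp add: th_def matrix_inv_cancel)

abbreviation "lam \<equiv> tree_hol A u x0 \<phi> Dm"

lemma Dm: "Dm \<subseteq> TX" "x0 \<in> Dm" "x \<in> TX \<Longrightarrow> \<exists>!y. y \<in> Dm \<and> y \<in> orbit \<Gamma> (bs_act A) x"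
  using hd by (auto simp: holonomy_data_def fundamental_domain_def)

text \<open>The choice in \<open>tree_hol\<close> is immaterial: if two elements \<open>g\<close>
  and \<open>h\<close> bring points of the domain to the same vertex, the points share an orbit and
  are equal, so \<open>g\<close> and \<open>h\<close> differ by a stabilizer element, which has
  trivial holonomy.\<close>

lemma lam_Dm:
  assumes g: "g \<in> carrier \<Gamma>" "d \<in> Dm" shows "lam (bs_act A g d) = ho g"
proof -
  let ?x = "bs_act A g d"
  define h where "h = (SOME h. h \<in> carrier \<Gamma> \<and> ?x \<in> bs_act A h ` Dm)"
  have "h \<in> carrier \<Gamma> \<and> ?x \<in> bs_act A h ` Dm" unfolding h_def by (rule someI[of _ g]) (use g in auto)
  then obtain d' where h: "h \<in> carrier \<Gamma>" "d' \<in> Dm" "?x = bs_act A h d'" by blast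
  have dT: "d \<in> TX" "d' \<in> TX" using Dm g h by auto
  have e: "bs_act A (inv\<^bsub>\<Gamma>\<^esub> h \<otimes>\<^bsub>\<Gamma>\<^esub> g) d = d'"
    using act_mult[of "inv\<^bsub>\<Gamma>\<^esub> h" g d] act_mult[of "inv\<^bsub>\<Gamma>\<^esub> h" h d'] act_one h g dT by simp
  have "d' \<in> orbit \<Gamma> (bs_act A) d" unfolding orbit_def using e g h by (metis (mono_tags, lifting) G.inv_closed G.m_closed mem_Collect_eq)
  moreover have "d \<in> orbit \<Gamma> (bs_act A) d" unfolding orbit_def using act_one[OF dT(1)] by (metis (mono_tags, lifting) G.one_closed mem_Collect_eq)
  ultimately have "d' = d" using Dm(3)[OF dT(1)] g h by blast
  then have "ho (inv\<^bsub>\<Gamma>\<^esub> h \<otimes>\<^bsub>\<Gamma>\<^esub> g) = mat 1" using ho_stab[OF _ dT(1)] e g h by simp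
  then have "ho (h \<otimes>\<^bsub>\<Gamma>\<^esub> (inv\<^bsub>\<Gamma>\<^esub> h \<otimes>\<^bsub>\<Gamma>\<^esub> g)) = ho h" using ho_mult h g by simp
  moreover have "h \<otimes>\<^bsub>\<Gamma>\<^esub> (inv\<^bsub>\<Gamma>\<^esub> h \<otimes>\<^bsub>\<Gamma>\<^esub> g) = g" using h g by (simp add: G.m_assoc[symmetric])
  ultimately show ?thesis by (simp add: tree_hol_def h_def)
qed

lemma Dm_cover: "x \<in> TX \<Longrightarrow> \<exists>g d. g \<in> carrier \<Gamma> \<and> d \<in> Dm \<and> x = bs_act A g d"
proof -
  assume x: "x \<in> TX"
  then obtain d where d: "d \<in> Dm" "d \<in> orbit \<Gamma> (bs_act A) x" using Dm(3) by blast
  then obtain g where g: "g \<in> carrier \<Gamma>" "d = bs_act A g x" by (auto simp: orbit_def)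
  have "x = bs_act A (inv\<^bsub>\<Gamma>\<^esub> g) d" using act_mult[of "inv\<^bsub>\<Gamma>\<^esub> g" g x] act_one g x by simp
  then show ?thesis using g d G.inv_closed by metis
qed

lemma lam_act: "g \<in> carrier \<Gamma> \<Longrightarrow> x \<in> TX \<Longrightarrow> lam (bs_act A g x) = ho g ** lam x"
proof -
  assume a: "g \<in> carrier \<Gamma>" "x \<in> TX"
  obtain h d where h: "h \<in> carrier \<Gamma>" "d \<in> Dm" "x = bs_act A h d" using Dm_cover a by blast
  have "bs_act A g x = bs_act A (g \<otimes>\<^bsub>\<Gamma>\<^esub> h) d" using act_mult[OF a(1) h(1) subsetD[OF Dm(1) h(2)]] h(3) by (simp only:)
  then have "lam (bs_act A g x) = ho (g \<otimes>\<^bsub>\<Gamma>\<^esub> h)" using lam_Dm[OF G.m_closed[OF a(1) h(1)] h(2)] by (rule ssubst)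
  also have "\<dots> = ho g ** ho h" by (rule ho_mult[OF a(1) h(1)])
  also have "ho h = lam x" using lam_Dm[OF h(1,2)] h(3) by metis
  finally show ?thesis .
qed

lemma lam_x0: "lam x0 = mat 1"
  using lam_Dm[OF _ Dm(2), of "\<one>\<^bsub>\<Gamma>\<^esub>"] act_one[OF x0] ho_stab[OF _ x0, of "\<one>\<^bsub>\<Gamma>\<^esub>"] by simp

lemma lam_inv: "x \<in> TX \<Longrightarrow> invertible (lam x)"
  using Dm_cover lam_Dm ho_inv by metis

text \<open>The density condition holds because the cone at \<open>x\<close> is a side of the edge,
  by \<open>cone_side\<close>, and every label lies in the closure of the labels of a full
  side.\<close>

lemma tree_action:
  assumes "bushy A u" "folded_holonomy A u x0 \<phi> Dm"
  shows "tree_action (bs_child u) (rt u) \<Gamma> (bs_act A) ho lam"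
proof
  fix x y assume "(x, y) \<in> bs_child u" then have "x \<in> TX" unfolding bs_child_def[OF u] by blast
  then show "x \<in> T.V" unfolding TV_V .
next
  show "\<exists>P0. finite P0 \<and> (\<forall>(x, y) \<in> bs_child u. \<exists>g\<in>carrier \<Gamma>. (bs_act A g x, bs_act A g y) \<in> P0)" by (rule cocompact)
next
  fix p x z and e :: real assume px: "(p, x) \<in> bs_child u" and z: "z \<in> T.V" and e: "0 < e"
  obtain a where a: "a \<in> arcs (bs_tree A u)" "tail (bs_tree A u) a = p" "head (bs_tree A u) a = x" using bs_child_arc[OF u px] by blast
  have "full (bs_tree A u) lam ((bs_child u)\<^sup>* `` {x})"
    using assms(2) cone_side[OF u px a] a unfolding folded_holonomy_def by blast
  then have "Abstract_Topology.closure_of (top_of_set GL) (lam ` ((bs_child u)\<^sup>* `` {x})) =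
     Abstract_Topology.closure_of (top_of_set GL) (lam ` TX)" by (simp add: full_def)
  moreover have GLz: "lam z \<in> GL" using lam_inv z TV_V by (simp add: GL_def)
  moreover have "lam z \<in> Abstract_Topology.closure_of (top_of_set GL) (lam ` TX)"
  proof -
    have "lam ` TX \<subseteq> GL" using lam_inv by (auto simp: GL_def)
    then have "lam ` TX \<subseteq> Abstract_Topology.closure_of (top_of_set GL) (lam ` TX)" by (simp add: closure_of_subset)
    then show ?thesis using z unfolding TV_V by blast
  qed
  ultimately have "lam z \<in> Abstract_Topology.closure_of (top_of_set GL) (lam ` ((bs_child u)\<^sup>* `` {x}))" by simp
  moreover have "openin (top_of_set GL) (GL \<inter> ball (lam z) e)" by (simp add: openin_open_Int)
  moreover have "lam z \<in> GL \<inter> ball (lam z) e" using GLz e by simp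
  ultimately have "\<exists>y\<in>lam ` ((bs_child u)\<^sup>* `` {x}). y \<in> GL \<inter> ball (lam z) e" unfolding in_closure_of by meson
  then obtain w where "(x, w) \<in> (bs_child u)\<^sup>*" "dist (lam z) (lam w) < e" by auto
  then show "\<exists>w. (x, w) \<in> (bs_child u)\<^sup>* \<and> norm (lam w - lam z) < e" by (metis dist_norm norm_minus_commute)
next
  show "\<exists>c1 c2 c3. {c1, c2, c3} \<subseteq> T.V \<and> c1 \<noteq> c2 \<and> c1 \<noteq> c3 \<and> c2 \<noteq> c3 \<and> T.dep c1 = T.dep c2 \<and> T.dep c1 = T.dep c3
       \<and> infinite ((bs_child u)\<^sup>* `` {c1}) \<and> infinite ((bs_child u)\<^sup>* `` {c2}) \<and> infinite ((bs_child u)\<^sup>* `` {c3})"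
    using T.rays_three[OF TV_V dominates_iff[OF u]] assms(1) by (simp add: bushy_def)
qed (use act_TV act_mult act_one act_bs_child locally_finite ho_inv lam_inv lam_act TV_V in auto)

end

section \<open>Word metrics\<close>

context group
begin

lemma foldr_closed: "set ws \<subseteq> carrier G \<Longrightarrow> foldr (\<lambda>x y. x \<otimes> y) ws \<one> \<in> carrier G"
  by (induction ws) auto

lemma foldr_append: "set ws \<subseteq> carrier G \<Longrightarrow> set vs \<subseteq> carrier G \<Longrightarrow>
  foldr (\<lambda>x y. x \<otimes> y) (ws @ vs) \<one> = foldr (\<lambda>x y. x \<otimes> y) ws \<one> \<otimes> foldr (\<lambda>x y. x \<otimes> y) vs \<one>"
  by (induction ws) (auto simp: m_assoc foldr_closed)

lemma symm_closed: "S \<subseteq> carrier G \<Longrightarrow> S \<union> (\<lambda>s. inv s) ` S \<subseteq> carrier G" by auto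

lemma word_exists:
  assumes S: "S \<subseteq> carrier G" and g: "g \<in> generate G S"
  shows "\<exists>ws. set ws \<subseteq> S \<union> (\<lambda>s. inv s) ` S \<and> g = foldr (\<lambda>x y. x \<otimes> y) ws \<one>"
  using g
proof (induction rule: generate.induct)
  case one
  then show ?case by (intro exI[of _ "[]"]) auto
next
  case (incl h)
  then show ?case using S by (intro exI[of _ "[h]"]) auto
next
  case (inv h)
  then show ?case using S by (intro exI[of _ "[inv h]"]) auto
next
  case (eng h1 h2)
  then obtain ws vs where "set ws \<subseteq> S \<union> (\<lambda>s. inv s) ` S" "h1 = foldr (\<lambda>x y. x \<otimes> y) ws \<one>"
    "set vs \<subseteq> S \<union> (\<lambda>s. inv s) ` S" "h2 = foldr (\<lambda>x y. x \<otimes> y) vs \<one>" by blast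
  moreover have "foldr (\<lambda>x y. x \<otimes> y) (ws @ vs) \<one> = foldr (\<lambda>x y. x \<otimes> y) ws \<one> \<otimes> foldr (\<lambda>x y. x \<otimes> y) vs \<one>"
    using calculation symm_closed[OF S] by (intro foldr_append) blast+
  ultimately show ?case by (intro exI[of _ "ws @ vs"]) simp
qed

lemma word_lengthE:
  assumes "S \<subseteq> carrier G" "g \<in> generate G S"
  obtains ws where "length ws = word_length G S g" "set ws \<subseteq> S \<union> (\<lambda>s. inv s) ` S" "g = foldr (\<lambda>x y. x \<otimes> y) ws \<one>"
proof -
  obtain ws where "set ws \<subseteq> S \<union> (\<lambda>s. inv s) ` S" "g = foldr (\<lambda>x y. x \<otimes> y) ws \<one>" using word_exists assms by blast
  then have "\<exists>k. \<exists>ws. length ws = k \<and> set ws \<subseteq> S \<union> (\<lambda>s. inv s) ` S \<and> g = foldr (\<lambda>x y. x \<otimes> y) ws \<one>" by blast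
  from LeastI_ex[OF this] show ?thesis using that unfolding word_length_def by blast
qed

lemma word_length_le:
  "set ws \<subseteq> S \<union> (\<lambda>s. inv s) ` S \<Longrightarrow> word_length G S (foldr (\<lambda>x y. x \<otimes> y) ws \<one>) \<le> length ws"
  unfolding word_length_def by (rule Least_le) blast

lemma word_length_mult:
  assumes S: "S \<subseteq> carrier G" "generate G S = carrier G" and "g \<in> carrier G" "h \<in> carrier G"
  shows "word_length G S (g \<otimes> h) \<le> word_length G S g + word_length G S h"
proof -
  obtain ws where ws: "length ws = word_length G S g" "set ws \<subseteq> S \<union> (\<lambda>s. inv s) ` S" "g = foldr (\<lambda>x y. x \<otimes> y) ws \<one>"
    using word_lengthE[OF S(1), of g] assms by metis
  obtain vs where vs: "length vs = word_length G S h" "set vs \<subseteq> S \<union> (\<lambda>s. inv s) ` S" "h = foldr (\<lambda>x y. x \<otimes> y) vs \<one>"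
    using word_lengthE[OF S(1), of h] assms by metis
  have "g \<otimes> h = foldr (\<lambda>x y. x \<otimes> y) (ws @ vs) \<one>"
    unfolding ws(3) vs(3) using ws(2) vs(2) symm_closed[OF S(1)] by (intro foldr_append[symmetric]) auto
  then show ?thesis using word_length_le[of "ws @ vs" S] ws vs by auto
qed

lemma word_length_inv:
  assumes S: "S \<subseteq> carrier G" "generate G S = carrier G" and "g \<in> carrier G"
  shows "word_length G S (inv g) \<le> word_length G S g"
proof -
  obtain ws where ws: "length ws = word_length G S g" "set ws \<subseteq> S \<union> (\<lambda>s. inv s) ` S" "g = foldr (\<lambda>x y. x \<otimes> y) ws \<one>"
    using word_lengthE[OF S(1), of g] assms by metis
  have "inv (foldr (\<lambda>x y. x \<otimes> y) vs \<one>) = foldr (\<lambda>x y. x \<otimes> y) (rev (map (\<lambda>s. inv s) vs)) \<one>" if "set vs \<subseteq> carrier G" for vs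
    using that
  proof (induction vs)
    case (Cons v vs)
    have "set (rev (map (\<lambda>s. inv s) vs)) \<subseteq> carrier G" "set [inv v] \<subseteq> carrier G" using Cons by auto
    from foldr_append[OF this] show ?case using foldr_closed[of vs] Cons by (simp add: inv_mult_group)
  qed simp
  moreover have "set ws \<subseteq> carrier G" using ws symm_closed[OF S(1)] by blast
  moreover have "set (rev (map (\<lambda>s. inv s) ws)) \<subseteq> S \<union> (\<lambda>s. inv s) ` S"
  proof
    fix x assume "x \<in> set (rev (map (\<lambda>s. inv s) ws))"
    then obtain y where y: "y \<in> set ws" "x = inv y" by auto
    then have "y \<in> S \<union> (\<lambda>s. inv s) ` S" using ws(2) by blast
    then show "x \<in> S \<union> (\<lambda>s. inv s) ` S" using S(1) inv_inv y(2) by auto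
  qed
  ultimately show ?thesis using word_length_le[of "rev (map (\<lambda>s. inv s) ws)" S] ws by simp
qed

lemma word_dist_triangle:
  assumes S: "S \<subseteq> carrier G" "generate G S = carrier G" and c: "a \<in> carrier G" "b \<in> carrier G" "c \<in> carrier G"
  shows "word_dist G S a c \<le> word_dist G S a b + word_dist G S b c"
proof -
  have "inv a \<otimes> c = (inv a \<otimes> b) \<otimes> (inv b \<otimes> c)" using c by (simp add: m_assoc) (simp add: m_assoc[symmetric])
  then have "word_length G S (inv a \<otimes> c) \<le> word_length G S (inv a \<otimes> b) + word_length G S (inv b \<otimes> c)"
    using word_length_mult[OF S, of "inv a \<otimes> b" "inv b \<otimes> c"] c by simp
  then show ?thesis unfolding word_dist_def by linarith
qed

lemma word_dist_sym:
  assumes S: "S \<subseteq> carrier G" "generate G S = carrier G" and c: "a \<in> carrier G" "b \<in> carrier G"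
  shows "word_dist G S a b \<le> word_dist G S b a"
  using word_length_inv[OF S, of "inv b \<otimes> a"] c by (simp add: word_dist_def inv_mult_group)

end

text \<open>Lipschitz maps, expressed by finite sets of differences so that no generating set has to
  be chosen.\<close>

definition coarse_map :: "('g, 'm) monoid_scheme \<Rightarrow> ('h, 'k) monoid_scheme \<Rightarrow> ('g \<Rightarrow> 'h) \<Rightarrow> bool" where
  "coarse_map G H f \<longleftrightarrow> f \<in> carrier G \<rightarrow> carrier H \<and> (\<forall>b\<in>carrier G. \<exists>Y. finite Y \<and>
     (\<forall>g\<in>carrier G. inv\<^bsub>H\<^esub> (f g) \<otimes>\<^bsub>H\<^esub> f (g \<otimes>\<^bsub>G\<^esub> b) \<in> Y))"

text \<open>Only the finitely many generators and their inverses matter: \<open>K\<close> bounds the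
  displacement caused by one letter, and a word is read letter by letter.\<close>

lemma coarse_map_lipschitz:
  assumes G: "group G" and H: "group H" and S: "finite S" "S \<subseteq> carrier G" "generate G S = carrier G"
    and S': "S' \<subseteq> carrier H" "generate H S' = carrier H" and f: "coarse_map G H f"
  shows "\<exists>K\<ge>0. \<forall>a\<in>carrier G. \<forall>b\<in>carrier G. word_dist H S' (f a) (f b) \<le> K * word_dist G S a b"
proof -
  interpret G: group G by fact
  interpret H: group H by fact
  let ?S = "S \<union> (\<lambda>s. inv\<^bsub>G\<^esub> s) ` S"
  have Sc: "?S \<subseteq> carrier G" using S G.symm_closed by blast
  have fc: "f g \<in> carrier H" if "g \<in> carrier G" for g using f that by (auto simp: coarse_map_def)
  have "\<forall>b\<in>?S. \<exists>Y. finite Y \<and> (\<forall>g\<in>carrier G. inv\<^bsub>H\<^esub> (f g) \<otimes>\<^bsub>H\<^esub> f (g \<otimes>\<^bsub>G\<^esub> b) \<in> Y)"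
    using f Sc unfolding coarse_map_def by blast
  then obtain Y where Y: "\<And>b. b \<in> ?S \<Longrightarrow> finite (Y b)"
    "\<And>b g. b \<in> ?S \<Longrightarrow> g \<in> carrier G \<Longrightarrow> inv\<^bsub>H\<^esub> (f g) \<otimes>\<^bsub>H\<^esub> f (g \<otimes>\<^bsub>G\<^esub> b) \<in> Y b" by metis
  define Z where "Z = (\<Union>b\<in>?S. Y b)"
  have Z: "finite Z" using Y S by (auto simp: Z_def)
  define K where "K = (\<Sum>z\<in>Z. real (word_length H S' z))"
  have K: "0 \<le> K" by (simp add: K_def sum_nonneg)
  have K1: "word_dist H S' (f g) (f (g \<otimes>\<^bsub>G\<^esub> b)) \<le> K" if "b \<in> ?S" "g \<in> carrier G" for b g
  proof -
    have "inv\<^bsub>H\<^esub> (f g) \<otimes>\<^bsub>H\<^esub> f (g \<otimes>\<^bsub>G\<^esub> b) \<in> Z" unfolding Z_def using Y that by blast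
    then show ?thesis unfolding K_def word_dist_def using Z by (intro member_le_sum) auto
  qed
  have w0: "word_dist H S' y y = 0" if "y \<in> carrier H" for y
    using H.word_length_le[of "[]" S'] that by (simp add: word_dist_def)
  have words: "word_dist H S' (f g) (f (g \<otimes>\<^bsub>G\<^esub> foldr (\<lambda>x y. x \<otimes>\<^bsub>G\<^esub> y) ws \<one>\<^bsub>G\<^esub>)) \<le> K * real (length ws)"
    if "set ws \<subseteq> ?S" "g \<in> carrier G" for ws g
    using that
  proof (induction ws arbitrary: g)
    case Nil
    then show ?case using w0 fc by simp
  next
    case (Cons s ws)
    have s: "s \<in> carrier G" "set ws \<subseteq> carrier G" using Cons Sc by auto
    let ?p = "foldr (\<lambda>x y. x \<otimes>\<^bsub>G\<^esub> y) ws \<one>\<^bsub>G\<^esub>"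
    have p: "?p \<in> carrier G" using G.foldr_closed s by blast
    have "word_dist H S' (f g) (f (g \<otimes>\<^bsub>G\<^esub> s \<otimes>\<^bsub>G\<^esub> ?p)) \<le> word_dist H S' (f g) (f (g \<otimes>\<^bsub>G\<^esub> s)) + word_dist H S' (f (g \<otimes>\<^bsub>G\<^esub> s)) (f (g \<otimes>\<^bsub>G\<^esub> s \<otimes>\<^bsub>G\<^esub> ?p))"
      using fc s p Cons by (intro H.word_dist_triangle[OF S']) auto
    also have "\<dots> \<le> K + K * real (length ws)"
      using Cons.IH[of "g \<otimes>\<^bsub>G\<^esub> s"] K1[of s g] Cons s by (intro add_mono) auto
    finally show ?case using Cons s p by (simp add: G.m_assoc algebra_simps)
  qed
  have "word_dist H S' (f a) (f b) \<le> K * word_dist G S a b" if ab: "a \<in> carrier G" "b \<in> carrier G" for a b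
  proof -
    obtain ws where ws: "length ws = word_length G S (inv\<^bsub>G\<^esub> a \<otimes>\<^bsub>G\<^esub> b)" "set ws \<subseteq> ?S" "inv\<^bsub>G\<^esub> a \<otimes>\<^bsub>G\<^esub> b = foldr (\<lambda>x y. x \<otimes>\<^bsub>G\<^esub> y) ws \<one>\<^bsub>G\<^esub>"
      using G.word_lengthE[OF S(2), of "inv\<^bsub>G\<^esub> a \<otimes>\<^bsub>G\<^esub> b"] S(3) ab by auto
    have "a \<otimes>\<^bsub>G\<^esub> (inv\<^bsub>G\<^esub> a \<otimes>\<^bsub>G\<^esub> b) = b" using ab by (simp add: G.m_assoc[symmetric])
    then show ?thesis using words[OF ws(2) ab(1)] ws by (simp add: word_dist_def)
  qed
  then show ?thesis using K by blast
qed

lemma quasi_isometric_groupsI: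
  assumes G: "group G" and H: "group H" and S: "finite S" "S \<subseteq> carrier G" "generate G S = carrier G"
    and S': "finite S'" "S' \<subseteq> carrier H" "generate H S' = carrier H"
    and f: "coarse_map G H f" and f': "coarse_map H G f'"
    and Y: "finite Y" "\<And>g. g \<in> carrier G \<Longrightarrow> inv\<^bsub>G\<^esub> g \<otimes>\<^bsub>G\<^esub> f' (f g) \<in> Y"
    and Y': "finite Y'" "\<And>h. h \<in> carrier H \<Longrightarrow> inv\<^bsub>H\<^esub> h \<otimes>\<^bsub>H\<^esub> f (f' h) \<in> Y'"
  shows "quasi_isometric_groups G H"
proof -
  interpret G: group G by fact
  interpret H: group H by fact
  obtain K1 where K1: "K1 \<ge> 0" "\<And>a b. a \<in> carrier G \<Longrightarrow> b \<in> carrier G \<Longrightarrow> word_dist H S' (f a) (f b) \<le> K1 * word_dist G S a b"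
    using coarse_map_lipschitz[OF G H S S'(2,3) f] by blast
  obtain K2 where K2: "K2 \<ge> 0" "\<And>a b. a \<in> carrier H \<Longrightarrow> b \<in> carrier H \<Longrightarrow> word_dist G S (f' a) (f' b) \<le> K2 * word_dist H S' a b"
    using coarse_map_lipschitz[OF H G S' S(2,3) f'] by blast
  define c where "c = (\<Sum>y\<in>Y. real (word_length G S y))"
  define c' where "c' = (\<Sum>y\<in>Y'. real (word_length H S' y))"
  have c: "0 \<le> c" "0 \<le> c'" by (simp_all add: c_def c'_def sum_nonneg)
  have fc: "f g \<in> carrier H" if "g \<in> carrier G" for g using f that by (auto simp: coarse_map_def)
  have fc': "f' g \<in> carrier G" if "g \<in> carrier H" for g using f' that by (auto simp: coarse_map_def)
  have n: "word_dist G S g (f' (f g)) \<le> c" if "g \<in> carrier G" for g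
    unfolding word_dist_def c_def using Y that by (intro member_le_sum) auto
  have n': "word_dist H S' h (f (f' h)) \<le> c'" if "h \<in> carrier H" for h
    unfolding word_dist_def c'_def using Y' that by (intro member_le_sum) auto
  define K where "K = K1 + K2 + 1"
  \<comment> \<open>\<open>2 * c\<close> replaces both points by their round trips in the lower
    bound, and \<open>c'\<close> serves the density of the image.\<close>
  define C where "C = 2 * c + c'"
  have pos: "0 \<le> word_dist G S a b" "0 \<le> word_dist H S' x y" for a b x y by (simp_all add: word_dist_def)
  have up: "word_dist H S' (f a) (f b) \<le> K * word_dist G S a b + C" if "a \<in> carrier G" "b \<in> carrier G" for a b
  proof -
    have "K1 * word_dist G S a b \<le> K * word_dist G S a b" using K1 K2 pos by (intro mult_right_mono) (auto simp: K_def)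
    then show ?thesis using K1(2)[OF that] c by (simp add: C_def)
  qed
  have low: "word_dist G S a b / K - C \<le> word_dist H S' (f a) (f b)" if ab: "a \<in> carrier G" "b \<in> carrier G" for a b
  proof -
    have 1: "word_dist G S a b \<le> word_dist G S a (f' (f a)) + word_dist G S (f' (f a)) b"
      using G.word_dist_triangle[OF S(2,3)] ab fc fc' by blast
    have 2: "word_dist G S (f' (f a)) b \<le> word_dist G S (f' (f a)) (f' (f b)) + word_dist G S (f' (f b)) b"
      using G.word_dist_triangle[OF S(2,3)] ab fc fc' by blast
    have 3: "word_dist G S (f' (f b)) b \<le> word_dist G S b (f' (f b))" using G.word_dist_sym[OF S(2,3)] ab fc fc' by blast
    have 4: "K2 * word_dist H S' (f a) (f b) \<le> K * word_dist H S' (f a) (f b)" using K1 K2 pos by (intro mult_right_mono) (auto simp: K_def)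
    have 5: "word_dist G S a b \<le> 2 * c + K * word_dist H S' (f a) (f b)"
      using 1 2 3 4 n[OF ab(1)] n[OF ab(2)] K2(2)[OF fc[OF ab(1)] fc[OF ab(2)]] by linarith
    have K: "1 \<le> K" using K1 K2 by (simp add: K_def)
    have "2 * c \<le> K * C" using c K mult_mono[of 1 K "2 * c" C] by (simp add: C_def)
    then have "word_dist G S a b \<le> K * (C + word_dist H S' (f a) (f b))" using 5 by (simp add: distrib_left)
    then have "word_dist G S a b / K \<le> C + word_dist H S' (f a) (f b)" using K by (simp add: pos_divide_le_eq mult.commute)
    then show ?thesis by simp
  qed
  have dense: "\<exists>x\<in>carrier G. word_dist H S' (f x) y \<le> C" if "y \<in> carrier H" for y
  proof (intro bexI)
    show "word_dist H S' (f (f' y)) y \<le> C"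
      using H.word_dist_sym[OF S'(2,3), of "f (f' y)" y] n'[OF that] fc fc' that c by (simp add: C_def)
  qed (use fc' that in auto)
  have "quasi_isometry (carrier G) (word_dist G S) (carrier H) (word_dist H S') f"
    unfolding quasi_isometry_def
  proof (intro conjI exI)
    show "f \<in> carrier G \<rightarrow> carrier H" using fc by auto
    show "1 \<le> K" "0 \<le> C" using K1 K2 c by (simp_all add: K_def C_def)
  qed (use up low dense in auto)
  then show ?thesis unfolding quasi_isometric_groups_def using S S' by blast
qed

section \<open>Groups acting on a tree times Euclidean space\<close>

lemma finite_int_vec: "finite {z :: int ^ 'n::finite. norm (rvec z) \<le> c}"
proof -
  have "vec_nth ` {z :: int ^ 'n. norm (rvec z) \<le> c} \<subseteq> {f. \<forall>i. f i \<in> {- \<lceil>c\<rceil>..\<lceil>c\<rceil>}}"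
  proof
    fix f assume "f \<in> vec_nth ` {z :: int ^ 'n. norm (rvec z) \<le> c}"
    then obtain z :: "int ^ 'n" where z: "f = vec_nth z" "norm (rvec z) \<le> c" by auto
    have "f i \<in> {- \<lceil>c\<rceil>..\<lceil>c\<rceil>}" for i
    proof -
      have "\<bar>real_of_int (f i)\<bar> \<le> c" using component_le_norm_cart[of "rvec z" i] z by (simp add: rvec_simps)
      then show ?thesis by (simp add: abs_le_iff) linarith
    qed
    then show "f \<in> {f. \<forall>i. f i \<in> {- \<lceil>c\<rceil>..\<lceil>c\<rceil>}}" by simp
  qed
  moreover have "finite {f :: 'n \<Rightarrow> int. \<forall>i. f i \<in> {- \<lceil>c\<rceil>..\<lceil>c\<rceil>}}"
    using finite_PiE[of "UNIV :: 'n set" "\<lambda>_. {- \<lceil>c\<rceil>..\<lceil>c\<rceil>}"] by (simp add: PiE_UNIV_domain Pi_def)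
  ultimately have "finite (vec_nth ` {z :: int ^ 'n. norm (rvec z) \<le> c})" by (rule finite_subset)
  then show ?thesis by (rule finite_imageD) (auto simp: inj_on_def vec_nth_inject)
qed

text \<open>The affine maps \<open>v \<mapsto> L g v + t g\<close> act on \<open>\<real>\<^sup>n\<close>, and the stabilizer of \<open>x0\<close> translates by the lattice \<open>B \<int>\<^sup>n\<close>.\<close>

locale lattice_action = tree_action C r G act L lam
  for C :: "('x \<times> 'x) set" and r and G :: "('g, 'm) monoid_scheme" (structure) and act and L :: "'g \<Rightarrow> real ^ 'n::finite ^ 'n" and lam +
  fixes t :: "'g \<Rightarrow> real ^ 'n" and x0 :: 'x and B :: "real ^ 'n ^ 'n"
  assumes x0: "x0 \<in> V" and lam_x0: "lam x0 = mat 1" and B: "invertible B"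
    and L_mult: "g \<in> carrier G \<Longrightarrow> h \<in> carrier G \<Longrightarrow> L (g \<otimes> h) = L g ** L h"
    and t_mult: "g \<in> carrier G \<Longrightarrow> h \<in> carrier G \<Longrightarrow> t (g \<otimes> h) = t g + L g *v t h"
    and stab_L: "g \<in> carrier G \<Longrightarrow> act g x0 = x0 \<Longrightarrow> L g = mat 1"
    and stab_t: "g \<in> carrier G \<Longrightarrow> act g x0 = x0 \<Longrightarrow> \<exists>z. t g = B *v rvec z"
    and stab_surj: "\<exists>g\<in>carrier G. act g x0 = x0 \<and> t g = B *v rvec z"
    and stab_inj: "g \<in> carrier G \<Longrightarrow> act g x0 = x0 \<Longrightarrow> h \<in> carrier G \<Longrightarrow> act h x0 = x0 \<Longrightarrow> t g = t h \<Longrightarrow> g = h"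
begin

lemma lam_L: "g \<in> carrier G \<Longrightarrow> lam (act g x0) = L g"
  using lam_act[OF _ x0] lam_x0 by simp

text \<open>Every edge is a translate of one of finitely many, and their heads are at bounded
  distance from \<open>x0\<close>.\<close>

lemma orbit_dense: "\<exists>M. \<forall>x\<in>V. \<exists>g\<in>carrier G. (act g x0, x) \<in> nb ^^ M"
proof -
  obtain X0 where X0: "finite X0" "X0 \<subseteq> C"
    "\<And>p x. (p, x) \<in> C \<Longrightarrow> \<exists>g q y. g \<in> carrier G \<and> (q, y) \<in> X0 \<and> act g q = p \<and> act g y = x" using reps by blast
  define M where "M = dep x0 + (\<Sum>e\<in>X0. dep (snd e))"
  have "\<exists>g\<in>carrier G. (act g x0, x) \<in> nb ^^ M" if "x \<in> V" for x
  proof (cases "x = r")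
    case True
    have "(x0, r) \<in> nb ^^ (dep x0 + dep r)" using nb_connected x0 root_V by blast
    then have "(x0, r) \<in> nb ^^ M" by (rule nb_mono[rotated]) (simp add: M_def dep_root)
    then show ?thesis using act_one[OF x0] True by (intro bexI[of _ \<one>]) auto
  next
    case False
    then obtain p where "(p, x) \<in> C" using V_cases[OF \<open>x \<in> V\<close>] by blast
    then obtain g q y where g: "g \<in> carrier G" "(q, y) \<in> X0" "act g y = x" using X0(3) by blast
    have "y \<in> V" using g X0 C_V2 by blast
    then have "(x0, y) \<in> nb ^^ (dep x0 + dep y)" using nb_connected x0 by blast
    moreover have "dep y \<le> (\<Sum>e\<in>X0. dep (snd e))" using member_le_sum[of "(q, y)" X0 "\<lambda>e. dep (snd e)"] X0(1) g by simp
    ultimately have "(x0, y) \<in> nb ^^ M" using nb_mono[of "dep x0 + dep y" M] by (simp add: M_def)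
    then show ?thesis using nb_act[OF g(1)] g by blast
  qed
  then show ?thesis by blast
qed

lemma nb_act_inv: "g \<in> carrier G \<Longrightarrow> h \<in> carrier G \<Longrightarrow> (act g x0, act h x0) \<in> nb ^^ k \<Longrightarrow> (x0, act (inv g \<otimes> h) x0) \<in> nb ^^ k"
  using nb_act[of "inv g" "act g x0" "act h x0" k] act_inv[of g x0] act_mult[of "inv g" h x0] x0 by simp

lemma t_inv_mult: "g \<in> carrier G \<Longrightarrow> h \<in> carrier G \<Longrightarrow> t (inv g \<otimes> h) = matrix_inv (L g) *v (t h - t g)"
proof -
  assume a: "g \<in> carrier G" "h \<in> carrier G"
  have "g \<otimes> (inv g \<otimes> h) = h" using a by (simp add: m_assoc[symmetric])
  then have "t h - t g = L g *v t (inv g \<otimes> h)" using t_mult[of g "inv g \<otimes> h"] a by simp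
  then show ?thesis using L_inv[OF a(1)] by (simp add: matrix_inv_cancel)
qed

lemma same_image_stab: "g \<in> carrier G \<Longrightarrow> h \<in> carrier G \<Longrightarrow> act g x0 = act h x0 \<Longrightarrow> act (inv g \<otimes> h) x0 = x0"
  using nb_act_inv[of g h 0] by simp

text \<open>Finitely many vertices are within distance \<open>k\<close>. Elements that carry
  \<open>x0\<close> to the same vertex differ by the stabilizer, where translation parts form a
  lattice and determine the element; a bound leaves finitely many.\<close>

lemma proper: "finite {g \<in> carrier G. (x0, act g x0) \<in> nb ^^ k \<and> norm (t g) \<le> c}"
proof -
  have one: "finite {g \<in> carrier G. act g x0 = y \<and> norm (t g) \<le> c}" (is "finite ?A") for y
  proof (cases "?A = {}")
    case False
    then obtain g0 where g0: "g0 \<in> carrier G" "act g0 x0 = y" by blast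
    let ?n = "real CARD('n)"
    let ?c = "?n * norm (matrix_inv B) * (?n * norm (matrix_inv (L g0)) * (c + norm (t g0)))"
    have z: "\<exists>z. t (inv g0 \<otimes> g) = B *v rvec z \<and> norm (rvec z) \<le> ?c" if g: "g \<in> ?A" for g
    proof -
      have gc: "g \<in> carrier G" "act g x0 = y" "norm (t g) \<le> c" using g by auto
      obtain z where z: "t (inv g0 \<otimes> g) = B *v rvec z" using stab_t[OF _ same_image_stab[OF g0(1) gc(1)]] g0 gc by auto
      have "matrix_inv B *v (B *v rvec z) = matrix_inv B *v (matrix_inv (L g0) *v (t g - t g0))"
        using t_inv_mult[OF g0(1) gc(1)] unfolding z by (rule arg_cong)
      then have "rvec z = matrix_inv B *v (matrix_inv (L g0) *v (t g - t g0))" unfolding matrix_inv_cancel(6)[OF B] .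
      moreover have "norm (matrix_inv B *v (matrix_inv (L g0) *v (t g - t g0))) \<le> ?n * norm (matrix_inv B) * norm (matrix_inv (L g0) *v (t g - t g0))"
        using op_bound_norm[of "matrix_inv B"] by (auto simp: op_bound_def)
      moreover have "norm (matrix_inv (L g0) *v (t g - t g0)) \<le> ?n * norm (matrix_inv (L g0)) * norm (t g - t g0)"
        using op_bound_norm[of "matrix_inv (L g0)"] by (auto simp: op_bound_def)
      moreover have "norm (t g - t g0) \<le> c + norm (t g0)" using norm_triangle_ineq4[of "t g" "t g0"] gc by linarith
      ultimately have "norm (rvec z) \<le> ?c"
        by (smt (verit, best) mult_left_mono mult_nonneg_nonneg norm_ge_zero of_nat_0_le_iff)
      then show ?thesis using z by blast
    qed
    have "(\<lambda>g. t (inv g0 \<otimes> g)) ` ?A \<subseteq> (\<lambda>z. B *v rvec z) ` {z. norm (rvec z) \<le> ?c}"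
    proof
      fix w assume "w \<in> (\<lambda>g. t (inv g0 \<otimes> g)) ` ?A"
      then obtain g where "g \<in> ?A" "w = t (inv g0 \<otimes> g)" by blast
      then show "w \<in> (\<lambda>z. B *v rvec z) ` {z. norm (rvec z) \<le> ?c}" using z[of g] by blast
    qed
    then have "finite ((\<lambda>g. t (inv g0 \<otimes> g)) ` ?A)" by (rule finite_subset) (intro finite_imageI finite_int_vec)
    moreover have "inj_on (\<lambda>g. t (inv g0 \<otimes> g)) ?A"
    proof (rule inj_onI)
      fix g h assume g: "g \<in> ?A" "h \<in> ?A" "t (inv g0 \<otimes> g) = t (inv g0 \<otimes> h)"
      then have "inv g0 \<otimes> g = inv g0 \<otimes> h" using same_image_stab g0 by (intro stab_inj) auto
      then show "g = h" using g g0 by (metis (mono_tags, lifting) inv_closed mem_Collect_eq Units_eq Units_l_cancel)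
    qed
    ultimately show ?thesis by (rule finite_imageD)
  qed (simp only: finite.emptyI)
  have "{g \<in> carrier G. (x0, act g x0) \<in> nb ^^ k \<and> norm (t g) \<le> c} \<subseteq> (\<Union>y\<in>{y. (x0, y) \<in> nb ^^ k}. {g \<in> carrier G. act g x0 = y \<and> norm (t g) \<le> c})"
    by auto
  moreover have "finite (\<Union>y\<in>{y. (x0, y) \<in> nb ^^ k}. {g \<in> carrier G. act g x0 = y \<and> norm (t g) \<le> c})"
    using finite_sphere[OF locally_finite x0, of k] one by (intro finite_UN_I) auto
  ultimately show ?thesis by (rule finite_subset)
qed

text \<open>The generators are a basis of the stabilizer together with one element for each orbit
  point within distance \<open>k\<close> of \<open>x0\<close>. An arbitrary element is reached along
  a path of the tree, each vertex of which is within \<open>M\<close> of the orbit.\<close>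

lemma finitely_generated: "\<exists>S. finite S \<and> S \<subseteq> carrier G \<and> generate G S = carrier G"
proof -
  obtain M where M: "\<And>x. x \<in> V \<Longrightarrow> \<exists>g\<in>carrier G. (act g x0, x) \<in> nb ^^ M" using orbit_dense by blast
  \<comment> \<open>\<open>M\<close> from an orbit point to the path, one edge along it, and
    \<open>M\<close> to the next orbit point.\<close>
  define k where "k = M + 1 + M"
  define Y where "Y = {y. (x0, y) \<in> nb ^^ k \<and> (\<exists>g\<in>carrier G. act g x0 = y)}"
  have fY: "finite Y" unfolding Y_def using finite_sphere[OF locally_finite x0, of k] by (auto intro: finite_subset[rotated])
  define p where "p y = (SOME g. g \<in> carrier G \<and> act g x0 = y)" for y
  have p: "p y \<in> carrier G \<and> act (p y) x0 = y" if "y \<in> Y" for y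
    unfolding p_def by (rule someI_ex) (use that in \<open>auto simp: Y_def\<close>)
  define q where "q i = (SOME g. g \<in> carrier G \<and> act g x0 = x0 \<and> t g = B *v rvec (axis i 1))" for i
  have q: "q i \<in> carrier G \<and> act (q i) x0 = x0 \<and> t (q i) = B *v rvec (axis i 1)" for i
    unfolding q_def using stab_surj[of "axis i 1"] by (rule_tac someI_ex) blast
  define S where "S = p ` Y \<union> range q"
  have S: "finite S" "S \<subseteq> carrier G" using fY p q by (auto simp: S_def)
  have gc: "generate G S \<subseteq> carrier G" using generate_incl S by blast
  \<comment> \<open>The lattice vectors whose translations in the stabilizer are generated; they
    form a subgroup that contains the basis.\<close>
  define Z where "Z = {z. \<exists>h\<in>generate G S. act h x0 = x0 \<and> t h = B *v rvec z}"
  have Z_add: "z + z' \<in> Z" if zz: "z \<in> Z" "z' \<in> Z" for z z'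
  proof -
    obtain h h' where h: "h \<in> generate G S" "act h x0 = x0" "t h = B *v rvec z" "h' \<in> generate G S" "act h' x0 = x0" "t h' = B *v rvec z'"
      using zz by (auto simp: Z_def)
    have hc: "h \<in> carrier G" "h' \<in> carrier G" using h gc by auto
    have "t (h \<otimes> h') = B *v rvec (z + z')" using t_mult hc stab_L h by (simp add: rvec_simps matrix_vector_right_distrib)
    moreover have "act (h \<otimes> h') x0 = x0" using act_mult hc x0 h by simp
    ultimately show ?thesis unfolding Z_def using generate.eng[OF h(1,4)] by (intro CollectI bexI[of _ "h \<otimes> h'"] conjI)
  qed
  have Z_neg: "- z \<in> Z" if z: "z \<in> Z" for z
  proof -
    obtain h where h: "h \<in> generate G S" "act h x0 = x0" "t h = B *v rvec z" using z by (auto simp: Z_def)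
    have hc: "h \<in> carrier G" using h gc by auto
    have t1: "t \<one> = 0" using t_mult[of \<one> \<one>] stab_L[of \<one>] act_one[OF x0] by simp
    have "t (inv h) = - t h" using t_mult[of h "inv h"] hc stab_L[OF hc h(2)] t1 by (simp add: eq_neg_iff_add_eq_0 add.commute)
    moreover have "act (inv h) x0 = x0" using act_inv[OF hc x0] h by simp
    moreover have "rvec (- z) = - rvec z" by (simp add: rvec_def vec_eq_iff)
    ultimately show ?thesis unfolding Z_def using generate_m_inv_closed[OF S(2) h(1)] h by (auto simp: vec.neg intro!: bexI[of _ "inv h"])
  qed
  have Z_0: "0 \<in> Z" using generate.one act_one[OF x0] t_mult[of \<one> \<one>] stab_L[of \<one>]
    by (auto simp: Z_def rvec_simps intro!: bexI[of _ \<one>])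
  have Z_ax: "axis i 1 \<in> Z" for i unfolding Z_def using q[of i] generate.incl[of "q i" S] by (auto simp: S_def)
  have Z_axk: "axis i k \<in> Z" for i k
  proof (induction k rule: int_induct[of _ 0])
    case base
    then show ?case using Z_0 by (simp add: zero_vec_def axis_def)
  next
    case (step1 j)
    have "axis i (j + 1) = axis i j + axis i 1" by (simp add: axis_def vec_eq_iff)
    then show ?case using Z_add step1 Z_ax by metis
  next
    case (step2 j)
    have "axis i (j - 1) = axis i j + - axis i 1" by (simp add: axis_def vec_eq_iff)
    then show ?case using Z_add step2 Z_ax Z_neg by metis
  qed
  have Z_sum: "(\<Sum>i\<in>I. axis i (z $ i)) \<in> Z" if "finite I" for I and z :: "int ^ 'n"
    using that by (induction I) (auto simp: Z_0 intro: Z_add Z_axk)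
  have Z_all: "z \<in> Z" for z
  proof -
    have "z = (\<Sum>i\<in>UNIV. axis i (z $ i))" by (simp add: vec_eq_iff axis_def if_distrib cong: if_cong)
    then show ?thesis using Z_sum[of UNIV z] by simp
  qed
  have H: "h \<in> generate G S" if h: "h \<in> carrier G" "act h x0 = x0" for h
  proof -
    obtain z where z: "t h = B *v rvec z" using stab_t h by blast
    obtain h' where h': "h' \<in> generate G S" "act h' x0 = x0" "t h' = B *v rvec z" using Z_all[of z] by (auto simp: Z_def)
    then have "h = h'" using stab_inj h z gc by auto
    then show ?thesis using h' by simp
  qed
  have U: "g \<in> generate G S" if g: "g \<in> carrier G" "(x0, act g x0) \<in> nb ^^ k" for g
  proof -
    have y: "act g x0 \<in> Y" using g by (auto simp: Y_def)
    have "inv (p (act g x0)) \<otimes> g \<in> generate G S" using H same_image_stab p[OF y] g by simp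
    moreover have "p (act g x0) \<in> generate G S" using y by (auto simp: S_def intro: generate.incl)
    moreover have "p (act g x0) \<otimes> (inv (p (act g x0)) \<otimes> g) = g" using p[OF y] g by (simp add: m_assoc[symmetric])
    ultimately show ?thesis using generate.eng by metis
  qed
  have all: "g \<in> generate G S" if "g \<in> carrier G" "x \<in> V" "(x0, x) \<in> nb ^^ m" "(act g x0, x) \<in> nb ^^ M" for g x m
    using that
  proof (induction m arbitrary: g x)
    case 0
    then have "(x0, act g x0) \<in> nb ^^ M" using relpow_sym[OF nb_sym] by auto
    then have "(x0, act g x0) \<in> nb ^^ k" by (rule nb_mono[rotated]) (simp add: k_def)
    then show ?case using U 0 by blast
  next
    case (Suc m)
    then obtain y where y: "(x0, y) \<in> nb ^^ m" "(y, x) \<in> nb" by auto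
    have yV: "y \<in> V" using y nb_relpow_V x0 by blast
    obtain h where h: "h \<in> carrier G" "(act h x0, y) \<in> nb ^^ M" using M[OF yV] by blast
    have hg: "h \<in> generate G S" using Suc.IH[OF h(1) yV y(1) h(2)] .
    have "(act h x0, x) \<in> nb ^^ (M + 1)" using h(2) y(2) by auto
    then have "(act h x0, act g x0) \<in> nb ^^ k" unfolding k_def
      by (rule relpow_trans_add) (rule relpow_sym[OF nb_sym Suc.prems(4)])
    then have "inv h \<otimes> g \<in> generate G S" using U nb_act_inv h Suc by simp
    moreover have "h \<otimes> (inv h \<otimes> g) = g" using h Suc by (simp add: m_assoc[symmetric])
    ultimately show ?case using generate.eng hg by metis
  qed
  have "g \<in> generate G S" if g: "g \<in> carrier G" for g
  proof (rule all[OF g])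
    show "act g x0 \<in> V" using act_V g x0 by blast
    then show "(x0, act g x0) \<in> nb ^^ (dep x0 + dep (act g x0))" using nb_connected x0 by blast
    show "(act g x0, act g x0) \<in> nb ^^ M" using nb_mono[of 0 M] by simp
  qed
  then show ?thesis using S gc by blast
qed

lemma lam_nb:
  assumes s: "1 \<le> s" "\<And>x y. (x, y) \<in> C \<Longrightarrow> close s (lam x) (lam y)" and x: "x \<in> V" "(x, y) \<in> nb ^^ k"
  shows "close (s ^ k) (lam x) (lam y)"
  using x(2)
proof (induction k arbitrary: y)
  case 0
  then show ?case using close_refl lam_inv x by auto
next
  case (Suc k)
  then obtain z where z: "(x, z) \<in> nb ^^ k" "(z, y) \<in> nb" by auto
  have zV: "z \<in> V" using z nb_relpow_V x by blast
  have "close s (lam z) (lam y)"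
    using z(2) s(2)[of z y] close_sym[OF s(2)[of y z]] close_refl[OF lam_inv[OF zV] s(1)] by (auto simp: nb_def)
  then have "close (s ^ k * s) (lam x) (lam y)" using Suc z close_trans by blast
  then show ?case by (simp add: mult.commute)
qed

end

lemma close_op_bound: "close c p q \<Longrightarrow> norm (matrix_inv p *v (q *v v)) \<le> c * norm v"
  by (auto simp: close_def op_bound_def matrix_vector_mul_assoc)

text \<open>\<open>norm (matrix_inv p *v v)\<close> is the norm of \<open>v\<close> in the fibre
  over a vertex labelled \<open>p\<close>, so close labels give equivalent fibre norms.\<close>

lemma close_change:
  assumes "close c p q" "norm (matrix_inv q *v v) \<le> d" shows "norm (matrix_inv p *v v) \<le> c * d"
proof -
  have q: "invertible q" "0 \<le> c" using close_inv[OF assms(1)] by auto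
  have "norm (matrix_inv p *v (q *v (matrix_inv q *v v))) \<le> c * norm (matrix_inv q *v v)" by (rule close_op_bound[OF assms(1)])
  also have "\<dots> \<le> c * d" using assms q by (intro mult_left_mono) auto
  finally show ?thesis using q by (simp add: matrix_inv_cancel)
qed

section \<open>Matched actions\<close>

locale matched_actions = T: lattice_action C r G act L lam t x0 B + T': lattice_action C' r' G' act' L' lam' t' x0' B'
  for C :: "('x \<times> 'x) set" and r and G :: "('g, 'm) monoid_scheme" and act and L :: "'g \<Rightarrow> real ^ 'n::finite ^ 'n" and lam and t and x0 and B
    and C' :: "('y \<times> 'y) set" and r' and G' :: "('h, 'k) monoid_scheme" and act' and L' :: "'h \<Rightarrow> real ^ 'n ^ 'n" and lam' and t' and x0' and B' +
  fixes F :: "'x \<Rightarrow> 'y" and F' :: "'y \<Rightarrow> 'x" and D :: nat and c :: real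
  assumes F_V: "x \<in> T.V \<Longrightarrow> F x \<in> T'.V" and F'_V: "y \<in> T'.V \<Longrightarrow> F' y \<in> T.V"
    and F_close: "x \<in> T.V \<Longrightarrow> close c (lam x) (lam' (F x))"
    and F'_close: "y \<in> T'.V \<Longrightarrow> close c (lam' y) (lam (F' y))"
    and F_nb: "x \<in> T.V \<Longrightarrow> (x, x1) \<in> C \<Longrightarrow> (F x, F x1) \<in> T'.nb ^^ D"
    and F'_nb: "y \<in> T'.V \<Longrightarrow> (y, y1) \<in> C' \<Longrightarrow> (F' y, F' y1) \<in> T.nb ^^ D"
    and F'F: "x \<in> T.V \<Longrightarrow> (F' (F x), x) \<in> T.nb ^^ D"
    and FF': "y \<in> T'.V \<Longrightarrow> (F (F' y), y) \<in> T'.nb ^^ D"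
begin

lemma swap: "matched_actions C' r' G' act' L' lam' t' x0' B' C r G act L lam t x0 B F' F D c"
  by unfold_locales (use F_V F'_V F_close F'_close F_nb F'_nb F'F FF' in auto)

lemma F_relpow: "x \<in> T.V \<Longrightarrow> (x, y) \<in> T.nb ^^ k \<Longrightarrow> (F x, F y) \<in> T'.nb ^^ (k * D)"
proof (induction k arbitrary: y)
  case (Suc k)
  then obtain z where z: "(x, z) \<in> T.nb ^^ k" "(z, y) \<in> T.nb" by auto
  have zV: "z \<in> T.V" "y \<in> T.V" using z Suc T.nb_relpow_V T.nb_V by blast+
  have "(F z, F y) \<in> T'.nb ^^ D"
    using z(2) F_nb[of z y] relpow_sym[OF T'.nb_sym F_nb[of y z]] T'.nb_mono[of 0 D "F z" "F z"] zV by (auto simp: T.nb_def)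
  then have "(F x, F y) \<in> T'.nb ^^ (k * D + D)" using Suc z by (intro relpow_trans_add[of _ "F z"]) auto
  then show ?case by (simp add: add.commute)
qed simp

text \<open>The metric on the fibre \<open>\<real>\<^sup>n\<close> over a vertex is pulled back by the inverse of the label, so \<open>good m d g h\<close> says that the
  orbit points of \<open>g\<close> and \<open>h\<close> in tree times \<open>\<real>\<^sup>n\<close> correspond up to \<open>m\<close> in the tree and \<open>d\<close> in the fibre.\<close>

definition good :: "nat \<Rightarrow> real \<Rightarrow> 'g \<Rightarrow> 'h \<Rightarrow> bool" where
  "good m d g h \<longleftrightarrow> g \<in> carrier G \<and> h \<in> carrier G' \<and> (act' h x0', F (act g x0)) \<in> T'.nb ^^ m
     \<and> norm (matrix_inv (L' h) *v (t' h - t g)) \<le> d"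

lemma good_mono: "good m d g h \<Longrightarrow> m \<le> m' \<Longrightarrow> d \<le> d' \<Longrightarrow> good m' d' g h"
  unfolding good_def using T'.nb_mono by fastforce

text \<open>First an orbit point near \<open>F (act g x0)\<close> is found. The stabilizer of
  \<open>x0'\<close> then corrects the fibre coordinate up to a fundamental cell of the lattice,
  without moving the point in the tree.\<close>

lemma good_exists: "\<exists>m d. \<forall>g\<in>carrier G. \<exists>h. good m d g h"
proof -
  obtain M where M: "\<And>y. y \<in> T'.V \<Longrightarrow> \<exists>h\<in>carrier G'. (act' h x0', y) \<in> T'.nb ^^ M" using T'.orbit_dense by blast
  let ?n = "real CARD('n)"
  let ?d = "?n * norm B' * ?n"
  have "\<exists>h. good M ?d g h" if g: "g \<in> carrier G" for g
  proof -
    have "F (act g x0) \<in> T'.V" using F_V T.act_V g T.x0 by blast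
    then obtain h1 where h1: "h1 \<in> carrier G'" "(act' h1 x0', F (act g x0)) \<in> T'.nb ^^ M" using M by blast
    \<comment> \<open>\<open>v\<close> is the offset in lattice coordinates, and translating by
      \<open>z\<close> leaves its fractional parts.\<close>
    define v where "v = matrix_inv B' *v (matrix_inv (L' h1) *v (t' h1 - t g))"
    define z :: "int ^ 'n" where "z = (\<chi> i. - \<lfloor>v $ i\<rfloor>)"
    have "norm (v + rvec z) \<le> (\<Sum>i\<in>UNIV. \<bar>(v + rvec z) $ i\<bar>)" by (rule norm_le_l1_cart)
    also have "\<dots> \<le> (\<Sum>i\<in>(UNIV :: 'n set). 1)"
    proof (rule sum_mono)
      fix i
      have "(v + rvec z) $ i = v $ i - real_of_int \<lfloor>v $ i\<rfloor>" by (simp add: rvec_simps z_def)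
      then show "\<bar>(v + rvec z) $ i\<bar> \<le> 1" by linarith
    qed
    finally have vz: "norm (v + rvec z) \<le> ?n" by simp
    obtain k where k: "k \<in> carrier G'" "act' k x0' = x0'" "t' k = B' *v rvec z" using T'.stab_surj by blast
    let ?h = "h1 \<otimes>\<^bsub>G'\<^esub> k"
    have h: "?h \<in> carrier G'" using h1 k by simp
    have a: "act' ?h x0' = act' h1 x0'" using T'.act_mult h1 k T'.x0 by simp
    have L: "L' ?h = L' h1" using T'.L_mult h1 k T'.stab_L by simp
    have "matrix_inv (L' ?h) *v (t' ?h - t g) = matrix_inv (L' h1) *v (t' h1 - t g) + t' k"
      using T'.t_mult[OF h1(1) k(1)] T'.L_inv[OF h1(1)] unfolding L
      by (simp add: matrix_vector_right_distrib matrix_vector_mult_diff_distrib matrix_inv_cancel)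
    also have "matrix_inv (L' h1) *v (t' h1 - t g) = B' *v v" using T'.B by (simp add: v_def matrix_inv_cancel)
    also have "B' *v v + t' k = B' *v (v + rvec z)" by (simp add: k matrix_vector_right_distrib)
    also have "norm \<dots> \<le> ?n * norm B' * norm (v + rvec z)" using op_bound_norm[of B'] unfolding op_bound_def by blast
    also have "\<dots> \<le> ?d" using vz by (intro mult_left_mono) auto
    finally show ?thesis using g h h1 a unfolding good_def by (intro exI[of _ ?h]) auto
  qed
  then show ?thesis by blast
qed

lemma good_close:
  "\<exists>e. \<forall>g h. good m d g h \<longrightarrow> close e (L' h) (L g)"
proof -
  obtain s where s: "1 \<le> s" "\<And>x y. (x, y) \<in> C' \<Longrightarrow> close s (lam' x) (lam' y)" using T'.lam_step by blast
  have "close (s ^ m * c) (L' h) (L g)" if "good m d g h" for g h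
  proof -
    have gh: "g \<in> carrier G" "h \<in> carrier G'" "(act' h x0', F (act g x0)) \<in> T'.nb ^^ m" using that by (auto simp: good_def)
    have V: "act g x0 \<in> T.V" "act' h x0' \<in> T'.V" using T.act_V T'.act_V gh T.x0 T'.x0 by auto
    have "close (s ^ m) (lam' (act' h x0')) (lam' (F (act g x0)))" using T'.lam_nb[OF s V(2) gh(3)] .
    moreover have "close c (lam' (F (act g x0))) (lam (act g x0))" using F_close[OF V(1)] close_sym by blast
    ultimately show ?thesis using close_trans T.lam_L T'.lam_L gh by metis
  qed
  then show ?thesis by blast
qed

text \<open>Partners of nearby orbit points are near each other, in the tree by
  \<open>F_relpow\<close> and in the fibre by the triangle inequality; \<open>T'.proper\<close> then
  leaves finitely many differences.\<close>

lemma coarse: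
  "\<exists>Y. finite Y \<and> (\<forall>g g' h h'. good m d g g' \<longrightarrow> good m d h h' \<longrightarrow> (act g x0, act h x0) \<in> T.nb ^^ a \<longrightarrow>
     norm (matrix_inv (L g) *v (t h - t g)) \<le> b \<longrightarrow> inv\<^bsub>G'\<^esub> g' \<otimes>\<^bsub>G'\<^esub> h' \<in> Y)"
proof -
  obtain s where s: "1 \<le> s" "\<And>x y. (x, y) \<in> C' \<Longrightarrow> close s (lam' x) (lam' y)" using T'.lam_step by blast
  obtain e where e: "\<And>g h. good m d g h \<Longrightarrow> close e (L' h) (L g)" using good_close by blast
  define N where "N = m + a * D + m"
  define Y where "Y = {k \<in> carrier G'. (x0', act' k x0') \<in> T'.nb ^^ N \<and> norm (t' k) \<le> s ^ N * d + e * b + d}"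
  have "inv\<^bsub>G'\<^esub> g' \<otimes>\<^bsub>G'\<^esub> h' \<in> Y"
    if gg: "good m d g g'" and hh: "good m d h h'" and a: "(act g x0, act h x0) \<in> T.nb ^^ a"
      and b: "norm (matrix_inv (L g) *v (t h - t g)) \<le> b" for g g' h h'
  proof -
    have cr: "g \<in> carrier G" "h \<in> carrier G" "g' \<in> carrier G'" "h' \<in> carrier G'" using gg hh by (auto simp: good_def)
    have V: "act g x0 \<in> T.V" "act h x0 \<in> T.V" "act' g' x0' \<in> T'.V" using T.act_V T'.act_V cr T.x0 T'.x0 by auto
    have "(F (act g x0), F (act h x0)) \<in> T'.nb ^^ (a * D)" using F_relpow[OF V(1) a] .
    moreover have "(act' g' x0', F (act g x0)) \<in> T'.nb ^^ m" "(act' h' x0', F (act h x0)) \<in> T'.nb ^^ m" using gg hh by (auto simp: good_def)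
    ultimately have nb: "(act' g' x0', act' h' x0') \<in> T'.nb ^^ N" unfolding N_def
      using relpow_trans_add[OF relpow_trans_add relpow_sym[OF T'.nb_sym]] by metis
    then have cl: "close (s ^ N) (L' g') (L' h')" using T'.lam_nb[OF s V(3)] T'.lam_L cr by metis
    let ?M = "matrix_inv (L' g')"
    \<comment> \<open>The way from \<open>g'\<close> to \<open>h'\<close> is taken via
      \<open>g\<close> and \<open>h\<close>. All three terms are measured in the fibre over
      \<open>g'\<close>; the first two are known over \<open>h'\<close> and \<open>g\<close>, so
      they need a change of fibre norm.\<close>
    have "t' (inv\<^bsub>G'\<^esub> g' \<otimes>\<^bsub>G'\<^esub> h') = ?M *v (t' h' - t h) + ?M *v (t h - t g) - ?M *v (t' g' - t g)"
      using T'.t_inv_mult cr by (simp add: matrix_vector_mult_diff_distrib)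
    then have "norm (t' (inv\<^bsub>G'\<^esub> g' \<otimes>\<^bsub>G'\<^esub> h')) \<le> norm (?M *v (t' h' - t h)) + norm (?M *v (t h - t g)) + norm (?M *v (t' g' - t g))"
      using norm_triangle_ineq4[of "?M *v (t' h' - t h) + ?M *v (t h - t g)" "?M *v (t' g' - t g)"]
        norm_triangle_ineq[of "?M *v (t' h' - t h)" "?M *v (t h - t g)"] by simp
    moreover have "norm (?M *v (t' h' - t h)) \<le> s ^ N * d" using close_change[OF cl] hh by (simp add: good_def)
    moreover have "norm (?M *v (t h - t g)) \<le> e * b" using close_change[OF e[OF gg] b] .
    moreover have "norm (?M *v (t' g' - t g)) \<le> d" using gg by (simp add: good_def)
    ultimately have "norm (t' (inv\<^bsub>G'\<^esub> g' \<otimes>\<^bsub>G'\<^esub> h')) \<le> s ^ N * d + e * b + d" by linarith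
    then show ?thesis unfolding Y_def using T'.nb_act_inv nb cr by simp
  qed
  moreover have "finite Y" unfolding Y_def by (rule T'.proper)
  ultimately show ?thesis by blast
qed

text \<open>Right multiplication by \<open>b\<close> moves the orbit point of each \<open>g\<close>
  by a translate of one displacement, so \<open>coarse\<close> gives a single finite set for all
  \<open>g\<close>.\<close>

lemma coarse_map:
  assumes f: "\<And>g. g \<in> carrier G \<Longrightarrow> good m d g (f g)"
  shows "coarse_map G G' f"
  unfolding coarse_map_def
proof (intro conjI ballI)
  show "f \<in> carrier G \<rightarrow> carrier G'" using f by (auto simp: good_def)
  fix b assume b: "b \<in> carrier G"
  define a where "a = T.dep x0 + T.dep (act b x0)"
  have ab: "(x0, act b x0) \<in> T.nb ^^ a" unfolding a_def using T.nb_connected T.act_V T.x0 b by blast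
  obtain Y where Y: "finite Y" "\<And>g g' h h'. good m d g g' \<Longrightarrow> good m d h h' \<Longrightarrow> (act g x0, act h x0) \<in> T.nb ^^ a \<Longrightarrow>
     norm (matrix_inv (L g) *v (t h - t g)) \<le> norm (t b) \<Longrightarrow> inv\<^bsub>G'\<^esub> g' \<otimes>\<^bsub>G'\<^esub> h' \<in> Y" using coarse by metis
  have "inv\<^bsub>G'\<^esub> (f g) \<otimes>\<^bsub>G'\<^esub> f (g \<otimes>\<^bsub>G\<^esub> b) \<in> Y" if g: "g \<in> carrier G" for g
  proof (rule Y(2)[OF f f])
    show "g \<in> carrier G" "g \<otimes>\<^bsub>G\<^esub> b \<in> carrier G" using g b by auto
    show "(act g x0, act (g \<otimes>\<^bsub>G\<^esub> b) x0) \<in> T.nb ^^ a" using T.nb_act[OF g ab] T.act_mult g b T.x0 by simp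
    have "t (g \<otimes>\<^bsub>G\<^esub> b) - t g = L g *v t b" using T.t_mult[OF g b] by simp
    then show "norm (matrix_inv (L g) *v (t (g \<otimes>\<^bsub>G\<^esub> b) - t g)) \<le> norm (t b)"
      using T.L_inv[OF g] by (simp add: matrix_inv_cancel)
  qed
  then show "\<exists>Y. finite Y \<and> (\<forall>g\<in>carrier G. inv\<^bsub>G'\<^esub> (f g) \<otimes>\<^bsub>G'\<^esub> f (g \<otimes>\<^bsub>G\<^esub> b) \<in> Y)" using Y(1) by blast
qed

interpretation S: matched_actions C' r' G' act' L' lam' t' x0' B' C r G act L lam t x0 B F' F D c
  by (rule swap)

text \<open>The tree coordinate returns by \<open>F'F\<close>. The fibre coordinate changes only by
  the two errors \<open>d\<close>, because the underlying map is the identity on fibres.\<close>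

lemma round_trip:
  "\<exists>Y. finite Y \<and> (\<forall>g h k. good m d g h \<longrightarrow> S.good m d h k \<longrightarrow> inv\<^bsub>G\<^esub> g \<otimes>\<^bsub>G\<^esub> k \<in> Y)"
proof -
  obtain s where s: "1 \<le> s" "\<And>x y. (x, y) \<in> C \<Longrightarrow> close s (lam x) (lam y)" using T.lam_step by blast
  obtain e where e: "\<And>g h. good m d g h \<Longrightarrow> close e (L' h) (L g)" using good_close by blast
  define N where "N = D + (m * D + m)"
  define Y where "Y = {k \<in> carrier G. (x0, act k x0) \<in> T.nb ^^ N \<and> norm (t k) \<le> s ^ N * d + e * d}"
  have "inv\<^bsub>G\<^esub> g \<otimes>\<^bsub>G\<^esub> k \<in> Y" if gh: "good m d g h" and hk: "S.good m d h k" for g h k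
  proof -
    have cr: "g \<in> carrier G" "h \<in> carrier G'" "k \<in> carrier G" using gh hk by (auto simp: good_def S.good_def)
    have V: "act g x0 \<in> T.V" "act' h x0' \<in> T'.V" using T.act_V T'.act_V cr T.x0 T'.x0 by auto
    have "(act' h x0', F (act g x0)) \<in> T'.nb ^^ m" using gh by (simp add: good_def)
    then have 1: "(F' (F (act g x0)), F' (act' h x0')) \<in> T.nb ^^ (m * D)"
      using relpow_sym[OF T.nb_sym S.F_relpow[OF V(2)]] by blast
    have 2: "(act g x0, F' (F (act g x0))) \<in> T.nb ^^ D" by (rule relpow_sym[OF T.nb_sym F'F[OF V(1)]])
    have 3: "(F' (act' h x0'), act k x0) \<in> T.nb ^^ m" by (rule relpow_sym[OF T.nb_sym]) (use hk in \<open>simp add: S.good_def\<close>)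
    have nb: "(act g x0, act k x0) \<in> T.nb ^^ N" unfolding N_def by (rule relpow_trans_add[OF 2 relpow_trans_add[OF 1 3]])
    have cl: "close (s ^ N) (L g) (L k)" using T.lam_nb[OF s V(1) nb] T.lam_L cr by metis
    let ?M = "matrix_inv (L g)"
    have "t k - t g = (t k - t' h) + (t' h - t g)" by simp
    then have "t (inv\<^bsub>G\<^esub> g \<otimes>\<^bsub>G\<^esub> k) = ?M *v (t k - t' h) + ?M *v (t' h - t g)"
      using T.t_inv_mult cr by (simp only: matrix_vector_right_distrib)
    then have "norm (t (inv\<^bsub>G\<^esub> g \<otimes>\<^bsub>G\<^esub> k)) \<le> norm (?M *v (t k - t' h)) + norm (?M *v (t' h - t g))"
      using norm_triangle_ineq by metis
    moreover have "norm (?M *v (t k - t' h)) \<le> s ^ N * d" using close_change[OF cl] hk by (simp add: S.good_def)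
    moreover have "norm (?M *v (t' h - t g)) \<le> e * d" using close_change[OF close_sym[OF e[OF gh]]] gh by (simp add: good_def)
    ultimately have "norm (t (inv\<^bsub>G\<^esub> g \<otimes>\<^bsub>G\<^esub> k)) \<le> s ^ N * d + e * d" by linarith
    then show ?thesis unfolding Y_def using T.nb_act_inv nb cr by simp
  qed
  moreover have "finite Y" unfolding Y_def by (rule T.proper)
  ultimately show ?thesis by blast
qed

end

theorem (in matched_actions) quasi_isometric: "quasi_isometric_groups G G'"
proof -
  interpret S: matched_actions C' r' G' act' L' lam' t' x0' B' C r G act L lam t x0 B F' F D c by (rule swap)
  obtain m1 d1 where 1: "\<And>g. g \<in> carrier G \<Longrightarrow> \<exists>h. good m1 d1 g h" using good_exists by blast
  obtain m2 d2 where 2: "\<And>h. h \<in> carrier G' \<Longrightarrow> \<exists>g. S.good m2 d2 h g" using S.good_exists by blast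
  let ?m = "m1 + m2" and ?d = "max d1 d2"
  have "\<exists>h. good ?m ?d g h" if "g \<in> carrier G" for g using 1[OF that] good_mono[of m1 d1 g _ ?m ?d] by (meson le_add1 max.cobounded1)
  then have "\<exists>f. \<forall>g\<in>carrier G. good ?m ?d g (f g)" by (intro bchoice ballI)
  then obtain f where f: "\<And>g. g \<in> carrier G \<Longrightarrow> good ?m ?d g (f g)" by blast
  have "\<exists>g. S.good ?m ?d h g" if "h \<in> carrier G'" for h using 2[OF that] S.good_mono[of m2 d2 h _ ?m ?d] by (meson le_add2 max.cobounded2)
  then have "\<exists>f'. \<forall>h\<in>carrier G'. S.good ?m ?d h (f' h)" by (intro bchoice ballI)
  then obtain f' where f': "\<And>h. h \<in> carrier G' \<Longrightarrow> S.good ?m ?d h (f' h)" by blast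
  have fc: "f g \<in> carrier G'" if "g \<in> carrier G" for g using f[OF that] by (simp add: good_def)
  have fc': "f' g \<in> carrier G" if "g \<in> carrier G'" for g using f'[OF that] by (simp add: S.good_def)
  obtain S1 where S1: "finite S1" "S1 \<subseteq> carrier G" "generate G S1 = carrier G" using T.finitely_generated by blast
  obtain S2 where S2: "finite S2" "S2 \<subseteq> carrier G'" "generate G' S2 = carrier G'" using T'.finitely_generated by blast
  obtain Y where Y: "finite Y" "\<forall>g h k. good ?m ?d g h \<longrightarrow> S.good ?m ?d h k \<longrightarrow> inv\<^bsub>G\<^esub> g \<otimes>\<^bsub>G\<^esub> k \<in> Y"
    using round_trip[of ?m ?d] by (elim exE conjE)
  obtain Y' where Y': "finite Y'" "\<forall>g h k. S.good ?m ?d g h \<longrightarrow> good ?m ?d h k \<longrightarrow> inv\<^bsub>G'\<^esub> g \<otimes>\<^bsub>G'\<^esub> k \<in> Y'"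
    using S.round_trip[of ?m ?d] by (elim exE conjE)
  have near: "inv\<^bsub>G\<^esub> g \<otimes>\<^bsub>G\<^esub> f' (f g) \<in> Y" if "g \<in> carrier G" for g using Y(2) f[OF that] f'[OF fc[OF that]] by simp
  have near': "inv\<^bsub>G'\<^esub> h \<otimes>\<^bsub>G'\<^esub> f (f' h) \<in> Y'" if "h \<in> carrier G'" for h using Y'(2) f'[OF that] f[OF fc'[OF that]] by simp
  show ?thesis
    by (rule quasi_isometric_groupsI[OF T.group_axioms T'.group_axioms S1 S2 coarse_map[OF f] S.coarse_map[OF f'] Y(1) near Y'(1) near'])
qed

section \<open>From labels at bounded Hausdorff distance to a matching of the trees\<close>

locale two_actions = T: lattice_action C r G act L lam t x0 B + T': lattice_action C' r' G' act' L' lam' t' x0' B'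
  for C :: "('x \<times> 'x) set" and r and G :: "('g, 'm) monoid_scheme" and act and L :: "'g \<Rightarrow> real ^ 'n::finite ^ 'n" and lam and t and x0 and B
    and C' :: "('y \<times> 'y) set" and r' and G' :: "('h, 'k) monoid_scheme" and act' and L' :: "'h \<Rightarrow> real ^ 'n ^ 'n" and lam' and t' and x0' and B' +
  assumes Hausdorff: "\<exists>k. (\<forall>x\<in>T.V. \<exists>y\<in>T'.V. close k (lam x) (lam' y)) \<and> (\<forall>y\<in>T'.V. \<exists>x\<in>T.V. close k (lam' y) (lam x))"
begin

text \<open>One unit \<open>E\<close> must serve both trees, so a label of either tree may become a
  target in the other. The Hausdorff bound \<open>k\<close> replaces such a target by a label of the
  tree in which steering takes place.\<close>

theorem quasi_isometric: "quasi_isometric_groups G G'"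
proof -
  obtain k0 where k0: "\<And>x. x \<in> T.V \<Longrightarrow> \<exists>y\<in>T'.V. close k0 (lam x) (lam' y)"
    "\<And>y. y \<in> T'.V \<Longrightarrow> \<exists>x\<in>T.V. close k0 (lam' y) (lam x)" using Hausdorff by blast
  define k where "k = max 1 k0"
  have k: "1 \<le> k" "\<And>x. x \<in> T.V \<Longrightarrow> \<exists>y\<in>T'.V. close k (lam x) (lam' y)"
    "\<And>y. y \<in> T'.V \<Longrightarrow> \<exists>x\<in>T.V. close k (lam' y) (lam x)"
  proof -
    have m: "close k p q" if "close k0 p q" for p q by (rule close_mono[OF that]) (simp add: k_def)
    show "1 \<le> k" by (simp add: k_def)
    show "\<exists>y\<in>T'.V. close k (lam x) (lam' y)" if "x \<in> T.V" for x using k0(1)[OF that] m by blast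
    show "\<exists>x\<in>T.V. close k (lam' y) (lam x)" if "y \<in> T'.V" for y using k0(2)[OF that] m by blast
  qed
  obtain s1 where s1: "1 \<le> s1" "\<And>x y. (x, y) \<in> C \<Longrightarrow> close s1 (lam x) (lam y)"
    "\<And>c. \<exists>R0. \<forall>x\<in>T.core. \<forall>z\<in>T.V. close c (lam x) (lam z) \<longrightarrow> (\<exists>y\<in>T.core. \<exists>j\<le>R0. (x, y) \<in> C ^^ j \<and> close s1 (lam z) (lam y))"
    using T.steer_exists by metis
  obtain s2 where s2: "1 \<le> s2" "\<And>x y. (x, y) \<in> C' \<Longrightarrow> close s2 (lam' x) (lam' y)"
    "\<And>c. \<exists>R0. \<forall>x\<in>T'.core. \<forall>z\<in>T'.V. close c (lam' x) (lam' z) \<longrightarrow> (\<exists>y\<in>T'.core. \<exists>j\<le>R0. (x, y) \<in> C' ^^ j \<and> close s2 (lam' z) (lam' y))"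
    using T'.steer_exists by metis
  define s where "s = max s1 s2"
  \<comment> \<open>\<open>s * s\<close> covers siblings, \<open>k * s\<close> covers steering
    towards a replaced target, and \<open>k\<close> the comparison of the roots.\<close>
  define c where "c = s * s * k"
  have s: "1 \<le> s" "s1 \<le> s" "s2 \<le> s" using s1 by (auto simp: s_def)
  have ss: "s \<le> s * s" using s mult_mono[of 1 s s s] by simp
  have s22: "1 \<le> s * s" using s ss by linarith
  have "1 * k \<le> s * s * k" "s * s * 1 \<le> s * s * k" "s * k \<le> s * s * k"
    using mult_right_mono[OF s22, of k] mult_left_mono[OF k(1), of "s * s"] mult_right_mono[OF ss, of k] k(1) s22 by auto
  then have c: "s * s \<le> c" "k \<le> c" "k * s \<le> c" "s \<le> c" "1 \<le> c"
    using s(1) ss k(1) s22 unfolding c_def mult.commute[of k s] by linarith+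
  define \<Lambda> where "\<Lambda> = lam ` T.V \<union> lam' ` T'.V"
  \<comment> \<open>Restricted to \<open>\<Lambda>\<close>, so that everything reached from a label
    by \<open>E\<close> is again a label of one of the trees; the diagonal keeps \<open>E\<close>
    reflexive elsewhere.\<close>
  define E where "E = {(p, q). p = q \<or> p \<in> \<Lambda> \<and> q \<in> \<Lambda> \<and> close c p q}"
  have symE: "sym E" unfolding E_def sym_def using close_sym by blast
  have IdE: "Id \<subseteq> E" by (auto simp: E_def)
  have inv\<Lambda>: "invertible p" if "p \<in> \<Lambda>" for p using that T.lam_inv T'.lam_inv by (auto simp: \<Lambda>_def)
  have E_close: "close (c ^ j) p q \<and> q \<in> \<Lambda>" if "p \<in> \<Lambda>" "(p, q) \<in> E ^^ j" for p q j
    using that(2)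
  proof (induction j arbitrary: q)
    case 0
    then show ?case using that close_refl inv\<Lambda> by auto
  next
    case (Suc j)
    then obtain w where w: "(p, w) \<in> E ^^ j" "(w, q) \<in> E" by auto
    then have IH: "close (c ^ j) p w" "w \<in> \<Lambda>" using Suc by blast+
    then have wq: "close c w q" "q \<in> \<Lambda>" using w(2) close_refl inv\<Lambda> c by (auto simp: E_def)
    have "close (c ^ j * c) p q" by (rule close_trans[OF IH(1) wq(1)])
    then show ?case using wq by (simp add: mult.commute)
  qed
  have E_I: "(p, q) \<in> E" if "p \<in> \<Lambda>" "q \<in> \<Lambda>" "close d p q" "d \<le> c" for p q d
    using that close_mono unfolding E_def by blast
  have lam\<Lambda>: "x \<in> T.V \<Longrightarrow> lam x \<in> \<Lambda>" "y \<in> T'.V \<Longrightarrow> lam' y \<in> \<Lambda>" for x y by (auto simp: \<Lambda>_def)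
  obtain R1 where R1: "\<forall>R\<ge>R1. pruned C r R T.core" using T.pruned_exists by blast
  obtain R1' where R1': "\<forall>R\<ge>R1'. pruned C' r' R T'.core" using T'.pruned_exists by blast
  \<comment> \<open>A target two units away is within \<open>c\<^sup>2\<close>, and within
    \<open>c\<^sup>2 * k\<close> after its replacement. The accuracy \<open>s1\<close> was fixed
    before this range.\<close>
  obtain R2 where R2: "\<forall>x\<in>T.core. \<forall>z\<in>T.V. close (c\<^sup>2 * k) (lam x) (lam z) \<longrightarrow> (\<exists>y\<in>T.core. \<exists>j\<le>R2. (x, y) \<in> C ^^ j \<and> close s1 (lam z) (lam y))"
    using s1(3) by blast
  obtain R2' where R2': "\<forall>x\<in>T'.core. \<forall>z\<in>T'.V. close (c\<^sup>2 * k) (lam' x) (lam' z) \<longrightarrow> (\<exists>y\<in>T'.core. \<exists>j\<le>R2'. (x, y) \<in> C' ^^ j \<and> close s2 (lam' z) (lam' y))"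
    using s2(3) by blast
  obtain R3 where R3: "\<forall>x\<in>T.core. \<exists>y j c d. j \<le> R3 \<and> (x, y) \<in> C ^^ j \<and> (y, c) \<in> C \<and> (y, d) \<in> C \<and> c \<noteq> d \<and> c \<in> T.core \<and> d \<in> T.core"
    using T.branch_exists by blast
  obtain R3' where R3': "\<forall>x\<in>T'.core. \<exists>y j c d. j \<le> R3' \<and> (x, y) \<in> C' ^^ j \<and> (y, c) \<in> C' \<and> (y, d) \<in> C' \<and> c \<noteq> d \<and> c \<in> T'.core \<and> d \<in> T'.core"
    using T'.branch_exists by blast
  define R where "R = R1 + R1' + R2 + R2' + R3 + R3'"
  have R: "R1 \<le> R" "R1' \<le> R" "R2 \<le> R" "R2' \<le> R" "R3 \<le> R" "R3' \<le> R" by (auto simp: R_def)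
  interpret P: pruned C r R T.core using R1 R by blast
  interpret P': pruned C' r' R T'.core using R1' R by blast
  have cck: "c ^ 2 \<le> c\<^sup>2 * k" using k(1) c by (simp add: mult_le_cancel_left1)
  interpret P: pruned_tree C r lam E R T.core
  proof unfold_locales
    show "(lam x, lam y) \<in> E" if "x \<in> T.V" "(x, y) \<in> C" for x y
      using E_I[OF _ _ s1(2)[OF that(2)]] lam\<Lambda> that T.C_V2 s c by auto
    show "(lam y, lam z) \<in> E" if "x \<in> T.V" "(x, y) \<in> C" "(x, z) \<in> C" for x y z
    proof (rule E_I[OF _ _ close_trans[OF close_sym[OF s1(2)[OF that(2)]] s1(2)[OF that(3)]]])
      show "s1 * s1 \<le> c" using mult_mono[of s1 s s1 s] s s1(1) c(1) by simp
    qed (use lam\<Lambda> that T.C_V2 in auto)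
    show "\<exists>y j. y \<in> T.core \<and> j \<le> R \<and> (x, y) \<in> C ^^ j \<and> (lam y, q) \<in> E" if x: "x \<in> T.core" and q: "(lam x, q) \<in> E ^^ 2" for x q
    proof -
      have q2: "close (c ^ 2) (lam x) q" "q \<in> \<Lambda>" using E_close[OF _ q] lam\<Lambda> P.core_V[OF x] by auto
      obtain z where z: "z \<in> T.V" "close k q (lam z)"
      proof (cases "q \<in> lam ` T.V")
        case True
        then show ?thesis using that close_refl[OF inv\<Lambda>[OF q2(2)] k(1)] by blast
      next
        case False
        then obtain y where "y \<in> T'.V" "q = lam' y" using q2(2) by (auto simp: \<Lambda>_def)
        then show ?thesis using that k(3)[of y] by blast
      qed
      have "close (c ^ 2 * k) (lam x) (lam z)" using close_trans q2 z by blast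
      then obtain y j where y: "y \<in> T.core" "j \<le> R2" "(x, y) \<in> C ^^ j" "close s1 (lam z) (lam y)" using R2 x z by blast
      have "close (k * s1) q (lam y)" using close_trans z y by blast
      moreover have "k * s1 \<le> c" using mult_left_mono[OF s(2), of k] k(1) c(3) by linarith
      ultimately have "(q, lam y) \<in> E" using E_I q2 lam\<Lambda> P.core_V y by blast
      then show ?thesis using y R symD[OF symE] by (meson le_trans)
    qed
    show "\<exists>y j c d. j \<le> R \<and> (x, y) \<in> C ^^ j \<and> (y, c) \<in> C \<and> (y, d) \<in> C \<and> c \<noteq> d \<and> c \<in> T.core \<and> d \<in> T.core" if "x \<in> T.core" for x
      using R3 that R by (meson le_trans)
  qed (rule symE, rule IdE)
  interpret P': pruned_tree C' r' lam' E R T'.core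
  proof unfold_locales
    show "(lam' x, lam' y) \<in> E" if "x \<in> T'.V" "(x, y) \<in> C'" for x y
      using E_I[OF _ _ s2(2)[OF that(2)]] lam\<Lambda> that T'.C_V2 s c by auto
    show "(lam' y, lam' z) \<in> E" if "x \<in> T'.V" "(x, y) \<in> C'" "(x, z) \<in> C'" for x y z
    proof (rule E_I[OF _ _ close_trans[OF close_sym[OF s2(2)[OF that(2)]] s2(2)[OF that(3)]]])
      show "s2 * s2 \<le> c" using mult_mono[of s2 s s2 s] s s2(1) c(1) by simp
    qed (use lam\<Lambda> that T'.C_V2 in auto)
    show "\<exists>y j. y \<in> T'.core \<and> j \<le> R \<and> (x, y) \<in> C' ^^ j \<and> (lam' y, q) \<in> E" if x: "x \<in> T'.core" and q: "(lam' x, q) \<in> E ^^ 2" for x q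
    proof -
      have q2: "close (c ^ 2) (lam' x) q" "q \<in> \<Lambda>" using E_close[OF _ q] lam\<Lambda> P'.core_V[OF x] by auto
      obtain z where z: "z \<in> T'.V" "close k q (lam' z)"
      proof (cases "q \<in> lam' ` T'.V")
        case True
        then show ?thesis using that close_refl[OF inv\<Lambda>[OF q2(2)] k(1)] by blast
      next
        case False
        then obtain y where "y \<in> T.V" "q = lam y" using q2(2) by (auto simp: \<Lambda>_def)
        then show ?thesis using that k(2)[of y] by blast
      qed
      have "close (c ^ 2 * k) (lam' x) (lam' z)" using close_trans q2 z by blast
      then obtain y j where y: "y \<in> T'.core" "j \<le> R2'" "(x, y) \<in> C' ^^ j" "close s2 (lam' z) (lam' y)" using R2' x z by blast
      have "close (k * s2) q (lam' y)" using close_trans z y by blast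
      moreover have "k * s2 \<le> c" using mult_left_mono[OF s(3), of k] k(1) c(3) by linarith
      ultimately have "(q, lam' y) \<in> E" using E_I q2 lam\<Lambda> P'.core_V y by blast
      then show ?thesis using y R symD[OF symE] by (meson le_trans)
    qed
    show "\<exists>y j c d. j \<le> R \<and> (x, y) \<in> C' ^^ j \<and> (y, c) \<in> C' \<and> (y, d) \<in> C' \<and> c \<noteq> d \<and> c \<in> T'.core \<and> d \<in> T'.core" if "x \<in> T'.core" for x
      using R3' that R by (meson le_trans)
  qed (rule symE, rule IdE)
  have rc: "\<exists>j. (lam r, lam' r') \<in> E ^^ j"
  proof -
    obtain y where y: "y \<in> T'.V" "close k (lam r) (lam' y)" using k(2) T.root_V by blast
    have "(lam r, lam' y) \<in> E" using E_I y c lam\<Lambda> T.root_V by blast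
    then have "(lam r, lam' y) \<in> E ^^ 1" by simp
    moreover have "(y, r') \<in> T'.nb ^^ (T'.dep y + T'.dep r')" using T'.nb_connected y T'.root_V by blast
    then have "(lam' y, lam' r') \<in> E ^^ (T'.dep y + T'.dep r')" using P'.lab_nb y by blast
    ultimately show ?thesis using relpow_trans_add by fast
  qed
  interpret PP: two_pruned_trees C r lam T.core C' r' lam' T'.core E R by unfold_locales (rule rc)
  obtain F F' D where
     F: "\<forall>n\<in>T.V. F n \<in> T'.V \<and> (lam n, lam' (F n)) \<in> E ^^ D \<and> (F' (F n), n) \<in> T.nb ^^ D"
     "\<forall>p\<in>T.V. \<forall>n. (p, n) \<in> C \<longrightarrow> (F p, F n) \<in> T'.nb ^^ D"
     and F': "\<forall>n\<in>T'.V. F' n \<in> T.V \<and> (lam' n, lam (F' n)) \<in> E ^^ D \<and> (F (F' n), n) \<in> T'.nb ^^ D"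
     "\<forall>p\<in>T'.V. \<forall>n. (p, n) \<in> C' \<longrightarrow> (F' p, F' n) \<in> T.nb ^^ D"
    using PP.coarse_matching by blast
  have cl: "close (c ^ D) (lam x) (lam' (F x))" if "x \<in> T.V" for x using F(1) E_close lam\<Lambda> that by blast
  have cl': "close (c ^ D) (lam' x) (lam (F' x))" if "x \<in> T'.V" for x using F'(1) E_close lam\<Lambda> that by blast
  interpret M: matched_actions C r G act L lam t x0 B C' r' G' act' L' lam' t' x0' B' F F' D "c ^ D"
    by unfold_locales (use F F' cl cl' in blast)+
  show ?thesis by (rule M.quasi_isometric)
qed

end

section \<open>Conjugation by a matrix, and the conclusion for graphs of groups\<close>

lemma norm_conj:
  fixes g h :: "real ^ 'n::finite ^ 'n"
  shows "\<exists>k>0. \<forall>M. norm (g ** M ** h) \<le> k * norm M"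
proof -
  let ?n = "real CARD('n)"
  let ?a = "real (CARD('n) * CARD('n)) * (?n * norm g * ?n * (?n * norm h))"
  let ?k = "?a + 1"
  have "norm (g ** M ** h) \<le> ?k * norm M" for M
  proof -
    have "op_bound (?n * norm g * (?n * norm M) * (?n * norm h)) (g ** M ** h)" by (intro op_bound_mult op_bound_norm)
    then have "norm (g ** M ** h) \<le> real (CARD('n) * CARD('n)) * (?n * norm g * (?n * norm M) * (?n * norm h))" by (rule norm_op_bound)
    also have "\<dots> = ?a * norm M" by (simp only: mult_ac)
    also have "\<dots> \<le> ?k * norm M" by (rule mult_right_mono) auto
    finally show ?thesis .
  qed
  moreover have "?k > 0" by (simp add: add_nonneg_pos)
  ultimately show ?thesis by blast
qed

context holonomy_setting
begin

text \<open>Conjugating labels and linear parts by \<open>g\<close> turns the integer lattice into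
  its image under \<open>g\<close> and puts the second group over the same fibre as the
  first.\<close>

lemma lattice_action:
  assumes "bushy A u" "folded_holonomy A u x0 \<phi> Dm" and g: "invertible g"
  shows "lattice_action (bs_child u) (rt u) \<Gamma> (bs_act A) (\<lambda>\<gamma>. g ** ho \<gamma> ** matrix_inv g) (\<lambda>x. g ** lam x ** matrix_inv g) (\<lambda>\<gamma>. g *v th \<gamma>) x0 g"
proof -
  interpret TA: tree_action "bs_child u" "rt u" \<Gamma> "bs_act A" ho lam by (rule tree_action[OF assms(1,2)])
  have gi: "invertible (matrix_inv g)" using g by (rule invertible_inv)
  have cancel: "matrix_inv g ** (g ** M) = M" "matrix_inv g *v (g *v v) = v" for M v using g by (simp_all add: matrix_inv_cancel)
  have HI: "\<gamma> \<in> carrier \<Gamma> \<Longrightarrow> bs_act A \<gamma> x0 = x0 \<Longrightarrow> \<gamma> \<in> H" for \<gamma> by (simp add: H_def')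
  show ?thesis
  proof unfold_locales
    show "\<exists>P0. finite P0 \<and> (\<forall>(x, y)\<in>bs_child u. \<exists>g\<in>carrier \<Gamma>. (bs_act A g x, bs_act A g y) \<in> P0)" by (rule cocompact)
    show "\<exists>c1 c2 c3. {c1, c2, c3} \<subseteq> T.V \<and> c1 \<noteq> c2 \<and> c1 \<noteq> c3 \<and> c2 \<noteq> c3 \<and> T.dep c1 = T.dep c2 \<and> T.dep c1 = T.dep c3
       \<and> infinite ((bs_child u)\<^sup>* `` {c1}) \<and> infinite ((bs_child u)\<^sup>* `` {c2}) \<and> infinite ((bs_child u)\<^sup>* `` {c3})" by (rule TA.three)
    show "invertible (g ** ho \<gamma> ** matrix_inv g)" if "\<gamma> \<in> carrier \<Gamma>" for \<gamma>
      using that by (intro invertible_mult g gi TA.L_inv)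
    show "invertible (g ** lam x ** matrix_inv g)" if "x \<in> T.V" for x
      using that by (intro invertible_mult g gi TA.lam_inv)
    show "g ** lam (bs_act A \<gamma> x) ** matrix_inv g = g ** ho \<gamma> ** matrix_inv g ** (g ** lam x ** matrix_inv g)"
      if "\<gamma> \<in> carrier \<Gamma>" "x \<in> T.V" for \<gamma> x
      using TA.lam_act[OF that] by (simp add: matrix_mul_assoc[symmetric] cancel)
    show "\<exists>w. (x, w) \<in> (bs_child u)\<^sup>* \<and> norm (g ** lam w ** matrix_inv g - g ** lam z ** matrix_inv g) < e"
      if px: "(p, x) \<in> bs_child u" "z \<in> T.V" "e > 0" for p x z and e :: real
    proof -
      obtain k where k: "k > 0" "\<And>M. norm (g ** M ** matrix_inv g) \<le> k * norm M" using norm_conj by blast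
      obtain w where w: "(x, w) \<in> (bs_child u)\<^sup>*" "norm (lam w - lam z) < e / k" using TA.full[OF px(1,2), of "e / k"] k px(3) by auto
      have "g ** lam w ** matrix_inv g - g ** lam z ** matrix_inv g = g ** (lam w - lam z) ** matrix_inv g"
        by (simp add: vec_eq_iff matrix_matrix_mult_def sum_subtractf right_diff_distrib left_diff_distrib)
      also have "norm \<dots> \<le> k * norm (lam w - lam z)" by (rule k)
      also have "\<dots> < e" using w(2) k(1) by (simp add: pos_less_divide_eq mult.commute)
      finally show ?thesis using w(1) by blast
    qed
    show "x0 \<in> T.V" using x0 TV_V by simp
    show "g ** lam x0 ** matrix_inv g = mat 1" using g by (simp add: lam_x0 matrix_inv_cancel)
    show "invertible g" by fact
    show "g ** ho (\<gamma> \<otimes>\<^bsub>\<Gamma>\<^esub> h) ** matrix_inv g = g ** ho \<gamma> ** matrix_inv g ** (g ** ho h ** matrix_inv g)"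
      if "\<gamma> \<in> carrier \<Gamma>" "h \<in> carrier \<Gamma>" for \<gamma> h
      using ho_mult[OF that] by (simp add: matrix_mul_assoc[symmetric] cancel)
    show "g *v th (\<gamma> \<otimes>\<^bsub>\<Gamma>\<^esub> h) = g *v th \<gamma> + g ** ho \<gamma> ** matrix_inv g *v (g *v th h)"
      if "\<gamma> \<in> carrier \<Gamma>" "h \<in> carrier \<Gamma>" for \<gamma> h
      using th_mult[OF that] by (simp add: matrix_vector_right_distrib matrix_vector_mul_assoc[symmetric] cancel)
    show "g ** ho \<gamma> ** matrix_inv g = mat 1" if "\<gamma> \<in> carrier \<Gamma>" "bs_act A \<gamma> x0 = x0" for \<gamma>
      using ho_stab[OF that(1) x0 that(2)] g by (simp add: matrix_inv_cancel)
    show "\<exists>z. g *v th \<gamma> = g *v rvec z" if "\<gamma> \<in> carrier \<Gamma>" "bs_act A \<gamma> x0 = x0" for \<gamma>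
      by (rule exI[of _ "\<phi> \<gamma>"]) (simp add: th_H[OF HI[OF that]])
    show "\<exists>\<gamma>\<in>carrier \<Gamma>. bs_act A \<gamma> x0 = x0 \<and> g *v th \<gamma> = g *v rvec z" for z
    proof -
      obtain \<gamma> where "\<gamma> \<in> H" "\<phi> \<gamma> = z" using phi_surj by blast
      then show ?thesis using th_H[of \<gamma>] H_def' by auto
    qed
    show "\<gamma> = h" if "\<gamma> \<in> carrier \<Gamma>" "bs_act A \<gamma> x0 = x0" "h \<in> carrier \<Gamma>" "bs_act A h x0 = x0" "g *v th \<gamma> = g *v th h" for \<gamma> h
    proof -
      have "th \<gamma> = th h" using that(5) cancel(2) by metis
      then have "\<phi> \<gamma> = \<phi> h" using th_H HI that rvec_inj by metis
      then show ?thesis using phi_inj HI that by (meson inj_onD)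
    qed
    show "x \<in> T.V" if "(x, y) \<in> bs_child u" for x y using that by (rule TA.C_V)
    show "bs_act A \<gamma> x \<in> T.V" if "\<gamma> \<in> carrier \<Gamma>" "x \<in> T.V" for \<gamma> x using that by (rule TA.act_V)
    show "bs_act A (\<gamma> \<otimes>\<^bsub>\<Gamma>\<^esub> h) x = bs_act A \<gamma> (bs_act A h x)"
      if "\<gamma> \<in> carrier \<Gamma>" "h \<in> carrier \<Gamma>" "x \<in> T.V" for \<gamma> h x using that by (rule TA.act_mult)
    show "bs_act A \<one>\<^bsub>\<Gamma>\<^esub> x = x" if "x \<in> T.V" for x using that by (rule TA.act_one)
    show "(bs_act A \<gamma> x, bs_act A \<gamma> y) \<in> bs_child u \<or> (bs_act A \<gamma> y, bs_act A \<gamma> x) \<in> bs_child u"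
      if "\<gamma> \<in> carrier \<Gamma>" "(x, y) \<in> bs_child u" for \<gamma> x y using that by (rule TA.act_C)
    show "finite (bs_child u `` {x})" if "x \<in> T.V" for x using that by (rule TA.locally_finite)
  qed
qed

lemma lam_image: "lam ` T.V = ho ` carrier \<Gamma>"
proof (intro equalityI subsetI)
  fix p assume "p \<in> lam ` T.V"
  then obtain x where x: "x \<in> TX" "p = lam x" using TV_V by auto
  obtain g d where "g \<in> carrier \<Gamma>" "d \<in> Dm" "x = bs_act A g d" using Dm_cover[OF x(1)] by blast
  then show "p \<in> ho ` carrier \<Gamma>" using x lam_Dm by auto
next
  fix p assume "p \<in> ho ` carrier \<Gamma>"
  then obtain g where g: "g \<in> carrier \<Gamma>" "p = ho g" by blast
  then have "p = lam (bs_act A g x0)" using lam_Dm Dm(2) by simp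
  moreover have "bs_act A g x0 \<in> T.V" using act_TV[OF g(1) x0] TV_V by simp
  ultimately show "p \<in> lam ` T.V" by blast
qed

end

text \<open>Compactness bounds the matrices from above. It also gives a positive minimum of
  \<open>norm (k *v v)\<close> over \<open>K\<close> and the unit sphere, which bounds the
  inverses.\<close>

lemma compact_GL_op_bound:
  fixes K :: "(real ^ 'n::finite ^ 'n) set"
  assumes "compact K" "K \<subseteq> GL"
  shows "\<exists>c. \<forall>k\<in>K. close c (mat 1) k"
proof (cases "K = {}")
  case False
  let ?S = "K \<times> sphere (0 :: real ^ 'n) 1"
  have cS: "compact ?S" using assms by (intro compact_Times) auto
  have "(axis undefined 1 :: real ^ 'n) \<in> sphere 0 1" by simp
  then have ne: "?S \<noteq> {}" using False by blast
  have "continuous_on ?S (\<lambda>x. norm (fst x *v snd x))"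
    unfolding matrix_vector_mult_def by (intro continuous_intros)
  then obtain m where m: "m \<in> ?S" "\<And>y. y \<in> ?S \<Longrightarrow> norm (fst m *v snd m) \<le> norm (fst y *v snd y)"
    using continuous_attains_inf[OF cS ne] by blast
  define \<mu> where "\<mu> = norm (fst m *v snd m)"
  have im: "invertible (fst m)" "snd m \<noteq> 0" using m assms by (auto simp: GL_def)
  have "fst m *v snd m \<noteq> 0" using im matrix_inv_cancel(6)[OF im(1), of "snd m"] by fastforce
  then have \<mu>: "\<mu> > 0" by (simp add: \<mu>_def)
  obtain b where b: "\<And>k. k \<in> K \<Longrightarrow> norm k \<le> b" using assms(1) compact_imp_bounded bounded_iff by metis
  let ?c = "max (real CARD('n) * b) (1 / \<mu>)"
  have "close ?c (mat 1) k" if k: "k \<in> K" for k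
  proof -
    have ik: "invertible k" using k assms by (auto simp: GL_def)
    have i1: "matrix_inv (mat 1 :: real ^ 'n ^ 'n) = mat 1" by (rule matrix_inv_eqI) simp
    have "real CARD('n) * norm k \<le> ?c" using b[OF k] by (intro max.coboundedI1 mult_left_mono) auto
    then have 1: "op_bound ?c k" using op_bound_mono[OF op_bound_norm] by blast
    have low: "\<mu> * norm v \<le> norm (k *v v)" for v
    proof (cases "v = 0")
      case False
      have "(k, (1 / norm v) *\<^sub>R v) \<in> ?S" using k False by simp
      then have "\<mu> \<le> norm (k *v ((1 / norm v) *\<^sub>R v))" using m(2) by (force simp: \<mu>_def)
      also have "\<dots> = norm (k *v v) / norm v" by (simp add: matrix_vector_mult_scaleR)
      finally show ?thesis using False by (simp add: pos_le_divide_eq)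
    qed simp
    have "op_bound (1 / \<mu>) (matrix_inv k)"
      unfolding op_bound_def
    proof (intro conjI allI)
      fix v
      have "\<mu> * norm (matrix_inv k *v v) \<le> norm v" using low[of "matrix_inv k *v v"] ik by (simp add: matrix_inv_cancel)
      then show "norm (matrix_inv k *v v) \<le> 1 / \<mu> * norm v" using \<mu> by (simp add: pos_le_divide_eq mult.commute)
    qed (use \<mu> in simp)
    then have 2: "op_bound ?c (matrix_inv k)" by (rule op_bound_mono) simp
    have "invertible (mat 1 :: real ^ 'n ^ 'n)" by (auto simp: invertible_def intro!: exI[of _ "mat 1"])
    then show ?thesis unfolding close_def using 1 2 ik by (simp add: i1)
  qed
  then show ?thesis by blast
qed auto

theorem theorem10:
  fixes A :: "('v, 'e, 'a, 'b) gog" and A' :: "('w, 'f, 'c, 'd) gog"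
    and u :: 'v and u' :: 'w
    and x0 :: "('v, 'e, 'a) tree_vertex" and x0' :: "('w, 'f, 'c) tree_vertex"
    and \<phi> :: "('v, 'e, 'a) word set \<Rightarrow> int ^ 'n::finite"
    and \<phi>' :: "('w, 'f, 'c) word set \<Rightarrow> int ^ 'n"
    and D :: "('v, 'e, 'a) tree_vertex set" and D' :: "('w, 'f, 'c) tree_vertex set"
    and g :: "real ^ 'n ^ 'n"
  assumes "graph_of_Zns TYPE('n) A" and "graph_of_Zns TYPE('n) A'"
    and "u \<in> verts (base A)" and "u' \<in> verts (base A')"
    and "bushy A u" and "bushy A' u'"
    and "holonomy_data A u x0 \<phi> D" and "holonomy_data A' u' x0' \<phi>' D'"
    and "folded_holonomy A u x0 \<phi> D" and "folded_holonomy A' u' x0' \<phi>' D'"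
    and "g \<in> GL"
    and "bounded_Hausdorff_GL (hol A u x0 \<phi> ` carrier (pi1 A u))
           ((\<lambda>\<gamma>. g ** hol A' u' x0' \<phi>' \<gamma> ** matrix_inv g) ` carrier (pi1 A' u'))"
  shows "quasi_isometric_groups (pi1 A u) (pi1 A' u')"
proof -
  interpret H: holonomy_setting A "TYPE('n)" u x0 \<phi> D by unfold_locales (use assms in auto)
  interpret H': holonomy_setting A' "TYPE('n)" u' x0' \<phi>' D' by unfold_locales (use assms in auto)
  have g: "invertible g" using assms by (simp add: GL_def)
  have i1: "invertible (mat 1 :: real ^ 'n ^ 'n)" by (auto simp: invertible_def intro!: exI[of _ "mat 1"])
  have m1: "matrix_inv (mat 1 :: real ^ 'n ^ 'n) = mat 1" by (rule matrix_inv_eqI) simp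
  \<comment> \<open>Conjugation by the identity brings the first group into the same form as the
    second.\<close>
  interpret Z: lattice_action "H.bs_child u" "H.rt u" "pi1 A u" "bs_act A" "hol A u x0 \<phi>" "tree_hol A u x0 \<phi> D" H.th x0 "mat 1"
    using H.lattice_action[OF assms(5,9) i1] by (simp add: m1)
  interpret Z': lattice_action "H'.bs_child u'" "H'.rt u'" "pi1 A' u'" "bs_act A'" "\<lambda>\<gamma>. g ** hol A' u' x0' \<phi>' \<gamma> ** matrix_inv g"
    "\<lambda>x. g ** tree_hol A' u' x0' \<phi>' D' x ** matrix_inv g" "\<lambda>\<gamma>. g *v H'.th \<gamma>" x0' g
    by (rule H'.lattice_action[OF assms(6,10) g])
  let ?X = "tree_hol A u x0 \<phi> D ` H.T.V" and ?Y = "(\<lambda>x. g ** tree_hol A' u' x0' \<phi>' D' x ** matrix_inv g) ` H'.T.V"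
  have Y: "?Y = (\<lambda>\<gamma>. g ** hol A' u' x0' \<phi>' \<gamma> ** matrix_inv g) ` carrier (pi1 A' u')"
  proof -
    have "?Y = (\<lambda>M. g ** M ** matrix_inv g) ` (tree_hol A' u' x0' \<phi>' D' ` H'.T.V)" by (rule image_image[symmetric])
    also have "\<dots> = (\<lambda>M. g ** M ** matrix_inv g) ` (hol A' u' x0' \<phi>' ` carrier (pi1 A' u'))" by (simp only: H'.lam_image)
    also have "\<dots> = (\<lambda>\<gamma>. g ** hol A' u' x0' \<phi>' \<gamma> ** matrix_inv g) ` carrier (pi1 A' u')" by (rule image_image)
    finally show ?thesis .
  qed
  obtain K where K: "compact K" "K \<subseteq> GL" "?X \<subseteq> {y ** k | y k. y \<in> ?Y \<and> k \<in> K}" "?Y \<subseteq> {x ** k | x k. x \<in> ?X \<and> k \<in> K}"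
    using assms(12) unfolding bounded_Hausdorff_GL_def Y H.lam_image by blast
  obtain c where c: "\<And>k. k \<in> K \<Longrightarrow> close c (mat 1) k" using compact_GL_op_bound[OF K(1,2)] by blast
  have mul: "close c (p ** k) p" if "k \<in> K" "invertible p" for p k
    using close_left[OF that(2) c[OF that(1)]] close_sym by simp blast
  interpret two_actions "H.bs_child u" "H.rt u" "pi1 A u" "bs_act A" "hol A u x0 \<phi>" "tree_hol A u x0 \<phi> D" H.th x0 "mat 1"
    "H'.bs_child u'" "H'.rt u'" "pi1 A' u'" "bs_act A'" "\<lambda>\<gamma>. g ** hol A' u' x0' \<phi>' \<gamma> ** matrix_inv g"
    "\<lambda>x. g ** tree_hol A' u' x0' \<phi>' D' x ** matrix_inv g" "\<lambda>\<gamma>. g *v H'.th \<gamma>" x0' g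
  proof unfold_locales
    have "\<exists>y\<in>H'.T.V. close c (tree_hol A u x0 \<phi> D x) (g ** tree_hol A' u' x0' \<phi>' D' y ** matrix_inv g)" if x: "x \<in> H.T.V" for x
    proof -
      have "tree_hol A u x0 \<phi> D x \<in> {y ** k | y k. y \<in> ?Y \<and> k \<in> K}" using K(3) x by blast
      then obtain y k where y: "y \<in> H'.T.V" "k \<in> K" "tree_hol A u x0 \<phi> D x = (g ** tree_hol A' u' x0' \<phi>' D' y ** matrix_inv g) ** k" by blast
      show ?thesis unfolding y(3) using mul[OF y(2) Z'.lam_inv[OF y(1)]] y(1) by blast
    qed
    moreover have "\<exists>x\<in>H.T.V. close c (g ** tree_hol A' u' x0' \<phi>' D' y ** matrix_inv g) (tree_hol A u x0 \<phi> D x)" if y: "y \<in> H'.T.V" for y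
    proof -
      have "g ** tree_hol A' u' x0' \<phi>' D' y ** matrix_inv g \<in> {x ** k | x k. x \<in> ?X \<and> k \<in> K}" using K(4) y by blast
      then obtain x k where x: "x \<in> H.T.V" "k \<in> K" "g ** tree_hol A' u' x0' \<phi>' D' y ** matrix_inv g = tree_hol A u x0 \<phi> D x ** k" by blast
      show ?thesis unfolding x(3) using mul[OF x(2) Z.lam_inv[OF x(1)]] x(1) by blast
    qed
    ultimately show "\<exists>k. (\<forall>x\<in>H.T.V. \<exists>y\<in>H'.T.V. close k (tree_hol A u x0 \<phi> D x) (g ** tree_hol A' u' x0' \<phi>' D' y ** matrix_inv g)) \<and>
      (\<forall>y\<in>H'.T.V. \<exists>x\<in>H.T.V. close k (g ** tree_hol A' u' x0' \<phi>' D' y ** matrix_inv g) (tree_hol A u x0 \<phi> D x))" by blast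
  qed
  show ?thesis by (rule quasi_isometric)
qed

end
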